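(* Let $w:[0,T]^2\to\mathbb R^d$ be a fractional Brownian sheet of Hurst parameter $H=(H_1,H_2)$ on a probability space $(\Omega,\mathcal F,\mathbb P)$. Suppose that $$\lambda<\frac{1}{2(H_1\vee H_2)}-\frac d2 .$$ Then for almost every $\omega\in\Omega$, $w$ admits a local time $L$ such that for $\gamma_1\in\big(\tfrac12,\,1-(\lambda+\tfrac d2)H_1\big)$ and $\gamma_2\in\big(\tfrac12,\,1-(\lambda+\tfrac d2)H_2\big)$ $$\|\square_{s,t}L\|_{H^\lambda_x}\lesssim (t_1-s_1)^{\gamma_1}(t_2-s_2)^{\gamma_2}.$$
   Context: Points of $[0,T]^2$ are written $s=(s_1,s_2)$, $t=(t_1,t_2)$; $s<t$ means $s_1<t_1$ and $s_2<t_2$, and the estimate is for $s<t$ in $[0,T]^2$. $\square_{s,t}f=f(t_1,t_2)-f(t_1,s_2)-f(s_1,t_2)+f(s_1,s_2)$ is the rectangular increment in the time variable. $a\lesssim b$ means $a\le Cb$ for some constant $C>0$ (here independent of $s,t$; the estimate is pathwise, so $C$ may depend on $\omega$). A ($d$-dimensional) fractional Brownian sheet of Hurst parameter $(H_1,H_2)$, $H_1,H_2\in(0,1)$, is a continuous centered Gaussian field with i.i.d. components, each with covariance $\prod_{i=1,2}\frac12\big(s_i^{2H_i}+t_i^{2H_i}-|t_i-s_i|^{2H_i}\big)$. The occupation measure of $w$ is $\mu^w_t(A)=\mathrm{Leb}\{s\in[0,T]^2:s<t,\ w_s\in A\}$ for Borel $A\subset\mathbb R^d$. If it is absolutely continuous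 with respect to Lebesgue measure on $\mathbb R^d$, its density $L_t=L^w_t$ is called the local time of $w$. $H^\lambda_x=H^\lambda(\mathbb R^d)$ is the $L^2$-based Bessel potential space, with norm $\|f\|_{H^\lambda}^2=\int_{\mathbb R^d}(1+|z|^2)^\lambda|\hat f(z)|^2dz$.
   Formalization: Assumes in addition λ + d/2 ≥ 0 and d < 1/H_1 + 1/H_2 (both automatic for λ ≥ 0): for λ < -d/2 exponents above 1 would force L = 0, and for d ≥ 1/H_1 + 1/H_2 the range of w is Lebesgue-null, so no local time exists. *)

theory Defs
  imports "HOL-Probability.Probability"
begin

definition time_square :: "real \<Rightarrow> (real \<times> real) set" where
  "time_square T = {0..T} \<times> {0..T}"

(* The library order on pairs has s < t iff s <= t and s is not t; here both
   coordinates must be strictly smaller. *)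
definition time_less :: "real \<times> real \<Rightarrow> real \<times> real \<Rightarrow> bool" where
  "time_less s t \<longleftrightarrow> fst s < fst t \<and> snd s < snd t"

definition rect_incr :: "(real \<times> real \<Rightarrow> 'b::ab_group_add) \<Rightarrow> real \<times> real \<Rightarrow> real \<times> real \<Rightarrow> 'b" where
  "rect_incr f s t =
     f (fst t, snd t) - f (fst t, snd s) - f (fst s, snd t) + f (fst s, snd s)"

(* Degenerate normal laws (point masses) count as Gaussian; normal_density needs
   a positive standard deviation, so they are a separate case. *)
definition gaussian_variable :: "'a measure \<Rightarrow> ('a \<Rightarrow> real) \<Rightarrow> bool" where
  "gaussian_variable M X \<longleftrightarrow>
     X \<in> borel_measurable M \<and>
     (\<exists>m \<sigma>. (\<sigma> = 0 \<and> (AE \<omega> in M. X \<omega> = m)) \<or>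
            (\<sigma> > 0 \<and> distributed M lborel X (\<lambda>x. ennreal (normal_density m \<sigma> x))))"

definition gaussian_field ::
    "'a measure \<Rightarrow> 'i set \<Rightarrow> ('i \<Rightarrow> 'a \<Rightarrow> 'b::euclidean_space) \<Rightarrow> bool" where
  "gaussian_field M I X \<longleftrightarrow>
     (\<forall>s\<in>I. X s \<in> borel_measurable M) \<and>
     (\<forall>F a. finite F \<and> F \<subseteq> I \<longrightarrow>
        gaussian_variable M (\<lambda>\<omega>. \<Sum>s\<in>F. a s \<bullet> X s \<omega>))"

definition fbm_cov :: "real \<Rightarrow> real \<Rightarrow> real \<Rightarrow> real" where
  "fbm_cov H u v = (u powr (2 * H) + v powr (2 * H) - \<bar>v - u\<bar> powr (2 * H)) / 2"

(* The i-th component is treated as one random element of the product space of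
   all real functions on the time square, so that independence and equality in
   law are statements about the whole component processes. *)
definition component_process ::
    "real \<Rightarrow> (real \<times> real \<Rightarrow> 'a \<Rightarrow> real ^ 'd) \<Rightarrow> 'd \<Rightarrow> 'a \<Rightarrow> (real \<times> real \<Rightarrow> real)" where
  "component_process T w i \<omega> = (\<lambda>s\<in>time_square T. w s \<omega> $ i)"

definition fractional_brownian_sheet ::
    "'a measure \<Rightarrow> real \<Rightarrow> real \<Rightarrow> real \<Rightarrow> (real \<times> real \<Rightarrow> 'a \<Rightarrow> real ^ 'd) \<Rightarrow> bool" where
  "fractional_brownian_sheet M T H1 H2 w \<longleftrightarrow>
     prob_space M \<and>
     0 < H1 \<and> H1 < 1 \<and> 0 < H2 \<and> H2 < 1 \<and>
     gaussian_field M (time_square T) w \<and>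
     (\<forall>\<omega>\<in>space M. continuous_on (time_square T) (\<lambda>s. w s \<omega>)) \<and>
     (\<forall>s\<in>time_square T. (\<integral>\<omega>. w s \<omega> \<partial>M) = 0) \<and>
     prob_space.indep_vars M (\<lambda>_. \<Pi>\<^sub>M s\<in>time_square T. borel) (component_process T w) UNIV \<and>
     (\<forall>i j. distr M (\<Pi>\<^sub>M s\<in>time_square T. borel) (component_process T w i) =
            distr M (\<Pi>\<^sub>M s\<in>time_square T. borel) (component_process T w j)) \<and>
     (\<forall>i. \<forall>s\<in>time_square T. \<forall>t\<in>time_square T.
        (\<integral>\<omega>. w s \<omega> $ i * w t \<omega> $ i \<partial>M) =
          fbm_cov H1 (fst s) (fst t) * fbm_cov H2 (snd s) (snd t))"

definition occupation_measure ::
    "real \<Rightarrow> (real \<times> real \<Rightarrow> 'b::euclidean_space) \<Rightarrow> real \<times> real \<Rightarrow> 'b measure" where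
  "occupation_measure T w t =
     distr (restrict_space lborel {s \<in> time_square T. time_less s t}) borel w"

(* Having a density with respect to Lebesgue measure contains the absolute
   continuity. The density is finite almost everywhere because the occupation
   measure is finite, so a nonnegative real-valued version is no restriction. *)
definition is_local_time ::
    "real \<Rightarrow> (real \<times> real \<Rightarrow> 'b::euclidean_space) \<Rightarrow> (real \<times> real \<Rightarrow> 'b \<Rightarrow> real) \<Rightarrow> bool" where
  "is_local_time T w L \<longleftrightarrow>
     (\<forall>t\<in>time_square T.
        L t \<in> borel_measurable borel \<and>
        (\<forall>x. 0 \<le> L t x) \<and>
        occupation_measure T w t = density lborel (\<lambda>x. ennreal (L t x)))"

(* No factor (2 pi)^(-d/2): normalising changes Bessel potential norms only by a
   multiplicative constant. *)
definition fourier_transform :: "('b::euclidean_space \<Rightarrow> real) \<Rightarrow> 'b \<Rightarrow> complex" where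
  "fourier_transform f z = (\<integral>x. f x *\<^sub>R cis (- (z \<bullet> x)) \<partial>lborel)"

(* Bessel potential space of (possibly negative) order lam, restricted to its
   integrable elements, whose Fourier transform is the integral above. Local
   times and their rectangular increments are integrable because occupation
   measures are finite. *)
definition bessel_integrand :: "real \<Rightarrow> ('b::euclidean_space \<Rightarrow> real) \<Rightarrow> 'b \<Rightarrow> real" where
  "bessel_integrand lam f z = (1 + (norm z)\<^sup>2) powr lam * (cmod (fourier_transform f z))\<^sup>2"

definition in_bessel_space :: "real \<Rightarrow> ('b::euclidean_space \<Rightarrow> real) \<Rightarrow> bool" where
  "in_bessel_space lam f \<longleftrightarrow>
     integrable lborel f \<and> integrable lborel (bessel_integrand lam f)"

definition bessel_norm :: "real \<Rightarrow> ('b::euclidean_space \<Rightarrow> real) \<Rightarrow> real" where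
  "bessel_norm lam f = sqrt (\<integral>z. bessel_integrand lam f z \<partial>lborel)"

(* On the range of lam and d. Rectangular increments are additive, so a bound
   with both exponents above 1 forces the local time to vanish, while its total
   mass at (T,T) is T^2; exponents above 1 are excluded exactly when
   lam + d/2 >= 0. If d > 1/H1 + 1/H2, the range of the sheet is Lebesgue-null and
   there is no local time; equality is the critical case, in which the expected
   squared L2 norm of a density diverges. Both lam + d/2 >= 0 and d < 1/H1 + 1/H2 hold
   automatically when lam >= 0 and lam < 1/(2 max H1 H2) - d/2. *)

end

theory Submission
  imports Defs
begin

text \<open>
  For a fixed second time \<open>b\<close> the slice \<open>w(\<cdot>, b)\<close> is a multiple, of size \<open>b powr H2\<close>, of a fractional
  Brownian motion, whose Mandelbrot--Van Ness kernel shows that the conditional variance of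
  \<open>w(a', b) - w(a, b)\<close> given the past of \<open>a < a'\<close> is at least of the order of \<open>(a' - a) powr (2 * H1)\<close>.
  Hence the occupation transform of the slice over a time interval has a conditional second moment,
  in weighted \<open>L\<^sup>2\<close>, of the expected order; a discrete John--Nirenberg argument upgrades this to
  moments of all orders, and Kolmogorov chaining gives the exponent in the first time variable.
  Integrating over \<open>b\<close> by the Cauchy--Schwarz inequality yields the exponent in the second
  variable: the singularity \<open>b powr (- 2 * \<alpha> * H2)\<close> on the axis is exactly what makes the loss in
  the second variable.  So only one-parameter processes are estimated.  A density exists since
  the variance of an increment dominates both one-parameter variances away from the axes, which for
  \<open>d < 1 / H1 + 1 / H2\<close> bounds the expected density of collisions of the path.
\<close>

text \<open>The parameter \<alpha> sits slightly above \<open>lam + d/2\<close>. For such \<alpha>,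
  integrating \<open>(1 + |z|^2) powr lam * exp (- x * |z|^2)\<close> over z costs at most a
  multiple of \<open>x powr (-\<alpha>)\<close> for bounded x. With x of size
  \<open>b powr (2 * H2) * r powr (2 * H1)\<close>, integrability in the time distance r and in b
  asks for \<open>2 * \<alpha> * H1 < 1\<close> and \<open>2 * \<alpha> * H2 < 1\<close>; the
  hypothesis on \<open>lam\<close> leaves room for this. The singularity in b integrates over a
  length \<Delta> to the order \<open>\<Delta> powr (1 - 2 * \<alpha> * H2)\<close>, Cauchy--Schwarz
  adds a factor \<Delta>, and the square root gives \<open>1 - \<alpha> * H2\<close>. Moments of
  order m lose 1/m and 1/(2m) in the two exponents, so m has to be arbitrarily large. One null set
  must serve all exponents, so the estimate is made for countably many pairs of \<alpha> and m.
  Since \<open>lam\<close> may be negative, Sobolev bounds do not provide a density, and absolute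
  continuity is a separate argument. Weights are cut off at a radius to make energies finite from
  the start; no final bound depends on the radius.\<close>

lemma borel_measurable_cis [measurable]: "cis \<in> borel_measurable borel"
  by (intro borel_measurable_continuous_onI continuous_intros)

section \<open>Kernel representation and nondeterminism of fractional Brownian motion\<close>

lemma nn_integral_powr_from_0:
  assumes "-1 < (p::real)" "0 \<le> c"
  shows "(\<integral>\<^sup>+x. ennreal (x powr p) * indicator {0..c} x \<partial>lborel) = ennreal (c powr (p+1) / (p+1))"
  by (rule nn_integral_has_integral_lebesgue'[OF _ has_integral_powr_from_0]) (use assms in auto)

definition pos_powr :: "real \<Rightarrow> real \<Rightarrow> real" where
  "pos_powr e x = (if 0 < x then x powr e else 0)"

text \<open>The unnormalised Mandelbrot--Van Ness kernel. For H = 1/2 and a \<ge> 0 it is the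
  indicator of the half-open interval from 0 to a, because \<open>pos_powr\<close> cuts off at 0 for
  exponent 0 as well.\<close>

definition fbm_kernel :: "real \<Rightarrow> real \<Rightarrow> real \<Rightarrow> real" where
  "fbm_kernel H a x = pos_powr (H - 1/2) (a - x) - pos_powr (H - 1/2) (- x)"

text \<open>By self-similarity this squared norm is the only factor between kernel inner products
  and \<open>fbm_cov\<close>; it is carried along instead of normalising the kernel.\<close>

definition fbm_kernel_const :: "real \<Rightarrow> real" where
  "fbm_kernel_const H = (\<integral>x. (fbm_kernel H 1 x)\<^sup>2 \<partial>lborel)"

lemma pos_powr_measurable [measurable]: "pos_powr e \<in> borel_measurable borel"
  unfolding pos_powr_def by measurable

lemma fbm_kernel_measurable [measurable]: "fbm_kernel H a \<in> borel_measurable borel"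
  unfolding fbm_kernel_def by measurable

text \<open>The mean value theorem. It makes the kernel decay like \<open>y powr (H - 3/2)\<close>
  at distance y before time 0.\<close>

lemma powr_diff_le:
  fixes e y :: real
  assumes "\<bar>e\<bar> \<le> 1" "1 \<le> y"
  shows "\<bar>(1 + y) powr e - y powr e\<bar> \<le> y powr (e - 1)"
proof -
  have "\<exists>z>y. z < 1 + y \<and> (1+y) powr e - y powr e = ((1+y) - y) * (e * z powr (e - 1))"
    by (rule MVT2) (use assms in \<open>auto intro!: derivative_eq_intros\<close>)
  then obtain z where z: "y < z" "(1+y) powr e - y powr e = e * z powr (e - 1)" by auto
  have "\<bar>e * z powr (e - 1)\<bar> \<le> 1 * y powr (e - 1)"
    unfolding abs_mult by (rule mult_mono) (use assms z in \<open>auto intro!: powr_mono2'\<close>)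
  then show ?thesis using z by simp
qed

text \<open>One summand per region: the singularity at time 1, the bounded part plus the singularity
  at time 0, and the tail. The exponent \<open>2 * H - 1\<close> is integrable at 0 since H > 0, and
  \<open>2 * H - 3\<close> at infinity since H < 1.\<close>

lemma fbm_kernel_square_le:
  assumes "0 < H" "H < 1"
  shows "(fbm_kernel H 1 x)\<^sup>2 \<le> (1 - x) powr (2*H-1) * indicator {0..1} (1 - x)
     + (8 * indicator {0..1} (- x) + 2 * ((- x) powr (2*H-1) * indicator {0..1} (- x)))
     + (- x) powr (2*H-3) * indicator {1..} (- x)"
proof -
  define y where "y = - x"
  consider "1 \<le> x" | "0 \<le> x" "x < 1" | "0 < y" "y < 1" | "1 \<le> y" unfolding y_def by linarith
  then show ?thesis
  proof cases
    case 1
    then show ?thesis by (auto simp: fbm_kernel_def pos_powr_def)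
  next
    case 2
    then have "(fbm_kernel H 1 x)\<^sup>2 = (1 - x) powr (2*H-1)"
      by (auto simp: fbm_kernel_def pos_powr_def power2_eq_square simp flip: powr_add)
    then show ?thesis using 2 by (auto simp: indicator_def)
  next
    case 3
    define p where "p = (1 + y) powr (H - 1/2)"
    define q where "q = y powr (H - 1/2)"
    have "p \<le> (1 + y) powr 1" unfolding p_def by (rule powr_mono) (use assms 3 in auto)
    then have p: "0 \<le> p" "p \<le> 2" using 3 by (auto simp: p_def)
    have q: "0 \<le> q" "q\<^sup>2 = y powr (2*H-1)"
      by (auto simp: q_def power2_eq_square simp flip: powr_add)
    have "(p - q)\<^sup>2 \<le> 2 * p\<^sup>2 + 2 * q\<^sup>2"
      using sum_squares_ge_zero[of "p+q" 0] by (simp add: power2_eq_square algebra_simps)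
    also have "p\<^sup>2 \<le> 4" using p power_mono[of p 2 2] by simp
    finally have "(p - q)\<^sup>2 \<le> 8 + 2 * y powr (2*H-1)" using q by simp
    moreover have "fbm_kernel H 1 x = p - q"
      using 3 by (auto simp: fbm_kernel_def pos_powr_def p_def q_def y_def)
    ultimately show ?thesis using 3 unfolding y_def by (auto simp: indicator_def)
  next
    case 4
    have "fbm_kernel H 1 x = (1+y) powr (H - 1/2) - y powr (H - 1/2)"
      using 4 by (auto simp: fbm_kernel_def pos_powr_def y_def)
    then have "\<bar>fbm_kernel H 1 x\<bar> \<le> y powr (H - 1/2 - 1)"
      using powr_diff_le[of "H - 1/2" y] 4 assms by auto
    then have "\<bar>fbm_kernel H 1 x\<bar>\<^sup>2 \<le> (y powr (H - 1/2 - 1))\<^sup>2" by (intro power_mono) auto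
    also have "\<dots> = y powr (2*H-3)" by (simp add: power2_eq_square flip: powr_add)
    finally show ?thesis using 4 unfolding y_def by (auto simp: indicator_def)
  qed
qed

lemma fbm_kernel_1_integrable:
  assumes "0 < H" "H < 1"
  shows "integrable lborel (\<lambda>x. (fbm_kernel H 1 x)\<^sup>2)"
proof -
  have int0: "integrable lborel (\<lambda>x::real. x powr (2*H-1) * indicator {0..1} x)"
  proof (rule integrableI_nonneg)
    show "(\<integral>\<^sup>+ x. ennreal (x powr (2*H-1) * indicator {0..1} x) \<partial>lborel) < \<infinity>"
      using nn_integral_powr_from_0[of "2*H-1" 1] assms
      by (simp add: ennreal_mult' ennreal_indicator)
  qed auto
  have int1: "integrable lborel (\<lambda>x::real. x powr (2*H-3) * indicator {1..} x)"
  proof (rule integrableI_nonneg)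
    have "(\<integral>\<^sup>+ x. ennreal (x powr (2*H-3)) * indicator {1..} x \<partial>lborel) = ennreal (- (1 powr (2*H-3+1)) / (2*H-3+1))"
      by (rule nn_integral_has_integral_lebesgue'[OF _ has_integral_powr_to_inf]) (use assms in auto)
    then show "(\<integral>\<^sup>+ x. ennreal (x powr (2*H-3) * indicator {1..} x) \<partial>lborel) < \<infinity>"
      by (simp add: ennreal_mult' ennreal_indicator)
  qed auto
  have int2: "integrable lborel (\<lambda>x::real. indicator {0..1} x :: real)" by simp
  note tr = lborel_integrable_real_affine[where c="-1"]
  show ?thesis
  proof (rule Bochner_Integration.integrable_bound[where f="\<lambda>x. (1 - x) powr (2*H-1) * indicator {0..1} (1 - x)
     + (8 * indicator {0..1} (- x) + 2 * ((- x) powr (2*H-1) * indicator {0..1} (- x)))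
     + (- x) powr (2*H-3) * indicator {1..} (- x)"])
    show "AE x in lborel. norm ((fbm_kernel H 1 x)\<^sup>2) \<le> norm ((1 - x) powr (2*H-1) * indicator {0..1} (1 - x)
     + (8 * indicator {0..1} (- x) + 2 * ((- x) powr (2*H-1) * indicator {0..1} (- x)))
     + (- x) powr (2*H-3) * indicator {1..} (- x))"
      using fbm_kernel_square_le[OF assms] by (intro AE_I2) (simp add: abs_of_nonneg)
  qed (use tr[OF int0, of 1] tr[OF int0, of 0] tr[OF int1, of 0] tr[OF int2, of 0] in auto)
qed

text \<open>Stationary increments and self-similarity: the terms in \<open>- x\<close> cancel, and
  the substitution \<open>b + h * x\<close> with \<open>h = a - b\<close> turns the difference into
  \<open>h powr (H - 1/2)\<close> times the kernel at time 1.\<close>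

lemma fbm_kernel_diff:
  assumes "0 < H" "H < 1"
  shows fbm_kernel_diff_integrable: "integrable lborel (\<lambda>x. (fbm_kernel H a x - fbm_kernel H b x)\<^sup>2)"
    and fbm_kernel_diff_integral:
      "(\<integral>x. (fbm_kernel H a x - fbm_kernel H b x)\<^sup>2 \<partial>lborel) = fbm_kernel_const H * \<bar>a - b\<bar> powr (2*H)"
proof -
  have *: "integrable lborel (\<lambda>x. (fbm_kernel H a x - fbm_kernel H b x)\<^sup>2) \<and>
      (\<integral>x. (fbm_kernel H a x - fbm_kernel H b x)\<^sup>2 \<partial>lborel) = fbm_kernel_const H * (a - b) powr (2*H)"
    if "b < a" for a b :: real
  proof -
    define h where "h = a - b"
    have h: "0 < h" using that by (simp add: h_def)
    have sc: "pos_powr e (h * y) = h powr e * pos_powr e y" for e y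
      using h by (auto simp: pos_powr_def powr_mult zero_less_mult_iff)
    have eq: "(fbm_kernel H a (b + h * x) - fbm_kernel H b (b + h * x))\<^sup>2
        = h powr (2*H-1) * (fbm_kernel H 1 x)\<^sup>2" for x
    proof -
      have "fbm_kernel H a (b + h * x) - fbm_kernel H b (b + h * x)
          = pos_powr (H-1/2) (h * (1 - x)) - pos_powr (H-1/2) (h * (- x))"
        by (auto simp: fbm_kernel_def h_def algebra_simps)
      also have "\<dots> = h powr (H - 1/2) * fbm_kernel H 1 x"
        unfolding sc by (simp add: fbm_kernel_def algebra_simps)
      finally show ?thesis
        by (simp add: power_mult_distrib) (simp add: power2_eq_square flip: powr_add)
    qed
    have "integrable lborel (\<lambda>x. (fbm_kernel H a (b + h * x) - fbm_kernel H b (b + h * x))\<^sup>2)"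
      unfolding eq using fbm_kernel_1_integrable[OF assms] by simp
    then have i: "integrable lborel (\<lambda>x. (fbm_kernel H a x - fbm_kernel H b x)\<^sup>2)"
      using h by (subst (asm) lborel_integrable_real_affine_iff[where f="\<lambda>x. (fbm_kernel H a x - fbm_kernel H b x)\<^sup>2"]) auto
    have "(\<integral>x. (fbm_kernel H a x - fbm_kernel H b x)\<^sup>2 \<partial>lborel)
       = h * (h powr (2*H-1) * fbm_kernel_const H)"
      using h by (subst lborel_integral_real_affine[where c=h and t=b])
        (auto simp: eq fbm_kernel_const_def)
    also have "\<dots> = fbm_kernel_const H * h powr (2*H)"
      using h powr_mult_base[of h "2*H-1"] by (simp add: algebra_simps)
    finally show ?thesis using i by (simp add: h_def)
  qed
  consider "a = b" | "b < a" | "a < b" by linarith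
  then have "integrable lborel (\<lambda>x. (fbm_kernel H a x - fbm_kernel H b x)\<^sup>2) \<and>
      (\<integral>x. (fbm_kernel H a x - fbm_kernel H b x)\<^sup>2 \<partial>lborel) = fbm_kernel_const H * \<bar>a - b\<bar> powr (2*H)"
  proof cases
    case 3
    then show ?thesis using *[of a b] by (simp add: power2_commute)
  qed (use * in auto)
  then show "integrable lborel (\<lambda>x. (fbm_kernel H a x - fbm_kernel H b x)\<^sup>2)"
    "(\<integral>x. (fbm_kernel H a x - fbm_kernel H b x)\<^sup>2 \<partial>lborel) = fbm_kernel_const H * \<bar>a - b\<bar> powr (2*H)"
    by auto
qed

lemma fbm_kernel_0 [simp]: "fbm_kernel H 0 x = 0"
  by (simp add: fbm_kernel_def)

text \<open>Polarisation, with the kernel at time 0 as the zero element. Its simplification rule is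
  switched off so that both squares keep the shape of a difference of kernels.\<close>

lemma fbm_kernel_mult_integrable:
  assumes "0 < H" "H < 1"
  shows "integrable lborel (\<lambda>x. fbm_kernel H a x * fbm_kernel H b x)"
proof -
  have "fbm_kernel H a x * fbm_kernel H b x = ((fbm_kernel H a x - fbm_kernel H 0 x)\<^sup>2
     + (fbm_kernel H b x - fbm_kernel H 0 x)\<^sup>2 - (fbm_kernel H a x - fbm_kernel H b x)\<^sup>2) / 2" for x
    by (simp add: power2_eq_square algebra_simps)
  then have eq: "(\<lambda>x. fbm_kernel H a x * fbm_kernel H b x) = (\<lambda>x. ((fbm_kernel H a x - fbm_kernel H 0 x)\<^sup>2
     + (fbm_kernel H b x - fbm_kernel H 0 x)\<^sup>2 - (fbm_kernel H a x - fbm_kernel H b x)\<^sup>2) / 2)" by auto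
  show ?thesis
    unfolding eq using fbm_kernel_diff_integrable[OF assms] by (simp del: fbm_kernel_0)
qed

lemma fbm_kernel_inner:
  assumes "0 < H" "H < 1" "0 \<le> a" "0 \<le> b"
  shows "(\<integral>x. fbm_kernel H a x * fbm_kernel H b x \<partial>lborel) = fbm_kernel_const H * fbm_cov H a b"
proof -
  have "fbm_kernel H a x * fbm_kernel H b x = ((fbm_kernel H a x - fbm_kernel H 0 x)\<^sup>2
     + (fbm_kernel H b x - fbm_kernel H 0 x)\<^sup>2 - (fbm_kernel H a x - fbm_kernel H b x)\<^sup>2) / 2" for x
    by (simp add: power2_eq_square algebra_simps)
  then have eq: "(\<lambda>x. fbm_kernel H a x * fbm_kernel H b x) = (\<lambda>x. ((fbm_kernel H a x - fbm_kernel H 0 x)\<^sup>2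
     + (fbm_kernel H b x - fbm_kernel H 0 x)\<^sup>2 - (fbm_kernel H a x - fbm_kernel H b x)\<^sup>2) / 2)" by auto
  have "(\<integral>x. fbm_kernel H a x * fbm_kernel H b x \<partial>lborel) =
     ((\<integral>x. (fbm_kernel H a x - fbm_kernel H 0 x)\<^sup>2 \<partial>lborel) + (\<integral>x. (fbm_kernel H b x - fbm_kernel H 0 x)\<^sup>2 \<partial>lborel)
      - (\<integral>x. (fbm_kernel H a x - fbm_kernel H b x)\<^sup>2 \<partial>lborel)) / 2"
    unfolding eq using fbm_kernel_diff_integrable[OF assms(1,2)] by (simp del: fbm_kernel_0)
  then show ?thesis
    unfolding fbm_kernel_diff_integral[OF assms(1,2)] fbm_cov_def
    using assms by (simp add: abs_minus_commute algebra_simps)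
qed

lemma fbm_kernel_sum_square:
  "(\<Sum>j\<in>J. c j * fbm_kernel H (\<tau> j) x)\<^sup>2
   = (\<Sum>j\<in>J. \<Sum>k\<in>J. c j * c k * (fbm_kernel H (\<tau> j) x * fbm_kernel H (\<tau> k) x))"
  unfolding power2_eq_square sum_product by (simp add: algebra_simps)

lemma fbm_kernel_sum_integrable:
  assumes "0 < H" "H < 1"
  shows "integrable lborel (\<lambda>x. (\<Sum>j\<in>J. c j * fbm_kernel H (\<tau> j) x)\<^sup>2)"
  unfolding fbm_kernel_sum_square using fbm_kernel_mult_integrable[OF assms]
  by (intro Bochner_Integration.integrable_sum) auto

text \<open>The isometry behind the nondeterminism: the variance of a linear combination of
  fractional Brownian motion is, up to a constant factor, a squared L2 norm, so that orthogonality
  in L2 can replace Gaussian conditioning.\<close>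

lemma fbm_kernel_sum_integral:
  assumes "0 < H" "H < 1" "\<And>j. j \<in> J \<Longrightarrow> 0 \<le> \<tau> j"
  shows "(\<integral>x. (\<Sum>j\<in>J. c j * fbm_kernel H (\<tau> j) x)\<^sup>2 \<partial>lborel)
    = fbm_kernel_const H * (\<Sum>j\<in>J. \<Sum>k\<in>J. c j * c k * fbm_cov H (\<tau> j) (\<tau> k))"
  unfolding fbm_kernel_sum_square using fbm_kernel_mult_integrable[OF assms(1,2)] assms
  by (simp add: Bochner_Integration.integral_sum fbm_kernel_inner sum_distrib_left algebra_simps)

text \<open>Only the summand with the largest time lives on the interval between the last two times.\<close>

lemma fbm_kernel_nondeterminism:
  assumes H: "0 < H" "H < 1" and "\<And>j. j \<in> J \<Longrightarrow> 0 \<le> \<tau> j \<and> \<tau> j \<le> a" "0 \<le> a" "a < a'"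
  shows "(a' - a) powr (2*H) / (2*H) \<le> (\<integral>x. (fbm_kernel H a' x + (\<Sum>j\<in>J. c j * fbm_kernel H (\<tau> j) x))\<^sup>2 \<partial>lborel)"
proof -
  define F where "F x = (fbm_kernel H a' x + (\<Sum>j\<in>J. c j * fbm_kernel H (\<tau> j) x))\<^sup>2" for x
  have F: "F x = (fbm_kernel H a' x)\<^sup>2 + (\<Sum>j\<in>J. 2 * c j * (fbm_kernel H a' x * fbm_kernel H (\<tau> j) x))
     + (\<Sum>j\<in>J. c j * fbm_kernel H (\<tau> j) x)\<^sup>2" for x
    unfolding F_def by (simp add: power2_sum sum_distrib_left algebra_simps)
  have iF: "integrable lborel F" unfolding F
    using fbm_kernel_diff_integrable[OF H, of a' 0] fbm_kernel_sum_integrable[OF H] fbm_kernel_mult_integrable[OF H]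
    by (intro Bochner_Integration.integrable_add Bochner_Integration.integrable_sum) auto
  have *: "ennreal ((a' - x) powr (2*H-1) * indicator {0..a'-a} (a' - x)) \<le> ennreal (F x)" if "x \<noteq> a" "x \<noteq> a'" for x
  proof (cases "a < x \<and> x < a'")
    case True
    then have "fbm_kernel H (\<tau> j) x = 0" if "j \<in> J" for j
      using assms(3)[OF that] by (auto simp: fbm_kernel_def pos_powr_def)
    then have "F x = (a' - x) powr (2*H-1)"
      using True assms(4) by (auto simp: F_def fbm_kernel_def pos_powr_def power2_eq_square simp flip: powr_add)
    then show ?thesis by (auto simp: indicator_def)
  next
    case False
    then show ?thesis using that by (auto simp: indicator_def F_def)
  qed
  have "ennreal ((a' - a) powr (2*H) / (2*H)) = (\<integral>\<^sup>+x. ennreal (x powr (2*H-1)) * indicator {0..a'-a} x \<partial>lborel)"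
    using H assms by (subst nn_integral_powr_from_0) auto
  also have "\<dots> = (\<integral>\<^sup>+x. ennreal ((a' - x) powr (2*H-1) * indicator {0..a'-a} (a' - x)) \<partial>lborel)"
    by (subst nn_integral_real_affine[where c="-1" and t=a']) (auto simp: ennreal_mult' ennreal_indicator)
  also have "\<dots> \<le> (\<integral>\<^sup>+x. ennreal (F x) \<partial>lborel)"
  proof (rule nn_integral_mono_AE)
    have "AE x in lborel. x \<noteq> a \<and> x \<noteq> a'"
      using AE_lborel_singleton[of a] AE_lborel_singleton[of a'] by eventually_elim auto
    then show "AE x in lborel. ennreal ((a' - x) powr (2*H-1) * indicator {0..a'-a} (a' - x)) \<le> ennreal (F x)"
      by eventually_elim (use * in blast)
  qed
  also have "\<dots> = ennreal (integral\<^sup>L lborel F)"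
    by (rule nn_integral_eq_integral[OF iF]) (auto simp: F_def)
  finally show ?thesis
    by (subst (asm) ennreal_le_iff) (auto simp: F_def[abs_def])
qed

text \<open>Nondeterminism with an empty past, between times 0 and 1.\<close>

lemma fbm_kernel_const_pos:
  assumes "0 < H" "H < 1"
  shows "0 < fbm_kernel_const H"
  using fbm_kernel_nondeterminism[OF assms, where J="{}" and a=0 and a'=1] assms
  by (simp add: fbm_kernel_const_def) (smt (verit) divide_pos_pos)

section \<open>Uniqueness of characteristic functions on generated sigma-algebras\<close>

text \<open>Gram--Schmidt without linear independence: coefficients exist although the family may be
  degenerate, as it is when the kernel at time 0 belongs to it.\<close>

lemma gram_projection:
  fixes f :: "'i \<Rightarrow> 'x \<Rightarrow> real"
  assumes int: "\<And>i j. integrable M (\<lambda>x. f i x * f j x)" and "finite P"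
  shows "\<exists>c. \<forall>s\<in>P. (\<integral>x. (f i x - (\<Sum>p\<in>P. c p * f p x)) * f s x \<partial>M) = 0"
  using \<open>finite P\<close>
proof (induction P arbitrary: i)
  case (insert y P)
  have lin: "(\<integral>x. (f i x - (\<Sum>p\<in>P. c p * f p x)) * f s x \<partial>M)
      = (\<integral>x. f i x * f s x \<partial>M) - (\<Sum>p\<in>P. c p * (\<integral>x. f p x * f s x \<partial>M))" for c i s and P :: "'i set"
  proof -
    have "(\<lambda>x. (f i x - (\<Sum>p\<in>P. c p * f p x)) * f s x) = (\<lambda>x. f i x * f s x - (\<Sum>p\<in>P. c p * (f p x * f s x)))"
      by (auto simp: left_diff_distrib sum_distrib_right mult.assoc)
    then show ?thesis using int by (simp add: Bochner_Integration.integral_sum)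
  qed
  have ilin: "integrable M (\<lambda>x. (f i x - (\<Sum>p\<in>P. c p * f p x)) * f s x)" for c i s and P :: "'i set"
  proof -
    have "(\<lambda>x. (f i x - (\<Sum>p\<in>P. c p * f p x)) * f s x) = (\<lambda>x. f i x * f s x - (\<Sum>p\<in>P. c p * (f p x * f s x)))"
      by (auto simp: left_diff_distrib sum_distrib_right mult.assoc)
    then show ?thesis using int by simp
  qed
  obtain cx where cx: "\<And>s. s\<in>P \<Longrightarrow> (\<integral>x. (f i x - (\<Sum>p\<in>P. cx p * f p x)) * f s x \<partial>M) = 0"
    using insert.IH[of i] by auto
  obtain cy where cy: "\<And>s. s\<in>P \<Longrightarrow> (\<integral>x. (f y x - (\<Sum>p\<in>P. cy p * f p x)) * f s x \<partial>M) = 0"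
    using insert.IH[of y] by auto
  define X where "X x = f i x - (\<Sum>p\<in>P. cx p * f p x)" for x
  define Y where "Y x = f y x - (\<Sum>p\<in>P. cy p * f p x)" for x
  have iX: "integrable M (\<lambda>x. X x * f s x)" and iY: "integrable M (\<lambda>x. Y x * f s x)" for s
    unfolding X_def Y_def by (rule ilin)+
  \<comment> \<open>v is the squared norm of the residual Y, because Y is orthogonal to P. If it
    vanishes, the new element lies in the span already and the coefficient t may be 0; otherwise t
    is the usual quotient, and the new residual is X - t Y.\<close>
  define v where "v = (\<integral>x. Y x * f y x \<partial>M)"
  have XY: "(\<integral>x. X x * f y x \<partial>M) = 0" if "v = 0"
  proof -
    have split: "Z x * f y x = Z x * Y x + (\<Sum>p\<in>P. cy p * (Z x * f p x))" for Z x
      unfolding Y_def by (simp add: algebra_simps sum_distrib_left)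
    have ZY: "integrable M (\<lambda>x. Z x * Y x) \<and> (\<integral>x. Z x * f y x \<partial>M) = (\<integral>x. Z x * Y x \<partial>M)"
      if "\<And>s. integrable M (\<lambda>x. Z x * f s x)" "\<And>s. s \<in> P \<Longrightarrow> (\<integral>x. Z x * f s x \<partial>M) = 0" for Z
    proof -
      have eq: "(\<lambda>x. Z x * Y x) = (\<lambda>x. Z x * f y x - (\<Sum>p\<in>P. cy p * (Z x * f p x)))"
        unfolding split by simp
      show ?thesis unfolding eq using that by (simp add: Bochner_Integration.integral_sum)
    qed
    have "integrable M (\<lambda>x. Y x * Y x)" "(\<integral>x. Y x * Y x \<partial>M) = 0"
      using ZY[of Y] iY cy that unfolding v_def Y_def by auto
    then have "AE x in M. Y x * Y x = 0"
      by (subst (asm) integral_nonneg_eq_0_iff_AE) auto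
    then have "AE x in M. X x * Y x = 0" by eventually_elim auto
    then have "(\<integral>x. X x * Y x \<partial>M) = 0" by (rule integral_eq_zero_AE)
    then show ?thesis using ZY[of X] iX cx unfolding X_def by auto
  qed
  define t where "t = (if v = 0 then 0 else (\<integral>x. X x * f y x \<partial>M) / v)"
  have "(\<integral>x. (f i x - (\<Sum>p\<in>insert y P. (if p = y then t else cx p - t * cy p) * f p x)) * f s x \<partial>M) = 0"
    if "s \<in> insert y P" for s
  proof -
    have "(\<Sum>p\<in>P. (if p = y then t else cx p - t * cy p) * f p x) = (\<Sum>p\<in>P. cx p * f p x) - t * (\<Sum>p\<in>P. cy p * f p x)" for x
      unfolding sum_distrib_left sum_subtractf[symmetric] using insert.hyps
      by (intro sum.cong) (auto simp: algebra_simps)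
    then have "(f i x - (\<Sum>p\<in>insert y P. (if p = y then t else cx p - t * cy p) * f p x)) * f s x
        = X x * f s x - t * (Y x * f s x)" for x
      unfolding sum.insert[OF insert.hyps] by (simp only:) (simp add: X_def Y_def algebra_simps)
    then have "(\<integral>x. (f i x - (\<Sum>p\<in>insert y P. (if p = y then t else cx p - t * cy p) * f p x)) * f s x \<partial>M)
       = (\<integral>x. X x * f s x \<partial>M) - t * (\<integral>x. Y x * f s x \<partial>M)"
      using iX iY by simp
    also have "\<dots> = 0"
    proof (cases "s = y")
      case True
      then show ?thesis using XY by (auto simp: t_def v_def)
    next
      case False
      then show ?thesis using that cx cy by (auto simp: X_def Y_def)
    qed
    finally show ?thesis .
  qed
  then show ?case by (intro exI[of _ "\<lambda>p. if p = y then t else cx p - t * cy p"] ballI)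
qed auto

text \<open>The positive and negative parts of D have equal mass m (frequency 0). If m = 0, D
  vanishes almost surely. Otherwise, divided by m, both parts are probability densities under which
  Y has the same characteristic function, so Levy's theorem identifies the two laws of Y.\<close>

lemma (in prob_space) char_uniqueness_real:
  fixes D Y :: "'a \<Rightarrow> real"
  assumes D: "integrable M D" and [measurable]: "Y \<in> borel_measurable M"
    and z: "\<And>y. (\<integral>\<omega>. complex_of_real (D \<omega>) * cis (y * Y \<omega>) \<partial>M) = 0"
    and A[measurable]: "A \<in> sets borel"
  shows "(\<integral>\<omega>. D \<omega> * indicator A (Y \<omega>) \<partial>M) = 0"
proof -
  have [measurable]: "D \<in> borel_measurable M" using D by auto
  define Dp where "Dp \<omega> = max (D \<omega>) 0" for \<omega>
  define Dm where "Dm \<omega> = max (- D \<omega>) 0" for \<omega>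
  have [measurable]: "Dp \<in> borel_measurable M" "Dm \<in> borel_measurable M" unfolding Dp_def Dm_def by measurable
  have DD: "D \<omega> = Dp \<omega> - Dm \<omega>" for \<omega> by (auto simp: Dp_def Dm_def)
  have ip: "integrable M Dp" and im: "integrable M Dm" using D unfolding Dp_def Dm_def by auto
  have nn: "0 \<le> Dp \<omega>" "0 \<le> Dm \<omega>" for \<omega> by (auto simp: Dp_def Dm_def)
  have icis: "integrable M (\<lambda>\<omega>. complex_of_real (G \<omega>) * cis (y * Y \<omega>))" if "integrable M G" for G y
    by (rule Bochner_Integration.integrable_bound[OF that]) (use that in \<open>auto simp: norm_mult\<close>)
  have eqc: "(\<integral>\<omega>. complex_of_real (Dp \<omega>) * cis (y * Y \<omega>) \<partial>M) = (\<integral>\<omega>. complex_of_real (Dm \<omega>) * cis (y * Y \<omega>) \<partial>M)" for y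
    using z[of y] icis[OF ip] icis[OF im] unfolding DD by (simp add: left_diff_distrib)
  define m where "m = (\<integral>\<omega>. Dp \<omega> \<partial>M)"
  have m': "m = (\<integral>\<omega>. Dm \<omega> \<partial>M)"
    using eqc[of 0] by (simp add: m_def)
  have "0 \<le> m" unfolding m_def using nn by simp
  show ?thesis
  proof (cases "m = 0")
    case True
    have "AE \<omega> in M. Dp \<omega> = 0" using True ip nn unfolding m_def by (subst (asm) integral_nonneg_eq_0_iff_AE) auto
    moreover have "AE \<omega> in M. Dm \<omega> = 0" using True im nn unfolding m' by (subst (asm) integral_nonneg_eq_0_iff_AE) auto
    ultimately have "AE \<omega> in M. D \<omega> * indicator A (Y \<omega>) = 0" by eventually_elim (simp add: DD)
    then show ?thesis by (rule integral_eq_zero_AE)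
  next
    case False
    then have m: "0 < m" using \<open>0 \<le> m\<close> by simp
    define N where "N G = distr (density M (\<lambda>\<omega>. ennreal (G \<omega> / m))) borel Y" for G
    have distrN: "real_distribution (N G)" if "integrable M G" "\<And>\<omega>. 0 \<le> G \<omega>" "(\<integral>\<omega>. G \<omega> \<partial>M) = m" for G
    proof -
      have [measurable]: "G \<in> borel_measurable M" using that by auto
      have "(\<integral>\<^sup>+\<omega>. ennreal (G \<omega> / m) \<partial>M) = ennreal (\<integral>\<omega>. G \<omega> / m \<partial>M)"
        using that m by (intro nn_integral_eq_integral) auto
      then have "prob_space (density M (\<lambda>\<omega>. ennreal (G \<omega> / m)))"
        using that m by (intro prob_spaceI) (simp add: emeasure_density cong: nn_integral_cong)
      then show ?thesis unfolding N_def
        by (intro real_distribution.intro prob_space.prob_space_distr real_distribution_axioms.intro) auto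
    qed
    have charN: "char (N G) y = (\<integral>\<omega>. complex_of_real (G \<omega>) * cis (y * Y \<omega>) \<partial>M) / m"
      if "integrable M G" "\<And>\<omega>. 0 \<le> G \<omega>" for G y
    proof -
      have [measurable]: "G \<in> borel_measurable M" using that by auto
      show ?thesis
        unfolding char_def N_def using that m
        by (subst integral_distr; (simp add: integral_density cis_conv_exp scaleR_conv_of_real)?)
    qed
    have "N Dp = N Dm"
      by (rule Levy_uniqueness[OF distrN distrN])
        (use ip im nn m' in \<open>auto simp: charN eqc m_def\<close>)
    then have "emeasure (N Dp) A = emeasure (N Dm) A" by simp
    moreover have emN: "emeasure (N G) A = ennreal (\<integral>\<omega>. G \<omega> / m * indicator A (Y \<omega>) \<partial>M)"
      if "integrable M G" "\<And>\<omega>. 0 \<le> G \<omega>" for G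
    proof -
      have [measurable]: "G \<in> borel_measurable M" using that by auto
      have i: "integrable M (\<lambda>\<omega>. G \<omega> / m * indicator A (Y \<omega>))"
        by (rule Bochner_Integration.integrable_bound[where f="\<lambda>\<omega>. G \<omega> / m"])
           (use that m in \<open>auto simp: indicator_def\<close>)
      have "emeasure (N G) A = (\<integral>\<^sup>+\<omega>. ennreal (G \<omega> / m * indicator A (Y \<omega>)) \<partial>M)"
        unfolding N_def by (subst emeasure_distr)
          (auto simp: emeasure_density indicator_def intro!: nn_integral_cong)
      also have "\<dots> = ennreal (\<integral>\<omega>. G \<omega> / m * indicator A (Y \<omega>) \<partial>M)"
        by (rule nn_integral_eq_integral[OF i]) (use that m in auto)
      finally show ?thesis .
    qed
    ultimately have "(\<integral>\<omega>. Dp \<omega> / m * indicator A (Y \<omega>) \<partial>M) = (\<integral>\<omega>. Dm \<omega> / m * indicator A (Y \<omega>) \<partial>M)"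
      using nn m by (simp add: emN[OF ip] emN[OF im] integral_nonneg_AE)
    then have e: "(\<integral>\<omega>. Dp \<omega> * indicator A (Y \<omega>) \<partial>M) = (\<integral>\<omega>. Dm \<omega> * indicator A (Y \<omega>) \<partial>M)"
      using m by simp
    have i: "integrable M (\<lambda>\<omega>. G \<omega> * indicator A (Y \<omega>))" if "integrable M G" for G :: "'a \<Rightarrow> real"
      by (rule Bochner_Integration.integrable_bound[OF that])
           (use that in \<open>auto simp: indicator_def\<close>)
    show ?thesis unfolding DD using e i[OF ip] i[OF im] by (simp add: left_diff_distrib)
  qed
qed

text \<open>Conjugation turns the hypothesis at y into the one at -y, so it holds for the conjugate
  of D too, hence for the real and imaginary parts.\<close>

lemma (in prob_space) char_uniqueness_complex:
  fixes D :: "'a \<Rightarrow> complex" and Y :: "'a \<Rightarrow> real"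
  assumes D: "integrable M D" and Y[measurable]: "Y \<in> borel_measurable M"
    and z: "\<And>y. (\<integral>\<omega>. D \<omega> * cis (y * Y \<omega>) \<partial>M) = 0"
    and A[measurable]: "A \<in> sets borel"
  shows "(\<integral>\<omega>. D \<omega> * indicator A (Y \<omega>) \<partial>M) = 0"
proof -
  have [measurable]: "D \<in> borel_measurable M" using D by auto
  have icis: "integrable M (\<lambda>\<omega>. G \<omega> * cis (y * Y \<omega>))" if "integrable M G" for G y
    by (rule Bochner_Integration.integrable_bound[OF that]) (use that in \<open>auto simp: norm_mult\<close>)
  have iind: "integrable M (\<lambda>\<omega>. D \<omega> * indicator A (Y \<omega>))"
    by (rule Bochner_Integration.integrable_bound[OF D]) (auto simp: norm_mult indicator_def)
  have zc: "(\<integral>\<omega>. cnj (D \<omega>) * cis (y * Y \<omega>) \<partial>M) = 0" for y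
  proof -
    have "(\<integral>\<omega>. cnj (D \<omega>) * cis (y * Y \<omega>) \<partial>M) = (\<integral>\<omega>. cnj (D \<omega> * cis ((- y) * Y \<omega>)) \<partial>M)"
      by (simp add: cis_cnj)
    also have "\<dots> = cnj (\<integral>\<omega>. D \<omega> * cis ((- y) * Y \<omega>) \<partial>M)" by (rule Bochner_Integration.integral_cnj)
    also have "\<dots> = 0" by (simp only: z) simp
    finally show ?thesis .
  qed
  have Dc: "integrable M (\<lambda>\<omega>. cnj (D \<omega>))" using D by simp
  have "complex_of_real (Re (D \<omega>)) = (D \<omega> + cnj (D \<omega>)) / 2"
    "complex_of_real (Im (D \<omega>)) = (D \<omega> - cnj (D \<omega>)) / (2 * \<i>)" for \<omega>
    by (auto simp: complex_eq_iff)
  note p = this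
  have "(\<integral>\<omega>. complex_of_real (Re (D \<omega>)) * cis (y * Y \<omega>) \<partial>M) = 0"
    "(\<integral>\<omega>. complex_of_real (Im (D \<omega>)) * cis (y * Y \<omega>) \<partial>M) = 0" for y
  proof -
    have *: "(\<integral>\<omega>. (D \<omega> * cis (y * Y \<omega>) + cnj (D \<omega>) * cis (y * Y \<omega>)) / 2 \<partial>M) = 0"
        "(\<integral>\<omega>. (D \<omega> * cis (y * Y \<omega>) - cnj (D \<omega>) * cis (y * Y \<omega>)) / (2 * \<i>) \<partial>M) = 0"
      using z[of y] zc[of y] icis[OF D, of y] icis[OF Dc, of y]
      by (simp_all only: integral_divide_zero Bochner_Integration.integral_add Bochner_Integration.integral_diff)
         simp_all
    show "(\<integral>\<omega>. complex_of_real (Re (D \<omega>)) * cis (y * Y \<omega>) \<partial>M) = 0"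
      using *(1) unfolding p(1) by (simp add: algebra_simps)
    show "(\<integral>\<omega>. complex_of_real (Im (D \<omega>)) * cis (y * Y \<omega>) \<partial>M) = 0"
      using *(2) unfolding p(2) by (simp only: left_diff_distrib times_divide_eq_left)
  qed
  then have r: "(\<integral>\<omega>. Re (D \<omega>) * indicator A (Y \<omega>) \<partial>M) = 0" "(\<integral>\<omega>. Im (D \<omega>) * indicator A (Y \<omega>) \<partial>M) = 0"
    using D by (auto intro!: char_uniqueness_real)
  have ind: "Re (indicator A x) = indicator A x" "Im (indicator A x) = 0" for x :: real
    by (auto simp: indicator_def)
  have "Re (\<integral>\<omega>. D \<omega> * indicator A (Y \<omega>) \<partial>M) = 0" "Im (\<integral>\<omega>. D \<omega> * indicator A (Y \<omega>) \<partial>M) = 0"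
    using r by (simp_all add: integral_Re[OF iind, symmetric] integral_Im[OF iind, symmetric] ind)
  then show ?thesis by (simp add: complex_eq_iff)
qed

text \<open>Induction that moves one indicator at a time into the weight. In the induction step the
  exponentials of the other coordinates belong to the weight as well, which is why D is
  complex.\<close>

lemma (in prob_space) char_uniqueness_finite:
  fixes D :: "'a \<Rightarrow> complex" and Y :: "'i \<Rightarrow> 'a \<Rightarrow> real"
  assumes "finite J" "integrable M D" "\<And>j. j \<in> J \<Longrightarrow> Y j \<in> borel_measurable M"
    and "\<And>y. (\<integral>\<omega>. D \<omega> * cis (\<Sum>j\<in>J. y j * Y j \<omega>) \<partial>M) = 0"
    and "\<And>j. j \<in> J \<Longrightarrow> A j \<in> sets borel"
  shows "(\<integral>\<omega>. D \<omega> * (\<Prod>j\<in>J. indicator (A j) (Y j \<omega>)) \<partial>M) = 0"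
  using assms
proof (induction J arbitrary: D)
  case empty
  then show ?case by simp
next
  case (insert j J)
  have [measurable]: "Y k \<in> borel_measurable M" if "k \<in> insert j J" for k using insert.prems that by auto
  have [measurable]: "A k \<in> sets borel" if "k \<in> insert j J" for k using insert.prems that by auto
  have [measurable]: "Y j \<in> borel_measurable M" "A j \<in> sets borel" by auto
  have [measurable]: "D \<in> borel_measurable M" using insert.prems by auto
  have "(\<integral>\<omega>. (D \<omega> * indicator (A j) (Y j \<omega>)) * cis (\<Sum>k\<in>J. y k * Y k \<omega>) \<partial>M) = 0" for y
  proof -
    have m: "(\<lambda>\<omega>. \<Sum>k\<in>J. y k * Y k \<omega>) \<in> borel_measurable M" by (intro borel_measurable_sum borel_measurable_times) auto
    have 1: "integrable M (\<lambda>\<omega>. D \<omega> * cis (\<Sum>k\<in>J. y k * Y k \<omega>))"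
      by (rule Bochner_Integration.integrable_bound[OF insert.prems(1)])
         (use m in \<open>auto simp: norm_mult\<close>)
    have 2: "(\<integral>\<omega>. D \<omega> * cis (\<Sum>k\<in>J. y k * Y k \<omega>) * cis (x * Y j \<omega>) \<partial>M) = 0" for x
    proof -
      have "(\<Sum>k\<in>insert j J. (y(j := x)) k * Y k \<omega>) = x * Y j \<omega> + (\<Sum>k\<in>J. y k * Y k \<omega>)" for \<omega>
        using insert.hyps by (subst sum.insert) (auto intro!: sum.cong)
      then show ?thesis using insert.prems(3)[of "y(j := x)"] by (simp add: cis_mult[symmetric] mult_ac)
    qed
    show ?thesis using char_uniqueness_complex[OF 1 _ 2, of "A j"] by (simp add: mult_ac)
  qed
  moreover have "integrable M (\<lambda>\<omega>. D \<omega> * indicator (A j) (Y j \<omega>))"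
    by (rule Bochner_Integration.integrable_bound[OF insert.prems(1)]) (auto simp: norm_mult indicator_def)
  ultimately have "(\<integral>\<omega>. (D \<omega> * indicator (A j) (Y j \<omega>)) * (\<Prod>k\<in>J. indicator (A k) (Y k \<omega>)) \<partial>M) = 0"
    by (intro insert.IH) (use insert.prems in auto)
  then show ?case using insert.hyps by (simp add: mult_ac)
qed

definition vimage_sets :: "'a set \<Rightarrow> ('i \<Rightarrow> 'a \<Rightarrow> real) \<Rightarrow> 'i set \<Rightarrow> 'a set set" where
  "vimage_sets \<Omega> Y J = {Y j -` A \<inter> \<Omega> | j A. j \<in> J \<and> A \<in> sets borel}"

lemma (in prob_space) vimage_sets_events:
  assumes "\<And>j. j \<in> J \<Longrightarrow> Y j \<in> borel_measurable M"
  shows "sigma_sets (space M) (vimage_sets (space M) Y J) \<subseteq> events"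
  using assms by (intro sets.sigma_sets_subset) (auto simp: vimage_sets_def)

text \<open>Dynkin's argument on cylinder events: they contain the generators (take the full line in
  the other coordinates) and are closed under intersection.\<close>

lemma (in prob_space) char_uniqueness_sigma:
  fixes D :: "'a \<Rightarrow> complex" and Y :: "'i \<Rightarrow> 'a \<Rightarrow> real"
  assumes J: "finite J" and D: "integrable M D" and Y: "\<And>j. j \<in> J \<Longrightarrow> Y j \<in> borel_measurable M"
    and z: "\<And>y. (\<integral>\<omega>. D \<omega> * cis (\<Sum>j\<in>J. y j * Y j \<omega>) \<partial>M) = 0"
    and E: "E \<in> sigma_sets (space M) (vimage_sets (space M) Y J)"
  shows "(\<integral>\<omega>. D \<omega> * indicator E \<omega> \<partial>M) = 0"
proof -
  define G where "G = {{\<omega> \<in> space M. \<forall>j\<in>J. Y j \<omega> \<in> A j} | A. \<forall>j\<in>J. A j \<in> sets borel}"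
  have "vimage_sets (space M) Y J \<subseteq> G"
  proof
    fix B assume "B \<in> vimage_sets (space M) Y J"
    then obtain j A where jA: "j \<in> J" "A \<in> sets borel" "B = Y j -` A \<inter> space M" by (auto simp: vimage_sets_def)
    have "B = {\<omega> \<in> space M. \<forall>k\<in>J. Y k \<omega> \<in> (if k = j then A else UNIV)}"
      using jA by (auto split: if_splits)
    moreover have "\<forall>k\<in>J. (if k = j then A else UNIV) \<in> sets borel" using jA by auto
    ultimately show "B \<in> G" unfolding G_def by (intro CollectI exI conjI)
  qed
  then have E: "E \<in> sigma_sets (space M) G" using E sigma_sets_mono' by blast
  have Gint: "Int_stable G"
  proof (rule Int_stableI)
    fix a b assume "a \<in> G" "b \<in> G"
    then obtain A B where "a = {\<omega> \<in> space M. \<forall>j\<in>J. Y j \<omega> \<in> A j}" "\<forall>j\<in>J. A j \<in> sets borel"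
       "b = {\<omega> \<in> space M. \<forall>j\<in>J. Y j \<omega> \<in> B j}" "\<forall>j\<in>J. B j \<in> sets borel" unfolding G_def by auto
    then have "a \<inter> b = {\<omega> \<in> space M. \<forall>j\<in>J. Y j \<omega> \<in> A j \<inter> B j}" "\<forall>j\<in>J. A j \<inter> B j \<in> sets borel" by auto
    then show "a \<inter> b \<in> G" unfolding G_def by (intro CollectI exI conjI)
  qed
  have Gsub: "G \<subseteq> events"
  proof
    fix B assume "B \<in> G"
    then obtain A where A: "B = {\<omega> \<in> space M. \<forall>j\<in>J. Y j \<omega> \<in> A j}" "\<forall>j\<in>J. A j \<in> sets borel" unfolding G_def by auto
    have "{\<omega> \<in> space M. \<forall>j\<in>J. Y j \<omega> \<in> A j} \<in> events"
      by (rule sets.sets_Collect_finite_All[OF _ J]) (use A Y in auto)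
    then show "B \<in> events" using A by simp
  qed
  have Gpow: "G \<subseteq> Pow (space M)" using Gsub sets.sets_into_space by blast
  have sub: "sigma_sets (space M) G \<subseteq> events" using Gsub by (rule sets.sigma_sets_subset)
  have iB: "integrable M (\<lambda>\<omega>. D \<omega> * indicator B \<omega>)" if "B \<in> events" for B
    using that D by (intro Bochner_Integration.integrable_bound[OF D]) (auto simp: norm_mult indicator_def)
  \<comment> \<open>Frequency 0; the complement step rests on it.\<close>
  have D0: "(\<integral>\<omega>. D \<omega> \<partial>M) = 0" using z[of "\<lambda>_. 0"] by simp
  show ?thesis
    using Gint Gpow E
  proof (induction rule: sigma_sets_induct_disjoint)
    case (basic B)
    then obtain A where A: "B = {\<omega> \<in> space M. \<forall>j\<in>J. Y j \<omega> \<in> A j}" "\<forall>j\<in>J. A j \<in> sets borel" unfolding G_def by auto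
    have "(\<integral>\<omega>. D \<omega> * indicator B \<omega> \<partial>M) = (\<integral>\<omega>. D \<omega> * (\<Prod>j\<in>J. indicator (A j) (Y j \<omega>)) \<partial>M)"
    proof (rule Bochner_Integration.integral_cong[OF refl])
      fix \<omega> assume w: "\<omega> \<in> space M"
      show "D \<omega> * indicator B \<omega> = D \<omega> * (\<Prod>j\<in>J. indicator (A j) (Y j \<omega>))"
      proof (cases "\<omega> \<in> B")
        case True
        then have "(\<Prod>j\<in>J. indicator (A j) (Y j \<omega>)) = (1::complex)"
          unfolding A(1) by (intro prod.neutral) auto
        then show ?thesis using True by simp
      next
        case False
        then obtain j where "j \<in> J" "Y j \<omega> \<notin> A j" using w unfolding A(1) by auto
        then have "(\<Prod>j\<in>J. indicator (A j) (Y j \<omega>)) = (0::complex)"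
          using J by (intro prod_zero bexI[of _ j]) auto
        then show ?thesis using False by simp
      qed
    qed
    also have "\<dots> = 0" by (rule char_uniqueness_finite) (use assms A in auto)
    finally show ?case .
  next
    case (compl B)
    have "(\<integral>\<omega>. D \<omega> * indicator (space M - B) \<omega> \<partial>M) = (\<integral>\<omega>. D \<omega> - D \<omega> * indicator B \<omega> \<partial>M)"
      by (intro Bochner_Integration.integral_cong) (auto simp: indicator_def)
    also have "\<dots> = 0" using D iB compl sub D0 by (subst Bochner_Integration.integral_diff) auto
    finally show ?case .
  next
    case (union B)
    have B: "range B \<subseteq> events" using union sub by auto
    have dj: "disjoint_family B" using union by simp
    have dif: "D x * of_bool P = (if P then D x else 0)" "of_bool P *\<^sub>R D x = (if P then D x else 0)" for x P by simp_all
    have i: "set_integrable M (\<Union>i. B i) D" using iB[of "\<Union>i. B i"] B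
      unfolding set_integrable_def indicator_scaleR_eq_if indicator_def by (simp add: dif)
    have "(LINT x:(\<Union>i. B i)|M. D x) = (\<Sum>i. LINT x:B i|M. D x)"
      using B dj by (intro lebesgue_integral_countable_add[OF _ _ i]) (auto simp: disjoint_family_on_def)
    moreover have "(LINT x:S|M. D x) = (\<integral>\<omega>. D \<omega> * indicator S \<omega> \<partial>M)" for S
      unfolding set_lebesgue_integral_def indicator_def by (simp add: dif)
    ultimately show ?case using union by simp
  qed simp
qed

text \<open>The past is generated by uncountably many times, while projections and characteristic
  functions are handled for finitely many; approximation in measure bridges the gap.\<close>

lemma (in prob_space) vimage_sets_approx:
  assumes Y: "\<And>j. j \<in> I \<Longrightarrow> Y j \<in> borel_measurable M"
    and "E \<in> sigma_sets (space M) (vimage_sets (space M) Y I)" "0 < e"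
  shows "\<exists>J E'. finite J \<and> J \<subseteq> I \<and> E' \<in> sigma_sets (space M) (vimage_sets (space M) Y J)
     \<and> prob ((E - E') \<union> (E' - E)) < e"
  using assms(2,3)
proof (induction arbitrary: e rule: sigma_sets.induct)
  case (Basic a)
  then obtain j A where "a = Y j -` A \<inter> space M" "j \<in> I" "A \<in> sets borel" by (auto simp: vimage_sets_def)
  then have "a \<in> sigma_sets (space M) (vimage_sets (space M) Y {j})" by (auto simp: vimage_sets_def)
  then show ?case using \<open>j \<in> I\<close> Basic by (intro exI[of _ "{j}"] exI[of _ a]) auto
next
  case Empty
  then show ?case by (intro exI[of _ "{}"] exI[of _ "{}"]) (auto intro: sigma_sets.Empty)
next
  case (Compl a)
  from Compl.IH[OF Compl.prems] obtain J E' where J: "finite J" "J \<subseteq> I"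
    "E' \<in> sigma_sets (space M) (vimage_sets (space M) Y J)" "prob ((a - E') \<union> (E' - a)) < e" by blast
  have vp: "vimage_sets (space M) Y K \<subseteq> Pow (space M)" for K by (auto simp: vimage_sets_def)
  have s: "a \<subseteq> space M" "E' \<subseteq> space M"
    using sigma_sets_into_sp[OF vp Compl.hyps] sigma_sets_into_sp[OF vp J(3)] by auto
  have "((space M - a) - (space M - E')) \<union> ((space M - E') - (space M - a)) = (a - E') \<union> (E' - a)"
    using s by auto
  then show ?case using J sigma_sets.Compl[OF J(3)] by (intro exI[of _ J] exI[of _ "space M - E'"]) simp
next
  case (Union a)
  have ev: "a i \<in> events" for i
    using Union.hyps[of i] vimage_sets_events[of I Y] Y by auto
  have "(\<lambda>n. prob (\<Union>i<n. a i)) \<longlonglongrightarrow> prob (\<Union>n. \<Union>i<n. a i)"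
    by (rule finite_Lim_measure_incseq) (use ev in \<open>auto simp: incseq_def intro: less_le_trans\<close>)
  moreover have "(\<Union>n. \<Union>i<n. a i) = (\<Union>i. a i)" by auto
  ultimately have "(\<lambda>n. prob (\<Union>i<n. a i)) \<longlonglongrightarrow> prob (\<Union>i. a i)" by simp
  then have "eventually (\<lambda>n. prob (\<Union>i. a i) - e/2 < prob (\<Union>i<n. a i)) sequentially"
    by (rule order_tendstoD) (use Union.prems in auto)
  then obtain n where n: "prob (\<Union>i. a i) - e/2 < prob (\<Union>i<n. a i)" by (auto simp: eventually_sequentially)
  \<comment> \<open>Half of e is spent on cutting the union at n, the other half on n
    approximations; \<open>Suc n\<close> keeps the quotient meaningful for n = 0.\<close>
  define e' where "e' = e / (2 * real (Suc n))"
  have e': "0 < e'" using Union.prems by (simp add: e'_def)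
  have "\<exists>J E'. finite J \<and> J \<subseteq> I \<and> E' \<in> sigma_sets (space M) (vimage_sets (space M) Y J)
     \<and> prob ((a i - E') \<union> (E' - a i)) < e'" for i using Union.IH[OF e'] .
  then obtain J E' where J: "\<And>i. finite (J i)" "\<And>i. J i \<subseteq> I"
     "\<And>i. E' i \<in> sigma_sets (space M) (vimage_sets (space M) Y (J i))"
     "\<And>i. prob ((a i - E' i) \<union> (E' i - a i)) < e'" by metis
  define J' where "J' = (\<Union>i<n. J i)"
  have E': "E' i \<in> events" for i
    using J(3)[of i] vimage_sets_events[of "J i" Y] J(2)[of i] Y by (meson subsetD)
  have "(\<Union>i<n. E' i) \<in> sigma_sets (space M) (vimage_sets (space M) Y J')"
  proof -
    interpret S: sigma_algebra "space M" "sigma_sets (space M) (vimage_sets (space M) Y J')"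
      by (rule sigma_algebra_sigma_sets) (auto simp: vimage_sets_def)
    have "E' i \<in> sigma_sets (space M) (vimage_sets (space M) Y J')" if "i < n" for i
    proof -
      have "vimage_sets (space M) Y (J i) \<subseteq> vimage_sets (space M) Y J'"
        using that unfolding J'_def vimage_sets_def by blast
      then show ?thesis using J(3)[of i] sigma_sets_mono' by (meson subsetD)
    qed
    then show ?thesis by (intro S.finite_UN) auto
  qed
  moreover have "prob (((\<Union>i. a i) - (\<Union>i<n. E' i)) \<union> ((\<Union>i<n. E' i) - (\<Union>i. a i))) < e"
  proof -
    have "((\<Union>i. a i) - (\<Union>i<n. E' i)) \<union> ((\<Union>i<n. E' i) - (\<Union>i. a i))
      \<subseteq> ((\<Union>i. a i) - (\<Union>i<n. a i)) \<union> (\<Union>i<n. (a i - E' i) \<union> (E' i - a i))" by auto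
    then have "prob (((\<Union>i. a i) - (\<Union>i<n. E' i)) \<union> ((\<Union>i<n. E' i) - (\<Union>i. a i)))
       \<le> prob (((\<Union>i. a i) - (\<Union>i<n. a i)) \<union> (\<Union>i<n. (a i - E' i) \<union> (E' i - a i)))"
      using ev E' by (intro finite_measure_mono) auto
    also have "\<dots> \<le> prob ((\<Union>i. a i) - (\<Union>i<n. a i)) + prob (\<Union>i<n. (a i - E' i) \<union> (E' i - a i))"
      using ev E' by (intro measure_Un_le) auto
    also have "prob ((\<Union>i. a i) - (\<Union>i<n. a i)) = prob (\<Union>i. a i) - prob (\<Union>i<n. a i)"
      using ev by (intro finite_measure_Diff) auto
    also have "prob (\<Union>i<n. (a i - E' i) \<union> (E' i - a i)) \<le> (\<Sum>i<n. prob ((a i - E' i) \<union> (E' i - a i)))"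
      using ev E' by (intro finite_measure_subadditive_finite) auto
    also have "\<dots> \<le> (\<Sum>i<n. e')" using J(4) by (intro sum_mono less_imp_le)
    also have "\<dots> \<le> e / 2" using Union.prems by (simp add: e'_def field_simps)
    finally show ?thesis using n by simp
  qed
  ultimately show ?case using J(1,2)
    by (intro exI[of _ J'] exI[of _ "\<Union>i<n. E' i"]) (auto simp: J'_def)
qed

section \<open>Gaussian structure of the sheet\<close>

text \<open>A centred point mass sits at 0, so the degenerate case fits the formulas with variance
  0; otherwise the characteristic function is that of the standard normal law at \<sigma>.\<close>

lemma (in prob_space) gaussian_variable_centered:
  assumes g: "gaussian_variable M Y" and m: "(\<integral>\<omega>. Y \<omega> \<partial>M) = 0"
  shows "integrable M Y" "integrable M (\<lambda>\<omega>. (Y \<omega>)\<^sup>2)"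
    "(\<integral>\<omega>. cis (Y \<omega>) \<partial>M) = complex_of_real (exp (- (\<integral>\<omega>. (Y \<omega>)\<^sup>2 \<partial>M) / 2))"
    "(\<integral>\<omega>. (Y \<omega>)\<^sup>2 \<partial>M) > 0 \<Longrightarrow> distributed M lborel Y (\<lambda>x. ennreal (normal_density 0 (sqrt (\<integral>\<omega>. (Y \<omega>)\<^sup>2 \<partial>M)) x))"
proof -
  have [measurable]: "Y \<in> borel_measurable M" using g by (simp add: gaussian_variable_def)
  have "integrable M Y \<and> integrable M (\<lambda>\<omega>. (Y \<omega>)\<^sup>2) \<and>
    (\<integral>\<omega>. cis (Y \<omega>) \<partial>M) = complex_of_real (exp (- (\<integral>\<omega>. (Y \<omega>)\<^sup>2 \<partial>M) / 2)) \<and>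
    ((\<integral>\<omega>. (Y \<omega>)\<^sup>2 \<partial>M) > 0 \<longrightarrow> distributed M lborel Y (\<lambda>x. ennreal (normal_density 0 (sqrt (\<integral>\<omega>. (Y \<omega>)\<^sup>2 \<partial>M)) x)))"
  proof -
    consider c where "AE \<omega> in M. Y \<omega> = c" | \<mu> \<sigma> where "\<sigma> > 0" "distributed M lborel Y (\<lambda>x. ennreal (normal_density \<mu> \<sigma> x))"
      using g unfolding gaussian_variable_def by auto
    then show ?thesis
    proof cases
      case 1
      have "(\<integral>\<omega>. Y \<omega> \<partial>M) = (\<integral>\<omega>. c \<partial>M)" using 1 by (intro integral_cong_AE) auto
      then have "c = 0" using m by (simp add: prob_space)
      then have Y0: "AE \<omega> in M. Y \<omega> = 0" using 1 by simp
      have "integrable M Y \<longleftrightarrow> integrable M (\<lambda>_. 0::real)" using Y0 by (intro integrable_cong_AE) auto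
      moreover have "integrable M (\<lambda>\<omega>. (Y \<omega>)\<^sup>2) \<longleftrightarrow> integrable M (\<lambda>_. 0::real)" using Y0 by (intro integrable_cong_AE) auto
      moreover have "(\<integral>\<omega>. (Y \<omega>)\<^sup>2 \<partial>M) = (\<integral>\<omega>. 0 \<partial>M)" using Y0 by (intro integral_cong_AE) auto
      moreover have "(\<integral>\<omega>. cis (Y \<omega>) \<partial>M) = (\<integral>\<omega>. 1 \<partial>M)"
        by (intro integral_cong_AE) (use Y0 in auto)
      ultimately show ?thesis by (simp add: prob_space)
    next
      case 2
      have \<mu>: "\<mu> = 0" using normal_distributed_expectation[OF 2] m by simp
      have v: "(\<integral>\<omega>. (Y \<omega>)\<^sup>2 \<partial>M) = \<sigma>\<^sup>2"
        using normal_distributed_variance[OF 2] m by simp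
      have i1: "integrable M Y"
        using distributed_integrable[OF 2(2), of "\<lambda>x. x"] integrable_normal_moment[OF 2(1), of \<mu> 1] \<mu> by auto
      have i2: "integrable M (\<lambda>\<omega>. (Y \<omega>)\<^sup>2)"
        using distributed_integrable[OF 2(2), of "\<lambda>x. x\<^sup>2"] integrable_normal_moment[OF 2(1), of \<mu> 2] \<mu> by auto
      have std: "distributed M lborel (\<lambda>\<omega>. Y \<omega> / \<sigma>) (\<lambda>x. ennreal (std_normal_density x))"
        using 2 normal_standard_normal_convert[OF 2(1), of Y 0] \<mu> by simp
      have "(\<integral>\<omega>. cis (Y \<omega>) \<partial>M) = (\<integral>\<omega>. iexp (\<sigma> * (Y \<omega> / \<sigma>)) \<partial>M)"
        using 2 by (simp add: cis_conv_exp)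
      also have "\<dots> = char (distr M lborel (\<lambda>\<omega>. Y \<omega> / \<sigma>)) \<sigma>"
        unfolding char_def by (subst integral_distr) auto
      also have "\<dots> = char std_normal_distribution \<sigma>"
        using std by (simp add: distributed_def)
      also have "\<dots> = complex_of_real (exp (- (\<sigma>\<^sup>2) / 2))" by (simp add: char_std_normal_distribution)
      finally show ?thesis using i1 i2 v 2 \<mu> by simp
    qed
  qed
  then show "integrable M Y" "integrable M (\<lambda>\<omega>. (Y \<omega>)\<^sup>2)"
    "(\<integral>\<omega>. cis (Y \<omega>) \<partial>M) = complex_of_real (exp (- (\<integral>\<omega>. (Y \<omega>)\<^sup>2 \<partial>M) / 2))"
    "(\<integral>\<omega>. (Y \<omega>)\<^sup>2 \<partial>M) > 0 \<Longrightarrow> distributed M lborel Y (\<lambda>x. ennreal (normal_density 0 (sqrt (\<integral>\<omega>. (Y \<omega>)\<^sup>2 \<partial>M)) x))"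
    by auto
qed

text \<open>The definition of a Gaussian field speaks of distinct indices; times that occur
  repeatedly are merged by adding their coefficients.\<close>

lemma gaussian_field_sum:
  fixes X :: "'i \<Rightarrow> 'a \<Rightarrow> 'b::euclidean_space"
  assumes g: "gaussian_field M I X" and J: "finite J" "\<tau> ` J \<subseteq> I"
  shows "gaussian_variable M (\<lambda>\<omega>. \<Sum>j\<in>J. a j \<bullet> X (\<tau> j) \<omega>)"
proof -
  have "(\<Sum>j\<in>J. a j \<bullet> X (\<tau> j) \<omega>) = (\<Sum>s\<in>\<tau> ` J. (\<Sum>j\<in>{j\<in>J. \<tau> j = s}. a j) \<bullet> X s \<omega>)" for \<omega>
    unfolding sum.image_gen[OF J(1), of "\<lambda>j. a j \<bullet> X (\<tau> j) \<omega>" \<tau>] inner_sum_left by (intro sum.cong) auto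
  then show ?thesis using g J unfolding gaussian_field_def by simp
qed

locale fbs = prob_space M for M :: "'a measure" +
  fixes T H1 H2 :: real and w :: "real \<times> real \<Rightarrow> 'a \<Rightarrow> real ^ 'd"
  assumes T: "0 < T" and sheet: "fractional_brownian_sheet M T H1 H2 w"
begin

lemma H: "0 < H1" "H1 < 1" "0 < H2" "H2 < 1"
  using sheet by (auto simp: fractional_brownian_sheet_def)

lemma w_measurable: "s \<in> time_square T \<Longrightarrow> w s \<in> borel_measurable M"
  using sheet by (auto simp: fractional_brownian_sheet_def gaussian_field_def)

lemma inner_axis_1: "axis i 1 \<bullet> x = (x::real^'d) $ i"
  by (simp add: inner_axis inner_commute)

lemma w_comp_measurable: "s \<in> time_square T \<Longrightarrow> (\<lambda>\<omega>. w s \<omega> $ i) \<in> borel_measurable M"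
proof -
  assume "s \<in> time_square T"
  have "(\<lambda>\<omega>. axis i 1 \<bullet> w s \<omega>) \<in> borel_measurable M"
    using w_measurable[OF \<open>s \<in> time_square T\<close>] by measurable
  then show ?thesis by (simp add: inner_axis_1)
qed

lemma w_continuous: "\<omega> \<in> space M \<Longrightarrow> continuous_on (time_square T) (\<lambda>s. w s \<omega>)"
  using sheet by (auto simp: fractional_brownian_sheet_def)

lemma w_gaussian:
  "finite J \<Longrightarrow> \<tau> ` J \<subseteq> time_square T \<Longrightarrow> gaussian_variable M (\<lambda>\<omega>. \<Sum>j\<in>J. a j \<bullet> w (\<tau> j) \<omega>)"
  using sheet by (intro gaussian_field_sum) (auto simp: fractional_brownian_sheet_def)

lemma gaussian_variable_integrable:
  assumes "gaussian_variable M Y"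
  shows "integrable M Y"
proof -
  have [measurable]: "Y \<in> borel_measurable M" using assms by (simp add: gaussian_variable_def)
  consider c where "AE \<omega> in M. Y \<omega> = c" | \<mu> \<sigma> where "\<sigma> > 0" "distributed M lborel Y (\<lambda>x. ennreal (normal_density \<mu> \<sigma> x))"
    using assms unfolding gaussian_variable_def by auto
  then show ?thesis
  proof cases
    case 1
    then have "integrable M Y \<longleftrightarrow> integrable M (\<lambda>_. c)" by (intro integrable_cong_AE) auto
    then show ?thesis by simp
  next
    case 2
    show ?thesis
      using distributed_integrable[OF 2(2), of "\<lambda>x. x"] integrable_normal_moment_nz_1[OF 2(1), of \<mu>] by auto
  qed
qed

lemma w_comp_gaussian: "s \<in> time_square T \<Longrightarrow> gaussian_variable M (\<lambda>\<omega>. w s \<omega> $ i)"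
  using w_gaussian[of "{()}" "\<lambda>_. s" "\<lambda>_. axis i 1"] by (simp add: inner_axis_1)

lemma w_comp_integrable: "s \<in> time_square T \<Longrightarrow> integrable M (\<lambda>\<omega>. w s \<omega> $ i)"
  by (rule gaussian_variable_integrable[OF w_comp_gaussian])

lemma w_comp_mean:
  assumes s: "s \<in> time_square T"
  shows "(\<integral>\<omega>. w s \<omega> $ i \<partial>M) = 0"
proof -
  have "integrable M (\<lambda>\<omega>. \<Sum>i\<in>UNIV. w s \<omega> $ i *\<^sub>R axis i (1::real))"
    using w_comp_integrable[OF s] by (intro Bochner_Integration.integrable_sum integrable_scaleR_left) auto
  moreover have "(\<Sum>i\<in>UNIV. w s \<omega> $ i *\<^sub>R axis i (1::real)) = w s \<omega>" for \<omega>
    using basis_expansion[of "w s \<omega>"] by (simp add: scalar_mult_eq_scaleR)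
  ultimately have iw: "integrable M (w s)" by simp
  have "(\<integral>\<omega>. axis i 1 \<bullet> w s \<omega> \<partial>M) = axis i 1 \<bullet> (\<integral>\<omega>. w s \<omega> \<partial>M)"
    using iw by (rule integral_inner_right)
  also have "(\<integral>\<omega>. w s \<omega> \<partial>M) = 0" using sheet s by (auto simp: fractional_brownian_sheet_def)
  finally show ?thesis by (simp add: inner_axis_1)
qed

lemma w_comp_cov:
  assumes "s \<in> time_square T" "t \<in> time_square T"
  shows "integrable M (\<lambda>\<omega>. w s \<omega> $ i * w t \<omega> $ j)"
    "(\<integral>\<omega>. w s \<omega> $ i * w t \<omega> $ j \<partial>M) = (if i = j then fbm_cov H1 (fst s) (fst t) * fbm_cov H2 (snd s) (snd t) else 0)"
proof -
  have sq: "integrable M (\<lambda>\<omega>. (w s \<omega> $ i)\<^sup>2)" if "s \<in> time_square T" for s i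
    by (rule gaussian_variable_centered(2)[OF w_comp_gaussian w_comp_mean]) (use that in auto)
  show i: "integrable M (\<lambda>\<omega>. w s \<omega> $ i * w t \<omega> $ j)"
  proof (rule Bochner_Integration.integrable_bound[where f="\<lambda>\<omega>. (w s \<omega> $ i)\<^sup>2 + (w t \<omega> $ j)\<^sup>2"])
    show "integrable M (\<lambda>\<omega>. (w s \<omega> $ i)\<^sup>2 + (w t \<omega> $ j)\<^sup>2)" using sq assms by auto
    have "\<bar>x * y\<bar> \<le> x\<^sup>2 + y\<^sup>2" for x y :: real
      using sum_squares_bound[of "\<bar>x\<bar>" "\<bar>y\<bar>"] mult_nonneg_nonneg[of "\<bar>x\<bar>" "\<bar>y\<bar>"] unfolding abs_mult power2_abs
      by linarith
    then show "AE \<omega> in M. norm (w s \<omega> $ i * w t \<omega> $ j) \<le> norm ((w s \<omega> $ i)\<^sup>2 + (w t \<omega> $ j)\<^sup>2)"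
      by (auto simp: abs_of_nonneg)
  qed (use w_comp_measurable assms in auto)
  show "(\<integral>\<omega>. w s \<omega> $ i * w t \<omega> $ j \<partial>M) = (if i = j then fbm_cov H1 (fst s) (fst t) * fbm_cov H2 (snd s) (snd t) else 0)"
  proof (cases "i = j")
    case True
    then show ?thesis using sheet assms by (auto simp: fractional_brownian_sheet_def)
  next
    case False
    let ?N = "\<Pi>\<^sub>M s\<in>time_square T. (borel :: real measure)"
    have ind: "indep_vars (\<lambda>_. ?N) (component_process T w) UNIV"
      using sheet by (auto simp: fractional_brownian_sheet_def)
    \<comment> \<open>A single choice of times, s for component i and t for all others, lets
      independence of the whole component processes pass to one evaluation of each.\<close>
    define \<tau> where "\<tau> k = (if k = i then s else t)" for k
    have \<tau>: "\<tau> k \<in> time_square T" for k using assms by (auto simp: \<tau>_def)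
    have "indep_vars (\<lambda>_. borel) (\<lambda>k \<omega>. (\<lambda>f. f (\<tau> k)) (component_process T w k \<omega>)) UNIV"
      by (rule indep_vars_compose2[OF ind]) (use \<tau> in \<open>auto intro: measurable_component_singleton\<close>)
    then have "indep_vars (\<lambda>_. borel) (\<lambda>k \<omega>. w (\<tau> k) \<omega> $ k) UNIV"
      using \<tau> by (simp add: component_process_def)
    then have "indep_vars (\<lambda>_. borel) (\<lambda>k \<omega>. w (\<tau> k) \<omega> $ k) {i, j}"
      by (rule indep_vars_subset) auto
    then have "(\<integral>\<omega>. (\<Prod>k\<in>{i,j}. w (\<tau> k) \<omega> $ k) \<partial>M) = (\<Prod>k\<in>{i,j}. \<integral>\<omega>. w (\<tau> k) \<omega> $ k \<partial>M)"
      by (intro indep_vars_lebesgue_integral) (use \<tau> w_comp_integrable in auto)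
    then have "(\<integral>\<omega>. w s \<omega> $ i * w t \<omega> $ j \<partial>M) = (\<integral>\<omega>. w s \<omega> $ i \<partial>M) * (\<integral>\<omega>. w t \<omega> $ j \<partial>M)"
      using False by (simp add: \<tau>_def)
    then show ?thesis using False w_comp_mean assms by simp
  qed
qed

text \<open>Distinct components are uncorrelated, which leaves the inner products of the coefficient
  vectors.\<close>

lemma w_sum:
  assumes J: "finite J" "\<tau> ` J \<subseteq> time_square T"
  shows w_sum_mean: "(\<integral>\<omega>. (\<Sum>j\<in>J. a j \<bullet> w (\<tau> j) \<omega>) \<partial>M) = 0"
    and w_sum_variance: "(\<integral>\<omega>. (\<Sum>j\<in>J. a j \<bullet> w (\<tau> j) \<omega>)\<^sup>2 \<partial>M)
     = (\<Sum>j\<in>J. \<Sum>k\<in>J. (a j \<bullet> a k) * (fbm_cov H1 (fst (\<tau> j)) (fst (\<tau> k)) * fbm_cov H2 (snd (\<tau> j)) (snd (\<tau> k))))"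
proof -
  have \<tau>: "\<tau> j \<in> time_square T" if "j \<in> J" for j using J that by auto
  have in_sum: "a j \<bullet> w (\<tau> j) \<omega> = (\<Sum>i\<in>UNIV. a j $ i * w (\<tau> j) \<omega> $ i)" for j \<omega>
    by (simp add: inner_vec_def)
  show "(\<integral>\<omega>. (\<Sum>j\<in>J. a j \<bullet> w (\<tau> j) \<omega>) \<partial>M) = 0"
    unfolding in_sum using w_comp_integrable \<tau> w_comp_mean by (simp add: Bochner_Integration.integral_sum)
  have "(\<Sum>j\<in>J. a j \<bullet> w (\<tau> j) \<omega>)\<^sup>2 = (\<Sum>j\<in>J. \<Sum>k\<in>J. \<Sum>i\<in>UNIV. \<Sum>l\<in>UNIV. a j $ i * a k $ l * (w (\<tau> j) \<omega> $ i * w (\<tau> k) \<omega> $ l))" for \<omega>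
    unfolding power2_eq_square in_sum sum_product by (simp add: mult_ac)
  then have "(\<integral>\<omega>. (\<Sum>j\<in>J. a j \<bullet> w (\<tau> j) \<omega>)\<^sup>2 \<partial>M)
    = (\<Sum>j\<in>J. \<Sum>k\<in>J. \<Sum>i\<in>UNIV. \<Sum>l\<in>UNIV. a j $ i * a k $ l * (\<integral>\<omega>. w (\<tau> j) \<omega> $ i * w (\<tau> k) \<omega> $ l \<partial>M))"
    using w_comp_cov(1) \<tau> by (simp add: Bochner_Integration.integral_sum)
  also have "\<dots> = (\<Sum>j\<in>J. \<Sum>k\<in>J. (a j \<bullet> a k) * (fbm_cov H1 (fst (\<tau> j)) (fst (\<tau> k)) * fbm_cov H2 (snd (\<tau> j)) (snd (\<tau> k))))"
    using \<tau> by (intro sum.cong refl) (simp add: w_comp_cov(2) inner_vec_def sum_distrib_right if_distrib cong: if_cong)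
  finally show "(\<integral>\<omega>. (\<Sum>j\<in>J. a j \<bullet> w (\<tau> j) \<omega>)\<^sup>2 \<partial>M)
     = (\<Sum>j\<in>J. \<Sum>k\<in>J. (a j \<bullet> a k) * (fbm_cov H1 (fst (\<tau> j)) (fst (\<tau> k)) * fbm_cov H2 (snd (\<tau> j)) (snd (\<tau> k))))" .
qed

lemma w_char:
  assumes J: "finite J" "\<tau> ` J \<subseteq> time_square T"
  shows "(\<integral>\<omega>. cis (\<Sum>j\<in>J. a j \<bullet> w (\<tau> j) \<omega>) \<partial>M) = complex_of_real (exp (- (\<Sum>j\<in>J. \<Sum>k\<in>J. (a j \<bullet> a k) * (fbm_cov H1 (fst (\<tau> j)) (fst (\<tau> k)) * fbm_cov H2 (snd (\<tau> j)) (snd (\<tau> k)))) / 2))"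
  using gaussian_variable_centered(3)[OF w_gaussian[OF J] w_sum_mean[OF J]] w_sum_variance[OF J] by simp

end

section \<open>Local nondeterminism of a slice given its past\<close>

context fbs
begin

definition past :: "real \<Rightarrow> real \<Rightarrow> 'a set set" where
  "past b u = sigma_sets (space M) (vimage_sets (space M) (\<lambda>(a, i) \<omega>. w (a, b) \<omega> $ i) ({0..u} \<times> UNIV))"

text \<open>The conditional variance of the inner product of z with the increment is at least
  \<open>b powr (2 * H2) / fbm_kernel_const H1 * |z|^2 * r powr (2 * H1) / (2 * H1)\<close> with r =
  a' - a; half of it stands in the exponent of a characteristic function.\<close>

definition lnd_const :: "real \<Rightarrow> real" where
  "lnd_const b = b powr (2 * H2) / (4 * H1 * fbm_kernel_const H1)"

text \<open>The variance takes the form of a sum over components of squared L2 norms of kernels,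
  ready for orthogonal decomposition.\<close>

lemma w_char_slice:
  assumes K: "finite K" "\<tau> ` K \<subseteq> {0..T}" and b: "0 \<le> b" "b \<le> T"
  shows "(\<integral>\<omega>. cis (\<Sum>j\<in>K. \<alpha> j \<bullet> w (\<tau> j, b) \<omega>) \<partial>M)
     = complex_of_real (exp (- (b powr (2*H2) / fbm_kernel_const H1 *
         (\<Sum>i\<in>UNIV. \<integral>x. (\<Sum>j\<in>K. \<alpha> j $ i * fbm_kernel H1 (\<tau> j) x)\<^sup>2 \<partial>lborel)) / 2))"
proof -
  have C: "0 < fbm_kernel_const H1" using fbm_kernel_const_pos H by auto
  have b2: "fbm_cov H2 b b = b powr (2*H2)" using b by (simp add: fbm_cov_def)
  have "(\<Sum>i\<in>UNIV. \<integral>x. (\<Sum>j\<in>K. \<alpha> j $ i * fbm_kernel H1 (\<tau> j) x)\<^sup>2 \<partial>lborel)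
     = fbm_kernel_const H1 * (\<Sum>i\<in>UNIV. \<Sum>j\<in>K. \<Sum>k\<in>K. \<alpha> j $ i * \<alpha> k $ i * fbm_cov H1 (\<tau> j) (\<tau> k))"
    using K H by (subst fbm_kernel_sum_integral) (auto simp: sum_distrib_left)
  also have "(\<Sum>i\<in>UNIV. \<Sum>j\<in>K. \<Sum>k\<in>K. \<alpha> j $ i * \<alpha> k $ i * fbm_cov H1 (\<tau> j) (\<tau> k))
     = (\<Sum>j\<in>K. \<Sum>k\<in>K. (\<alpha> j \<bullet> \<alpha> k) * fbm_cov H1 (\<tau> j) (\<tau> k))"
    by (subst sum.swap, intro sum.cong refl, subst sum.swap) (simp add: inner_vec_def sum_distrib_right)
  finally have "b powr (2*H2) / fbm_kernel_const H1 * (\<Sum>i\<in>UNIV. \<integral>x. (\<Sum>j\<in>K. \<alpha> j $ i * fbm_kernel H1 (\<tau> j) x)\<^sup>2 \<partial>lborel)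
     = (\<Sum>j\<in>K. \<Sum>k\<in>K. (\<alpha> j \<bullet> \<alpha> k) * (fbm_cov H1 (\<tau> j) (\<tau> k) * fbm_cov H2 b b))"
    using C by (simp add: b2 sum_distrib_right sum_distrib_left mult_ac)
  then show ?thesis
    using w_char[of K "\<lambda>j. (\<tau> j, b)" \<alpha>] K b by (auto simp: time_square_def image_subset_iff)
qed

text \<open>Let \<xi> be the part of the kernel increment orthogonal to the kernels of the past
  times, and q the characteristic function of the corresponding Gaussian part. Subtracting q times
  the exponential of the projected increment leaves D, whose joint characteristic integrals with the
  past all vanish. So D integrates to 0 over E, and the integral in question is q times one that is
  at most the probability of E. No conditional law is constructed.\<close>

lemma lnd_finite:
  assumes b: "0 \<le> b" "b \<le> T" and u: "0 \<le> u" "u \<le> a" "a < a'" "a' \<le> T"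
    and J: "finite J" "J \<subseteq> {0..u} \<times> UNIV"
    and E: "E \<in> sigma_sets (space M) (vimage_sets (space M) (\<lambda>(a, i) \<omega>. w (a, b) \<omega> $ i) J)"
  shows "norm (\<integral>\<omega>. cis (z \<bullet> (w (a', b) \<omega> - w (a, b) \<omega>)) * indicator E \<omega> \<partial>M)
     \<le> exp (- lnd_const b * (norm z)\<^sup>2 * (a' - a) powr (2*H1)) * prob E"
proof -
  have C: "0 < fbm_kernel_const H1" using fbm_kernel_const_pos H by auto
  define f where "f = fbm_kernel H1"
  have fm[measurable]: "f p \<in> borel_measurable borel" for p unfolding f_def by measurable
  have ff: "integrable lborel (\<lambda>x. f i x * f j x)" for i j
    unfolding f_def using fbm_kernel_mult_integrable H by auto
  define P where "P = fst ` J"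
  have P: "finite P" "P \<subseteq> {0..u}" using J by (auto simp: P_def)
  obtain c1 where c1: "\<And>s. s \<in> P \<Longrightarrow> (\<integral>x. (f a' x - (\<Sum>p\<in>P. c1 p * f p x)) * f s x \<partial>lborel) = 0"
    using gram_projection[where f=f and i="a'", OF ff P(1)] by (elim exE) blast
  obtain c2 where c2: "\<And>s. s \<in> P \<Longrightarrow> (\<integral>x. (f a x - (\<Sum>p\<in>P. c2 p * f p x)) * f s x \<partial>lborel) = 0"
    using gram_projection[where f=f and i="a", OF ff P(1)] by (elim exE) blast
  \<comment> \<open>The projection of the increment, obtained by linearity from those of its two end
    points.\<close>
  define c where "c p = c1 p - c2 p" for p
  define \<xi> where "\<xi> x = f a' x - f a x - (\<Sum>p\<in>P. c p * f p x)" for x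
  have ilin: "integrable lborel (\<lambda>x. (f a x - (\<Sum>p\<in>P. c p * f p x)) * f s x)" for c a s
  proof -
    have "(\<lambda>x. (f a x - (\<Sum>p\<in>P. c p * f p x)) * f s x) = (\<lambda>x. f a x * f s x - (\<Sum>p\<in>P. c p * (f p x * f s x)))"
      by (auto simp: left_diff_distrib sum_distrib_right mult.assoc)
    then show ?thesis using ff by simp
  qed
  have \<xi>f_eq: "(\<lambda>x. \<xi> x * f s x) = (\<lambda>x. (f a' x - (\<Sum>p\<in>P. c1 p * f p x)) * f s x - (f a x - (\<Sum>p\<in>P. c2 p * f p x)) * f s x)" for s
    by (auto simp: \<xi>_def c_def algebra_simps sum_subtractf)
  have \<xi>f: "integrable lborel (\<lambda>x. \<xi> x * f s x)" for s unfolding \<xi>f_eq by (intro Bochner_Integration.integrable_diff ilin)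
  have \<xi>f0: "(\<integral>x. \<xi> x * f s x \<partial>lborel) = 0" if "s \<in> P" for s
    unfolding \<xi>f_eq using ilin c1[OF that] c2[OF that] by simp
  have \<xi>2: "integrable lborel (\<lambda>x. (\<xi> x)\<^sup>2)"
  proof -
    have "(\<xi> x)\<^sup>2 = \<xi> x * (f a' x - f a x - (\<Sum>p\<in>P. c p * f p x))" for x
      by (simp add: \<xi>_def power2_eq_square)
    then have "(\<lambda>x. (\<xi> x)\<^sup>2) = (\<lambda>x. \<xi> x * f a' x - \<xi> x * f a x - (\<Sum>p\<in>P. c p * (\<xi> x * f p x)))"
      by (simp add: right_diff_distrib sum_distrib_left mult.left_commute)
    then show ?thesis using \<xi>f by simp
  qed
  define V where "V = (\<integral>x. (\<xi> x)\<^sup>2 \<partial>lborel)"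
  have V: "(a' - a) powr (2*H1) / (2*H1) \<le> V"
  proof -
    \<comment> \<open>The time a joins the past with coefficient -1; the disjoint sum keeps it apart
      from a possible equal element of P.\<close>
    have "\<xi> x = fbm_kernel H1 a' x + (\<Sum>j\<in>P <+> {()}. (case j of Inl p \<Rightarrow> - c p | Inr _ \<Rightarrow> -1) * fbm_kernel H1 (case j of Inl p \<Rightarrow> p | Inr _ \<Rightarrow> a) x)" for x
      using P by (subst sum.Plus) (auto simp: \<xi>_def f_def sum_negf)
    then show ?thesis unfolding V_def
      by (simp only:) (rule fbm_kernel_nondeterminism, use H u P in auto)
  qed
  \<comment> \<open>\<kappa> converts squared kernel norms into variances of the slice at level
    b.\<close>
  define \<kappa> where "\<kappa> = b powr (2*H2) / fbm_kernel_const H1"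
  have \<kappa>: "0 \<le> \<kappa>" using C by (simp add: \<kappa>_def)
  define q where "q = exp (- (\<kappa> * ((norm z)\<^sup>2 * V)) / 2)"
  define D where "D \<omega> = cis (z \<bullet> (w (a', b) \<omega> - w (a, b) \<omega>)) - complex_of_real q * cis (\<Sum>p\<in>P. c p * (z \<bullet> w (p, b) \<omega>))" for \<omega>
  have wm[measurable]: "w (p, b) \<in> borel_measurable M" if "p \<in> {0..T}" for p
    using that b by (intro w_measurable) (auto simp: time_square_def)
  have am[measurable]: "w (a, b) \<in> borel_measurable M" "w (a', b) \<in> borel_measurable M" using u by (auto intro!: wm)
  have pm: "(\<lambda>\<omega>. \<Sum>p\<in>P. g p (w (p, b) \<omega>)) \<in> borel_measurable M"
    if "\<And>p. g p \<in> borel_measurable borel" for g :: "real \<Rightarrow> _ \<Rightarrow> real"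
    by (intro borel_measurable_sum measurable_compose[OF wm that]) (use P u in auto)
  have pm1[measurable]: "(\<lambda>\<omega>. \<Sum>p\<in>P. c p * (z \<bullet> w (p, b) \<omega>)) \<in> borel_measurable M"
    by (rule pm) measurable
  have Dm[measurable]: "D \<in> borel_measurable M" unfolding D_def by measurable
  have cis_int: "integrable M (\<lambda>\<omega>. cis (g \<omega>))" if "g \<in> borel_measurable M" for g
    by (rule integrable_const_bound[where B=1]) (use that in auto)
  have D: "integrable M D" unfolding D_def
    by (intro Bochner_Integration.integrable_diff integrable_mult_right impI cis_int) measurable
  have Yx: "(\<lambda>\<omega>. w s \<omega> $ i) \<in> borel_measurable M" if "s \<in> time_square T" for s i using w_comp_measurable that by auto
  have main: "(\<integral>\<omega>. D \<omega> * indicator E \<omega> \<partial>M) = 0"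
  proof (rule char_uniqueness_sigma[OF J(1) D _ _ E])
    fix j assume "j \<in> J"
    then show "(case j of (a, i) \<Rightarrow> \<lambda>\<omega>. w (a, b) \<omega> $ i) \<in> borel_measurable M"
      using J u b by (cases j) (auto intro!: Yx simp: time_square_def)
  next
    fix y :: "real \<times> 'd \<Rightarrow> real"
    \<comment> \<open>The frequencies of all components at one time are gathered into one vector, to
      match the form of \<open>w_char_slice\<close>.\<close>
    define y' where "y' p = (\<Sum>j\<in>{j\<in>J. fst j = p}. y j *\<^sub>R axis (snd j) (1::real))" for p
    have yy: "(\<Sum>j\<in>J. y j * (case j of (a, i) \<Rightarrow> \<lambda>\<omega>. w (a, b) \<omega> $ i) \<omega>) = (\<Sum>p\<in>P. y' p \<bullet> w (p, b) \<omega>)" for \<omega>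
    proof -
      have "(\<Sum>j\<in>J. y j * (case j of (a, i) \<Rightarrow> \<lambda>\<omega>. w (a, b) \<omega> $ i) \<omega>) = (\<Sum>j\<in>J. (y j *\<^sub>R axis (snd j) 1) \<bullet> w (fst j, b) \<omega>)"
        by (intro sum.cong) (auto simp: inner_axis_1)
      also have "\<dots> = (\<Sum>p\<in>P. y' p \<bullet> w (p, b) \<omega>)"
        unfolding sum.image_gen[OF J(1), of "\<lambda>j. (y j *\<^sub>R axis (snd j) 1) \<bullet> w (fst j, b) \<omega>" fst] y'_def inner_sum_left P_def
        by (intro sum.cong refl) auto
      finally show ?thesis .
    qed
    define A where "A i x = (\<Sum>p\<in>P. (y' p $ i + z $ i * c p) * f p x)" for i x
    have A2: "integrable lborel (\<lambda>x. (A i x)\<^sup>2)" for i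
      unfolding A_def f_def by (rule fbm_kernel_sum_integrable[OF H(1,2), where \<tau>="\<lambda>p. p"])
    have A\<xi>_eq: "(\<lambda>x. A i x * \<xi> x) = (\<lambda>x. \<Sum>p\<in>P. (y' p $ i + z $ i * c p) * (\<xi> x * f p x))" for i
      by (auto simp: A_def sum_distrib_left sum_distrib_right mult_ac)
    have A\<xi>: "integrable lborel (\<lambda>x. A i x * \<xi> x)" "(\<integral>x. A i x * \<xi> x \<partial>lborel) = 0" for i
      unfolding A\<xi>_eq using \<xi>f \<xi>f0 by (auto simp: Bochner_Integration.integral_sum)
    \<comment> \<open>Pythagoras: A is a combination of past kernels, hence orthogonal to
      \<xi>.\<close>
    have "(\<integral>x. (A i x + z $ i * \<xi> x)\<^sup>2 \<partial>lborel) = (\<integral>x. (A i x)\<^sup>2 + (z $ i)\<^sup>2 * (\<xi> x)\<^sup>2 + 2 * z $ i * (A i x * \<xi> x) \<partial>lborel)" for i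
      by (intro Bochner_Integration.integral_cong) (auto simp: power2_eq_square algebra_simps)
    also have "\<dots> i = (\<integral>x. (A i x)\<^sup>2 \<partial>lborel) + (z $ i)\<^sup>2 * V" for i
      using A2 \<xi>2 A\<xi> by (simp add: V_def)
    finally have AV: "(\<integral>x. (A i x + z $ i * \<xi> x)\<^sup>2 \<partial>lborel) = (\<integral>x. (A i x)\<^sup>2 \<partial>lborel) + (z $ i)\<^sup>2 * V" for i .
    have nz: "(norm z)\<^sup>2 = (\<Sum>i\<in>UNIV. (z $ i)\<^sup>2)"
      unfolding power2_norm_eq_inner inner_vec_def by (simp add: power2_eq_square)
    \<comment> \<open>Indices for the past times and, through the booleans, for a' and a; again a
      disjoint sum because times may coincide.\<close>
    define ct :: "real + bool \<Rightarrow> real ^ 'd" where "ct j = (case j of Inl p \<Rightarrow> y' p | Inr r \<Rightarrow> if r then z else - z)" for j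
    define tt where "tt j = (case j of Inl p \<Rightarrow> p | Inr r \<Rightarrow> if r then a' else a)" for j :: "real + bool"
    have "(\<integral>\<omega>. cis (\<Sum>j\<in>P <+> UNIV. ct j \<bullet> w (tt j, b) \<omega>) \<partial>M)
       = complex_of_real (exp (- (\<kappa> * (\<Sum>i\<in>UNIV. \<integral>x. (\<Sum>j\<in>P <+> UNIV. ct j $ i * fbm_kernel H1 (tt j) x)\<^sup>2 \<partial>lborel)) / 2))"
      unfolding \<kappa>_def by (rule w_char_slice) (use P u b in \<open>auto simp: tt_def\<close>)
    moreover have "(\<Sum>j\<in>P <+> UNIV. ct j $ i * fbm_kernel H1 (tt j) x) = A i x + z $ i * \<xi> x" for i x
      using P by (subst sum.Plus) (auto simp: ct_def tt_def A_def \<xi>_def f_def UNIV_bool algebra_simps sum_distrib_left sum.distrib)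
    moreover have "(\<Sum>j\<in>P <+> UNIV. ct j \<bullet> w (tt j, b) \<omega>) = z \<bullet> (w (a', b) \<omega> - w (a, b) \<omega>) + (\<Sum>p\<in>P. y' p \<bullet> w (p, b) \<omega>)" for \<omega>
      using P by (subst sum.Plus) (auto simp: ct_def tt_def UNIV_bool inner_diff_right)
    ultimately have 1: "(\<integral>\<omega>. cis (z \<bullet> (w (a', b) \<omega> - w (a, b) \<omega>) + (\<Sum>p\<in>P. y' p \<bullet> w (p, b) \<omega>)) \<partial>M)
       = complex_of_real (exp (- (\<kappa> * (\<Sum>i\<in>UNIV. (\<integral>x. (A i x)\<^sup>2 \<partial>lborel) + (z $ i)\<^sup>2 * V)) / 2))"
      by (simp add: AV)
    have "(\<integral>\<omega>. cis (\<Sum>p\<in>P. (y' p + c p *\<^sub>R z) \<bullet> w (p, b) \<omega>) \<partial>M)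
       = complex_of_real (exp (- (\<kappa> * (\<Sum>i\<in>UNIV. \<integral>x. (\<Sum>p\<in>P. (y' p + c p *\<^sub>R z) $ i * fbm_kernel H1 p x)\<^sup>2 \<partial>lborel)) / 2))"
      unfolding \<kappa>_def by (rule w_char_slice) (use P u b in auto)
    then have 2: "(\<integral>\<omega>. cis ((\<Sum>p\<in>P. c p * (z \<bullet> w (p, b) \<omega>)) + (\<Sum>p\<in>P. y' p \<bullet> w (p, b) \<omega>)) \<partial>M)
       = complex_of_real (exp (- (\<kappa> * (\<Sum>i\<in>UNIV. \<integral>x. (A i x)\<^sup>2 \<partial>lborel)) / 2))"
      by (simp add: A_def f_def inner_add_left sum.distrib algebra_simps)
    have q12: "exp (- (\<kappa> * (\<Sum>i\<in>UNIV. (\<integral>x. (A i x)\<^sup>2 \<partial>lborel) + (z $ i)\<^sup>2 * V)) / 2)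
       = q * exp (- (\<kappa> * (\<Sum>i\<in>UNIV. \<integral>x. (A i x)\<^sup>2 \<partial>lborel)) / 2)"
    proof -
      have "(\<Sum>i\<in>UNIV. (\<integral>x. (A i x)\<^sup>2 \<partial>lborel) + (z $ i)\<^sup>2 * V) = (\<Sum>i\<in>UNIV. \<integral>x. (A i x)\<^sup>2 \<partial>lborel) + (norm z)\<^sup>2 * V"
        by (simp add: nz sum.distrib sum_distrib_right)
      then show ?thesis
        unfolding q_def exp_add[symmetric] by (simp only:) (simp add: distrib_left add_divide_distrib)
    qed
    have ym[measurable]: "(\<lambda>\<omega>. \<Sum>p\<in>P. y' p \<bullet> w (p, b) \<omega>) \<in> borel_measurable M" by (rule pm) measurable
    have "(\<integral>\<omega>. D \<omega> * cis (\<Sum>p\<in>P. y' p \<bullet> w (p, b) \<omega>) \<partial>M)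
       = (\<integral>\<omega>. cis (z \<bullet> (w (a', b) \<omega> - w (a, b) \<omega>) + (\<Sum>p\<in>P. y' p \<bullet> w (p, b) \<omega>))
           - complex_of_real q * cis ((\<Sum>p\<in>P. c p * (z \<bullet> w (p, b) \<omega>)) + (\<Sum>p\<in>P. y' p \<bullet> w (p, b) \<omega>)) \<partial>M)"
      by (intro Bochner_Integration.integral_cong refl) (simp add: D_def left_diff_distrib mult.assoc cis_mult)
    also have "\<dots> = (\<integral>\<omega>. cis (z \<bullet> (w (a', b) \<omega> - w (a, b) \<omega>) + (\<Sum>p\<in>P. y' p \<bullet> w (p, b) \<omega>)) \<partial>M)
           - complex_of_real q * (\<integral>\<omega>. cis ((\<Sum>p\<in>P. c p * (z \<bullet> w (p, b) \<omega>)) + (\<Sum>p\<in>P. y' p \<bullet> w (p, b) \<omega>)) \<partial>M)"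
      by (subst Bochner_Integration.integral_diff) (auto intro!: cis_int)
    also have "\<dots> = 0"
      unfolding 1 2 q12 by simp
    finally show "(\<integral>\<omega>. D \<omega> * cis (\<Sum>j\<in>J. y j * (case j of (a, i) \<Rightarrow> \<lambda>\<omega>. w (a, b) \<omega> $ i) \<omega>) \<partial>M) = 0"
      unfolding yy .
  qed
  have Eev[measurable]: "E \<in> events"
    using E by (rule subsetD[OF vimage_sets_events, rotated])
       (use J u b in \<open>auto intro!: Yx simp: time_square_def\<close>)
  have ci: "integrable M (\<lambda>\<omega>. cis (g \<omega>) * indicator E \<omega>)" if "g \<in> borel_measurable M" for g
    by (rule integrable_const_bound[where B=1]) (use that in \<open>auto simp: norm_mult indicator_def\<close>)
  have "(\<integral>\<omega>. D \<omega> * indicator E \<omega> \<partial>M) = (\<integral>\<omega>. cis (z \<bullet> (w (a', b) \<omega> - w (a, b) \<omega>)) * indicator E \<omega>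
     - complex_of_real q * (cis (\<Sum>p\<in>P. c p * (z \<bullet> w (p, b) \<omega>)) * indicator E \<omega>) \<partial>M)"
    by (intro Bochner_Integration.integral_cong refl) (simp add: D_def left_diff_distrib mult.assoc)
  then have "(\<integral>\<omega>. cis (z \<bullet> (w (a', b) \<omega> - w (a, b) \<omega>)) * indicator E \<omega> \<partial>M)
     = complex_of_real q * (\<integral>\<omega>. cis (\<Sum>p\<in>P. c p * (z \<bullet> w (p, b) \<omega>)) * indicator E \<omega> \<partial>M)"
    unfolding main by (subst (asm) Bochner_Integration.integral_diff) (auto intro!: ci)
  also have "norm \<dots> \<le> q * prob E"
  proof -
    have "norm (\<integral>\<omega>. cis (\<Sum>p\<in>P. c p * (z \<bullet> w (p, b) \<omega>)) * indicator E \<omega> \<partial>M)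
      \<le> (\<integral>\<omega>. indicator E \<omega> \<partial>M)"
    proof (rule order_trans[OF integral_norm_bound], rule integral_mono)
      show "integrable M (\<lambda>\<omega>. indicator E \<omega> :: real)"
        by (rule integrable_real_indicator) (auto simp: emeasure_eq_measure)
      show "integrable M (\<lambda>\<omega>. norm (cis (\<Sum>p\<in>P. c p * (z \<bullet> w (p, b) \<omega>)) * indicator E \<omega>))"
        by (intro integrable_norm ci pm1)
    qed (auto simp: norm_mult indicator_def)
    then show ?thesis by (simp add: norm_mult q_def)
  qed
  also have "q \<le> exp (- lnd_const b * (norm z)\<^sup>2 * (a' - a) powr (2*H1))"
  proof -
    have "lnd_const b * (norm z)\<^sup>2 * (a' - a) powr (2*H1) = \<kappa> * ((norm z)\<^sup>2 * ((a' - a) powr (2*H1) / (2*H1))) / 2"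
      by (simp add: lnd_const_def \<kappa>_def mult_ac)
    also have "\<dots> \<le> \<kappa> * ((norm z)\<^sup>2 * V) / 2"
      using V \<kappa> by (intro divide_right_mono mult_left_mono) auto
    finally show ?thesis by (simp add: q_def)
  qed
  finally show ?thesis by (simp add: mult_right_mono)
qed

lemma past_events:
  assumes "0 \<le> b" "b \<le> T" "u \<le> T"
  shows "past b u \<subseteq> events"
  unfolding past_def using assms
  by (intro vimage_sets_events) (auto intro!: w_comp_measurable simp: time_square_def)

text \<open>When E is replaced, both sides change by at most the probability of the symmetric
  difference, so the bound passes from finitely many coordinates to the whole past.\<close>

lemma lnd_past:
  assumes b: "0 \<le> b" "b \<le> T" and u: "0 \<le> u" "u \<le> a" "a < a'" "a' \<le> T" and E: "E \<in> past b u"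
  shows "norm (\<integral>\<omega>. cis (z \<bullet> (w (a', b) \<omega> - w (a, b) \<omega>)) * indicator E \<omega> \<partial>M)
     \<le> exp (- lnd_const b * (norm z)\<^sup>2 * (a' - a) powr (2*H1)) * prob E" (is "norm (?I E) \<le> ?q * prob E")
proof (rule field_le_epsilon)
  fix e :: real assume e: "0 < e"
  let ?Y = "\<lambda>(a, i) \<omega>. w (a, b) \<omega> $ i"
  have Y: "?Y j \<in> borel_measurable M" if "j \<in> {0..u} \<times> UNIV" for j
    using that u b by (cases j) (auto intro!: w_comp_measurable simp: time_square_def)
  have "0 < e / 2" using e by simp
  from vimage_sets_approx[where Y="?Y", OF Y E[unfolded past_def] this]
  obtain J E' where J: "finite J" "J \<subseteq> {0..u} \<times> UNIV" and E': "E' \<in> sigma_sets (space M) (vimage_sets (space M) ?Y J)"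
     and p: "prob ((E - E') \<union> (E' - E)) < e / 2" by blast
  have Eev[measurable]: "E \<in> events" using past_events[of b u] E b u by auto
  have E'ev[measurable]: "E' \<in> events"
    using E' by (rule subsetD[OF vimage_sets_events, rotated]) (use J Y in auto)
  have am[measurable]: "w (a, b) \<in> borel_measurable M" "w (a', b) \<in> borel_measurable M"
    using u b by (auto intro!: w_measurable simp: time_square_def)
  have ci: "integrable M (\<lambda>\<omega>. cis (z \<bullet> (w (a', b) \<omega> - w (a, b) \<omega>)) * indicator E \<omega>)" if [measurable]: "E \<in> events" for E
    by (rule integrable_const_bound[where B=1]) (use that in \<open>auto simp: norm_mult indicator_def\<close>)
  have "?I E - ?I E' = (\<integral>\<omega>. cis (z \<bullet> (w (a', b) \<omega> - w (a, b) \<omega>)) * indicator E \<omega> - cis (z \<bullet> (w (a', b) \<omega> - w (a, b) \<omega>)) * indicator E' \<omega> \<partial>M)"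
    using ci by (subst Bochner_Integration.integral_diff) auto
  also have "norm \<dots> \<le> (\<integral>\<omega>. indicator ((E - E') \<union> (E' - E)) \<omega> \<partial>M)"
  proof (rule order_trans[OF integral_norm_bound], rule integral_mono)
    show "integrable M (\<lambda>\<omega>. indicator ((E - E') \<union> (E' - E)) \<omega> :: real)"
      by (rule integrable_real_indicator) (auto simp: emeasure_eq_measure)
  qed (use ci in \<open>auto simp: norm_mult indicator_def\<close>)
  also have "\<dots> = prob ((E - E') \<union> (E' - E))" by simp
  finally have "norm (?I E - ?I E') < e / 2" using p by simp
  moreover have "norm (?I E') \<le> ?q * prob E'" by (rule lnd_finite[OF b u J E'])
  moreover have "?q * prob E' \<le> ?q * prob E + e / 2"
  proof -
    have "prob E' \<le> prob (E \<union> ((E - E') \<union> (E' - E)))" by (rule finite_measure_mono) auto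
    also have "\<dots> \<le> prob E + prob ((E - E') \<union> (E' - E))" by (rule measure_Un_le) auto
    finally have "prob E' \<le> prob E + e / 2" using p by simp
    moreover have "0 \<le> lnd_const b" using fbm_kernel_const_pos[of H1] H by (auto simp: lnd_const_def)
    then have "?q \<le> 1" by simp
    then have "?q * (e / 2) \<le> 1 * (e / 2)" using e by (intro mult_right_mono) auto
    ultimately show ?thesis
      using mult_left_mono[of "prob E'" "prob E + e / 2" ?q] by (simp add: distrib_left)
  qed
  moreover have "norm (?I E) \<le> norm (?I E - ?I E') + norm (?I E')" 
    using norm_triangle_ineq[of "?I E - ?I E'" "?I E'"] by simp
  ultimately show "norm (?I E) \<le> ?q * prob E + e" by simp
qed

end

section \<open>Chaining, John--Nirenberg moments and elementary estimates\<close>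

text \<open>Both end points are rounded inward to the next coarser grid, at the cost of at most one
  cell at either end per level; at level m at most one cell is left. The lower limit i0 admits only
  cells that start at or after i0, which keeps the bound in the future of a given time.\<close>

lemma dyadic_chaining:
  fixes N :: "nat \<Rightarrow> nat \<Rightarrow> real"
  assumes sub: "\<And>i j k. i \<le> j \<Longrightarrow> j \<le> k \<Longrightarrow> k \<le> 2 ^ n \<Longrightarrow> N i k \<le> N i j + N j k"
    and zero: "\<And>i. N i i \<le> 0" and Q: "\<And>l. 0 \<le> Q l"
    and bound: "\<And>l k. l \<le> n \<Longrightarrow> k < 2 ^ l \<Longrightarrow> i0 \<le> k * 2 ^ (n - l) \<Longrightarrow> N (k * 2 ^ (n - l)) ((k + 1) * 2 ^ (n - l)) \<le> Q l"
    and "i0 \<le> i" "i \<le> j" "j \<le> 2 ^ n" "j - i \<le> 2 ^ (n - m)" "m \<le> n"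
  shows "N i j \<le> 2 * (\<Sum>l\<in>{m..n}. Q l)"
proof -
  have "N (x * 2 ^ (n - l)) (y * 2 ^ (n - l)) \<le> 2 * (\<Sum>l\<in>{m..l}. Q l)"
    if "m \<le> l" "l \<le> n" "i0 \<le> x * 2 ^ (n - l)" "x \<le> y" "y \<le> 2 ^ l" "y - x \<le> 2 ^ (l - m)" for l x y
    using that
  proof (induction l arbitrary: x y rule: dec_induct)
    case base
    then consider "y = x" | "y = x + 1" by force
    then show ?case
    proof cases
      case 1
      then show ?thesis using zero[of "x * 2 ^ (n - m)"] Q[of m] by simp
    next
      case 2
      then have "N (x * 2 ^ (n - m)) (y * 2 ^ (n - m)) \<le> Q m"
        using base.prems bound[of m x] by auto
      then show ?thesis using Q[of m] by simp
    qed
  next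
    case (step l)
    \<comment> \<open>Rounding up on the left and down on the right at least halves the gap.\<close>
    define x' y' where "x' = (x + 1) div 2" and "y' = y div 2"
    have e: "2 ^ (n - l) = 2 * (2::nat) ^ (n - Suc l)" using step.prems by (simp add: Suc_diff_Suc flip: power_Suc)
    have S: "(\<Sum>l\<in>{m..Suc l}. Q l) = (\<Sum>l\<in>{m..l}. Q l) + Q (Suc l)"
    proof -
      have "{m..Suc l} = insert (Suc l) {m..l}" using step.hyps by auto
      then show ?thesis by simp
    qed
    have Snn: "0 \<le> (\<Sum>l\<in>{m..l}. Q l)" using Q by (intro sum_nonneg) auto
    show ?case
    proof (cases "x' \<le> y'")
      case True
      have d: "2 ^ (Suc l - m) = 2 * (2::nat) ^ (l - m)" using step.hyps by (simp add: Suc_diff_le)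
      have IH: "N (x' * 2 ^ (n - l)) (y' * 2 ^ (n - l)) \<le> 2 * (\<Sum>l\<in>{m..l}. Q l)"
      proof (rule step.IH)
        have "x * 2 ^ (n - Suc l) \<le> (2 * x') * 2 ^ (n - Suc l)" unfolding x'_def by (intro mult_right_mono) auto
        with step.prems(2) have "i0 \<le> (2 * x') * 2 ^ (n - Suc l)" by (rule order_trans)
        then show "i0 \<le> x' * 2 ^ (n - l)" unfolding e by (simp add: mult_ac)
        show "y' \<le> 2 ^ l" using step.prems by (auto simp: y'_def)
        have "y' - x' \<le> (y - x) div 2" unfolding x'_def y'_def by linarith
        then show "y' - x' \<le> 2 ^ (l - m)" using step.prems(5) unfolding d by linarith
      qed (use step.prems True in auto)
      have le: "z * 2 ^ (n - Suc l) \<le> 2 ^ n" if "z \<le> y" for z :: nat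
      proof -
        have "z * 2 ^ (n - Suc l) \<le> 2 ^ Suc l * 2 ^ (n - Suc l)" using that step.prems by (intro mult_right_mono) auto
        also have "\<dots> = 2 ^ n" using step.prems by (simp only: power_add[symmetric]) simp
        finally show ?thesis .
      qed
      have edge: "N (u * 2 ^ (n - Suc l)) (v * 2 ^ (n - Suc l)) \<le> Q (Suc l)" if "x \<le> u" "v = u \<or> v = u + 1" "v \<le> y" for u v
      proof (cases "v = u")
        case True then show ?thesis using zero Q by (meson order_trans)
      next
        case False
        then have "v = u + 1" using that by simp
        have "x * 2 ^ (n - Suc l) \<le> u * 2 ^ (n - Suc l)" using that by (intro mult_right_mono) auto
        then have "i0 \<le> u * 2 ^ (n - Suc l)" using step.prems(2) by (rule order_trans[rotated])
        then show ?thesis using \<open>v = u + 1\<close> that step.prems bound[of "Suc l" u] by auto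
      qed
      have xy: "x \<le> 2 * x'" "2 * x' = x \<or> 2 * x' = x + 1" "2 * y' \<le> y" "y = 2 * y' \<or> y = 2 * y' + 1"
        unfolding x'_def y'_def by linarith+
      have "N (x * 2 ^ (n - Suc l)) (y * 2 ^ (n - Suc l)) \<le> N (x * 2 ^ (n - Suc l)) (2 * x' * 2 ^ (n - Suc l)) + N (2 * x' * 2 ^ (n - Suc l)) (y * 2 ^ (n - Suc l))"
        using xy True le[of y] by (intro sub mult_right_mono) auto
      also have "N (2 * x' * 2 ^ (n - Suc l)) (y * 2 ^ (n - Suc l)) \<le> N (2 * x' * 2 ^ (n - Suc l)) (2 * y' * 2 ^ (n - Suc l)) + N (2 * y' * 2 ^ (n - Suc l)) (y * 2 ^ (n - Suc l))"
        using xy True le[of y] by (intro sub mult_right_mono) auto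
      also have "N (x * 2 ^ (n - Suc l)) (2 * x' * 2 ^ (n - Suc l)) \<le> Q (Suc l)"
        using xy True by (intro edge) auto
      also have "N (2 * y' * 2 ^ (n - Suc l)) (y * 2 ^ (n - Suc l)) \<le> Q (Suc l)"
        using xy True by (intro edge) auto
      finally show ?thesis using IH unfolding S e by (simp add: mult_ac)
    next
      case False
      \<comment> \<open>The rounded points cross only if both ends are the same odd number.\<close>
      then have "x = y" using step.prems(3) unfolding x'_def y'_def by linarith
      then show ?thesis using zero[of "x * 2 ^ (n - Suc l)"] Snn Q[of "Suc l"] unfolding S by simp
    qed
  qed
  from this[of n i j] show ?thesis using assms by simp
qed

text \<open>The discrete form of the derivative of a power, taken at the larger point.\<close>

lemma power_diff_le_mult:
  fixes x y :: real
  assumes "0 \<le> y" "y \<le> x"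
  shows "x ^ Suc m - y ^ Suc m \<le> real (Suc m) * (x - y) * x ^ m"
proof -
  have "x ^ Suc m - y ^ Suc m = (x - y) * (\<Sum>i<Suc m. y ^ (m - i) * x ^ i)"
    using power_diff_sumr2[of x "Suc m" y] by simp
  also have "\<dots> \<le> (x - y) * (\<Sum>i<Suc m. x ^ m)"
  proof (intro mult_left_mono sum_mono)
    fix i assume "i \<in> {..<Suc m}"
    then have "x ^ m = x ^ (m - i) * x ^ i" by (simp flip: power_add)
    moreover have "y ^ (m - i) * x ^ i \<le> x ^ (m - i) * x ^ i"
      using assms by (intro mult_right_mono power_mono) auto
    ultimately show "y ^ (m - i) * x ^ i \<le> x ^ m" by simp
  qed (use assms in simp)
  finally show ?thesis by (simp add: mult_ac)
qed

text \<open>A discrete John--Nirenberg (energy) inequality. Conditional expectations are expressed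
  by testing against nonnegative functions measurable with respect to the past.\<close>

lemma john_nirenberg_moments:
  fixes A :: "nat \<Rightarrow> 'a \<Rightarrow> real" and F :: "nat \<Rightarrow> 'a measure"
  assumes F: "\<And>i. i \<le> N \<Longrightarrow> subalgebra M (F i)" "\<And>i j. i \<le> j \<Longrightarrow> j \<le> N \<Longrightarrow> subalgebra (F j) (F i)"
    and A: "\<And>i. i \<le> N \<Longrightarrow> A i \<in> borel_measurable (F i)"
    and mono: "\<And>i \<omega>. \<omega> \<in> space M \<Longrightarrow> i < N \<Longrightarrow> A i \<omega> \<le> A (Suc i) \<omega>"
    and K: "0 \<le> K"
    and E: "\<And>i g. 1 \<le> i \<Longrightarrow> i \<le> N \<Longrightarrow> g \<in> borel_measurable (F i) \<Longrightarrow>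
       (\<integral>\<^sup>+\<omega>. g \<omega> * ennreal (A N \<omega> - A (i - 1) \<omega>) \<partial>M) \<le> ennreal K * (\<integral>\<^sup>+\<omega>. g \<omega> \<partial>M)"
    and i: "1 \<le> i" "i \<le> N" and g: "g \<in> borel_measurable (F i)"
  shows "(\<integral>\<^sup>+\<omega>. g \<omega> * ennreal ((A N \<omega> - A (i - 1) \<omega>) ^ m) \<partial>M) \<le> ennreal (fact m * K ^ m) * (\<integral>\<^sup>+\<omega>. g \<omega> \<partial>M)"
  using i g
proof (induction m arbitrary: i g)
  case (Suc m)
  have FM: "f \<in> borel_measurable M" if "f \<in> borel_measurable (F i)" "i \<le> N" for f :: "'a \<Rightarrow> ennreal" and i
    using measurable_from_subalg[OF F(1) that(1)] that by auto
  have FMr: "f \<in> borel_measurable M" if "f \<in> borel_measurable (F i)" "i \<le> N" for f :: "'a \<Rightarrow> real" and i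
    using measurable_from_subalg[OF F(1) that(1)] that by auto
  have AM[measurable]: "A j \<in> borel_measurable M" if "j \<le> N" for j using A FMr that by blast
  have mono': "A j \<omega> \<le> A k \<omega>" if "\<omega> \<in> space M" "j \<le> k" "k \<le> N" for j k \<omega>
    using that(2,3)
  proof (induction k rule: dec_induct)
    case (step l) then show ?case using mono[of \<omega> l] that by auto
  qed simp
  \<comment> \<open>The remaining increment is counted from j - 1 and not from j, in accordance with
    the hypothesis \<open>E\<close>, which covers the step leading to time j as well.\<close>
  define S where "S j \<omega> = (A j \<omega> - A (j - 1) \<omega>) * (A N \<omega> - A (j - 1) \<omega>) ^ m" for j \<omega>
  have tele: "(\<Sum>j\<in>{i..N}. f j - f (j - 1)) = f N - f (i - 1)" for f :: "nat \<Rightarrow> real"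
    using sum_telescope''[of "i - 1" N f] Suc.prems by simp
  have gM: "g \<in> borel_measurable M" using Suc.prems FM by blast
  have gj: "(\<lambda>\<omega>. g \<omega> * ennreal (A j \<omega> - A (j - 1) \<omega>)) \<in> borel_measurable (F j)" if "i \<le> j" "j \<le> N" for j
  proof -
    have "g \<in> borel_measurable (F j)" using measurable_from_subalg[OF F(2)] Suc.prems that by blast
    moreover have "A (j - 1) \<in> borel_measurable (F j)"
      using measurable_from_subalg[OF F(2)[of "j - 1" j] A[of "j - 1"]] that by auto
    moreover have "A j \<in> borel_measurable (F j)" using A that by auto
    ultimately show ?thesis by measurable
  qed
  have "(\<integral>\<^sup>+\<omega>. g \<omega> * ennreal ((A N \<omega> - A (i - 1) \<omega>) ^ Suc m) \<partial>M)
     \<le> (\<integral>\<^sup>+\<omega>. ennreal (Suc m) * (\<Sum>j\<in>{i..N}. g \<omega> * ennreal (A j \<omega> - A (j - 1) \<omega>) * ennreal ((A N \<omega> - A (j - 1) \<omega>) ^ m)) \<partial>M)"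
  proof (rule nn_integral_mono)
    fix \<omega> assume \<omega>: "\<omega> \<in> space M"
    \<comment> \<open>The powers of the remaining increments telescope; the last one is 0.\<close>
    have "(A N \<omega> - A (i - 1) \<omega>) ^ Suc m = (\<Sum>j\<in>{i..N}. (A N \<omega> - A (j - 1) \<omega>) ^ Suc m - (A N \<omega> - A j \<omega>) ^ Suc m)"
    proof -
      have "(\<Sum>j = i..N. (- ((A N \<omega> - A j \<omega>) ^ Suc m)) - (- ((A N \<omega> - A (j - 1) \<omega>) ^ Suc m)))
          = (- ((A N \<omega> - A N \<omega>) ^ Suc m)) - (- ((A N \<omega> - A (i - 1) \<omega>) ^ Suc m))"
        by (rule tele)
      then show ?thesis by simp
    qed
    also have "\<dots> \<le> (\<Sum>j\<in>{i..N}. real (Suc m) * S j \<omega>)"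
    proof (rule sum_mono)
      fix j assume j: "j \<in> {i..N}"
      then show "(A N \<omega> - A (j - 1) \<omega>) ^ Suc m - (A N \<omega> - A j \<omega>) ^ Suc m \<le> real (Suc m) * S j \<omega>"
        using power_diff_le_mult[of "A N \<omega> - A j \<omega>" "A N \<omega> - A (j - 1) \<omega>" m]
          mono'[OF \<omega>, of j N] mono'[OF \<omega>, of "j - 1" j] by (simp add: S_def mult_ac)
    qed
    finally have "ennreal ((A N \<omega> - A (i - 1) \<omega>) ^ Suc m) \<le> ennreal (\<Sum>j\<in>{i..N}. real (Suc m) * S j \<omega>)"
      by (rule ennreal_leI)
    also have "\<dots> = ennreal (Suc m) * (\<Sum>j\<in>{i..N}. ennreal (A j \<omega> - A (j - 1) \<omega>) * ennreal ((A N \<omega> - A (j - 1) \<omega>) ^ m))"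
    proof -
      have nn: "0 \<le> A j \<omega> - A (j - 1) \<omega>" "0 \<le> A N \<omega> - A (j - 1) \<omega>" if "j \<in> {i..N}" for j
        using mono'[OF \<omega>, of "j - 1" j] mono'[OF \<omega>, of "j - 1" N] that by auto
      have "(\<Sum>j\<in>{i..N}. ennreal (A j \<omega> - A (j - 1) \<omega>) * ennreal ((A N \<omega> - A (j - 1) \<omega>) ^ m)) = (\<Sum>j\<in>{i..N}. ennreal (S j \<omega>))"
        unfolding S_def using nn by (intro sum.cong refl ennreal_mult[symmetric] zero_le_power) auto
      also have "\<dots> = ennreal (\<Sum>j\<in>{i..N}. S j \<omega>)"
        using nn by (intro sum_ennreal) (auto simp: S_def)
      finally show ?thesis unfolding sum_distrib_left[symmetric] by (simp only: ennreal_mult' of_nat_0_le_iff)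
    qed
    finally have "g \<omega> * ennreal ((A N \<omega> - A (i - 1) \<omega>) ^ Suc m)
       \<le> g \<omega> * (ennreal (Suc m) * (\<Sum>j\<in>{i..N}. ennreal (A j \<omega> - A (j - 1) \<omega>) * ennreal ((A N \<omega> - A (j - 1) \<omega>) ^ m)))"
      by (rule mult_left_mono) simp
    then show "g \<omega> * ennreal ((A N \<omega> - A (i - 1) \<omega>) ^ Suc m) \<le> ennreal (Suc m) * (\<Sum>j\<in>{i..N}. g \<omega> * ennreal (A j \<omega> - A (j - 1) \<omega>) * ennreal ((A N \<omega> - A (j - 1) \<omega>) ^ m))"
      by (simp add: sum_distrib_left mult_ac)
  qed
  also have "\<dots> = ennreal (Suc m) * (\<Sum>j\<in>{i..N}. \<integral>\<^sup>+\<omega>. g \<omega> * ennreal (A j \<omega> - A (j - 1) \<omega>) * ennreal ((A N \<omega> - A (j - 1) \<omega>) ^ m) \<partial>M)"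
  proof -
    have "(\<lambda>\<omega>. g \<omega> * ennreal (A j \<omega> - A (j - 1) \<omega>) * ennreal ((A N \<omega> - A (j - 1) \<omega>) ^ m)) \<in> borel_measurable M" if "j \<in> {i..N}" for j
      using AM[of j] AM[of "j - 1"] AM[of N] that gM by auto
    then show ?thesis by (subst nn_integral_cmult, force, subst nn_integral_sum) auto
  qed
  \<comment> \<open>The increment up to j is known at time j, so it joins the test function, and the
    induction hypothesis is used with start j.\<close>
  also have "\<dots> \<le> ennreal (Suc m) * (\<Sum>j\<in>{i..N}. ennreal (fact m * K ^ m) * (\<integral>\<^sup>+\<omega>. g \<omega> * ennreal (A j \<omega> - A (j - 1) \<omega>) \<partial>M))"
    using Suc.prems gj by (intro mult_left_mono sum_mono Suc.IH) auto
  also have "\<dots> = ennreal (Suc m) * (ennreal (fact m * K ^ m) * (\<integral>\<^sup>+\<omega>. g \<omega> * ennreal (A N \<omega> - A (i - 1) \<omega>) \<partial>M))"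
  proof -
    have "(\<Sum>j\<in>{i..N}. \<integral>\<^sup>+\<omega>. g \<omega> * ennreal (A j \<omega> - A (j - 1) \<omega>) \<partial>M) = (\<integral>\<^sup>+\<omega>. (\<Sum>j\<in>{i..N}. g \<omega> * ennreal (A j \<omega> - A (j - 1) \<omega>)) \<partial>M)"
      using gj FM by (intro nn_integral_sum[symmetric]) (meson atLeastAtMost_iff)
    also have "\<dots> = (\<integral>\<^sup>+\<omega>. g \<omega> * ennreal (A N \<omega> - A (i - 1) \<omega>) \<partial>M)"
    proof (rule nn_integral_cong)
      fix \<omega> assume \<omega>: "\<omega> \<in> space M"
      have "(\<Sum>j\<in>{i..N}. ennreal (A j \<omega> - A (j - 1) \<omega>)) = ennreal (\<Sum>j\<in>{i..N}. A j \<omega> - A (j - 1) \<omega>)"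
        using mono'[OF \<omega>] by (intro sum_ennreal) auto
      also have "(\<Sum>j\<in>{i..N}. A j \<omega> - A (j - 1) \<omega>) = A N \<omega> - A (i - 1) \<omega>"
        by (rule tele)
      finally show "(\<Sum>j\<in>{i..N}. g \<omega> * ennreal (A j \<omega> - A (j - 1) \<omega>)) = g \<omega> * ennreal (A N \<omega> - A (i - 1) \<omega>)"
        by (simp flip: sum_distrib_left)
    qed
    finally show ?thesis by (simp only: sum_distrib_left[symmetric])
  qed
  \<comment> \<open>What is left is a first moment started at i, hence one more factor K.\<close>
  also have "\<dots> \<le> ennreal (Suc m) * (ennreal (fact m * K ^ m) * (ennreal K * (\<integral>\<^sup>+\<omega>. g \<omega> \<partial>M)))"
    using Suc.prems by (intro mult_left_mono E) auto
  also have "\<dots> = ennreal (fact (Suc m) * K ^ Suc m) * (\<integral>\<^sup>+\<omega>. g \<omega> \<partial>M)"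
  proof -
    have "ennreal (fact (Suc m) * K ^ Suc m) = ennreal (Suc m) * (ennreal (fact m * K ^ m) * ennreal K)"
      using K by (simp only: ennreal_mult[symmetric] mult_nonneg_nonneg zero_le_power fact_ge_zero of_nat_0_le_iff) (simp add: mult_ac)
    then show ?thesis by (simp add: mult_ac)
  qed
  finally show ?case .
qed simp

section \<open>Elementary integrals and joint measurability\<close>

lemma nn_integral_powr_dist:
  fixes c \<eta> :: real
  assumes "\<eta> < 1" "c \<in> {s..t}"
  shows "(\<integral>\<^sup>+a. ennreal (\<bar>a - c\<bar> powr (-\<eta>)) * indicator {s..t} a \<partial>lborel) \<le> ennreal (2 * (t - s) powr (1 - \<eta>) / (1 - \<eta>))"
proof -
  have h: "(\<integral>\<^sup>+x. ennreal (x powr (-\<eta>)) * indicator {0..t - s} x \<partial>lborel) = ennreal ((t - s) powr (1 - \<eta>) / (1 - \<eta>))"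
    using nn_integral_has_integral_lebesgue'[OF _ has_integral_powr_from_0[of "-\<eta>" "t - s"]] assms by simp
  have "(\<integral>\<^sup>+a. ennreal (\<bar>a - c\<bar> powr (-\<eta>)) * indicator {s..t} a \<partial>lborel)
     \<le> (\<integral>\<^sup>+a. ennreal ((a - c) powr (-\<eta>)) * indicator {0..t - s} (a - c) + ennreal ((c - a) powr (-\<eta>)) * indicator {0..t - s} (c - a) \<partial>lborel)"
    using assms by (intro nn_integral_mono) (auto simp: indicator_def abs_if)
  also have "\<dots> = (\<integral>\<^sup>+a. ennreal ((a - c) powr (-\<eta>)) * indicator {0..t - s} (a - c) \<partial>lborel)
     + (\<integral>\<^sup>+a. ennreal ((c - a) powr (-\<eta>)) * indicator {0..t - s} (c - a) \<partial>lborel)"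
    by (rule nn_integral_add) measurable
  also have "(\<integral>\<^sup>+a. ennreal ((a - c) powr (-\<eta>)) * indicator {0..t - s} (a - c) \<partial>lborel) = (\<integral>\<^sup>+x. ennreal (x powr (-\<eta>)) * indicator {0..t - s} x \<partial>lborel)"
    by (subst nn_integral_real_affine[where c=1 and t=c]) auto
  also have "(\<integral>\<^sup>+a. ennreal ((c - a) powr (-\<eta>)) * indicator {0..t - s} (c - a) \<partial>lborel) = (\<integral>\<^sup>+x. ennreal (x powr (-\<eta>)) * indicator {0..t - s} x \<partial>lborel)"
    by (subst nn_integral_real_affine[where c="-1" and t=c]) auto
  finally show ?thesis
    unfolding h using assms by (simp flip: ennreal_plus add: add_divide_distrib[symmetric])
qed

text \<open>From \<open>y \<le> exp y\<close> at y = x / \<alpha>, raised to the power \<alpha>; it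
  serves to trade exponential for polynomial decay.\<close>

lemma powr_le_exp:
  fixes x \<alpha> :: real
  assumes "0 < \<alpha>" "0 \<le> x"
  shows "x powr \<alpha> \<le> \<alpha> powr \<alpha> * exp x"
proof (cases "x = 0")
  case False
  have "x / \<alpha> \<le> exp (x / \<alpha>)" using exp_ge_add_one_self[of "x / \<alpha>"] by linarith
  then have "(x / \<alpha>) powr \<alpha> \<le> exp (x / \<alpha>) powr \<alpha>" using assms by (intro powr_mono2) auto
  also have "exp (x / \<alpha>) powr \<alpha> = exp x" using assms by (simp add: powr_def)
  finally show ?thesis using assms by (simp add: powr_divide field_simps)
qed (use assms in simp)

text \<open>The exponent is shared equally by the coordinates: \<open>1 + |z|^2\<close> is at least
  \<open>1 + (z \<bullet> b)^2\<close>, and each share \<delta> exceeds 1/2, so the product of the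
  one-dimensional integrals is finite.\<close>

lemma nn_integral_japanese_bracket:
  assumes "real DIM('b::euclidean_space) / 2 < \<beta>"
  shows "(\<integral>\<^sup>+z. ennreal ((1 + (norm (z::'b))\<^sup>2) powr (-\<beta>)) \<partial>lborel) < \<infinity>"
proof -
  define \<delta> where "\<delta> = \<beta> / DIM('b)"
  have \<delta>: "1/2 < \<delta>" using assms by (simp add: \<delta>_def field_simps)
  have "(1 + (norm z)\<^sup>2) powr (-\<beta>) \<le> (\<Prod>b\<in>Basis. (1 + (z \<bullet> b)\<^sup>2) powr (-\<delta>))" for z :: 'b
  proof -
    have "(1 + (norm z)\<^sup>2) powr (-\<beta>) = (\<Prod>b\<in>(Basis::'b set). (1 + (norm z)\<^sup>2) powr (-\<delta>))"
    proof -
      have "((1 + (norm z)\<^sup>2) powr (-\<delta>)) ^ DIM('b) = (1 + (norm z)\<^sup>2) powr (real DIM('b) * (-\<delta>))"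
        by (rule powr_power) (simp add: add_pos_nonneg[THEN less_imp_neq, symmetric])
      then show ?thesis by (simp add: \<delta>_def)
    qed
    also have "\<dots> \<le> (\<Prod>b\<in>Basis. (1 + (z \<bullet> b)\<^sup>2) powr (-\<delta>))"
    proof (intro prod_mono conjI)
      fix b :: 'b assume b: "b \<in> Basis"
      have "(z \<bullet> b)\<^sup>2 \<le> (norm z)\<^sup>2" using Basis_le_norm[OF b, of z] by (metis abs_ge_zero power2_abs power_mono)
      then show "(1 + (norm z)\<^sup>2) powr (-\<delta>) \<le> (1 + (z \<bullet> b)\<^sup>2) powr (-\<delta>)"
        using \<delta> by (intro powr_mono2') (auto simp: add_pos_nonneg)
    qed auto
    finally show ?thesis .
  qed
  then have "(\<integral>\<^sup>+z. ennreal ((1 + (norm (z::'b))\<^sup>2) powr (-\<beta>)) \<partial>lborel)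
     \<le> (\<integral>\<^sup>+z. (\<Prod>b\<in>Basis. ennreal ((1 + ((z::'b) \<bullet> b)\<^sup>2) powr (-\<delta>))) \<partial>lborel)"
    by (intro nn_integral_mono) (simp add: prod_ennreal ennreal_leI)
  also have "\<dots> = (\<Prod>b\<in>(Basis::'b set). \<integral>\<^sup>+x. ennreal ((1 + x\<^sup>2) powr (-\<delta>)) \<partial>lborel)"
    by (rule nn_integral_lborel_prod) auto
  also have "\<dots> < \<infinity>"
  proof -
    have h: "(\<integral>\<^sup>+x. ennreal (x powr (-2*\<delta>)) * indicator {1..} x \<partial>lborel) < \<infinity>"
      using nn_integral_has_integral_lebesgue'[OF _ has_integral_powr_to_inf[of "-2*\<delta>" 1]] \<delta> by simp
    have h': "(\<integral>\<^sup>+x. ennreal ((- x) powr (-2*\<delta>)) * indicator {1..} (- x) \<partial>lborel) < \<infinity>"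
      using h by (subst (asm) nn_integral_real_affine[where c="-1" and t=0]) auto
    have "ennreal ((1 + x\<^sup>2) powr (-\<delta>)) \<le> indicator {-1<..<1} x + ennreal (x powr (-2*\<delta>)) * indicator {1..} x + ennreal ((- x) powr (-2*\<delta>)) * indicator {1..} (- x)" for x :: real
    proof -
      have sm: "(1 + x\<^sup>2) powr (-\<delta>) \<le> 1"
        using powr_mono2'[of "-\<delta>" 1 "1 + x\<^sup>2"] \<delta> by simp
      have la: "(1 + x\<^sup>2) powr (-\<delta>) \<le> \<bar>x\<bar> powr (-2*\<delta>)" if "1 \<le> \<bar>x\<bar>"
      proof -
        have "(1 + x\<^sup>2) powr (-\<delta>) \<le> (\<bar>x\<bar>\<^sup>2) powr (-\<delta>)" using \<delta> that by (intro powr_mono2') auto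
        also have "\<bar>x\<bar>\<^sup>2 = \<bar>x\<bar> powr 2" using that powr_realpow[of "\<bar>x\<bar>" 2] by simp
        also have "(\<bar>x\<bar> powr 2) powr (-\<delta>) = \<bar>x\<bar> powr (-2*\<delta>)"
          by (simp only: powr_powr mult_minus_right mult_minus_left)
        finally show ?thesis .
      qed
      consider "\<bar>x\<bar> < 1" | "1 \<le> x" | "1 \<le> - x" by linarith
      then show ?thesis
        by cases (use sm la in \<open>auto simp: indicator_def ennreal_leI intro!: order_trans[OF ennreal_leI[OF sm]]\<close>)
    qed
    then have "(\<integral>\<^sup>+x. ennreal ((1 + x\<^sup>2) powr (-\<delta>)) \<partial>lborel)
      \<le> (\<integral>\<^sup>+x. indicator {-1<..<1} x + ennreal (x powr (-2*\<delta>)) * indicator {1..} x + ennreal ((- x) powr (-2*\<delta>)) * indicator {1..} (- x) \<partial>lborel)"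
      by (intro nn_integral_mono) auto
    also have "\<dots> < \<infinity>" using h h' by (simp add: nn_integral_add)
    finally show ?thesis by (simp add: power_less_top_ennreal)
  qed
  finally show ?thesis .
qed

text \<open>The Caratheodory argument: rounding the parameter down to a grid leaves countably many
  values, and continuity recovers the function in the limit.\<close>

lemma borel_measurable_continuous_param:
  fixes f :: "real \<Rightarrow> 'a \<Rightarrow> 'b::{metric_space, second_countable_topology}"
  assumes cont: "\<And>\<omega>. \<omega> \<in> space N \<Longrightarrow> continuous_on UNIV (\<lambda>a. f a \<omega>)"
    and meas: "\<And>a. f a \<in> borel_measurable N"
  shows "(\<lambda>p. f (fst p) (snd p)) \<in> borel_measurable (borel \<Otimes>\<^sub>M N)"
proof (rule borel_measurable_LIMSEQ_metric)
  define g where "g n p = f (real_of_int \<lfloor>fst p * Suc n\<rfloor> / Suc n) (snd p)" for n :: nat and p :: "real \<times> 'a"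
  show "g n \<in> borel_measurable (borel \<Otimes>\<^sub>M N)" for n
    unfolding g_def
    by (rule measurable_compose_countable[where f="\<lambda>k p. f (real_of_int k / real (Suc n)) (snd p)"])
       (auto intro: measurable_compose[OF measurable_snd meas])
  fix p assume "p \<in> space ((borel::real measure) \<Otimes>\<^sub>M N)"
  then have p: "snd p \<in> space N" by (auto simp: space_pair_measure)
  have "(\<lambda>n. real_of_int \<lfloor>fst p * Suc n\<rfloor> / Suc n) \<longlonglongrightarrow> fst p"
  proof (rule tendsto_sandwich)
    show "(\<lambda>n. fst p - 1 / real (Suc n)) \<longlonglongrightarrow> fst p"
      using tendsto_diff[OF tendsto_const LIMSEQ_Suc[OF lim_1_over_n], of "fst p"] by simp
    have "fst p * Suc n - 1 \<le> real_of_int \<lfloor>fst p * Suc n\<rfloor>" "real_of_int \<lfloor>fst p * Suc n\<rfloor> \<le> fst p * Suc n" for n by linarith+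
    then have "(fst p * Suc n - 1) / Suc n \<le> real_of_int \<lfloor>fst p * Suc n\<rfloor> / Suc n"
       "real_of_int \<lfloor>fst p * Suc n\<rfloor> / Suc n \<le> fst p * Suc n / Suc n" for n by (intro divide_right_mono; simp)+
    then show "\<forall>\<^sub>F n in sequentially. fst p - 1 / real (Suc n) \<le> real_of_int \<lfloor>fst p * Suc n\<rfloor> / Suc n"
      "\<forall>\<^sub>F n in sequentially. real_of_int \<lfloor>fst p * Suc n\<rfloor> / Suc n \<le> fst p"
      by (auto simp: diff_divide_distrib)
  qed simp
  then show "(\<lambda>n. g n p) \<longlonglongrightarrow> f (fst p) (snd p)"
    unfolding g_def using cont[OF p] by (auto simp: continuous_on_eq_continuous_at intro: isCont_tendsto_compose)
qed

section \<open>Occupation transforms of nondeterministic processes\<close>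

text \<open>Kept on the whole line with the Borel sets, so that integrands and product
  sigma-algebras are the same for all intervals; it is the null measure if s > t.\<close>

definition interval_measure_on :: "real \<Rightarrow> real \<Rightarrow> real measure" where
  "interval_measure_on s t = density lborel (indicator {s..t})"

lemma sets_interval_measure_on [measurable_cong, simp]: "sets (interval_measure_on s t) = sets borel"
  by (simp add: interval_measure_on_def)

lemma space_interval_measure_on [simp]: "space (interval_measure_on s t) = UNIV"
  by (simp add: interval_measure_on_def)

lemma finite_interval_measure_on: "finite_measure (interval_measure_on s t)"
  by (rule finite_measureI) (simp add: interval_measure_on_def emeasure_density emeasure_lborel_Icc_eq)

lemma nn_integral_interval_measure_on:
  "f \<in> borel_measurable borel \<Longrightarrow> (\<integral>\<^sup>+a. f a \<partial>interval_measure_on s t) = (\<integral>\<^sup>+a. f a * indicator {s..t} a \<partial>lborel)"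
  unfolding interval_measure_on_def by (subst nn_integral_density) (auto simp: mult.commute)

lemma integral_interval_measure_on:
  fixes f :: "real \<Rightarrow> 'b::{banach, second_countable_topology}"
  shows "f \<in> borel_measurable borel \<Longrightarrow> (\<integral>a. f a \<partial>interval_measure_on s t) = (\<integral>a. indicator {s..t} a *\<^sub>R f a \<partial>lborel)"
proof -
  assume "f \<in> borel_measurable borel"
  moreover have "interval_measure_on s t = density lborel (\<lambda>x. ennreal (indicator {s..t} x))"
    unfolding interval_measure_on_def by (simp add: ennreal_indicator)
  ultimately show ?thesis by (simp add: integral_density)
qed

lemma emeasure_interval_measure_on: "s \<le> t \<Longrightarrow> emeasure (interval_measure_on s t) UNIV = ennreal (t - s)"
  by (simp add: interval_measure_on_def emeasure_density)

text \<open>The time-slice process of the argument: \<open>F u\<close> is the past at time \<open>u\<close>, and \<open>lnd\<close> is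
  the only trace of Gaussianity that is used.\<close>

locale lnd_process = prob_space M for M :: "'a measure" +
  fixes X :: "real \<Rightarrow> 'a \<Rightarrow> 'b::euclidean_space" and T H \<kappa> :: real and F :: "real \<Rightarrow> 'a set set"
  assumes T: "0 < T" and H: "0 < H" and \<kappa>: "0 < \<kappa>"
    and X_cont: "\<And>\<omega>. \<omega> \<in> space M \<Longrightarrow> continuous_on UNIV (\<lambda>a. X a \<omega>)"
    and F_sigma: "\<And>u. 0 \<le> u \<Longrightarrow> u \<le> T \<Longrightarrow> sigma_algebra (space M) (F u)"
    and F_events: "\<And>u. 0 \<le> u \<Longrightarrow> u \<le> T \<Longrightarrow> F u \<subseteq> sets M"
    and F_mono: "\<And>u v. 0 \<le> u \<Longrightarrow> u \<le> v \<Longrightarrow> v \<le> T \<Longrightarrow> F u \<subseteq> F v"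
    and adapted: "\<And>u a. 0 \<le> u \<Longrightarrow> u \<le> T \<Longrightarrow> a \<le> u \<Longrightarrow> X a \<in> borel_measurable (sigma (space M) (F u))"
    and X_meas: "\<And>a. X a \<in> borel_measurable M"
    and lnd: "\<And>u a a' E z. 0 \<le> u \<Longrightarrow> u \<le> a \<Longrightarrow> a < a' \<Longrightarrow> a' \<le> T \<Longrightarrow> E \<in> F u \<Longrightarrow>
      norm (\<integral>\<omega>. cis (z \<bullet> (X a' \<omega> - X a \<omega>)) * indicator E \<omega> \<partial>M) \<le> exp (- \<kappa> * (norm z)\<^sup>2 * (a' - a) powr (2*H)) * prob E"
begin

definition past_algebra :: "real \<Rightarrow> 'a measure" where
  "past_algebra u = sigma (space M) (F u)"

text \<open>The Fourier transform of the occupation measure of X during the interval, defined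
  through time so that no density is involved.\<close>

definition occ :: "real \<Rightarrow> real \<Rightarrow> 'b \<Rightarrow> 'a \<Rightarrow> complex" where
  "occ s t z \<omega> = (\<integral>a. cis (- (z \<bullet> X a \<omega>)) \<partial>interval_measure_on s t)"

lemma space_past [simp]: "space (past_algebra u) = space M"
  by (simp add: past_algebra_def space_measure_of_conv)

lemma sets_past: "0 \<le> u \<Longrightarrow> u \<le> T \<Longrightarrow> sets (past_algebra u) = F u"
proof -
  assume u: "0 \<le> u" "u \<le> T"
  interpret S: sigma_algebra "space M" "F u" using F_sigma[OF u] .
  show ?thesis unfolding past_algebra_def using S.sigma_sets_eq S.space_closed by simp
qed

lemma subalgebra_past:
  "0 \<le> u \<Longrightarrow> u \<le> T \<Longrightarrow> subalgebra M (past_algebra u)"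
  "0 \<le> u \<Longrightarrow> u \<le> v \<Longrightarrow> v \<le> T \<Longrightarrow> subalgebra (past_algebra v) (past_algebra u)"
  using F_events F_mono by (auto simp: subalgebra_def sets_past)

lemma X_joint [measurable]: "(\<lambda>p. X (fst p) (snd p)) \<in> borel_measurable (borel \<Otimes>\<^sub>M M)"
  by (rule borel_measurable_continuous_param[OF X_cont X_meas])

text \<open>Stopping at u makes the process measurable for the past at every parameter and does not
  change the transforms of intervals that end by time u.\<close>

lemma X_joint_past:
  assumes "0 \<le> u" "u \<le> T"
  shows "(\<lambda>p. X (min u (fst p)) (snd p)) \<in> borel_measurable (borel \<Otimes>\<^sub>M past_algebra u)"
proof (rule borel_measurable_continuous_param[where f="\<lambda>a. X (min u a)"])
  fix \<omega> assume "\<omega> \<in> space (past_algebra u)"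
  then show "continuous_on UNIV (\<lambda>a. X (min u a) \<omega>)"
    by (intro continuous_on_compose2[OF X_cont[of \<omega>]] continuous_intros) auto
next
  fix a
  show "X (min u a) \<in> borel_measurable (past_algebra u)"
    unfolding past_algebra_def by (rule adapted) (use assms in auto)
qed

lemma X_path [measurable]: "\<omega> \<in> space M \<Longrightarrow> (\<lambda>a. X a \<omega>) \<in> borel_measurable borel"
  using X_cont by (intro borel_measurable_continuous_onI) auto

lemma occ_joint_past:
  assumes "0 \<le> u" "u \<le> T" "t \<le> u"
  shows "(\<lambda>p. occ s t (fst p) (snd p)) \<in> borel_measurable (borel \<Otimes>\<^sub>M past_algebra u)"
proof -
  have [measurable]: "(\<lambda>p. X (min u (fst p)) (snd p)) \<in> borel_measurable (borel \<Otimes>\<^sub>M past_algebra u)"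
    by (rule X_joint_past[OF assms(1,2)])
  interpret finite_measure "interval_measure_on s t" by (rule finite_interval_measure_on)
  have eq: "(\<integral>a. cis (- (fst p \<bullet> X (min u a) (snd p))) \<partial>interval_measure_on s t) = occ s t (fst p) (snd p)"
    if "p \<in> space (borel \<Otimes>\<^sub>M past_algebra u)" for p
  proof -
    have [measurable]: "snd p \<in> space M" using that by (auto simp: space_pair_measure)
    have [measurable]: "(\<lambda>a. X a (snd p)) \<in> borel_measurable borel" by (rule X_path) fact
    have [measurable]: "(\<lambda>a. X (min u a) (snd p)) \<in> borel_measurable borel"
      by (rule measurable_compose[OF _ \<open>(\<lambda>a. X a (snd p)) \<in> borel_measurable borel\<close>]) measurable
    show ?thesis unfolding occ_def
      by (subst (1 2) integral_interval_measure_on; (measurable)?)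
         (use assms in \<open>auto intro!: Bochner_Integration.integral_cong simp: indicator_def\<close>)
  qed
  have "(\<lambda>p. \<integral>a. cis (- (fst p \<bullet> X (min u a) (snd p))) \<partial>interval_measure_on s t) \<in> borel_measurable (borel \<Otimes>\<^sub>M past_algebra u)"
  proof (rule borel_measurable_lebesgue_integral)
    have "(\<lambda>q. X (min u (snd q)) (snd (fst q))) \<in> borel_measurable ((borel \<Otimes>\<^sub>M past_algebra u) \<Otimes>\<^sub>M interval_measure_on s t)"
      by (rule measurable_compose[where f="\<lambda>q. (snd q, snd (fst q))" and g="\<lambda>p. X (min u (fst p)) (snd p)", OF _ X_joint_past[OF assms(1,2)], simplified]) measurable
    then show "(\<lambda>(p, a). cis (- (fst p \<bullet> X (min u a) (snd p)))) \<in> borel_measurable ((borel \<Otimes>\<^sub>M past_algebra u) \<Otimes>\<^sub>M interval_measure_on s t)"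
      unfolding split_beta' by measurable
  qed
  then show ?thesis by (subst (asm) measurable_cong[OF eq]) auto
qed

lemma occ_joint:
  "(\<lambda>p. occ s t (fst p) (snd p)) \<in> borel_measurable (borel \<Otimes>\<^sub>M M)"
proof -
  interpret finite_measure "interval_measure_on s t" by (rule finite_interval_measure_on)
  show ?thesis unfolding occ_def
  proof (rule borel_measurable_lebesgue_integral)
    have "(\<lambda>q. X (snd q) (snd (fst q))) \<in> borel_measurable ((borel \<Otimes>\<^sub>M M) \<Otimes>\<^sub>M interval_measure_on s t)"
      by (rule measurable_compose[where f="\<lambda>q. (snd q, snd (fst q))" and g="\<lambda>p. X (fst p) (snd p)", OF _ X_joint, simplified]) measurable
    then show "(\<lambda>(p, a). cis (- (fst p \<bullet> X a (snd p)))) \<in> borel_measurable ((borel \<Otimes>\<^sub>M M) \<Otimes>\<^sub>M interval_measure_on s t)"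
      unfolding split_beta' by measurable
  qed
qed

lemma occ_meas_z [measurable]: "\<omega> \<in> space M \<Longrightarrow> (\<lambda>z. occ s t z \<omega>) \<in> borel_measurable borel"
proof -
  assume "\<omega> \<in> space M"
  then have "(\<lambda>z. (z, \<omega>)) \<in> borel \<rightarrow>\<^sub>M borel \<Otimes>\<^sub>M M" by simp
  from measurable_compose[OF this occ_joint] show ?thesis by simp
qed

lemma occ_meas_\<omega> [measurable]: "(\<lambda>\<omega>. occ s t z \<omega>) \<in> borel_measurable M"
proof -
  have "(\<lambda>\<omega>. (z, \<omega>)) \<in> M \<rightarrow>\<^sub>M borel \<Otimes>\<^sub>M M" by simp
  from measurable_compose[OF this occ_joint] show ?thesis by simp
qed

lemma cis_integrable:
  assumes "\<omega> \<in> space M"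
  shows "integrable (interval_measure_on s t) (\<lambda>a. cis (- (z \<bullet> X a \<omega>)))"
proof -
  interpret finite_measure "interval_measure_on s t" by (rule finite_interval_measure_on)
  show ?thesis by (rule integrable_const_bound[where B=1]) (use X_path[OF assms] in auto)
qed

lemma occ_norm_le:
  assumes "\<omega> \<in> space M" "s \<le> t"
  shows "norm (occ s t z \<omega>) \<le> t - s"
proof -
  interpret finite_measure "interval_measure_on s t" by (rule finite_interval_measure_on)
  have "norm (occ s t z \<omega>) \<le> (\<integral>a. norm (cis (- (z \<bullet> X a \<omega>))) \<partial>interval_measure_on s t)"
    unfolding occ_def by (rule integral_norm_bound)
  then show ?thesis using emeasure_interval_measure_on[OF assms(2)] assms by (simp add: measure_def)
qed

lemma occ_add:
  assumes \<omega>: "\<omega> \<in> space M" and "s \<le> t" "t \<le> u"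
  shows "occ s u z \<omega> = occ s t z \<omega> + occ t u z \<omega>"
proof -
  have c: "(\<lambda>a. cis (- (z \<bullet> X a \<omega>))) \<in> borel_measurable borel" using X_path[OF \<omega>] by measurable
  have i: "integrable lborel (\<lambda>a. indicator {s..t} a *\<^sub>R cis (- (z \<bullet> X a \<omega>)))" for s t
    by (rule Bochner_Integration.integrable_bound[where f="indicator {s..t} :: real \<Rightarrow> real"])
       (use c in \<open>auto intro!: integrable_real_indicator simp: emeasure_lborel_Icc_eq\<close>)
  have "(\<integral>a. indicator {s..u} a *\<^sub>R cis (- (z \<bullet> X a \<omega>)) \<partial>lborel)
    = (\<integral>a. indicator {s..t} a *\<^sub>R cis (- (z \<bullet> X a \<omega>)) + indicator {t..u} a *\<^sub>R cis (- (z \<bullet> X a \<omega>)) \<partial>lborel)"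
  proof (rule integral_cong_AE)
    show "AE a in lborel. indicator {s..u} a *\<^sub>R cis (- (z \<bullet> X a \<omega>)) = indicator {s..t} a *\<^sub>R cis (- (z \<bullet> X a \<omega>)) + indicator {t..u} a *\<^sub>R cis (- (z \<bullet> X a \<omega>))"
      using AE_lborel_singleton[of t] by eventually_elim (use assms in \<open>auto simp: indicator_def\<close>)
  qed (use c in auto)
  then show ?thesis unfolding occ_def integral_interval_measure_on[OF c]
    using i by simp
qed

lemma occ_self: "\<omega> \<in> space M \<Longrightarrow> occ s s z \<omega> = 0"
  using occ_norm_le[of \<omega> s s z] by simp

text \<open>The squared modulus is a double time integral of
  \<open>cis (z \<bullet> (X a - X a'))\<close>; after Fubini each pair of times is estimated by
  \<open>lnd\<close>.\<close>

lemma occ_second_moment: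
  assumes u: "0 \<le> u" "u \<le> s" "s \<le> t" "t \<le> T" and E: "E \<in> F u"
  shows "(\<integral>\<^sup>+\<omega>. ennreal ((norm (occ s t z \<omega>))\<^sup>2) * indicator E \<omega> \<partial>M)
     \<le> (\<integral>\<^sup>+a. \<integral>\<^sup>+a'. ennreal (exp (- \<kappa> * (norm z)\<^sup>2 * \<bar>a' - a\<bar> powr (2*H))) \<partial>interval_measure_on s t \<partial>interval_measure_on s t) * emeasure M E"
proof -
  let ?L = "interval_measure_on s t"
  interpret L: finite_measure ?L by (rule finite_interval_measure_on)
  interpret LM: pair_sigma_finite ?L M ..
  interpret LMf: finite_measure "?L \<Otimes>\<^sub>M M" by (rule finite_measure_pair_measure) unfold_locales
  interpret LL: pair_sigma_finite ?L ?L ..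
  interpret LLf: finite_measure "?L \<Otimes>\<^sub>M ?L" by (rule finite_measure_pair_measure) unfold_locales
  have Eev[measurable]: "E \<in> sets M" using F_events[of u] u E by auto
  define k where "k a a' \<omega> = cis (z \<bullet> (X a' \<omega> - X a \<omega>)) * indicator E \<omega>" for a a' \<omega>
  have kn: "norm (k a a' \<omega>) \<le> 1" for a a' \<omega> by (auto simp: k_def norm_mult indicator_def)
  have X1: "(\<lambda>p. X (f p) (g p)) \<in> borel_measurable N" if "f \<in> borel_measurable N" "g \<in> measurable N M" for f g and N :: "'z measure"
    using measurable_compose[OF measurable_Pair[OF that] X_joint] by simp
  have km: "(\<lambda>p. k (f p) (g p) (h p)) \<in> borel_measurable N"
    if [measurable]: "f \<in> borel_measurable N" "g \<in> borel_measurable N" "h \<in> measurable N M" for f g h and N :: "'z measure"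
  proof -
    have [measurable]: "(\<lambda>p. X (f p) (h p)) \<in> borel_measurable N" "(\<lambda>p. X (g p) (h p)) \<in> borel_measurable N"
      by (rule X1; fact)+
    show ?thesis unfolding k_def by measurable
  qed
  define e where "e a a' = exp (- \<kappa> * (norm z)\<^sup>2 * \<bar>a' - a\<bar> powr (2*H))" for a a'
  have e01: "0 \<le> e a a'" "e a a' \<le> 1" for a a' using \<kappa> by (auto simp: e_def)
  have em[measurable]: "(\<lambda>p. e (f p) (g p)) \<in> borel_measurable N"
    if [measurable]: "f \<in> borel_measurable N" "g \<in> borel_measurable N" for f g and N :: "'z measure"
    unfolding e_def by measurable
  \<comment> \<open>On the diagonal the bound is an equality; for a' < a the roles are exchanged by
    changing the sign of z.\<close>
  have kb: "norm (\<integral>\<omega>. k a a' \<omega> \<partial>M) \<le> e a a' * prob E" if "a \<in> {s..t}" "a' \<in> {s..t}" for a a'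
  proof -
    consider "a = a'" | "a < a'" | "a' < a" by linarith
    then show ?thesis
    proof cases
      case 1
      then have "k a a' = (\<lambda>\<omega>. complex_of_real (indicator E \<omega>))" by (auto simp: k_def indicator_def)
      then have "(\<integral>\<omega>. k a a' \<omega> \<partial>M) = complex_of_real (prob E)" by simp
      then show ?thesis using 1 by (simp add: e_def)
    next
      case 2
      then show ?thesis using lnd[of u a a' E z] that u E by (simp add: k_def e_def)
    next
      case 3
      have "k a a' \<omega> = cis ((- z) \<bullet> (X a \<omega> - X a' \<omega>)) * indicator E \<omega>" for \<omega>
        by (simp add: k_def inner_diff_right)
      then show ?thesis using lnd[of u a' a E "- z"] 3 that u E by (simp add: e_def abs_minus_commute)
    qed
  qed
  have occ2: "complex_of_real ((norm (occ s t z \<omega>))\<^sup>2) * indicator E \<omega> = (\<integral>a. \<integral>a'. k a' a \<omega> \<partial>?L \<partial>?L)"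
    if \<omega>: "\<omega> \<in> space M" for \<omega>
  proof -
    have c: "cnj (occ s t z \<omega>) = (\<integral>a. cis (z \<bullet> X a \<omega>) \<partial>?L)"
      unfolding occ_def Bochner_Integration.integral_cnj[symmetric] by (simp add: cis_cnj)
    have ci: "integrable ?L (\<lambda>a. cis (z \<bullet> X a \<omega>))"
      using cis_integrable[OF \<omega>, of s t "- z"] by simp
    have "(\<integral>a. \<integral>a'. k a' a \<omega> \<partial>?L \<partial>?L) = (\<integral>a. \<integral>a'. (cis (z \<bullet> X a \<omega>) * indicator E \<omega>) * cis (- (z \<bullet> X a' \<omega>)) \<partial>?L \<partial>?L)"
      by (simp add: k_def inner_diff_right cis_mult mult_ac)
    also have "\<dots> = (\<integral>a. cis (z \<bullet> X a \<omega>) \<partial>?L) * indicator E \<omega> * occ s t z \<omega>"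
      by (simp add: occ_def[symmetric])
    also have "\<dots> = complex_of_real ((norm (occ s t z \<omega>))\<^sup>2) * indicator E \<omega>"
      unfolding c[symmetric] by (simp add: complex_norm_square[symmetric] mult_ac flip: of_real_power)
    finally show ?thesis by simp
  qed
  have "complex_of_real (\<integral>\<omega>. (norm (occ s t z \<omega>))\<^sup>2 * indicator E \<omega> \<partial>M) = (\<integral>\<omega>. complex_of_real ((norm (occ s t z \<omega>))\<^sup>2 * indicator E \<omega>) \<partial>M)"
    by (rule integral_complex_of_real[symmetric])
  also have "\<dots> = (\<integral>\<omega>. \<integral>a. \<integral>a'. k a' a \<omega> \<partial>?L \<partial>?L \<partial>M)"
    by (intro Bochner_Integration.integral_cong refl) (simp add: occ2[symmetric] indicator_def)
  also have "\<dots> = (\<integral>a. \<integral>\<omega>. \<integral>a'. k a' a \<omega> \<partial>?L \<partial>M \<partial>?L)"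
  proof (rule LM.Fubini_integral)
    show "integrable (?L \<Otimes>\<^sub>M M) (\<lambda>(a, \<omega>). \<integral>a'. k a' a \<omega> \<partial>?L)"
    proof (rule LMf.integrable_const_bound[where B="measure ?L UNIV"])
      show "(\<lambda>(a, \<omega>). \<integral>a'. k a' a \<omega> \<partial>?L) \<in> borel_measurable (?L \<Otimes>\<^sub>M M)"
        unfolding split_beta' by (rule L.borel_measurable_lebesgue_integral) (unfold split_beta', rule km; measurable)
      have "norm (\<integral>a'. k a' a \<omega> \<partial>?L) \<le> measure ?L UNIV" if "\<omega> \<in> space M" for a \<omega>
      proof -
        have "norm (\<integral>a'. k a' a \<omega> \<partial>?L) \<le> (\<integral>a'. norm (k a' a \<omega>) \<partial>?L)" by (rule integral_norm_bound)
        also have "\<dots> \<le> (\<integral>a'. 1 \<partial>?L)"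
          by (rule integral_mono) (use that in \<open>auto intro!: integrable_norm L.integrable_const_bound[where B=1] km simp: kn\<close>)
        finally show ?thesis by simp
      qed
      then show "AE x in ?L \<Otimes>\<^sub>M M. norm (case x of (a, \<omega>) \<Rightarrow> \<integral>a'. k a' a \<omega> \<partial>?L) \<le> measure ?L UNIV"
        by (intro AE_I2) (auto simp: space_pair_measure)
    qed
  qed
  also have "\<dots> = (\<integral>a. \<integral>a'. \<integral>\<omega>. k a' a \<omega> \<partial>M \<partial>?L \<partial>?L)"
  proof (intro Bochner_Integration.integral_cong refl LM.Fubini_integral)
    fix a
    show "integrable (?L \<Otimes>\<^sub>M M) (\<lambda>(a', \<omega>). k a' a \<omega>)"
      by (rule LMf.integrable_const_bound[where B=1]) (auto simp: kn split_beta' intro!: km)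
  qed
  finally have eq: "complex_of_real (\<integral>\<omega>. (norm (occ s t z \<omega>))\<^sup>2 * indicator E \<omega> \<partial>M) = (\<integral>a. \<integral>a'. \<integral>\<omega>. k a' a \<omega> \<partial>M \<partial>?L \<partial>?L)" .
  have AEL: "AE a in ?L. a \<in> {s..t}"
    unfolding interval_measure_on_def by (subst AE_density) (auto simp: indicator_def)
  have ie: "integrable ?L (\<lambda>a'. e a a')" for a
    by (rule L.integrable_const_bound[where B=1]) (auto simp: e01)
  have ie2: "integrable ?L (\<lambda>a. \<integral>a'. e a a' \<partial>?L)"
  proof (rule L.integrable_const_bound[where B="measure ?L UNIV"])
    have "norm (\<integral>a'. e a a' \<partial>?L) \<le> (\<integral>a'. 1 \<partial>?L)" for a
      by (rule order_trans[OF integral_norm_bound], rule integral_mono) (auto intro: ie simp: e01)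
    then show "AE a in ?L. norm (\<integral>a'. e a a' \<partial>?L) \<le> measure ?L UNIV" by simp
    show "(\<lambda>a. \<integral>a'. e a a' \<partial>?L) \<in> borel_measurable ?L"
      by (rule L.borel_measurable_lebesgue_integral) (unfold split_beta', measurable)
  qed
  have mk1: "(\<lambda>a'. \<integral>\<omega>. k a' a \<omega> \<partial>M) \<in> borel_measurable ?L" for a
    by (rule borel_measurable_lebesgue_integral) (unfold split_beta', rule km; measurable)
  have ik1: "integrable ?L (\<lambda>a'. \<integral>\<omega>. k a' a \<omega> \<partial>M)" for a
  proof (rule L.integrable_const_bound[where B=1])
    have "norm (\<integral>\<omega>. k a' a \<omega> \<partial>M) \<le> (\<integral>\<omega>. 1 \<partial>M)" for a'
      by (rule order_trans[OF integral_norm_bound], rule integral_mono)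
         (auto intro!: integrable_norm integrable_const_bound[where B=1] km simp: kn)
    then show "AE a' in ?L. norm (\<integral>\<omega>. k a' a \<omega> \<partial>M) \<le> 1" by (simp add: prob_space)
  qed (rule mk1)
  have b1: "norm (\<integral>a'. \<integral>\<omega>. k a' a \<omega> \<partial>M \<partial>?L) \<le> (\<integral>a'. e a a' \<partial>?L) * prob E" if "a \<in> {s..t}" for a
  proof -
    have "norm (\<integral>a'. \<integral>\<omega>. k a' a \<omega> \<partial>M \<partial>?L) \<le> (\<integral>a'. norm (\<integral>\<omega>. k a' a \<omega> \<partial>M) \<partial>?L)" by (rule integral_norm_bound)
    also have "\<dots> \<le> (\<integral>a'. e a a' * prob E \<partial>?L)"
    proof (rule integral_mono_AE)
      show "AE a' in ?L. norm (\<integral>\<omega>. k a' a \<omega> \<partial>M) \<le> e a a' * prob E"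
        using AEL
      proof eventually_elim
        case (elim a')
        then show ?case using kb[of a' a] that by (simp add: e_def abs_minus_commute)
      qed
    qed (use ik1 ie in auto)
    finally show ?thesis by simp
  qed
  have "norm (\<integral>a. \<integral>a'. \<integral>\<omega>. k a' a \<omega> \<partial>M \<partial>?L \<partial>?L) \<le> (\<integral>a. (\<integral>a'. e a a' \<partial>?L) * prob E \<partial>?L)"
  proof (cases "integrable ?L (\<lambda>a. \<integral>a'. \<integral>\<omega>. k a' a \<omega> \<partial>M \<partial>?L)")
    case True
    have "norm (\<integral>a. \<integral>a'. \<integral>\<omega>. k a' a \<omega> \<partial>M \<partial>?L \<partial>?L) \<le> (\<integral>a. norm (\<integral>a'. \<integral>\<omega>. k a' a \<omega> \<partial>M \<partial>?L) \<partial>?L)" by (rule integral_norm_bound)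
    also have "\<dots> \<le> (\<integral>a. (\<integral>a'. e a a' \<partial>?L) * prob E \<partial>?L)"
    proof (rule integral_mono_AE)
      show "AE a in ?L. norm (\<integral>a'. \<integral>\<omega>. k a' a \<omega> \<partial>M \<partial>?L) \<le> (\<integral>a'. e a a' \<partial>?L) * prob E"
        using AEL by eventually_elim (rule b1)
    qed (use True ie2 in auto)
    finally show ?thesis .
  next
    \<comment> \<open>A non-integrable Bochner integral is 0 by convention.\<close>
    case False
    then show ?thesis by (simp add: not_integrable_integral_eq e01 integral_nonneg_AE)
  qed
  then have *: "(\<integral>\<omega>. (norm (occ s t z \<omega>))\<^sup>2 * indicator E \<omega> \<partial>M) \<le> (\<integral>a. \<integral>a'. e a a' \<partial>?L \<partial>?L) * prob E"
    unfolding eq[symmetric] by simp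
  have "(\<integral>\<^sup>+\<omega>. ennreal ((norm (occ s t z \<omega>))\<^sup>2) * indicator E \<omega> \<partial>M) = (\<integral>\<^sup>+\<omega>. ennreal ((norm (occ s t z \<omega>))\<^sup>2 * indicator E \<omega>) \<partial>M)"
    by (intro nn_integral_cong) (simp add: ennreal_mult' ennreal_indicator)
  also have "\<dots> = ennreal (\<integral>\<omega>. (norm (occ s t z \<omega>))\<^sup>2 * indicator E \<omega> \<partial>M)"
  proof (rule nn_integral_eq_integral)
    show "integrable M (\<lambda>\<omega>. (norm (occ s t z \<omega>))\<^sup>2 * indicator E \<omega>)"
    proof (rule integrable_const_bound[where B="(t - s)\<^sup>2"])
      show "AE \<omega> in M. norm ((norm (occ s t z \<omega>))\<^sup>2 * indicator E \<omega>) \<le> (t - s)\<^sup>2"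
        using occ_norm_le[OF _ u(3), of _ z] by (intro AE_I2) (auto simp: indicator_def intro!: power_mono)
    qed simp
  qed auto
  also have "\<dots> \<le> ennreal ((\<integral>a. \<integral>a'. e a a' \<partial>?L \<partial>?L) * prob E)" using * by (rule ennreal_leI)
  also have "\<dots> = ennreal (\<integral>a. \<integral>a'. e a a' \<partial>?L \<partial>?L) * emeasure M E"
    by (simp add: ennreal_mult' emeasure_eq_measure e01 integral_nonneg_AE ennreal_mult'')
  also have "ennreal (\<integral>a. \<integral>a'. e a a' \<partial>?L \<partial>?L) = (\<integral>\<^sup>+a. ennreal (\<integral>a'. e a a' \<partial>?L) \<partial>?L)"
    by (rule nn_integral_eq_integral[symmetric]) (use ie2 e01 in \<open>auto intro: integral_nonneg_AE\<close>)
  also have "\<dots> = (\<integral>\<^sup>+a. \<integral>\<^sup>+a'. ennreal (e a a') \<partial>?L \<partial>?L)"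
    by (intro nn_integral_cong nn_integral_eq_integral[symmetric] ie) (auto simp: e01)
  finally show ?thesis unfolding e_def .
qed

end

text \<open>Conditional estimates are used in the form of test functions of the past; this monotone
  class step derives them from estimates on past events.\<close>

lemma nn_integral_test_functions:
  assumes F: "subalgebra M F" and f[measurable]: "f \<in> borel_measurable M"
    and le: "\<And>E. E \<in> sets F \<Longrightarrow> (\<integral>\<^sup>+x. f x * indicator E x \<partial>M) \<le> c * emeasure M E"
    and g: "g \<in> borel_measurable F"
  shows "(\<integral>\<^sup>+x. g x * f x \<partial>M) \<le> c * (\<integral>\<^sup>+x. g x \<partial>M)"
  using g
proof (induction rule: borel_measurable_induct)
  case (cong f' g')
  have "space F = space M" using F by (simp add: subalgebra_def)
  then have "(\<integral>\<^sup>+x. f' x * f x \<partial>M) = (\<integral>\<^sup>+x. g' x * f x \<partial>M)" "(\<integral>\<^sup>+x. f' x \<partial>M) = (\<integral>\<^sup>+x. g' x \<partial>M)"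
    using cong by (auto intro!: nn_integral_cong)
  then show ?case using cong by simp
next
  case (set A)
  then have "A \<in> sets M" using F by (auto simp: subalgebra_def)
  then show ?case using le[OF set] by (simp add: mult.commute)
next
  case (mult u d)
  have [measurable]: "u \<in> borel_measurable M" using measurable_from_subalg[OF F] mult by auto
  have "(\<integral>\<^sup>+x. d * u x * f x \<partial>M) = d * (\<integral>\<^sup>+x. u x * f x \<partial>M)"
    by (simp add: mult.assoc nn_integral_cmult)
  also have "\<dots> \<le> d * (c * (\<integral>\<^sup>+x. u x \<partial>M))" using mult by (intro mult_left_mono) auto
  finally show ?case by (simp add: nn_integral_cmult mult_ac)
next
  case (add u v)
  have [measurable]: "u \<in> borel_measurable M" "v \<in> borel_measurable M" using measurable_from_subalg[OF F] add by auto
  have "(\<integral>\<^sup>+x. (v x + u x) * f x \<partial>M) = (\<integral>\<^sup>+x. v x * f x \<partial>M) + (\<integral>\<^sup>+x. u x * f x \<partial>M)"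
    by (simp add: distrib_right nn_integral_add)
  also have "\<dots> \<le> c * (\<integral>\<^sup>+x. v x \<partial>M) + c * (\<integral>\<^sup>+x. u x \<partial>M)" using add by (intro add_mono) auto
  finally show ?case by (simp add: nn_integral_add distrib_left)
next
  case (seq U)
  have [measurable]: "U i \<in> borel_measurable M" for i using measurable_from_subalg[OF F] seq by auto
  have inc: "incseq (\<lambda>i x. U i x * f x)" using seq(3) by (auto simp: incseq_def le_fun_def intro!: mult_right_mono)
  have "(\<integral>\<^sup>+x. (SUP i. U i) x * f x \<partial>M) = (\<integral>\<^sup>+x. (SUP i. U i x * f x) \<partial>M)"
    by (simp add: SUP_mult_right_ennreal image_comp)
  also have "\<dots> = (SUP i. \<integral>\<^sup>+x. U i x * f x \<partial>M)"
    by (rule nn_integral_monotone_convergence_SUP[OF inc]) measurable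
  also have "\<dots> \<le> c * (\<integral>\<^sup>+x. (SUP i. U i) x \<partial>M)"
  proof (rule SUP_least)
    fix i
    have "(\<integral>\<^sup>+x. U i x * f x \<partial>M) \<le> c * (\<integral>\<^sup>+x. U i x \<partial>M)" by (rule seq)
    also have "\<dots> \<le> c * (\<integral>\<^sup>+x. (SUP i. U i) x \<partial>M)"
      by (intro mult_left_mono nn_integral_mono) (auto simp: image_comp intro: SUP_upper)
    finally show "(\<integral>\<^sup>+x. U i x * f x \<partial>M) \<le> c * (\<integral>\<^sup>+x. (SUP i. U i) x \<partial>M)" .
  qed
  finally show ?case by (simp add: image_comp)
qed

text \<open>Minkowski's inequality from a pointwise Young inequality with weights B/A and A/B, which
  are optimal when A and B are the two norms.\<close>

lemma weighted_L2_triangle: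
  fixes f g :: "'b \<Rightarrow> complex"
  assumes wt: "\<And>z. 0 \<le> wt z"
    and f: "integrable M (\<lambda>z. wt z * (norm (f z))\<^sup>2)" and g: "integrable M (\<lambda>z. wt z * (norm (g z))\<^sup>2)"
    and fg: "integrable M (\<lambda>z. wt z * (norm (f z + g z))\<^sup>2)"
  shows "sqrt (\<integral>z. wt z * (norm (f z + g z))\<^sup>2 \<partial>M) \<le> sqrt (\<integral>z. wt z * (norm (f z))\<^sup>2 \<partial>M) + sqrt (\<integral>z. wt z * (norm (g z))\<^sup>2 \<partial>M)"
proof (rule field_le_epsilon)
  fix \<delta> :: real assume "0 < \<delta>"
  \<comment> \<open>The shift by \<delta>/2 avoids division by a vanishing norm.\<close>
  define A B where "A = sqrt (\<integral>z. wt z * (norm (f z))\<^sup>2 \<partial>M) + \<delta> / 2" and "B = sqrt (\<integral>z. wt z * (norm (g z))\<^sup>2 \<partial>M) + \<delta> / 2"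
  have nn: "0 \<le> (\<integral>z. wt z * (norm (f z))\<^sup>2 \<partial>M)" "0 \<le> (\<integral>z. wt z * (norm (g z))\<^sup>2 \<partial>M)"
    using wt by (auto intro!: integral_nonneg_AE)
  then have AB: "0 < A" "0 < B" using \<open>0 < \<delta>\<close> by (auto simp: A_def B_def intro: add_nonneg_pos)
  have fA: "(\<integral>z. wt z * (norm (f z))\<^sup>2 \<partial>M) \<le> A\<^sup>2" "(\<integral>z. wt z * (norm (g z))\<^sup>2 \<partial>M) \<le> B\<^sup>2"
    using AB \<open>0 < \<delta>\<close> by (auto intro!: sqrt_le_D simp: A_def B_def)
  have pt: "wt z * (norm (f z + g z))\<^sup>2 \<le> (1 + B / A) * (wt z * (norm (f z))\<^sup>2) + (1 + A / B) * (wt z * (norm (g z))\<^sup>2)" for z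
  proof -
    have y: "2 * x * y \<le> B / A * x\<^sup>2 + A / B * y\<^sup>2" for x y :: real
    proof -
      have "0 \<le> (B * x - A * y)\<^sup>2 / (A * B)" using AB by simp
      also have "\<dots> = B / A * x\<^sup>2 + A / B * y\<^sup>2 - 2 * x * y" using AB by (simp add: field_simps power2_eq_square)
      finally show ?thesis by simp
    qed
    have "(norm (f z + g z))\<^sup>2 \<le> (norm (f z) + norm (g z))\<^sup>2" by (intro power_mono norm_triangle_ineq) auto
    also have "\<dots> \<le> (1 + B / A) * (norm (f z))\<^sup>2 + (1 + A / B) * (norm (g z))\<^sup>2"
      using y[of "norm (f z)" "norm (g z)"] unfolding power2_sum by (simp add: distrib_right)
    finally show ?thesis using mult_left_mono[OF _ wt[of z]] by (fastforce simp: algebra_simps)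
  qed
  have "(\<integral>z. wt z * (norm (f z + g z))\<^sup>2 \<partial>M) \<le> (\<integral>z. (1 + B / A) * (wt z * (norm (f z))\<^sup>2) + (1 + A / B) * (wt z * (norm (g z))\<^sup>2) \<partial>M)"
    by (rule integral_mono[OF fg _ pt]) (use f g in auto)
  also have "\<dots> = (1 + B / A) * (\<integral>z. wt z * (norm (f z))\<^sup>2 \<partial>M) + (1 + A / B) * (\<integral>z. wt z * (norm (g z))\<^sup>2 \<partial>M)"
    using f g by simp
  also have "\<dots> \<le> (1 + B / A) * A\<^sup>2 + (1 + A / B) * B\<^sup>2"
    using fA AB by (intro add_mono mult_left_mono) auto
  also have "\<dots> = (A + B)\<^sup>2" using AB by (simp add: field_simps power2_eq_square)
  finally have "sqrt (\<integral>z. wt z * (norm (f z + g z))\<^sup>2 \<partial>M) \<le> A + B" using AB by (intro real_le_lsqrt) auto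
  then show "sqrt (\<integral>z. wt z * (norm (f z + g z))\<^sup>2 \<partial>M) \<le> sqrt (\<integral>z. wt z * (norm (f z))\<^sup>2 \<partial>M) + sqrt (\<integral>z. wt z * (norm (g z))\<^sup>2 \<partial>M) + \<delta>"
    by (simp add: A_def B_def)
qed

text \<open>The added 1 makes positivity immediate.\<close>

definition bracket_const :: "'b::euclidean_space itself \<Rightarrow> real \<Rightarrow> real" where
  "bracket_const _ \<beta> = enn2real (\<integral>\<^sup>+z. ennreal ((1 + (norm (z::'b))\<^sup>2) powr (-\<beta>)) \<partial>lborel) + 1"

text \<open>The factors stem from the polynomial bound for the exponential, from completing
  \<open>|z|^2\<close> to \<open>1 + |z|^2\<close>, from the integral over z, and from the time
  integral of \<open>r powr (- 2 * \<alpha> * H)\<close> without its power of the length. The power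
  of \<kappa> is kept out, since \<kappa> carries the singularity of the slices.\<close>

definition second_moment_const :: "'b::euclidean_space itself \<Rightarrow> real \<Rightarrow> real \<Rightarrow> real \<Rightarrow> real \<Rightarrow> real" where
  "second_moment_const b lam \<alpha> v H = \<alpha> powr \<alpha> * exp v * bracket_const b (\<alpha> - lam) * (2 / (1 - 2 * \<alpha> * H))"

text \<open>Integrability of \<open>wt\<close> makes every energy finite, while the moment bounds
  depend on the weight only through \<open>wt_le\<close>. The bound v is a parameter of its own so
  that constants can be uniform over slices.\<close>

locale lnd_weight = lnd_process M X T H \<kappa> F
  for M :: "'a measure" and X :: "real \<Rightarrow> 'a \<Rightarrow> 'b::euclidean_space" and T H \<kappa> and F +
  fixes wt :: "'b \<Rightarrow> real" and lam \<alpha> v :: real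
  assumes wt_meas[measurable]: "wt \<in> borel_measurable borel" and wt_nonneg: "\<And>z. 0 \<le> wt z"
    and wt_int: "integrable lborel wt" and wt_le: "\<And>z. wt z \<le> (1 + (norm z)\<^sup>2) powr lam"
    and \<alpha>: "0 < \<alpha>" "2 * \<alpha> * H < 1" "real DIM('b) / 2 < \<alpha> - lam"
    and v: "\<kappa> * T powr (2 * H) \<le> v"
begin

definition N2 :: "real \<Rightarrow> real \<Rightarrow> 'a \<Rightarrow> real" where
  "N2 s t \<omega> = (\<integral>z. wt z * (norm (occ s t z \<omega>))\<^sup>2 \<partial>lborel)"

definition Nrm :: "real \<Rightarrow> real \<Rightarrow> 'a \<Rightarrow> real" where
  "Nrm s t \<omega> = sqrt (N2 s t \<omega>)"

definition B :: real where
  "B = second_moment_const TYPE('b) lam \<alpha> v H * \<kappa> powr (-\<alpha>)"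

lemma B_pos: "0 < B"
  using \<alpha> \<kappa> unfolding B_def second_moment_const_def bracket_const_def
  by (intro mult_pos_pos add_nonneg_pos divide_pos_pos) auto

lemma N2_integrable:
  assumes \<omega>: "\<omega> \<in> space M" and "s \<le> t"
  shows "integrable lborel (\<lambda>z. wt z * (norm (occ s t z \<omega>))\<^sup>2)"
proof (rule Bochner_Integration.integrable_bound[where f="\<lambda>z. (t - s)\<^sup>2 * wt z"])
  show "AE z in lborel. norm (wt z * (norm (occ s t z \<omega>))\<^sup>2) \<le> norm ((t - s)\<^sup>2 * wt z)"
    using occ_norm_le[OF assms] wt_nonneg
    by (intro AE_I2) (simp add: abs_mult mult.commute mult_left_mono power_mono)
qed (use wt_int occ_meas_z[OF \<omega>] in auto)

lemma N2_nonneg: "0 \<le> N2 s t \<omega>"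
  unfolding N2_def using wt_nonneg by (intro integral_nonneg_AE) auto

lemma N2_le:
  assumes "\<omega> \<in> space M" "s \<le> t"
  shows "N2 s t \<omega> \<le> (\<integral>z. wt z \<partial>lborel) * (t - s)\<^sup>2"
proof -
  have "N2 s t \<omega> \<le> (\<integral>z. wt z * (t - s)\<^sup>2 \<partial>lborel)"
    unfolding N2_def using occ_norm_le[OF assms] wt_nonneg wt_int
    by (intro integral_mono N2_integrable assms) (auto intro!: mult_left_mono power_mono)
  then show ?thesis by simp
qed

lemma Nrm_nonneg: "0 \<le> Nrm s t \<omega>"
  using N2_nonneg by (simp add: Nrm_def)

lemma Nrm_square: "(Nrm s t \<omega>)\<^sup>2 = N2 s t \<omega>"
  using N2_nonneg by (simp add: Nrm_def)

lemma Nrm_self: "\<omega> \<in> space M \<Longrightarrow> Nrm s s \<omega> = 0"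
  by (simp add: Nrm_def N2_def occ_self)

lemma Nrm_le:
  assumes "\<omega> \<in> space M" "s \<le> t"
  shows "Nrm s t \<omega> \<le> sqrt (\<integral>z. wt z \<partial>lborel) * (t - s)"
  using real_sqrt_le_mono[OF N2_le[OF assms]] assms by (simp add: Nrm_def real_sqrt_mult)

lemma Nrm_triangle:
  assumes "\<omega> \<in> space M" "s \<le> t" "t \<le> u"
  shows "Nrm s u \<omega> \<le> Nrm s t \<omega> + Nrm t u \<omega>"
proof -
  have eq: "occ s u z \<omega> = occ s t z \<omega> + occ t u z \<omega>" for z by (rule occ_add[OF assms])
  show ?thesis unfolding Nrm_def N2_def eq
  proof (rule weighted_L2_triangle[where f="\<lambda>z. occ s t z \<omega>" and g="\<lambda>z. occ t u z \<omega>"])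
    have "s \<le> u" using assms by simp
    from N2_integrable[OF assms(1) this]
    show "integrable lborel (\<lambda>z. wt z * (norm (occ s t z \<omega> + occ t u z \<omega>))\<^sup>2)"
      unfolding eq .
  qed (rule wt_nonneg N2_integrable assms)+
qed

lemma N2_measurable_past:
  assumes "0 \<le> u" "u \<le> T" "t \<le> u"
  shows "N2 s t \<in> borel_measurable (past_algebra u)"
  unfolding N2_def[abs_def]
proof (rule lborel.borel_measurable_lebesgue_integral)
  have [measurable]: "(\<lambda>q. occ s t (snd q) (fst q)) \<in> borel_measurable (past_algebra u \<Otimes>\<^sub>M lborel)"
    by (rule measurable_compose[where f="\<lambda>q. (snd q, fst q)", OF _ occ_joint_past[OF assms], simplified]) measurable
  show "(\<lambda>(x, y). wt y * (norm (occ s t y x))\<^sup>2) \<in> borel_measurable (past_algebra u \<Otimes>\<^sub>M lborel)"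
    unfolding split_beta' by measurable
qed

lemma N2_measurable [measurable]: "N2 s t \<in> borel_measurable M"
  unfolding N2_def[abs_def]
proof (rule lborel.borel_measurable_lebesgue_integral)
  have [measurable]: "(\<lambda>q. occ s t (snd q) (fst q)) \<in> borel_measurable (M \<Otimes>\<^sub>M lborel)"
    by (rule measurable_compose[where f="\<lambda>q. (snd q, fst q)", OF _ occ_joint, simplified]) measurable
  show "(\<lambda>(x, y). wt y * (norm (occ s t y x))\<^sup>2) \<in> borel_measurable (M \<Otimes>\<^sub>M lborel)"
    unfolding split_beta' by measurable
qed

lemma Nrm_measurable_past:
  assumes "0 \<le> u" "u \<le> T" "t \<le> u"
  shows "Nrm s t \<in> borel_measurable (past_algebra u)"
  unfolding Nrm_def[abs_def] using N2_measurable_past[OF assms] by measurable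

text \<open>\<open>exp (- x * |z|^2)\<close> equals \<open>exp x * exp (- x * (1 + |z|^2))\<close>;
  \<open>powr_le_exp\<close> trades the second factor for a negative power of order \<alpha>, which
  beats \<open>lam\<close> by more than d/2.\<close>

lemma nn_integral_weight_exp:
  assumes x: "0 < x" "x \<le> v"
  shows "(\<integral>\<^sup>+z. ennreal (wt z * exp (- x * (norm z)\<^sup>2)) \<partial>lborel) \<le> ennreal (\<alpha> powr \<alpha> * exp v * bracket_const TYPE('b) (\<alpha> - lam) * x powr (-\<alpha>))"
proof -
  have pt: "wt z * exp (- x * (norm z)\<^sup>2) \<le> \<alpha> powr \<alpha> * exp v * x powr (-\<alpha>) * (1 + (norm z)\<^sup>2) powr (- (\<alpha> - lam))" for z :: 'b
  proof -
    define y where "y = 1 + (norm z)\<^sup>2"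
    have y: "1 \<le> y" by (simp add: y_def)
    have "exp (- x * (norm z)\<^sup>2) = exp x * exp (- (x * y))" by (simp add: y_def algebra_simps flip: exp_add)
    moreover have "exp (- (x * y)) \<le> \<alpha> powr \<alpha> * (x * y) powr (-\<alpha>)"
    proof -
      have "(x * y) powr \<alpha> \<le> \<alpha> powr \<alpha> * exp (x * y)" using x y \<alpha> by (intro powr_le_exp) auto
      then show ?thesis using x y by (simp add: exp_minus powr_minus field_simps)
    qed
    moreover have "exp x \<le> exp v" using x by simp
    ultimately have "exp (- x * (norm z)\<^sup>2) \<le> exp v * (\<alpha> powr \<alpha> * (x * y) powr (-\<alpha>))"
      by (simp only:) (intro mult_mono, auto)
    then have "wt z * exp (- x * (norm z)\<^sup>2) \<le> y powr lam * (exp v * (\<alpha> powr \<alpha> * (x * y) powr (-\<alpha>)))"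
      using wt_le[of z] wt_nonneg[of z] by (intro mult_mono) (auto simp: y_def)
    also have "\<dots> = \<alpha> powr \<alpha> * exp v * x powr (-\<alpha>) * (y powr lam * y powr (-\<alpha>))"
      using x y by (simp add: powr_mult mult_ac)
    also have "y powr lam * y powr (-\<alpha>) = y powr (- (\<alpha> - lam))" by (simp add: powr_add[symmetric])
    finally show ?thesis by (simp add: y_def)
  qed
  have "(\<integral>\<^sup>+z. ennreal (wt z * exp (- x * (norm z)\<^sup>2)) \<partial>lborel)
     \<le> (\<integral>\<^sup>+z. ennreal (\<alpha> powr \<alpha> * exp v * x powr (-\<alpha>)) * ennreal ((1 + (norm z)\<^sup>2) powr (- (\<alpha> - lam))) \<partial>(lborel :: 'b measure))"
    by (intro nn_integral_mono) (use pt in \<open>auto simp flip: ennreal_mult intro!: ennreal_leI\<close>)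
  also have "\<dots> = ennreal (\<alpha> powr \<alpha> * exp v * x powr (-\<alpha>)) * (\<integral>\<^sup>+z. ennreal ((1 + (norm (z::'b))\<^sup>2) powr (- (\<alpha> - lam))) \<partial>lborel)"
    by (rule nn_integral_cmult) measurable
  also have "(\<integral>\<^sup>+z. ennreal ((1 + (norm (z::'b))\<^sup>2) powr (- (\<alpha> - lam))) \<partial>lborel) \<le> ennreal (bracket_const TYPE('b) (\<alpha> - lam))"
  proof -
    have "(\<integral>\<^sup>+z. ennreal ((1 + (norm (z::'b))\<^sup>2) powr (- (\<alpha> - lam))) \<partial>lborel) = ennreal (enn2real (\<integral>\<^sup>+z. ennreal ((1 + (norm (z::'b))\<^sup>2) powr (- (\<alpha> - lam))) \<partial>lborel))"
      using nn_integral_japanese_bracket[where 'b='b, OF \<alpha>(3)] by simp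
    also have "\<dots> \<le> ennreal (bracket_const TYPE('b) (\<alpha> - lam))" unfolding bracket_const_def by (intro ennreal_leI) simp
    finally show ?thesis .
  qed
  finally have "(\<integral>\<^sup>+z. ennreal (wt z * exp (- x * (norm z)\<^sup>2)) \<partial>lborel)
     \<le> ennreal (\<alpha> powr \<alpha> * exp v * x powr (-\<alpha>)) * ennreal (bracket_const TYPE('b) (\<alpha> - lam))"
    by (simp only: mult_left_mono zero_le)
  also have "\<dots> = ennreal (\<alpha> powr \<alpha> * exp v * bracket_const TYPE('b) (\<alpha> - lam) * x powr (-\<alpha>))"
    by (subst ennreal_mult[symmetric]) (auto simp: bracket_const_def mult_ac)
  finally show ?thesis .
qed

text \<open>Fubini and \<open>nn_integral_weight_exp\<close> leave the double time integral of
  \<open>|a' - a| powr (- 2 * \<alpha> * H)\<close>. It converges because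
  \<open>2 * \<alpha> * H < 1\<close>, and is of the order of the length to the power
  \<open>2 - 2 * \<alpha> * H\<close>.\<close>

lemma N2_second_moment:
  assumes u: "0 \<le> u" "u \<le> s" "s \<le> t" "t \<le> T" and E: "E \<in> F u"
  shows "(\<integral>\<^sup>+\<omega>. ennreal (N2 s t \<omega>) * indicator E \<omega> \<partial>M) \<le> ennreal (B * (t - s) powr (2 - 2 * \<alpha> * H)) * emeasure M E"
proof -
  let ?L = "interval_measure_on s t"
  interpret L: finite_measure ?L by (rule finite_interval_measure_on)
  interpret MB: pair_sigma_finite M "lborel :: 'b measure" ..
  interpret LB: pair_sigma_finite ?L "lborel :: 'b measure" ..
  have Eev[measurable]: "E \<in> sets M" using F_events[of u] u E by auto
  define C where "C = \<alpha> powr \<alpha> * exp v * bracket_const TYPE('b) (\<alpha> - lam)"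
  have C: "0 \<le> C" by (simp add: C_def bracket_const_def)
  define e where "e z a a' = exp (- \<kappa> * (norm z)\<^sup>2 * \<bar>a' - a\<bar> powr (2*H))" for z :: 'b and a a'
  have em[measurable]: "(\<lambda>p. e (h p) (f p) (g p)) \<in> borel_measurable N"
    if [measurable]: "f \<in> borel_measurable N" "g \<in> borel_measurable N" "h \<in> borel_measurable N" for f g h and N :: "'z measure"
    unfolding e_def by measurable
  have [measurable]: "(\<lambda>q. occ s t (snd q) (fst q)) \<in> borel_measurable (M \<Otimes>\<^sub>M lborel)"
    by (rule measurable_compose[where f="\<lambda>q. (snd q, fst q)", OF _ occ_joint, simplified]) measurable
  have "(\<integral>\<^sup>+\<omega>. ennreal (N2 s t \<omega>) * indicator E \<omega> \<partial>M) = (\<integral>\<^sup>+\<omega>. \<integral>\<^sup>+z. ennreal (wt z * (norm (occ s t z \<omega>))\<^sup>2) * indicator E \<omega> \<partial>lborel \<partial>M)"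
  proof (rule nn_integral_cong)
    fix \<omega> assume \<omega>: "\<omega> \<in> space M"
    have "ennreal (N2 s t \<omega>) = (\<integral>\<^sup>+z. ennreal (wt z * (norm (occ s t z \<omega>))\<^sup>2) \<partial>lborel)"
      unfolding N2_def using N2_integrable[OF \<omega> u(3)] wt_nonneg by (intro nn_integral_eq_integral[symmetric]) auto
    then show "ennreal (N2 s t \<omega>) * indicator E \<omega> = (\<integral>\<^sup>+z. ennreal (wt z * (norm (occ s t z \<omega>))\<^sup>2) * indicator E \<omega> \<partial>lborel)"
      using occ_meas_z[OF \<omega>] by (subst nn_integral_multc) auto
  qed
  also have "\<dots> = (\<integral>\<^sup>+z. \<integral>\<^sup>+\<omega>. ennreal (wt z * (norm (occ s t z \<omega>))\<^sup>2) * indicator E \<omega> \<partial>M \<partial>lborel)"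
    by (rule MB.Fubini'[symmetric]) (unfold split_beta', measurable)
  also have "\<dots> \<le> (\<integral>\<^sup>+z. ennreal (wt z) * ((\<integral>\<^sup>+a. \<integral>\<^sup>+a'. ennreal (e z a a') \<partial>?L \<partial>?L) * emeasure M E) \<partial>lborel)"
  proof (rule nn_integral_mono)
    fix z :: 'b
    have "(\<integral>\<^sup>+\<omega>. ennreal (wt z * (norm (occ s t z \<omega>))\<^sup>2) * indicator E \<omega> \<partial>M) = ennreal (wt z) * (\<integral>\<^sup>+\<omega>. ennreal ((norm (occ s t z \<omega>))\<^sup>2) * indicator E \<omega> \<partial>M)"
      using wt_nonneg by (subst nn_integral_cmult[symmetric]) (auto simp: ennreal_mult mult.assoc)
    also have "\<dots> \<le> ennreal (wt z) * ((\<integral>\<^sup>+a. \<integral>\<^sup>+a'. ennreal (e z a a') \<partial>?L \<partial>?L) * emeasure M E)"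
      unfolding e_def by (intro mult_left_mono occ_second_moment[OF u E]) auto
    finally show "(\<integral>\<^sup>+\<omega>. ennreal (wt z * (norm (occ s t z \<omega>))\<^sup>2) * indicator E \<omega> \<partial>M) \<le> ennreal (wt z) * ((\<integral>\<^sup>+a. \<integral>\<^sup>+a'. ennreal (e z a a') \<partial>?L \<partial>?L) * emeasure M E)" .
  qed
  also have "\<dots> = (\<integral>\<^sup>+z. \<integral>\<^sup>+a. \<integral>\<^sup>+a'. ennreal (wt z * e z a a') \<partial>?L \<partial>?L \<partial>lborel) * emeasure M E"
  proof -
    have "ennreal (wt z) * ((\<integral>\<^sup>+a. \<integral>\<^sup>+a'. ennreal (e z a a') \<partial>?L \<partial>?L) * emeasure M E)
       = (\<integral>\<^sup>+a. \<integral>\<^sup>+a'. ennreal (wt z * e z a a') \<partial>?L \<partial>?L) * emeasure M E" for z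
    proof -
      have "(\<integral>\<^sup>+a. \<integral>\<^sup>+a'. ennreal (wt z * e z a a') \<partial>?L \<partial>?L) = ennreal (wt z) * (\<integral>\<^sup>+a. \<integral>\<^sup>+a'. ennreal (e z a a') \<partial>?L \<partial>?L)"
        using wt_nonneg[of z] by (simp add: ennreal_mult e_def nn_integral_cmult del: ennreal_mult_eq_top_iff)
      then show ?thesis by (simp add: mult_ac)
    qed
    then show ?thesis by (simp add: nn_integral_multc)
  qed
  also have "(\<integral>\<^sup>+z. \<integral>\<^sup>+a. \<integral>\<^sup>+a'. ennreal (wt z * e z a a') \<partial>?L \<partial>?L \<partial>lborel) = (\<integral>\<^sup>+a. \<integral>\<^sup>+z. \<integral>\<^sup>+a'. ennreal (wt z * e z a a') \<partial>?L \<partial>lborel \<partial>?L)"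
    by (rule LB.Fubini') (unfold split_beta', measurable)
  also have "\<dots> = (\<integral>\<^sup>+a. \<integral>\<^sup>+a'. \<integral>\<^sup>+z. ennreal (wt z * e z a a') \<partial>lborel \<partial>?L \<partial>?L)"
    by (intro nn_integral_cong LB.Fubini') (unfold split_beta', measurable)
  also have "\<dots> \<le> (\<integral>\<^sup>+a. ennreal (C * \<kappa> powr (-\<alpha>) * (2 * (t - s) powr (1 - 2*\<alpha>*H) / (1 - 2*\<alpha>*H))) \<partial>?L)"
  proof (rule nn_integral_mono_AE)
    have AEL: "AE a in ?L. a \<in> {s..t}"
      unfolding interval_measure_on_def by (subst AE_density) (auto simp: indicator_def)
    show "AE a in ?L. (\<integral>\<^sup>+a'. \<integral>\<^sup>+z. ennreal (wt z * e z a a') \<partial>lborel \<partial>?L) \<le> ennreal (C * \<kappa> powr (-\<alpha>) * (2 * (t - s) powr (1 - 2*\<alpha>*H) / (1 - 2*\<alpha>*H)))"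
      using AEL
    proof eventually_elim
      case (elim a)
      have "(\<integral>\<^sup>+a'. \<integral>\<^sup>+z. ennreal (wt z * e z a a') \<partial>lborel \<partial>?L) \<le> (\<integral>\<^sup>+a'. ennreal (C * \<kappa> powr (-\<alpha>)) * ennreal (\<bar>a' - a\<bar> powr (- (2*\<alpha>*H))) \<partial>?L)"
      proof (rule nn_integral_mono_AE)
        have "AE a' in lborel. a' \<noteq> a" by (rule AE_lborel_singleton)
        then have "AE a' in ?L. a' \<noteq> a" unfolding interval_measure_on_def by (subst AE_density) auto
        then show "AE a' in ?L. (\<integral>\<^sup>+z. ennreal (wt z * e z a a') \<partial>lborel) \<le> ennreal (C * \<kappa> powr (-\<alpha>)) * ennreal (\<bar>a' - a\<bar> powr (- (2*\<alpha>*H)))"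
          using AEL
        proof eventually_elim
          case (elim a')
          define x where "x = \<kappa> * \<bar>a' - a\<bar> powr (2*H)"
          have "\<bar>a' - a\<bar> powr (2*H) \<le> T powr (2*H)"
            using elim \<open>a \<in> {s..t}\<close> u H by (intro powr_mono2) auto
          then have "x \<le> \<kappa> * T powr (2*H)" unfolding x_def using \<kappa> by (intro mult_left_mono) auto
          then have x: "0 < x" "x \<le> v" using order_trans[OF _ v] elim \<kappa> by (auto simp: x_def)
          have "(\<integral>\<^sup>+z. ennreal (wt z * e z a a') \<partial>lborel) = (\<integral>\<^sup>+z. ennreal (wt z * exp (- x * (norm z)\<^sup>2)) \<partial>lborel)"
            by (simp add: e_def x_def mult_ac)
          also have "\<dots> \<le> ennreal (C * x powr (-\<alpha>))"
            unfolding C_def by (rule nn_integral_weight_exp[OF x])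
          also have "x powr (-\<alpha>) = \<kappa> powr (-\<alpha>) * \<bar>a' - a\<bar> powr (- (2*\<alpha>*H))"
            using \<kappa> elim by (simp add: x_def powr_mult powr_powr mult_ac)
          finally show ?case using C by (simp add: ennreal_mult[symmetric] mult_ac)
        qed
      qed
      also have "\<dots> = ennreal (C * \<kappa> powr (-\<alpha>)) * (\<integral>\<^sup>+a'. ennreal (\<bar>a' - a\<bar> powr (- (2*\<alpha>*H))) \<partial>?L)"
        by (rule nn_integral_cmult) measurable
      also have "\<dots> \<le> ennreal (C * \<kappa> powr (-\<alpha>)) * ennreal (2 * (t - s) powr (1 - 2*\<alpha>*H) / (1 - 2*\<alpha>*H))"
        by (subst nn_integral_interval_measure_on, measurable) (intro mult_left_mono nn_integral_powr_dist, use \<alpha> elim in auto)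
      finally show ?case using C \<alpha> by (simp add: ennreal_mult[symmetric])
    qed
  qed
  also have "\<dots> = ennreal (B * (t - s) powr (2 - 2 * \<alpha> * H))"
  proof -
    have "(t - s) powr (2 - 2*\<alpha>*H) = (t - s) * (t - s) powr (1 - 2*\<alpha>*H)"
      using u by (cases "s = t") (auto simp: powr_mult_base)
    then show ?thesis using u C \<alpha> emeasure_interval_measure_on[OF u(3)]
      unfolding B_def second_moment_const_def C_def[symmetric]
      by (simp add: ennreal_mult[symmetric] mult_ac)
  qed
  finally show ?thesis by (simp add: mult_right_mono)
qed

lemma N2_second_moment_test:
  assumes u: "0 \<le> u" "u \<le> s" "s \<le> t" "t \<le> T" and g: "g \<in> borel_measurable (past_algebra u)"
  shows "(\<integral>\<^sup>+\<omega>. g \<omega> * ennreal (N2 s t \<omega>) \<partial>M) \<le> ennreal (B * (t - s) powr (2 - 2 * \<alpha> * H)) * (\<integral>\<^sup>+\<omega>. g \<omega> \<partial>M)"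
  by (rule nn_integral_test_functions[OF subalgebra_past(1)[of u] _ _ g])
     (use u in \<open>auto simp: sets_past intro!: N2_second_moment\<close>)

end

section \<open>Moments of all orders for the norm of the occupation transform\<close>

context lnd_weight
begin

lemma Nrm_measurable [measurable]: "Nrm s t \<in> borel_measurable M"
  unfolding Nrm_def[abs_def] by measurable

text \<open>Second moments suffice for chaining because \<open>2 - 2\<alpha>H > 1\<close>: the supremum of \<open>Nrm\<close> over all
  later grid points has a conditional first moment of the order of a single increment.\<close>

lemma Nrm_moment:
  assumes st: "0 \<le> s" "s < t" "t \<le> T"
  shows "(\<integral>\<^sup>+\<omega>. ennreal (Nrm s t \<omega> ^ p) \<partial>M)
     \<le> ennreal (fact p * (sqrt B * (t - s) powr (1 - \<alpha> * H) * (1 + 2 / (1 - 2 powr (- (1/2 - \<alpha> * H))))) ^ p)"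
proof -
  define R where "R = sqrt B * (t - s) powr (1 - \<alpha> * H)"
  define r where "r = 2 powr (- (1/2 - \<alpha> * H))"
  have R: "0 < R" using B_pos st by (simp add: R_def)
  have r: "0 < r" "r < 1" using \<alpha> powr_less_mono[of "- (1/2 - \<alpha> * H)" 0 2] by (auto simp: r_def)
  define W where "W = sqrt (\<integral>z. wt z \<partial>lborel) * (t - s)"
  have W: "0 \<le> W" using wt_nonneg st by (simp add: W_def integral_nonneg_AE)
  \<comment> \<open>The mesh is so fine that the deterministic Lipschitz bound on one cell is at
    most R. This covers the step from i - 1 to i, which lies before the conditioning time.\<close>
  obtain n :: nat where n0: "W / R < 2 ^ n" using real_arch_pow[of 2 "W / R"] by auto
  then have n: "W / 2 ^ n \<le> R" using R by (simp add: field_simps)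
  define N :: nat where "N = 2 ^ n"
  have N: "1 \<le> N" by (simp add: N_def)
  define u where "u i = s + (t - s) * real i / 2 ^ n" for i :: nat
  have u_mono: "u i \<le> u j" if "i \<le> j" for i j
    using that st by (auto simp: u_def intro!: divide_right_mono mult_left_mono)
  have uN: "u N = t" "u 0 = s" by (auto simp: u_def N_def)
  have u_bd: "0 \<le> u i" "i \<le> N \<Longrightarrow> u i \<le> T" for i
    using u_mono[of 0 i] u_mono[of i N] uN st by auto
  \<comment> \<open>The running maximum, because the norm itself need not be monotone in the end
    point.\<close>
  define A where "A i \<omega> = Max ((\<lambda>j. Nrm (u 0) (u j) \<omega>) ` {..i})" for i \<omega>
  have A_meas: "A i \<in> borel_measurable (past_algebra (u i))" if "i \<le> N" for i
    unfolding A_def[abs_def]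
    by (rule borel_measurable_Max) (use that u_bd u_mono in \<open>auto intro!: Nrm_measurable_past\<close>)
  have A_ge: "Nrm (u 0) (u j) \<omega> \<le> A i \<omega>" if "j \<le> i" for i j \<omega>
    unfolding A_def using that by (intro Max_ge) auto
  have A_mono: "A i \<omega> \<le> A (Suc i) \<omega>" for i \<omega>
    unfolding A_def by (intro Max_mono) auto
  \<comment> \<open>Chosen so that the bounds for the \<open>2 ^ l\<close> second moments of level l
    add up to the square of \<open>\<epsilon> l\<close>; the sum over l converges because
    \<open>2 * \<alpha> * H < 1\<close> makes r smaller than 1.\<close>
  define \<epsilon> where "\<epsilon> l = R * r ^ l" for l
  have \<epsilon>: "0 < \<epsilon> l" for l using R r by (simp add: \<epsilon>_def)
  \<comment> \<open>Only cells that start at or after i, whose energies can be estimated given the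
    past of i.\<close>
  define Kl where "Kl i l = {k. k < 2 ^ l \<and> i \<le> k * 2 ^ (n - l)}" for i l :: nat
  have finKl: "finite (Kl i l)" "card (Kl i l) \<le> 2 ^ l" for i l
    using card_mono[of "{..<2 ^ l}" "Kl i l"] by (auto simp: Kl_def intro: finite_subset[of _ "{..<2 ^ l}"])
  \<comment> \<open>By the arithmetic-geometric inequality this dominates every norm of the level,
    and it is affine in the energies, so second moments suffice.\<close>
  define Q where "Q i l \<omega> = (\<epsilon> l + (\<Sum>k\<in>Kl i l. N2 (u (k * 2 ^ (n - l))) (u ((k + 1) * 2 ^ (n - l))) \<omega>) / \<epsilon> l) / 2" for i l \<omega>
  have Q_nonneg: "0 \<le> Q i l \<omega>" for i l \<omega>
    unfolding Q_def using \<epsilon>[of l] N2_nonneg by (auto intro!: divide_nonneg_pos add_nonneg_nonneg sum_nonneg)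
  have Q_bound: "Nrm (u (k * 2 ^ (n - l))) (u ((k + 1) * 2 ^ (n - l))) \<omega> \<le> Q i l \<omega>" if "k \<in> Kl i l" for k i l \<omega>
  proof -
    define x where "x = Nrm (u (k * 2 ^ (n - l))) (u ((k + 1) * 2 ^ (n - l))) \<omega>"
    have "x\<^sup>2 \<le> (\<Sum>k\<in>Kl i l. N2 (u (k * 2 ^ (n - l))) (u ((k + 1) * 2 ^ (n - l))) \<omega>)"
      unfolding x_def Nrm_square using that finKl N2_nonneg by (intro member_le_sum) auto
    moreover have "x \<le> (\<epsilon> l + x\<^sup>2 / \<epsilon> l) / 2"
    proof -
      have "0 \<le> (x - \<epsilon> l)\<^sup>2 / \<epsilon> l" using \<epsilon>[of l] by simp
      also have "\<dots> = x\<^sup>2 / \<epsilon> l - 2 * x + \<epsilon> l" using \<epsilon>[of l] by (simp add: field_simps power2_eq_square)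
      finally show ?thesis by simp
    qed
    ultimately show ?thesis unfolding Q_def x_def[symmetric] using \<epsilon>[of l]
      by (smt (verit) divide_right_mono)
  qed
  have len: "u ((k + 1) * 2 ^ (n - l)) - u (k * 2 ^ (n - l)) = (t - s) / 2 ^ l" if "l \<le> n" for k l
  proof -
    have "(2::real) ^ n = 2 ^ l * 2 ^ (n - l)" using that by (simp flip: power_add)
    then show ?thesis by (simp add: u_def field_simps)
  qed
  have idx: "(k + 1) * 2 ^ (n - l) \<le> N" if "k < 2 ^ l" "l \<le> n" for k l :: nat
  proof -
    have "(k + 1) * 2 ^ (n - l) \<le> 2 ^ l * 2 ^ (n - l)" using that by (intro mult_right_mono) auto
    also have "\<dots> = N" using that by (simp add: N_def flip: power_add)
    finally show ?thesis .
  qed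
  \<comment> \<open>Both halves of the arithmetic-geometric bound contribute
    \<open>\<epsilon> l / 2\<close> to the conditional mean.\<close>
  have EQ: "(\<integral>\<^sup>+\<omega>. g \<omega> * ennreal (Q i l \<omega>) \<partial>M) \<le> ennreal (\<epsilon> l) * (\<integral>\<^sup>+\<omega>. g \<omega> \<partial>M)"
    if "l \<le> n" "i \<le> N" and g: "g \<in> borel_measurable (past_algebra (u i))" for g i l
  proof -
    have [measurable]: "g \<in> borel_measurable M"
      using measurable_from_subalg[OF subalgebra_past(1) g] u_bd that by auto
    define h where "h k \<omega> = N2 (u (k * 2 ^ (n - l))) (u ((k + 1) * 2 ^ (n - l))) \<omega>" for k \<omega>
    have [measurable]: "h k \<in> borel_measurable M" for k unfolding h_def by measurable
    have hk: "(\<integral>\<^sup>+\<omega>. g \<omega> * ennreal (h k \<omega>) \<partial>M) \<le> ennreal (B * ((t - s) / 2 ^ l) powr (2 - 2 * \<alpha> * H)) * (\<integral>\<^sup>+\<omega>. g \<omega> \<partial>M)"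
      if "k \<in> Kl i l" for k
      unfolding len[OF \<open>l \<le> n\<close>, of k, symmetric] h_def
      using that u_bd idx[of k l] \<open>l \<le> n\<close> by (intro N2_second_moment_test[OF _ _ _ _ g] u_mono) (auto simp: Kl_def)
    have \<epsilon>2: "2 ^ l * (B * ((t - s) / 2 ^ l) powr (2 - 2 * \<alpha> * H)) = (\<epsilon> l)\<^sup>2"
    proof -
      have "(t - s) powr (2 - 2 * \<alpha> * H) = ((t - s) powr (1 - \<alpha> * H))\<^sup>2"
        by (simp add: power2_eq_square powr_add[symmetric] mult_ac)
      moreover have "((2::real) ^ l) powr (2 - 2 * \<alpha> * H) * (r ^ l)\<^sup>2 = 2 ^ l"
        by (simp add: r_def powr_realpow[symmetric] powr_powr power2_eq_square powr_add[symmetric] algebra_simps)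
      ultimately show ?thesis using B_pos st
        by (simp add: \<epsilon>_def R_def power_mult_distrib powr_divide field_simps)
    qed
    have "(\<integral>\<^sup>+\<omega>. g \<omega> * ennreal (Q i l \<omega>) \<partial>M) = (\<integral>\<^sup>+\<omega>. ennreal (\<epsilon> l / 2) * g \<omega> + ennreal (1 / (2 * \<epsilon> l)) * (\<Sum>k\<in>Kl i l. g \<omega> * ennreal (h k \<omega>)) \<partial>M)"
    proof (rule nn_integral_cong)
      fix \<omega>
      have "Q i l \<omega> = \<epsilon> l / 2 + 1 / (2 * \<epsilon> l) * (\<Sum>k\<in>Kl i l. h k \<omega>)"
        by (simp add: Q_def h_def add_divide_distrib)
      then have "ennreal (Q i l \<omega>) = ennreal (\<epsilon> l / 2) + ennreal (1 / (2 * \<epsilon> l)) * (\<Sum>k\<in>Kl i l. ennreal (h k \<omega>))"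
        using \<epsilon>[of l] N2_nonneg by (simp add: sum_ennreal ennreal_mult[symmetric] ennreal_plus[symmetric] sum_nonneg h_def del: ennreal_plus)
      then show "g \<omega> * ennreal (Q i l \<omega>) = ennreal (\<epsilon> l / 2) * g \<omega> + ennreal (1 / (2 * \<epsilon> l)) * (\<Sum>k\<in>Kl i l. g \<omega> * ennreal (h k \<omega>))"
        by (simp add: distrib_left sum_distrib_left mult_ac)
    qed
    also have "\<dots> = ennreal (\<epsilon> l / 2) * (\<integral>\<^sup>+\<omega>. g \<omega> \<partial>M) + ennreal (1 / (2 * \<epsilon> l)) * (\<Sum>k\<in>Kl i l. \<integral>\<^sup>+\<omega>. g \<omega> * ennreal (h k \<omega>) \<partial>M)"
      by (simp add: nn_integral_add nn_integral_cmult nn_integral_sum)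
    also have "\<dots> \<le> ennreal (\<epsilon> l / 2) * (\<integral>\<^sup>+\<omega>. g \<omega> \<partial>M) + ennreal (1 / (2 * \<epsilon> l)) * (\<Sum>k\<in>Kl i l. ennreal (B * ((t - s) / 2 ^ l) powr (2 - 2 * \<alpha> * H)) * (\<integral>\<^sup>+\<omega>. g \<omega> \<partial>M))"
      by (intro add_left_mono mult_left_mono sum_mono hk) auto
    also have "\<dots> \<le> ennreal (\<epsilon> l / 2) * (\<integral>\<^sup>+\<omega>. g \<omega> \<partial>M) + ennreal (1 / (2 * \<epsilon> l)) * (2 ^ l * (ennreal (B * ((t - s) / 2 ^ l) powr (2 - 2 * \<alpha> * H)) * (\<integral>\<^sup>+\<omega>. g \<omega> \<partial>M)))"
    proof -
      have "of_nat (card (Kl i l)) \<le> (of_nat (2 ^ l) :: ennreal)" using finKl(2)[of i l] by (simp only: of_nat_le_iff)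
      then show ?thesis
        unfolding sum_constant by (intro add_left_mono mult_left_mono mult_right_mono) auto
    qed
    also have "\<dots> = ennreal (\<epsilon> l / 2) * (\<integral>\<^sup>+\<omega>. g \<omega> \<partial>M) + ennreal (1 / (2 * \<epsilon> l) * (2 ^ l * (B * ((t - s) / 2 ^ l) powr (2 - 2 * \<alpha> * H)))) * (\<integral>\<^sup>+\<omega>. g \<omega> \<partial>M)"
    proof -
      have "(2::ennreal) ^ l = ennreal (2 ^ l)" by (simp add: ennreal_power[symmetric])
      moreover have "ennreal (1 / (2 * \<epsilon> l) * (2 ^ l * (B * ((t - s) / 2 ^ l) powr (2 - 2 * \<alpha> * H))))
        = ennreal (1 / (2 * \<epsilon> l)) * (ennreal (2 ^ l) * ennreal (B * ((t - s) / 2 ^ l) powr (2 - 2 * \<alpha> * H)))"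
        using B_pos \<epsilon>[of l] by (subst ennreal_mult, simp, simp, subst ennreal_mult) auto
      ultimately show ?thesis by (simp only: mult.assoc)
    qed
    also have "1 / (2 * \<epsilon> l) * (2 ^ l * (B * ((t - s) / 2 ^ l) powr (2 - 2 * \<alpha> * H))) = \<epsilon> l / 2"
      unfolding \<epsilon>2 using \<epsilon>[of l] by (simp add: power2_eq_square)
    also have "ennreal (\<epsilon> l / 2) * (\<integral>\<^sup>+\<omega>. g \<omega> \<partial>M) + ennreal (\<epsilon> l / 2) * (\<integral>\<^sup>+\<omega>. g \<omega> \<partial>M) = ennreal (\<epsilon> l) * (\<integral>\<^sup>+\<omega>. g \<omega> \<partial>M)"
      using \<epsilon>[of l] by (simp add: distrib_right[symmetric] ennreal_plus[symmetric] del: ennreal_plus)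
    finally show ?thesis .
  qed
  \<comment> \<open>One R for the step from i - 1 to i, the rest for chaining with two ends.\<close>
  define K where "K = R + 2 * (\<Sum>l\<in>{..n}. \<epsilon> l)"
  have K0: "0 \<le> K" unfolding K_def using R \<epsilon> by (intro add_nonneg_nonneg mult_nonneg_nonneg sum_nonneg) (auto intro: less_imp_le)
  have AS: "A N \<omega> - A (i - 1) \<omega> \<le> R + 2 * (\<Sum>l\<in>{..n}. Q i l \<omega>)" if i: "1 \<le> i" "i \<le> N" and \<omega>: "\<omega> \<in> space M" for i \<omega>
  proof -
    \<comment> \<open>Triangle inequality through i - 1 and i: the running maximum up to i - 1, one
      Lipschitz step, then chaining in the future of i.\<close>
    have "Nrm (u 0) (u j) \<omega> \<le> A (i - 1) \<omega> + (R + 2 * (\<Sum>l\<in>{..n}. Q i l \<omega>))" if j: "j \<le> N" for j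
    proof (cases "j \<le> i - 1")
      case True
      then show ?thesis using A_ge[OF True, of \<omega>] R Q_nonneg by (smt (verit) sum_nonneg)
    next
      case False
      then have ij: "i \<le> j" by simp
      have "Nrm (u 0) (u j) \<omega> \<le> Nrm (u 0) (u (i - 1)) \<omega> + Nrm (u (i - 1)) (u j) \<omega>"
        using ij by (intro Nrm_triangle \<omega> u_mono) auto
      also have "Nrm (u (i - 1)) (u j) \<omega> \<le> Nrm (u (i - 1)) (u i) \<omega> + Nrm (u i) (u j) \<omega>"
        using ij by (intro Nrm_triangle \<omega> u_mono) auto
      also have "Nrm (u (i - 1)) (u i) \<omega> \<le> R"
      proof -
        have "Nrm (u (i - 1)) (u i) \<omega> \<le> sqrt (\<integral>z. wt z \<partial>lborel) * (u i - u (i - 1))"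
          by (intro Nrm_le \<omega> u_mono) auto
        also have "u i - u (i - 1) = (t - s) / 2 ^ n"
          using i by (simp add: u_def of_nat_diff field_simps)
        finally show ?thesis using n by (simp add: W_def)
      qed
      also have "Nrm (u i) (u j) \<omega> \<le> 2 * (\<Sum>l\<in>{0..n}. Q i l \<omega>)"
      proof (rule dyadic_chaining[where N="\<lambda>i j. Nrm (u i) (u j) \<omega>" and i0=i and m=0])
        show "j - i \<le> 2 ^ (n - 0)" using i j by (simp add: N_def)
        show "Nrm (u (k * 2 ^ (n - l))) (u ((k + 1) * 2 ^ (n - l))) \<omega> \<le> Q i l \<omega>"
          if "l \<le> n" "k < 2 ^ l" "i \<le> k * 2 ^ (n - l)" for k l
          by (rule Q_bound) (use that in \<open>simp add: Kl_def\<close>)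
      qed (use ij j Q_nonneg Nrm_self[OF \<omega>] in \<open>auto intro!: Nrm_triangle[OF \<omega>] u_mono simp: N_def\<close>)
      finally show ?thesis using A_ge[of "i - 1" "i - 1" \<omega>] by (simp add: atLeast0AtMost)
    qed
    then have "A N \<omega> \<le> A (i - 1) \<omega> + (R + 2 * (\<Sum>l\<in>{..n}. Q i l \<omega>))"
      unfolding A_def[of N] by (intro Max.boundedI) auto
    then show ?thesis by simp
  qed
  have EA: "(\<integral>\<^sup>+\<omega>. g \<omega> * ennreal (A N \<omega> - A (i - 1) \<omega>) \<partial>M) \<le> ennreal K * (\<integral>\<^sup>+\<omega>. g \<omega> \<partial>M)"
    if i: "1 \<le> i" "i \<le> N" and g: "g \<in> borel_measurable (past_algebra (u i))" for i g
  proof -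
    have [measurable]: "g \<in> borel_measurable M"
      using measurable_from_subalg[OF subalgebra_past(1) g] u_bd that by auto
    have [measurable]: "Q i l \<in> borel_measurable M" for l unfolding Q_def[abs_def] by measurable
    have "(\<integral>\<^sup>+\<omega>. g \<omega> * ennreal (A N \<omega> - A (i - 1) \<omega>) \<partial>M) \<le> (\<integral>\<^sup>+\<omega>. ennreal R * g \<omega> + 2 * (\<Sum>l\<in>{..n}. g \<omega> * ennreal (Q i l \<omega>)) \<partial>M)"
    proof (rule nn_integral_mono)
      fix \<omega> assume "\<omega> \<in> space M"
      then have "g \<omega> * ennreal (A N \<omega> - A (i - 1) \<omega>) \<le> g \<omega> * ennreal (R + 2 * (\<Sum>l\<in>{..n}. Q i l \<omega>))"
        using AS[OF i] by (intro mult_left_mono ennreal_leI) auto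
      also have "ennreal (R + 2 * (\<Sum>l\<in>{..n}. Q i l \<omega>)) = ennreal R + 2 * (\<Sum>l\<in>{..n}. ennreal (Q i l \<omega>))"
        using R Q_nonneg by (simp add: ennreal_plus ennreal_mult sum_nonneg sum_ennreal)
      finally show "g \<omega> * ennreal (A N \<omega> - A (i - 1) \<omega>) \<le> ennreal R * g \<omega> + 2 * (\<Sum>l\<in>{..n}. g \<omega> * ennreal (Q i l \<omega>))"
        by (simp add: distrib_left sum_distrib_left mult_ac)
    qed
    also have "\<dots> = ennreal R * (\<integral>\<^sup>+\<omega>. g \<omega> \<partial>M) + 2 * (\<Sum>l\<in>{..n}. \<integral>\<^sup>+\<omega>. g \<omega> * ennreal (Q i l \<omega>) \<partial>M)"
      by (simp add: nn_integral_add nn_integral_cmult nn_integral_sum)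
    also have "\<dots> \<le> ennreal R * (\<integral>\<^sup>+\<omega>. g \<omega> \<partial>M) + 2 * (\<Sum>l\<in>{..n}. ennreal (\<epsilon> l) * (\<integral>\<^sup>+\<omega>. g \<omega> \<partial>M))"
      using i g by (intro add_left_mono mult_left_mono sum_mono EQ) auto
    also have "\<dots> = (ennreal R + 2 * (\<Sum>l\<in>{..n}. ennreal (\<epsilon> l))) * (\<integral>\<^sup>+\<omega>. g \<omega> \<partial>M)"
      by (simp only: sum_distrib_right[symmetric] distrib_right mult.assoc)
    also have "ennreal R + 2 * (\<Sum>l\<in>{..n}. ennreal (\<epsilon> l)) = ennreal K"
      using R \<epsilon> by (simp add: K_def ennreal_plus ennreal_mult sum_nonneg sum_ennreal less_imp_le)
    finally show ?thesis .
  qed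
  have "(\<integral>\<^sup>+\<omega>. 1 * ennreal ((A N \<omega> - A (1 - 1) \<omega>) ^ p) \<partial>M) \<le> ennreal (fact p * K ^ p) * (\<integral>\<^sup>+\<omega>. 1 \<partial>M)"
    by (rule john_nirenberg_moments[where F="\<lambda>i. past_algebra (u i)" and A=A and N=N])
       (use A_meas A_mono K0 EA N u_bd u_mono in \<open>auto intro!: subalgebra_past\<close>)
  then have JN: "(\<integral>\<^sup>+\<omega>. ennreal ((A N \<omega> - A 0 \<omega>) ^ p) \<partial>M) \<le> ennreal (fact p * K ^ p)"
    by (simp add: emeasure_space_1)
  have "(\<integral>\<^sup>+\<omega>. ennreal (Nrm s t \<omega> ^ p) \<partial>M) \<le> (\<integral>\<^sup>+\<omega>. ennreal ((A N \<omega> - A 0 \<omega>) ^ p) \<partial>M)"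
  proof (intro nn_integral_mono ennreal_leI power_mono)
    fix \<omega> assume "\<omega> \<in> space M"
    then have "A 0 \<omega> = 0" by (simp add: A_def Nrm_self)
    then show "Nrm s t \<omega> \<le> A N \<omega> - A 0 \<omega>" using A_ge[of N N \<omega>] uN by simp
  qed (rule Nrm_nonneg)
  also note JN
  also have "K \<le> R * (1 + 2 / (1 - r))"
  proof -
    have "(\<Sum>l\<in>{..n}. \<epsilon> l) = R * (\<Sum>l\<in>{..n}. r ^ l)" by (simp add: \<epsilon>_def sum_distrib_left)
    also have "(\<Sum>l\<in>{..n}. r ^ l) \<le> 1 / (1 - r)"
      using sum_le_suminf[OF summable_geometric[of r], of "{..n}"] suminf_geometric[of r] r by simp
    finally have "(\<Sum>l\<in>{..n}. \<epsilon> l) \<le> R * (1 / (1 - r))" using R by (simp add: mult_left_mono)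
    then have "K \<le> R + 2 * (R * (1 / (1 - r)))" unfolding K_def by linarith
    then show ?thesis by (simp add: distrib_left mult.commute)
  qed
  then have "ennreal (fact p * K ^ p) \<le> ennreal (fact p * (R * (1 + 2 / (1 - r))) ^ p)"
    using K0 by (intro ennreal_leI mult_left_mono power_mono) auto
  finally show ?thesis by (simp add: R_def r_def)
qed

end

section \<open>Slices of the sheet and the pathwise estimate\<close>

text \<open>Chaining starts at the level whose cells are comparable with t - s. The Lipschitz bound
  only pays for the two end pieces off the finest grid; it disappears in the limit, so W does not
  enter the constant.\<close>

lemma holder_from_dyadic:
  fixes N :: "real \<Rightarrow> real \<Rightarrow> real"
  assumes T: "0 < T" and \<gamma>: "0 < \<gamma>" and q: "0 \<le> q"
    and sub: "\<And>s t u. 0 \<le> s \<Longrightarrow> s \<le> t \<Longrightarrow> t \<le> u \<Longrightarrow> u \<le> T \<Longrightarrow> N s u \<le> N s t + N t u"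
    and lip: "\<And>s t. 0 \<le> s \<Longrightarrow> s \<le> t \<Longrightarrow> t \<le> T \<Longrightarrow> N s t \<le> W * (t - s)"
    and dy: "\<And>n k. k < 2 ^ n \<Longrightarrow> N (real k * T / 2 ^ n) (real (k + 1) * T / 2 ^ n) \<le> q * 2 powr (- \<gamma> * real n)"
    and st: "0 \<le> s" "s < t" "t \<le> T"
  shows "N s t \<le> q * (2 * (2 / T) powr \<gamma> / (1 - 2 powr (-\<gamma>))) * (t - s) powr \<gamma>"
proof -
  \<comment> \<open>The level with \<open>t - s \<le> T / 2^m < 2 * (t - s)\<close>.\<close>
  define m where "m = nat \<lfloor>log 2 (T / (t - s))\<rfloor>"
  have Tst: "1 \<le> T / (t - s)" using st by (simp add: field_simps)
  then have lnn: "0 \<le> log 2 (T / (t - s))" by simp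
  have m1: "2 ^ m * (t - s) \<le> T"
  proof -
    have "real m \<le> log 2 (T / (t - s))" unfolding m_def using lnn by simp
    then have "2 powr (real m) \<le> T / (t - s)" using Tst by (simp add: le_log_iff)
    then show ?thesis using st by (simp add: powr_realpow field_simps)
  qed
  have m2: "T < 2 * 2 ^ m * (t - s)"
  proof -
    have "log 2 (T / (t - s)) < real m + 1" unfolding m_def using lnn by linarith
    then have "T / (t - s) < 2 powr (real m + 1)" using Tst by (simp add: log_less_iff)
    then show ?thesis using st by (simp add: powr_realpow powr_add field_simps)
  qed
  define r where "r = 2 powr (-\<gamma>)"
  have r: "0 < r" "r < 1" using \<gamma> powr_less_mono[of "-\<gamma>" 0 2] by (auto simp: r_def)
  have rn: "2 powr (- \<gamma> * real n) = r ^ n" for n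
    by (simp add: r_def powr_realpow[symmetric] powr_powr)
  \<comment> \<open>The sign of W follows only if the left-hand side is positive; otherwise the
    claim is trivial.\<close>
  have W: "0 \<le> W" if "N s t > 0" using lip[of s t] st that by (smt (verit) mult_nonpos_nonneg)
  have est: "N s t \<le> W * (T / 2 ^ n) * 2 + 2 * (q * (r ^ m / (1 - r)))" if n: "m < n" "W \<ge> 0" for n
  proof -
    define h where "h = T / 2 ^ n"
    have h: "0 < h" using T by (simp add: h_def)
    have hT: "2 ^ n * h = T" by (simp add: h_def)
    \<comment> \<open>The outermost grid points inside the interval, at distance less than h from
      its ends.\<close>
    define i j where "i = nat \<lceil>s / h\<rceil>" and "j = nat \<lfloor>t / h\<rfloor>"
    have s0: "0 \<le> s / h" "0 \<le> t / h" using st h by auto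
    have ri: "s / h \<le> real i" "real i < s / h + 1" using s0 unfolding i_def by linarith+
    have rj: "real j \<le> t / h" "t / h < real j + 1" using s0 unfolding j_def by linarith+
    have ri': "s \<le> real i * h" "real i * h < s + h" using ri h by (simp_all add: field_simps)
    have rj': "real j * h \<le> t" "t < real j * h + h" using rj h by (simp_all add: field_simps)
    have "2 * h \<le> t - s \<or> h < t - s"
    proof -
      have "2 ^ (m + 1) \<le> (2::real) ^ n" using n by (intro power_increasing) auto
      then have "2 * 2 ^ m * h \<le> T" using hT h by (metis mult_right_mono less_imp_le power_add power_one_right mult.commute)
      then have "2 * 2 ^ m * h < 2 * 2 ^ m * (t - s)" using m2 by linarith
      then show ?thesis by (simp add: mult_less_cancel_left_disj)
    qed
    then have "h < t - s" using h by linarith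
    then have "real i * h < (real j + 1) * h" using ri' rj' by (simp add: distrib_right)
    then have ij: "i \<le> j" using h by (simp add: mult_less_cancel_right)
    have jn: "j \<le> 2 ^ n"
    proof -
      have "real j * h \<le> 2 ^ n * h" using rj' st hT by linarith
      then have "real j \<le> 2 ^ n" using h by simp
      then show ?thesis by (metis of_nat_le_iff of_nat_numeral of_nat_power)
    qed
    have jmi: "j - i \<le> 2 ^ (n - m)"
    proof -
      have "(real j - real i) * h \<le> t - s" using ri' rj' by (simp add: left_diff_distrib)
      then have "2 ^ m * ((real j - real i) * h) \<le> 2 ^ m * (t - s)" by (intro mult_left_mono) auto
      also have "\<dots> \<le> 2 ^ n * h" using m1 hT by simp
      also have "(2::real) ^ n = 2 ^ m * 2 ^ (n - m)" using n by (simp flip: power_add)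
      finally have "real j - real i \<le> 2 ^ (n - m)" using h by simp
      then have "real (j - i) \<le> real (2 ^ (n - m))" using ij by (simp add: of_nat_diff)
      then show ?thesis by (simp only: of_nat_le_iff)
    qed
    have jT: "real x * h \<le> T" if "x \<le> 2 ^ n" for x
    proof -
      have "real x \<le> 2 ^ n" using that by (metis of_nat_le_iff of_nat_numeral of_nat_power)
      then have "real x * h \<le> 2 ^ n * h" using h by (intro mult_right_mono) auto
      then show ?thesis using hT by simp
    qed
    have "N (real i * h) (real j * h) \<le> 2 * (\<Sum>l\<in>{m..n}. q * r ^ l)"
    proof -
      \<comment> \<open>Cut off outside the grid, because the chaining lemma asks for the diagonal
        bound at every index.\<close>
      define N' where "N' i j = (if j \<le> 2 ^ n then N (real i * h) (real j * h) else 0)" for i j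
      have "N' i j \<le> 2 * (\<Sum>l\<in>{m..n}. q * r ^ l)"
      proof (rule dyadic_chaining[of n N' "\<lambda>l. q * r ^ l" 0 i j m])
        fix x :: nat
        show "N' x x \<le> 0"
          using lip[of "real x * h" "real x * h"] jT[of x] h by (simp add: N'_def)
      next
        fix l k :: nat assume l: "l \<le> n" "k < 2 ^ l"
        have "(2::real) ^ n = 2 ^ l * 2 ^ (n - l)" using l by (simp flip: power_add)
        then have "real (x * 2 ^ (n - l)) * h = real x * T / 2 ^ l" for x
          by (simp add: h_def)
        then have "N (real (k * 2 ^ (n - l)) * h) (real ((k + 1) * 2 ^ (n - l)) * h) \<le> q * r ^ l"
          using dy[of k l] l unfolding rn by (simp only:)
        then show "N' (k * 2 ^ (n - l)) ((k + 1) * 2 ^ (n - l)) \<le> q * r ^ l"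
          using q r by (simp add: N'_def)
      next
        fix i j k :: nat assume "i \<le> j" "j \<le> k" "k \<le> 2 ^ n"
        then have "N (real i * h) (real k * h) \<le> N (real i * h) (real j * h) + N (real j * h) (real k * h)"
          using jT[of k] h by (intro sub mult_right_mono) auto
        then show "N' i k \<le> N' i j + N' j k"
          using \<open>j \<le> k\<close> \<open>k \<le> 2 ^ n\<close> by (simp add: N'_def)
      qed (use ij jn jmi n q r in auto)
      then show ?thesis using jn by (simp add: N'_def)
    qed
    also have "(\<Sum>l\<in>{m..n}. q * r ^ l) \<le> q * (r ^ m / (1 - r))"
    proof -
      have "(\<Sum>l\<in>{m..n}. r ^ l) = r ^ m * (\<Sum>l\<in>{0..n - m}. r ^ l)"
        unfolding sum_distrib_left using n
        by (intro sum.reindex_bij_witness[of _ "\<lambda>l. l + m" "\<lambda>l. l - m"]) (auto simp: power_add[symmetric])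
      also have "(\<Sum>l\<in>{0..n - m}. r ^ l) \<le> 1 / (1 - r)"
        using sum_le_suminf[OF summable_geometric[of r], of "{0..n - m}"] suminf_geometric[of r] r by simp
      finally have "(\<Sum>l\<in>{m..n}. r ^ l) \<le> r ^ m / (1 - r)" using r by (simp add: mult_left_mono)
      then show ?thesis using q by (simp only: sum_distrib_left[symmetric] mult_left_mono)
    qed
    finally have mid: "N (real i * h) (real j * h) \<le> 2 * (q * (r ^ m / (1 - r)))" by simp
    have le: "real i * h \<le> real j * h" using ij h by (intro mult_right_mono) auto
    have "N s t \<le> N s (real i * h) + N (real i * h) t"
      using ri' rj' le st by (intro sub) linarith+
    also have "N (real i * h) t \<le> N (real i * h) (real j * h) + N (real j * h) t"
      using ri' rj' le st h by (intro sub) auto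
    also have "N s (real i * h) \<le> W * h"
      using lip[of s "real i * h"] ri' rj' le st mult_left_mono[of "real i * h - s" h W] n by linarith
    also have "N (real j * h) t \<le> W * h"
      using lip[of "real j * h" t] ri' rj' le st mult_left_mono[of "t - real j * h" h W] n by linarith
    finally show ?thesis using mid unfolding h_def[symmetric] by linarith
  qed
  have fin: "N s t \<le> 2 * (q * (r ^ m / (1 - r)))"
  proof (cases "N s t > 0")
    case False
    moreover have "0 \<le> 2 * (q * (r ^ m / (1 - r)))" using q r by simp
    ultimately show ?thesis by linarith
  next
    case True
    \<comment> \<open>As n grows the end pieces vanish.\<close>
    have "(\<lambda>n. W * (T * (1 / 2) ^ n) * 2 + 2 * (q * (r ^ m / (1 - r)))) \<longlonglongrightarrow> W * (T * 0) * 2 + 2 * (q * (r ^ m / (1 - r)))"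
      by (intro tendsto_intros LIMSEQ_power_zero) simp
    moreover have "\<forall>\<^sub>F n in sequentially. N s t \<le> W * (T * (1 / 2) ^ n) * 2 + 2 * (q * (r ^ m / (1 - r)))"
      using eventually_gt_at_top[of m] by eventually_elim (use est W[OF True] in \<open>simp add: power_one_over\<close>)
    ultimately have "N s t \<le> W * (T * 0) * 2 + 2 * (q * (r ^ m / (1 - r)))"
      by (rule tendsto_lowerbound) simp
    then show ?thesis by simp
  qed
  have "r ^ m \<le> (2 / T) powr \<gamma> * (t - s) powr \<gamma>"
  proof -
    have "r ^ m = (1 / 2 ^ m) powr \<gamma>"
      unfolding rn[symmetric] by (simp add: powr_divide powr_realpow[symmetric] powr_powr powr_minus_divide mult.commute)
    also have "\<dots> \<le> (2 / T * (t - s)) powr \<gamma>"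
      using m2 T \<gamma> by (intro powr_mono2) (auto simp: field_simps)
    also have "\<dots> = (2 / T) powr \<gamma> * (t - s) powr \<gamma>" by (rule powr_mult)
    finally show ?thesis .
  qed
  then have "2 * (q * (r ^ m / (1 - r))) \<le> 2 * (q * ((2 / T) powr \<gamma> * (t - s) powr \<gamma> / (1 - r)))"
    using q r by (intro mult_left_mono divide_right_mono) auto
  then show ?thesis using fin by (simp add: r_def mult_ac)
qed

text \<open>Young's inequality with exponents m/(m-1) and m. The weight \<tau> stays free; it will
  balance a singular time integral against an integrated random constant.\<close>

lemma mult_le_young:
  fixes x y \<tau> :: real
  assumes m: "2 \<le> m" and nn: "0 \<le> x" "0 \<le> y" and \<tau>: "0 < \<tau>"
  shows "x * y powr (1 / real m) \<le> \<tau> powr (real m / (real m - 1)) * x powr (real m / (real m - 1)) + \<tau> powr (- real m) * y"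
proof -
  define q where "q = real m / (real m - 1)"
  have q: "1 < q" using m by (simp add: q_def)
  have "x * y powr (1 / real m) = (\<tau> * x) * (y powr (1 / real m) / \<tau>)" using \<tau> by simp
  also have "\<dots> \<le> (\<tau> * x) powr q / q + (y powr (1 / real m) / \<tau>) powr (real m) / real m"
    by (rule Youngs_inequality) (use m q nn \<tau> in \<open>auto simp: q_def field_simps\<close>)
  also have "(\<tau> * x) powr q / q \<le> (\<tau> * x) powr q / 1" using q by (intro divide_left_mono) auto
  also have "(y powr (1 / real m) / \<tau>) powr (real m) / real m \<le> (y powr (1 / real m) / \<tau>) powr (real m) / 1"
    using m by (intro divide_left_mono) auto
  also have "(y powr (1 / real m) / \<tau>) powr (real m) = \<tau> powr (- real m) * y"
    using m nn \<tau> by (simp add: powr_divide powr_powr powr_minus field_simps)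
  finally show ?thesis using nn \<tau> by (simp add: powr_mult q_def)
qed

text \<open>Nonnegativity of the variance under the normalised measure.\<close>

lemma (in finite_measure) square_integral_le:
  fixes f :: "'a \<Rightarrow> real"
  assumes f: "integrable M f" and f2: "integrable M (\<lambda>x. (f x)\<^sup>2)"
  shows "(\<integral>x. f x \<partial>M)\<^sup>2 \<le> measure M (space M) * (\<integral>x. (f x)\<^sup>2 \<partial>M)"
proof (cases "measure M (space M) = 0")
  case True
  then have "emeasure M (space M) = 0" by (simp add: emeasure_eq_measure)
  then have "AE x in M. False" by (intro AE_I[of _ _ "space M"]) auto
  then have "AE x in M. f x = 0" by eventually_elim simp
  then have "(\<integral>x. f x \<partial>M) = 0" by (rule integral_eq_zero_AE)
  then show ?thesis using True by simp
next
  case False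
  define \<mu> c where "\<mu> = measure M (space M)" and "c = (\<integral>x. f x \<partial>M) / \<mu>"
  have \<mu>: "0 < \<mu>" using False by (simp add: \<mu>_def less_le)
  have "0 \<le> (\<integral>x. (f x - c)\<^sup>2 \<partial>M)" by simp
  also have "(\<lambda>x. (f x - c)\<^sup>2) = (\<lambda>x. (f x)\<^sup>2 - 2 * c * f x + c\<^sup>2)" by (auto simp: power2_eq_square algebra_simps)
  also have "(\<integral>x. (f x)\<^sup>2 - 2 * c * f x + c\<^sup>2 \<partial>M) = (\<integral>x. (f x)\<^sup>2 \<partial>M) - 2 * c * (\<integral>x. f x \<partial>M) + c\<^sup>2 * \<mu>"
    using f f2 by (simp add: \<mu>_def)
  also have "\<dots> = (\<integral>x. (f x)\<^sup>2 \<partial>M) - (\<integral>x. f x \<partial>M)\<^sup>2 / \<mu>"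
    using \<mu> by (simp add: c_def power2_eq_square field_simps)
  finally show ?thesis using \<mu> by (simp add: \<mu>_def[symmetric] field_simps)
qed

text \<open>The Bessel weight cut off at radius R: integrable for every \<open>lam\<close> and
  increasing in R, so the radius can be sent to infinity by monotone limits.\<close>

definition ball_weight :: "real \<Rightarrow> nat \<Rightarrow> 'b::euclidean_space \<Rightarrow> real" where
  "ball_weight lam R z = indicator (ball 0 (real R)) z * (1 + (norm z)\<^sup>2) powr lam"

lemma ball_weight_measurable [measurable]: "ball_weight lam R \<in> borel_measurable borel"
  unfolding ball_weight_def[abs_def] by (intro borel_measurable_times borel_measurable_indicator) (auto, measurable)

lemma ball_weight_nonneg: "0 \<le> ball_weight lam R z"
  by (simp add: ball_weight_def)

lemma ball_weight_le: "ball_weight lam R z \<le> (1 + (norm z)\<^sup>2) powr lam"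
  by (simp add: ball_weight_def indicator_def)

lemma ball_weight_mono: "R \<le> R' \<Longrightarrow> ball_weight lam R z \<le> ball_weight lam R' z"
  by (auto simp: ball_weight_def indicator_def)

lemma ball_weight_integrable: "integrable lborel (ball_weight lam R :: 'b::euclidean_space \<Rightarrow> real)"
proof (rule Bochner_Integration.integrable_bound[where f="\<lambda>z. (1 + (real R)\<^sup>2) powr \<bar>lam\<bar> * indicator (ball 0 (real R)) z"])
  show "integrable lborel (\<lambda>z::'b. (1 + (real R)\<^sup>2) powr \<bar>lam\<bar> * indicator (ball 0 (real R)) z)"
    using emeasure_lborel_ball_finite[of "0::'b" "real R"] by (intro integrable_mult_right integrable_real_indicator) auto
  have "(1 + (norm z)\<^sup>2) powr lam \<le> (1 + (real R)\<^sup>2) powr \<bar>lam\<bar>" if "norm z < real R" for z :: 'b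
  proof -
    have "(1 + (norm z)\<^sup>2) powr lam \<le> (1 + (norm z)\<^sup>2) powr \<bar>lam\<bar>" by (intro powr_mono) auto
    also have "\<dots> \<le> (1 + (real R)\<^sup>2) powr \<bar>lam\<bar>"
      using that by (intro powr_mono2) (auto intro!: power_mono add_nonneg_nonneg)
    finally show ?thesis .
  qed
  then show "AE z in lborel. norm (ball_weight lam R z) \<le> norm ((1 + (real R)\<^sup>2) powr \<bar>lam\<bar> * indicator (ball (0::'b) (real R)) z)"
    by (intro AE_I2) (auto simp: ball_weight_def indicator_def)
qed simp

section \<open>Slices as nondeterministic processes\<close>

context fbs
begin

definition clamp_time :: "real \<Rightarrow> real" where
  "clamp_time a = max 0 (min T a)"

text \<open>The sheet extended to the whole plane by constancy beyond the time square, so that its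
  paths are continuous everywhere.\<close>

definition W :: "real \<Rightarrow> real \<Rightarrow> 'a \<Rightarrow> real ^ 'd" where
  "W a b = w (clamp_time a, clamp_time b)"

lemma clamp_time: "0 \<le> clamp_time a" "clamp_time a \<le> T" "a \<in> {0..T} \<Longrightarrow> clamp_time a = a"
  "a \<le> u \<Longrightarrow> 0 \<le> u \<Longrightarrow> clamp_time a \<le> u"
  using T by (auto simp: clamp_time_def)

lemma clamp_time_in: "(clamp_time a, clamp_time b) \<in> time_square T"
  using clamp_time by (auto simp: time_square_def)

lemma W_measurable: "W a b \<in> borel_measurable M"
  unfolding W_def by (rule w_measurable[OF clamp_time_in])

lemma continuous_clamp: "continuous_on A clamp_time"
  unfolding clamp_time_def by (intro continuous_intros)

lemma W_continuous:
  assumes "\<omega> \<in> space M"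
  shows "continuous_on UNIV (\<lambda>p. W (fst p) (snd p) \<omega>)"
  unfolding W_def
  by (rule continuous_on_compose2[OF w_continuous[OF assms], where f="\<lambda>p. (clamp_time (fst p), clamp_time (snd p))"])
     (auto intro!: continuous_on_compose2[OF continuous_clamp] continuous_intros simp: clamp_time_in)

lemma W_continuous1: "\<omega> \<in> space M \<Longrightarrow> continuous_on UNIV (\<lambda>a. W a b \<omega>)"
  by (rule continuous_on_compose2[OF W_continuous _ subset_UNIV, where f="\<lambda>a. (a, b)", simplified])
     (auto intro!: continuous_intros)

lemma W_continuous2: "\<omega> \<in> space M \<Longrightarrow> continuous_on UNIV (\<lambda>b. W a b \<omega>)"
  by (rule continuous_on_compose2[OF W_continuous _ subset_UNIV, where f="\<lambda>b. (a, b)", simplified])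
     (auto intro!: continuous_intros)

lemma W_joint:
  assumes f: "f \<in> borel_measurable N" and g: "g \<in> borel_measurable N" and h: "h \<in> measurable N M"
  shows "(\<lambda>p. W (f p) (g p) (h p)) \<in> borel_measurable N"
proof -
  have 1: "(\<lambda>q. W a (fst q) (snd q)) \<in> borel_measurable (borel \<Otimes>\<^sub>M M)" for a
    by (rule borel_measurable_continuous_param[where f="W a", OF W_continuous2 W_measurable])
  have 2: "(\<lambda>p. W (fst p) (fst (snd p)) (snd (snd p))) \<in> borel_measurable (borel \<Otimes>\<^sub>M (borel \<Otimes>\<^sub>M M))"
    by (rule borel_measurable_continuous_param[where f="\<lambda>a q. W a (fst q) (snd q)", OF _ 1])
       (auto simp: space_pair_measure intro: W_continuous1)
  have "(\<lambda>p. (f p, (g p, h p))) \<in> measurable N (borel \<Otimes>\<^sub>M (borel \<Otimes>\<^sub>M M))" using f g h by measurable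
  from measurable_compose[OF this 2] show ?thesis by simp
qed

lemma lnd_const_pos: "0 < b \<Longrightarrow> 0 < lnd_const b"
  using fbm_kernel_const_pos[of H1] H by (simp add: lnd_const_def)

text \<open>For negative a the clamped time is 0, which belongs to every past.\<close>

lemma past_adapted:
  assumes u: "0 \<le> u" "u \<le> T" and "a \<le> u" and b: "b \<in> {0..T}"
  shows "W a b \<in> borel_measurable (sigma (space M) (past b u))"
proof -
  let ?Y = "\<lambda>(a, i) \<omega>. w (a, b) \<omega> $ i"
  have sub: "past b u \<subseteq> Pow (space M)"
    unfolding past_def by (rule sigma_sets_into_sp[THEN PowI, THEN subsetI, rotated]) (auto simp: vimage_sets_def)
  have sets: "sets (sigma (space M) (past b u)) = past b u"
  proof -
    have "vimage_sets (space M) ?Y ({0..u} \<times> UNIV) \<subseteq> Pow (space M)" by (auto simp: vimage_sets_def)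
    from sigma_sets_sigma_sets_eq[OF this] sets_measure_of[OF sub] show ?thesis by (simp add: past_def)
  qed
  have comp: "(\<lambda>\<omega>. w (clamp_time a, b) \<omega> $ i) \<in> borel_measurable (sigma (space M) (past b u))" for i
  proof (rule measurableI)
    fix A :: "real set" assume "A \<in> sets borel"
    then have "(\<lambda>\<omega>. w (clamp_time a, b) \<omega> $ i) -` A \<inter> space M \<in> past b u"
      unfolding past_def vimage_sets_def using clamp_time(1,4)[of a] assms
      by (intro sigma_sets.Basic CollectI exI[of _ "(clamp_time a, i)"] exI[of _ A]) auto
    then show "(\<lambda>\<omega>. w (clamp_time a, b) \<omega> $ i) -` A \<inter> space (sigma (space M) (past b u)) \<in> sets (sigma (space M) (past b u))"
      using sets by (simp add: space_measure_of_conv)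
  qed auto
  have "W a b = w (clamp_time a, b)" using b by (simp add: W_def clamp_time(3))
  then show ?thesis
    unfolding borel_measurable_euclidean_space[of "W a b"]
    using comp by (auto simp: Basis_vec_def inner_axis)
qed

text \<open>At b = 0 the slice is degenerate and the constant vanishes, hence b > 0 here and almost
  every b later.\<close>

lemma lnd_process_slice:
  assumes b: "0 < b" "b \<le> T"
  shows "lnd_process M (\<lambda>a. W a b) T H1 (lnd_const b) (past b)"
proof (intro lnd_process.intro lnd_process_axioms.intro)
  show "prob_space M" by unfold_locales
  show "0 < T" "0 < H1" "0 < lnd_const b" using T H lnd_const_pos b by auto
  show "continuous_on UNIV (\<lambda>a. W a b \<omega>)" if "\<omega> \<in> space M" for \<omega> by (rule W_continuous1[OF that])
  show "sigma_algebra (space M) (past b u)" for u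
    unfolding past_def by (rule sigma_algebra_sigma_sets) (auto simp: vimage_sets_def)
  show "past b u \<subseteq> events" if "0 \<le> u" "u \<le> T" for u using past_events[of b u] b that by simp
  show "past b u \<subseteq> past b u'" if "0 \<le> u" "u \<le> u'" "u' \<le> T" for u u'
    unfolding past_def by (rule sigma_sets_mono') (use that in \<open>force simp: vimage_sets_def\<close>)
  show "W a b \<in> borel_measurable (sigma (space M) (past b u))" if "0 \<le> u" "u \<le> T" "a \<le> u" for u a
    using that b by (intro past_adapted) auto
  show "W a b \<in> borel_measurable M" for a by (rule W_measurable)
  show "norm (\<integral>\<omega>. cis (z \<bullet> (W a' b \<omega> - W a b \<omega>)) * indicator E \<omega> \<partial>M) \<le> exp (- lnd_const b * (norm z)\<^sup>2 * (a' - a) powr (2*H1)) * prob E"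
    if "0 \<le> u" "u \<le> a" "a < a'" "a' \<le> T" "E \<in> past b u" for u a a' E z
  proof -
    have "W a b = w (a, b)" "W a' b = w (a', b)" using that b by (auto simp: W_def clamp_time(3))
    then show ?thesis using lnd_past[of b u a a' E z] that b by simp
  qed
qed

text \<open>The same integral as \<open>occ\<close>, with the level b as an argument: integration
  over b needs joint measurability, and the interpretations of the locale are made for one b > 0 at
  a time.\<close>

definition slice_ft :: "real \<Rightarrow> real \<Rightarrow> real \<Rightarrow> real ^ 'd \<Rightarrow> 'a \<Rightarrow> complex" where
  "slice_ft s t b z \<omega> = (\<integral>a. cis (- (z \<bullet> W a b \<omega>)) \<partial>interval_measure_on s t)"

definition slice_energy :: "(real ^ 'd \<Rightarrow> real) \<Rightarrow> real \<Rightarrow> real \<Rightarrow> real \<Rightarrow> 'a \<Rightarrow> real" where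
  "slice_energy wt s t b \<omega> = (\<integral>z. wt z * (norm (slice_ft s t b z \<omega>))\<^sup>2 \<partial>lborel)"

lemma slice_ft_joint:
  assumes [measurable]: "f \<in> borel_measurable N" "g \<in> borel_measurable N" "h \<in> measurable N M"
  shows "(\<lambda>p. slice_ft s t (f p) (g p) (h p)) \<in> borel_measurable N"
proof -
  interpret finite_measure "interval_measure_on s t" by (rule finite_interval_measure_on)
  have [measurable]: "(\<lambda>q. W (snd q) (f (fst q)) (h (fst q))) \<in> borel_measurable (N \<Otimes>\<^sub>M interval_measure_on s t)"
    by (rule W_joint) measurable
  show ?thesis unfolding slice_ft_def
    by (rule borel_measurable_lebesgue_integral) (unfold split_beta', measurable)
qed

lemma slice_energy_joint:
  assumes [measurable]: "wt \<in> borel_measurable borel" "f \<in> borel_measurable N" "h \<in> measurable N M"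
  shows "(\<lambda>p. slice_energy wt s t (f p) (h p)) \<in> borel_measurable N"
proof -
  have [measurable]: "(\<lambda>q. slice_ft s t (f (fst q)) (snd q) (h (fst q))) \<in> borel_measurable (N \<Otimes>\<^sub>M lborel)"
    by (rule slice_ft_joint) measurable
  show ?thesis unfolding slice_energy_def
    by (rule lborel.borel_measurable_lebesgue_integral) (unfold split_beta', measurable)
qed

lemma slice_ft_norm_le:
  assumes "\<omega> \<in> space M" "s \<le> t"
  shows "norm (slice_ft s t b z \<omega>) \<le> t - s"
proof -
  interpret finite_measure "interval_measure_on s t" by (rule finite_interval_measure_on)
  have "norm (slice_ft s t b z \<omega>) \<le> (\<integral>a. norm (cis (- (z \<bullet> W a b \<omega>))) \<partial>interval_measure_on s t)"
    unfolding slice_ft_def by (rule integral_norm_bound)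
  then show ?thesis using emeasure_interval_measure_on[OF assms(2)] assms by (simp add: measure_def)
qed

text \<open>Cauchy--Schwarz in the second time variable replaces a two-parameter argument.\<close>

lemma rectangle_le_slices:
  assumes \<omega>: "\<omega> \<in> space M" and st: "s1 \<le> t1" "s2 \<le> t2"
    and wt[measurable]: "wt \<in> borel_measurable borel" "\<And>z. 0 \<le> wt z" "integrable lborel wt"
  shows "(\<integral>\<^sup>+z. ennreal (wt z * (norm (\<integral>b. slice_ft s1 t1 b z \<omega> \<partial>interval_measure_on s2 t2))\<^sup>2) \<partial>lborel)
     \<le> ennreal (t2 - s2) * (\<integral>\<^sup>+b. ennreal (slice_energy wt s1 t1 b \<omega>) \<partial>interval_measure_on s2 t2)"
proof -
  let ?L = "interval_measure_on s2 t2"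
  interpret L: finite_measure ?L by (rule finite_interval_measure_on)
  interpret LB: pair_sigma_finite ?L "lborel :: (real ^ 'd) measure" ..
  have [measurable]: "(\<lambda>q. slice_ft s1 t1 (fst q) (snd q) \<omega>) \<in> borel_measurable (?L \<Otimes>\<^sub>M lborel)"
    using \<omega> by (intro slice_ft_joint) auto
  have m1[measurable]: "(\<lambda>b. slice_ft s1 t1 b z \<omega>) \<in> borel_measurable ?L" for z
    using \<omega> by (intro slice_ft_joint) auto
  have m2[measurable]: "(\<lambda>z. slice_ft s1 t1 b z \<omega>) \<in> borel_measurable borel" for b
    using \<omega> by (intro slice_ft_joint) auto
  have bd: "norm (slice_ft s1 t1 b z \<omega>) \<le> t1 - s1" for b z by (rule slice_ft_norm_le[OF \<omega> st(1)])
  have i1: "integrable ?L (\<lambda>b. norm (slice_ft s1 t1 b z \<omega>))" for z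
    by (rule L.integrable_const_bound[where B="t1 - s1"]) (use bd in auto)
  have i2: "integrable ?L (\<lambda>b. (norm (slice_ft s1 t1 b z \<omega>))\<^sup>2)" for z
    by (rule L.integrable_const_bound[where B="(t1 - s1)\<^sup>2"]) (use bd in \<open>auto intro!: power_mono\<close>)
  have mL: "measure ?L UNIV = t2 - s2" using emeasure_interval_measure_on[OF st(2)] st by (simp add: measure_def)
  have "(norm (\<integral>b. slice_ft s1 t1 b z \<omega> \<partial>?L))\<^sup>2 \<le> (t2 - s2) * (\<integral>b. (norm (slice_ft s1 t1 b z \<omega>))\<^sup>2 \<partial>?L)" for z
  proof -
    have "(norm (\<integral>b. slice_ft s1 t1 b z \<omega> \<partial>?L))\<^sup>2 \<le> (\<integral>b. norm (slice_ft s1 t1 b z \<omega>) \<partial>?L)\<^sup>2"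
      by (intro power_mono integral_norm_bound) auto
    also have "\<dots> \<le> (t2 - s2) * (\<integral>b. (norm (slice_ft s1 t1 b z \<omega>))\<^sup>2 \<partial>?L)"
      using L.square_integral_le[OF i1 i2] mL by simp
    finally show ?thesis .
  qed
  then have "(\<integral>\<^sup>+z. ennreal (wt z * (norm (\<integral>b. slice_ft s1 t1 b z \<omega> \<partial>?L))\<^sup>2) \<partial>lborel)
     \<le> (\<integral>\<^sup>+z. ennreal (wt z * ((t2 - s2) * (\<integral>b. (norm (slice_ft s1 t1 b z \<omega>))\<^sup>2 \<partial>?L))) \<partial>lborel)"
    using wt by (intro nn_integral_mono ennreal_leI mult_left_mono) auto
  also have "\<dots> = (\<integral>\<^sup>+z. ennreal (t2 - s2) * (\<integral>\<^sup>+b. ennreal (wt z * (norm (slice_ft s1 t1 b z \<omega>))\<^sup>2) \<partial>?L) \<partial>lborel)"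
  proof (rule nn_integral_cong)
    fix z
    have "(\<integral>\<^sup>+b. ennreal (wt z * (norm (slice_ft s1 t1 b z \<omega>))\<^sup>2) \<partial>?L) = ennreal (wt z * (\<integral>b. (norm (slice_ft s1 t1 b z \<omega>))\<^sup>2 \<partial>?L))"
      using i2 wt by (subst nn_integral_eq_integral) auto
    then show "ennreal (wt z * ((t2 - s2) * (\<integral>b. (norm (slice_ft s1 t1 b z \<omega>))\<^sup>2 \<partial>?L))) = ennreal (t2 - s2) * (\<integral>\<^sup>+b. ennreal (wt z * (norm (slice_ft s1 t1 b z \<omega>))\<^sup>2) \<partial>?L)"
      using st wt by (simp add: ennreal_mult[symmetric] mult_ac)
  qed
  also have "\<dots> = ennreal (t2 - s2) * (\<integral>\<^sup>+z. \<integral>\<^sup>+b. ennreal (wt z * (norm (slice_ft s1 t1 b z \<omega>))\<^sup>2) \<partial>?L \<partial>lborel)"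
  proof (rule nn_integral_cmult, rule L.borel_measurable_nn_integral)
    have [measurable]: "(\<lambda>q. slice_ft s1 t1 (snd q) (fst q) \<omega>) \<in> borel_measurable (lborel \<Otimes>\<^sub>M ?L)"
      using \<omega> by (intro slice_ft_joint) auto
    show "(\<lambda>(z, b). ennreal (wt z * (norm (slice_ft s1 t1 b z \<omega>))\<^sup>2)) \<in> borel_measurable (lborel \<Otimes>\<^sub>M ?L)"
      unfolding split_beta' by measurable
  qed
  also have "(\<integral>\<^sup>+z. \<integral>\<^sup>+b. ennreal (wt z * (norm (slice_ft s1 t1 b z \<omega>))\<^sup>2) \<partial>?L \<partial>lborel) = (\<integral>\<^sup>+b. \<integral>\<^sup>+z. ennreal (wt z * (norm (slice_ft s1 t1 b z \<omega>))\<^sup>2) \<partial>lborel \<partial>?L)"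
    by (rule LB.Fubini') (unfold split_beta', measurable)
  also have "\<dots> = (\<integral>\<^sup>+b. ennreal (slice_energy wt s1 t1 b \<omega>) \<partial>?L)"
  proof (rule nn_integral_cong)
    fix b
    have "integrable lborel (\<lambda>z. wt z * (norm (slice_ft s1 t1 b z \<omega>))\<^sup>2)"
    proof (rule Bochner_Integration.integrable_bound[where f="\<lambda>z. (t1 - s1)\<^sup>2 * wt z"])
      show "AE z in lborel. norm (wt z * (norm (slice_ft s1 t1 b z \<omega>))\<^sup>2) \<le> norm ((t1 - s1)\<^sup>2 * wt z)"
        using bd wt(2) by (intro AE_I2) (simp add: abs_mult mult.commute mult_left_mono power_mono)
    qed (use wt in auto)
    then show "(\<integral>\<^sup>+z. ennreal (wt z * (norm (slice_ft s1 t1 b z \<omega>))\<^sup>2) \<partial>lborel) = ennreal (slice_energy wt s1 t1 b \<omega>)"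
      unfolding slice_energy_def using wt by (intro nn_integral_eq_integral) auto
  qed
  finally show ?thesis .
qed

end

lemma AE_interval_measure_on: "(AE b in interval_measure_on s t. P b) \<longleftrightarrow> (AE b in lborel. b \<in> {s..t} \<longrightarrow> P b)"
  unfolding interval_measure_on_def by (subst AE_density) (auto simp: indicator_def)

section \<open>Pathwise estimate with one random constant\<close>

context fbs
begin

text \<open>The bound v is taken at b = T, where \<open>lnd_const\<close> is largest, so one
  constant serves all slices.\<close>

lemma lnd_weight_slice:
  assumes \<alpha>: "0 < \<alpha>" "2 * \<alpha> * H1 < 1" "real CARD('d) / 2 < \<alpha> - lam" and b: "0 < b" "b \<le> T"
  shows "lnd_weight M (\<lambda>a. W a b) T H1 (lnd_const b) (past b) (ball_weight lam R) lam \<alpha> (lnd_const T * T powr (2 * H1))"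
proof (intro lnd_weight.intro lnd_weight_axioms.intro lnd_process_slice b)
  show "lnd_const b * T powr (2 * H1) \<le> lnd_const T * T powr (2 * H1)"
    using b H fbm_kernel_const_pos[of H1] unfolding lnd_const_def
    by (intro mult_right_mono divide_right_mono powr_mono2) auto
qed (use \<alpha> ball_weight_nonneg ball_weight_le ball_weight_integrable in auto)

text \<open>What remains of the norm's moment bound of order 2m once the powers of b and of the
  length are split off; it depends neither on b nor on the radius of the weight.\<close>

definition moment_const :: "real \<Rightarrow> real \<Rightarrow> nat \<Rightarrow> real" where
  "moment_const lam \<alpha> m = fact (2 * m) * (second_moment_const TYPE(real ^ 'd) lam \<alpha> (lnd_const T * T powr (2 * H1)) H1
      * (1 / (4 * H1 * fbm_kernel_const H1)) powr (-\<alpha>)) ^ m * (1 + 2 / (1 - 2 powr (- (1/2 - \<alpha> * H1)))) ^ (2 * m)"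

text \<open>The m-th power of the energy is the 2m-th power of the norm, and
  \<open>lnd_const b powr (-\<alpha>)\<close> supplies the singularity on the axis.\<close>

lemma slice_energy_moment:
  assumes \<alpha>: "0 < \<alpha>" "2 * \<alpha> * H1 < 1" "real CARD('d) / 2 < \<alpha> - lam" and b: "0 < b" "b \<le> T"
    and st: "0 \<le> s" "s < t" "t \<le> T"
  shows "(\<integral>\<^sup>+\<omega>. ennreal (slice_energy (ball_weight lam R) s t b \<omega> ^ m) \<partial>M)
    \<le> ennreal (moment_const lam \<alpha> m * b powr (- (2 * \<alpha> * H2 * real m)) * (t - s) powr (2 * real m * (1 - \<alpha> * H1)))"
proof -
  interpret L: lnd_weight M "\<lambda>a. W a b" T H1 "lnd_const b" "past b" "ball_weight lam R :: real ^ 'd \<Rightarrow> real" lam \<alpha> "lnd_const T * T powr (2 * H1)"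
    by (rule lnd_weight_slice[OF \<alpha> b])
  have N2: "L.N2 s t \<omega> = slice_energy (ball_weight lam R) s t b \<omega>" for \<omega>
    by (simp add: L.N2_def slice_energy_def L.occ_def slice_ft_def)
  have eq: "L.Nrm s t \<omega> ^ (2 * m) = slice_energy (ball_weight lam R) s t b \<omega> ^ m" for \<omega>
    unfolding power_mult L.Nrm_square N2 ..
  define k0 where "k0 = 1 / (4 * H1 * fbm_kernel_const H1)"
  have k0: "0 < k0" using fbm_kernel_const_pos[of H1] H by (simp add: k0_def)
  have "lnd_const b powr (-\<alpha>) = k0 powr (-\<alpha>) * b powr (- (2 * \<alpha> * H2))"
  proof -
    have "lnd_const b = k0 * b powr (2 * H2)" by (simp add: lnd_const_def k0_def)
    moreover have "2 * H2 * - \<alpha> = - (2 * \<alpha> * H2)" by simp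
    ultimately show ?thesis by (simp only: powr_mult powr_powr)
  qed
  then have B: "L.B = second_moment_const TYPE(real ^ 'd) lam \<alpha> (lnd_const T * T powr (2 * H1)) H1 * k0 powr (-\<alpha>) * b powr (- (2 * \<alpha> * H2))"
    by (simp add: L.B_def)
  have "(\<integral>\<^sup>+\<omega>. ennreal (slice_energy (ball_weight lam R) s t b \<omega> ^ m) \<partial>M)
    \<le> ennreal (fact (2 * m) * (sqrt L.B * (t - s) powr (1 - \<alpha> * H1) * (1 + 2 / (1 - 2 powr (- (1/2 - \<alpha> * H1))))) ^ (2 * m))"
    using L.Nrm_moment[OF st, of "2 * m"] unfolding eq .
  also have "(sqrt L.B * (t - s) powr (1 - \<alpha> * H1) * (1 + 2 / (1 - 2 powr (- (1/2 - \<alpha> * H1))))) ^ (2 * m)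
    = L.B ^ m * (t - s) powr (2 * real m * (1 - \<alpha> * H1)) * (1 + 2 / (1 - 2 powr (- (1/2 - \<alpha> * H1)))) ^ (2 * m)"
  proof -
    have "sqrt L.B ^ (2 * m) = L.B ^ m" using L.B_pos by (simp add: power_mult)
    moreover have "((t - s) powr (1 - \<alpha> * H1)) ^ (2 * m) = (t - s) powr (2 * real m * (1 - \<alpha> * H1))"
      using st by (simp add: powr_realpow[symmetric] powr_powr mult_ac)
    ultimately show ?thesis by (simp add: power_mult_distrib)
  qed
  also have "L.B ^ m = (second_moment_const TYPE(real ^ 'd) lam \<alpha> (lnd_const T * T powr (2 * H1)) H1 * k0 powr (-\<alpha>)) ^ m * b powr (- (2 * \<alpha> * H2 * real m))"
    unfolding B using b by (simp add: power_mult_distrib powr_realpow[symmetric] powr_powr mult_ac)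
  finally show ?thesis by (simp add: moment_const_def k0_def mult_ac)
qed

text \<open>For each b the sum q over all dyadic cells of the first variable controls the Holder
  norm of the slice. The bound for its expectation blows up at b = 0 like a power that the weight in
  Z removes, so Z has a finite mean, uniformly in R. On a path where the supremum of Z over R is
  finite, the integral over b of \<open>b powr (-\<eta>) * Q b powr (1/m)\<close> is split by
  Young's inequality into a deterministic singular integral and a multiple of Z.\<close>

lemma slice_estimate:
  assumes \<alpha>: "0 < \<alpha>" "2 * \<alpha> * H1 < 1" "real CARD('d) / 2 < \<alpha> - lam"
    and m: "2 \<le> m" "2 * \<alpha> * H2 * (real m / (real m - 1)) < 1" and \<gamma>: "0 < 1 - \<alpha> * H1 - 1 / real m"
  shows "AE \<omega> in M. \<exists>C\<ge>0. \<forall>R s1 t1 s2 t2. 0 \<le> s1 \<longrightarrow> s1 < t1 \<longrightarrow> t1 \<le> T \<longrightarrow> 0 \<le> s2 \<longrightarrow> s2 < t2 \<longrightarrow> t2 \<le> T \<longrightarrow>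
    (\<integral>\<^sup>+z. ennreal (ball_weight lam R z * (norm (\<integral>b. slice_ft s1 t1 b z \<omega> \<partial>interval_measure_on s2 t2))\<^sup>2) \<partial>lborel)
      \<le> ennreal (C * (t1 - s1) powr (2 * (1 - \<alpha> * H1 - 1 / real m)) * (t2 - s2) powr (2 * (1 - \<alpha> * H2 - 1 / (2 * real m))))"
proof -
  define \<gamma>1 where "\<gamma>1 = 1 - \<alpha> * H1 - 1 / real m"
  define \<eta> where "\<eta> = 2 * \<alpha> * H2"
  define E where "E R s t b \<omega> = slice_energy (ball_weight lam R) s t b \<omega>" for R s t b \<omega>
  have E_nonneg: "0 \<le> E R s t b \<omega>" for R s t b \<omega>
    unfolding E_def slice_energy_def
    by (intro integral_nonneg_AE AE_I2 mult_nonneg_nonneg ball_weight_nonneg) auto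
  define pt where "pt n k = real k * T / 2 ^ n" for n k :: nat
  \<comment> \<open>The exponent \<open>2 * m * \<gamma>1\<close> equals
    \<open>2 * m * (1 - \<alpha> * H1) - 2\<close>. Of the loss of 2, one unit pays for the
    \<open>2 ^ n\<close> cells and the other makes the sum over n geometric.\<close>
  define q where "q R b \<omega> = (\<Sum>n. ennreal (2 powr (2 * real m * \<gamma>1 * real n)) * (\<Sum>k<2^n. ennreal (E R (pt n k) (pt n (k+1)) b \<omega> ^ m)))" for R b \<omega>
  let ?L = "interval_measure_on 0 T"
  define Z where "Z R \<omega> = (\<integral>\<^sup>+b. ennreal (b powr (\<eta> * real m)) * q R b \<omega> \<partial>?L)" for R \<omega>
  interpret L: finite_measure ?L by (rule finite_interval_measure_on)
  interpret MB: pair_sigma_finite ?L M ..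
  have E_joint: "(\<lambda>p. E R s t (f p) (h p)) \<in> borel_measurable N" if "f \<in> borel_measurable N" "h \<in> measurable N M" for R s t f h and N :: "'z measure"
    unfolding E_def by (rule slice_energy_joint[OF ball_weight_measurable that])
  have q_joint: "(\<lambda>p. q R (f p) (h p)) \<in> borel_measurable N" if "f \<in> borel_measurable N" "h \<in> measurable N M" for R f h and N :: "'z measure"
  proof -
    have [measurable]: "(\<lambda>p. E R s t (f p) (h p)) \<in> borel_measurable N" for s t by (rule E_joint[OF that])
    show ?thesis unfolding q_def by measurable
  qed
  have q_meas[measurable]: "(\<lambda>b. q R b \<omega>) \<in> borel_measurable borel" if "\<omega> \<in> space M" for R \<omega>
    using that by (intro q_joint) auto
  have Z_meas[measurable]: "Z R \<in> borel_measurable M" for R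
  proof -
    have [measurable]: "(\<lambda>p. q R (snd p) (fst p)) \<in> borel_measurable (M \<Otimes>\<^sub>M ?L)"
      by (rule q_joint) measurable
    show ?thesis unfolding Z_def[abs_def]
      by (rule L.borel_measurable_nn_integral) (unfold split_beta', measurable)
  qed
  have E_mono: "E R s t b \<omega> \<le> E R' s t b \<omega>" if "R \<le> R'" "\<omega> \<in> space M" "s \<le> t" for R R' s t b \<omega>
  proof -
    have [measurable]: "(\<lambda>z. slice_ft s t b z \<omega>) \<in> borel_measurable borel"
      using that by (intro slice_ft_joint) auto
    have i: "integrable lborel (\<lambda>z. ball_weight lam R z * (norm (slice_ft s t b z \<omega>))\<^sup>2)" for R
    proof (rule Bochner_Integration.integrable_bound[where f="\<lambda>z. (t - s)\<^sup>2 * ball_weight lam R z"])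
      show "AE z in lborel. norm (ball_weight lam R z * (norm (slice_ft s t b z \<omega>))\<^sup>2) \<le> norm ((t - s)\<^sup>2 * ball_weight lam R z)"
        using slice_ft_norm_le[OF that(2,3)] ball_weight_nonneg[of lam R]
        by (intro AE_I2) (simp add: abs_mult mult.commute mult_left_mono power_mono)
    qed (use ball_weight_integrable in auto)
    show ?thesis unfolding E_def slice_energy_def
      by (rule integral_mono[OF i i]) (intro mult_right_mono ball_weight_mono that, simp)
  qed
  have pt_less: "pt n k < pt n (k + 1)" for n k using T by (simp add: pt_def field_simps)
  have pt_range: "0 \<le> pt n k" "k \<le> 2 ^ n \<Longrightarrow> pt n k \<le> T" for n k
  proof -
    show "0 \<le> pt n k" using T by (simp add: pt_def)
    assume "k \<le> 2 ^ n"
    then have "real k \<le> 2 ^ n" by (metis of_nat_le_iff of_nat_numeral of_nat_power)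
    then have "real k * T \<le> 2 ^ n * T" using T by (intro mult_right_mono) auto
    then show "pt n k \<le> T" by (simp add: pt_def field_simps)
  qed
  have Z_mono: "Z R \<omega> \<le> Z R' \<omega>" if "R \<le> R'" "\<omega> \<in> space M" for R R' \<omega>
    unfolding Z_def q_def
    by (intro nn_integral_mono mult_left_mono suminf_le sum_mono ennreal_leI power_mono E_mono E_nonneg that)
       (auto intro: less_imp_le pt_less[simplified])
  define D where "D = moment_const lam \<alpha> m * T powr (2 * real m * (1 - \<alpha> * H1))"
  have D0: "0 \<le> moment_const lam \<alpha> m"
  proof -
    have "0 \<le> second_moment_const TYPE(real ^ 'd) lam \<alpha> (lnd_const T * T powr (2 * H1)) H1"
      using \<alpha> by (simp add: second_moment_const_def bracket_const_def)
    moreover have "(2::real) powr (- (1/2 - \<alpha> * H1)) < 1"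
      using \<alpha> powr_less_mono[of "- (1/2 - \<alpha> * H1)" 0 2] by simp
    ultimately show ?thesis unfolding moment_const_def
      by (intro mult_nonneg_nonneg zero_le_power) auto
  qed
  \<comment> \<open>The weight cancels the power of b exactly; the factor 2 is the sum of the
    geometric series.\<close>
  have qE: "(\<integral>\<^sup>+\<omega>. ennreal (b powr (\<eta> * real m)) * q R b \<omega> \<partial>M) \<le> ennreal (2 * D)" if b: "0 < b" "b \<le> T" for R b
  proof -
    have [measurable]: "E R s t b \<in> borel_measurable M" for s t
      using E_joint[of "\<lambda>_. b" M "\<lambda>\<omega>. \<omega>" R s t] by simp
    have qm: "q R b \<in> borel_measurable M" using q_joint[of "\<lambda>_. b" M "\<lambda>\<omega>. \<omega>" R] by simp
    have "(\<integral>\<^sup>+\<omega>. q R b \<omega> \<partial>M) = (\<Sum>n. ennreal (2 powr (2 * real m * \<gamma>1 * real n)) * (\<Sum>k<2^n. \<integral>\<^sup>+\<omega>. ennreal (E R (pt n k) (pt n (k+1)) b \<omega> ^ m) \<partial>M))"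
      unfolding q_def by (simp add: nn_integral_suminf nn_integral_cmult nn_integral_sum)
    also have "\<dots> \<le> (\<Sum>n. ennreal (D * b powr (- (\<eta> * real m)) * (1/2) ^ n))"
    proof (rule suminf_le)
      fix n
      have len: "pt n (k + 1) - pt n k = T / 2 ^ n" for k by (simp add: pt_def field_simps)
      define y where "y = moment_const lam \<alpha> m * b powr (- (\<eta> * real m)) * (T / 2 ^ n) powr (2 * real m * (1 - \<alpha> * H1))"
      have y0: "0 \<le> y" using D0 by (simp add: y_def)
      have "(\<Sum>k<2^n. \<integral>\<^sup>+\<omega>. ennreal (E R (pt n k) (pt n (k+1)) b \<omega> ^ m) \<partial>M) \<le> (\<Sum>k<(2::nat)^n. ennreal y)"
      proof (rule sum_mono)
        fix k :: nat assume "k \<in> {..<2^n}"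
        then show "(\<integral>\<^sup>+\<omega>. ennreal (E R (pt n k) (pt n (k+1)) b \<omega> ^ m) \<partial>M) \<le> ennreal y"
          using slice_energy_moment[OF \<alpha> b, of "pt n k" "pt n (k + 1)" R m] pt_range pt_less[of n k]
          unfolding E_def len y_def \<eta>_def by simp
      qed
      also have "\<dots> = ennreal (2 ^ n * y)" using y0 by (simp add: ennreal_mult ennreal_of_nat_eq_real_of_nat)
      finally have "ennreal (2 powr (2 * real m * \<gamma>1 * real n)) * (\<Sum>k<2^n. \<integral>\<^sup>+\<omega>. ennreal (E R (pt n k) (pt n (k+1)) b \<omega> ^ m) \<partial>M)
         \<le> ennreal (2 powr (2 * real m * \<gamma>1 * real n)) * ennreal (2 ^ n * y)" by (rule mult_left_mono) simp
      also have "\<dots> = ennreal (2 powr (2 * real m * \<gamma>1 * real n) * (2 ^ n * y))"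
        using y0 by (subst ennreal_mult) auto
      also have "2 powr (2 * real m * \<gamma>1 * real n) * (2 ^ n * y) = D * b powr (- (\<eta> * real m)) * (1/2) ^ n"
      proof -
        define x where "x = 2 * real m * (1 - \<alpha> * H1)"
        have e: "2 * real m * \<gamma>1 = x - 2" using m by (simp add: \<gamma>1_def x_def field_simps)
        have "(T / 2 ^ n) powr x = T powr x * 2 powr (- (x * real n))"
          using T by (simp add: powr_divide powr_realpow[symmetric] powr_powr powr_minus_divide mult.commute)
        moreover have "2 powr ((x - 2) * real n) * 2 ^ n * 2 powr (- (x * real n)) = (1/2) ^ n"
        proof -
          have "2 powr ((x - 2) * real n) * 2 ^ n * 2 powr (- (x * real n)) = 2 powr ((x - 2) * real n + real n + - (x * real n))"
            unfolding powr_add by (simp add: powr_realpow)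
          also have "(x - 2) * real n + real n + - (x * real n) = - real n" by (simp add: algebra_simps)
          finally show ?thesis by (simp add: powr_minus powr_realpow power_one_over inverse_eq_divide)
        qed
        ultimately show ?thesis unfolding y_def D_def x_def[symmetric] e by (simp add: mult_ac)
      qed
      finally show "ennreal (2 powr (2 * real m * \<gamma>1 * real n)) * (\<Sum>k<2^n. \<integral>\<^sup>+\<omega>. ennreal (E R (pt n k) (pt n (k+1)) b \<omega> ^ m) \<partial>M) \<le> ennreal (D * b powr (- (\<eta> * real m)) * (1/2) ^ n)" .
    qed auto
    also have "\<dots> = ennreal (\<Sum>n. D * b powr (- (\<eta> * real m)) * (1/2) ^ n)"
      using D0 by (intro suminf_ennreal2) (auto simp: D_def intro!: summable_mult summable_geometric)
    also have "(\<Sum>n. D * b powr (- (\<eta> * real m)) * (1/2) ^ n) = D * b powr (- (\<eta> * real m)) * 2"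
      by (subst suminf_mult) (auto simp: suminf_geometric intro!: summable_geometric)
    finally have "ennreal (b powr (\<eta> * real m)) * (\<integral>\<^sup>+\<omega>. q R b \<omega> \<partial>M) \<le> ennreal (b powr (\<eta> * real m)) * ennreal (D * b powr (- (\<eta> * real m)) * 2)"
      by (rule mult_left_mono) simp
    also have "\<dots> = ennreal (b powr (\<eta> * real m) * (D * b powr (- (\<eta> * real m)) * 2))"
      using D0 by (subst ennreal_mult) (auto simp: D_def)
    also have "b powr (\<eta> * real m) * (D * b powr (- (\<eta> * real m)) * 2) = 2 * D"
      using b by (simp add: powr_minus)
    finally show ?thesis using qm by (simp add: nn_integral_cmult)
  qed
  have ZE: "(\<integral>\<^sup>+\<omega>. Z R \<omega> \<partial>M) \<le> ennreal (2 * D * T)" for R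
  proof -
    have [measurable]: "(\<lambda>p. q R (fst p) (snd p)) \<in> borel_measurable (?L \<Otimes>\<^sub>M M)"
      by (rule q_joint) measurable
    have "(\<integral>\<^sup>+\<omega>. Z R \<omega> \<partial>M) = (\<integral>\<^sup>+b. \<integral>\<^sup>+\<omega>. ennreal (b powr (\<eta> * real m)) * q R b \<omega> \<partial>M \<partial>?L)"
      unfolding Z_def by (rule MB.Fubini') (unfold split_beta', measurable)
    also have "\<dots> \<le> (\<integral>\<^sup>+b. ennreal (2 * D) \<partial>?L)"
    proof (rule nn_integral_mono_AE)
      show "AE b in ?L. (\<integral>\<^sup>+\<omega>. ennreal (b powr (\<eta> * real m)) * q R b \<omega> \<partial>M) \<le> ennreal (2 * D)"
        unfolding AE_interval_measure_on using AE_lborel_singleton[of 0]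
        by eventually_elim (use qE in auto)
    qed
    also have "\<dots> = ennreal (2 * D * T)"
      using T D0 emeasure_interval_measure_on[of 0 T] by (simp add: ennreal_mult[symmetric] D_def)
    finally show ?thesis .
  qed
  \<comment> \<open>The energies increase with R, so monotone convergence yields one exceptional set
    for all radii.\<close>
  have "(\<integral>\<^sup>+\<omega>. (SUP R. Z R \<omega>) \<partial>M) = (SUP R. \<integral>\<^sup>+\<omega>. Z R \<omega> \<partial>M)"
    by (rule nn_integral_monotone_convergence_SUP_AE) (auto intro!: AE_I2 Z_mono)
  also have "\<dots> \<le> ennreal (2 * D * T)" using ZE by (intro SUP_least)
  finally have "(\<integral>\<^sup>+\<omega>. (SUP R. Z R \<omega>) \<partial>M) \<noteq> \<infinity>" by (auto simp: top_unique)
  then have "AE \<omega> in M. (SUP R. Z R \<omega>) \<noteq> \<infinity>" by (intro nn_integral_PInf_AE) auto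
  then show ?thesis
    using AE_space
  proof eventually_elim
    case (elim \<omega>)
    note \<omega> = \<open>\<omega> \<in> space M\<close>
    define Cz where "Cz = enn2real (SUP R. Z R \<omega>)"
    have Cz: "Z R \<omega> \<le> ennreal Cz" for R
    proof -
      have "(SUP R. Z R \<omega>) < \<top>" using elim(1) unfolding infinity_ennreal_def by (simp only: less_top)
      from ennreal_enn2real[OF this] show ?thesis
        unfolding Cz_def by (simp only: SUP_upper[of R UNIV "\<lambda>R. Z R \<omega>"] UNIV_I)
    qed
    have Cz0: "0 \<le> Cz" by (simp add: Cz_def)
    define hc where "hc = 2 * (2 / T) powr \<gamma>1 / (1 - 2 powr (-\<gamma>1))"
    define q' where "q' = real m / (real m - 1)"
    define c2 where "c2 = 2 / (1 - \<eta> * q')"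
    have \<eta>q: "\<eta> * q' < 1" using m(2) by (simp add: \<eta>_def q'_def)
    have \<eta>0: "0 < \<eta>" using \<alpha> H by (simp add: \<eta>_def)
    have q'1: "1 < q'" using m by (simp add: q'_def)
    have c20: "0 \<le> c2" using \<eta>q by (simp add: c2_def)
    have main: "(\<integral>\<^sup>+z. ennreal (ball_weight lam R z * (norm (\<integral>b. slice_ft s1 t1 b z \<omega> \<partial>interval_measure_on s2 t2))\<^sup>2) \<partial>lborel)
      \<le> ennreal (hc\<^sup>2 * (c2 + Cz) * (t1 - s1) powr (2 * \<gamma>1) * (t2 - s2) powr (2 * (1 - \<alpha> * H2 - 1 / (2 * real m))))"
      if st: "0 \<le> s1" "s1 < t1" "t1 \<le> T" "0 \<le> s2" "s2 < t2" "t2 \<le> T" for R s1 t1 s2 t2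
    proof -
      \<comment> \<open>Infinite values become 0 here; bounds through Q are claimed only where the
        argument is finite, that is for almost every b.\<close>
      define Q where "Q b = enn2real (ennreal (b powr (\<eta> * real m)) * q R b \<omega>)" for b
      have Q0: "0 \<le> Q b" for b by (simp add: Q_def)
      have [measurable]: "Q \<in> borel_measurable borel" unfolding Q_def[abs_def] using q_meas[OF \<omega>] by measurable
      have "Z R \<omega> \<noteq> \<infinity>" using Cz[of R] by (auto simp: top_unique)
      then have "AE b in ?L. ennreal (b powr (\<eta> * real m)) * q R b \<omega> \<noteq> \<infinity>"
        unfolding Z_def using q_meas[OF \<omega>] by (intro nn_integral_PInf_AE) auto
      then have fin: "AE b in lborel. b \<in> {0..T} \<longrightarrow> ennreal (b powr (\<eta> * real m)) * q R b \<omega> \<noteq> \<infinity>"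
        unfolding AE_interval_measure_on .
      have Ebound: "E R s1 t1 b \<omega> \<le> hc\<^sup>2 * (t1 - s1) powr (2 * \<gamma>1) * (b powr (-\<eta>) * Q b powr (1 / real m))"
        if b: "0 < b" "b \<le> T" and fb: "ennreal (b powr (\<eta> * real m)) * q R b \<omega> \<noteq> \<infinity>" for b
      proof -
        interpret S: lnd_weight M "\<lambda>a. W a b" T H1 "lnd_const b" "past b" "ball_weight lam R :: real ^ 'd \<Rightarrow> real" lam \<alpha> "lnd_const T * T powr (2 * H1)"
          by (rule lnd_weight_slice[OF \<alpha> b])
        have N2: "S.N2 s t \<omega> = E R s t b \<omega>" for s t
          by (simp add: S.N2_def E_def slice_energy_def S.occ_def slice_ft_def)
        \<comment> \<open>X bounds the dyadic energies up to the power of the mesh; its square root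
          is the constant given to \<open>holder_from_dyadic\<close>.\<close>
        define X where "X = b powr (-\<eta>) * Q b powr (1 / real m)"
        have X0: "0 \<le> X" by (simp add: X_def)
        have dy: "E R (pt n k) (pt n (k+1)) b \<omega> \<le> X * 2 powr (- (2 * \<gamma>1 * real n))" if k: "k < 2 ^ n" for n k
        proof -
          define e where "e = E R (pt n k) (pt n (k+1)) b \<omega>"
          \<comment> \<open>A single cell is bounded by the whole sum q; the m-th root is taken at
            the end.\<close>
          have "ennreal (e ^ m) \<le> (\<Sum>k<2^n. ennreal (E R (pt n k) (pt n (k+1)) b \<omega> ^ m))"
            unfolding e_def using k by (intro member_le_sum) auto
          then have "ennreal (2 powr (2 * real m * \<gamma>1 * real n)) * ennreal (e ^ m) \<le> ennreal (2 powr (2 * real m * \<gamma>1 * real n)) * (\<Sum>k<2^n. ennreal (E R (pt n k) (pt n (k+1)) b \<omega> ^ m))"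
            by (rule mult_left_mono) simp
          also have "\<dots> \<le> q R b \<omega>" unfolding q_def
            using sum_le_suminf[of "\<lambda>n. ennreal (2 powr (2 * real m * \<gamma>1 * real n)) * (\<Sum>k<2^n. ennreal (E R (pt n k) (pt n (k+1)) b \<omega> ^ m))" "{n}"] by simp
          finally have "ennreal (b powr (\<eta> * real m)) * (ennreal (2 powr (2 * real m * \<gamma>1 * real n)) * ennreal (e ^ m)) \<le> ennreal (b powr (\<eta> * real m)) * q R b \<omega>"
            by (rule mult_left_mono) simp
          also have "\<dots> = ennreal (Q b)" unfolding Q_def using fb by (simp add: less_top)
          finally have "ennreal (b powr (\<eta> * real m) * (2 powr (2 * real m * \<gamma>1 * real n) * e ^ m)) \<le> ennreal (Q b)"
            using E_nonneg by (simp add: ennreal_mult e_def)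
          then have le: "b powr (\<eta> * real m) * (2 powr (2 * real m * \<gamma>1 * real n) * e ^ m) \<le> Q b"
            using Q0 by (simp add: ennreal_le_iff)
          have "(b powr \<eta> * 2 powr (2 * \<gamma>1 * real n) * e) ^ m \<le> (Q b powr (1 / real m)) ^ m"
          proof -
            have "(Q b powr (1 / real m)) ^ m = Q b"
            proof (cases "Q b = 0")
              case True then show ?thesis using m by (simp add: power_0_left)
            next
              case False
              then show ?thesis using Q0[of b] m by (simp add: powr_realpow[symmetric] powr_powr)
            qed
            moreover have "(b powr \<eta> * 2 powr (2 * \<gamma>1 * real n) * e) ^ m = b powr (\<eta> * real m) * (2 powr (2 * real m * \<gamma>1 * real n) * e ^ m)"
              using b by (simp add: power_mult_distrib powr_realpow[symmetric] powr_powr mult_ac)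
            ultimately show ?thesis using le by simp
          qed
          then have "b powr \<eta> * 2 powr (2 * \<gamma>1 * real n) * e \<le> Q b powr (1 / real m)"
            using power_le_imp_le_base[of "b powr \<eta> * 2 powr (2 * \<gamma>1 * real n) * e" "m - 1" "Q b powr (1 / real m)"] m
            by simp
          then show ?thesis unfolding e_def[symmetric] X_def using b
            by (simp add: powr_minus field_simps)
        qed
        have "S.Nrm s1 t1 \<omega> \<le> sqrt X * (2 * (2 / T) powr \<gamma>1 / (1 - 2 powr (-\<gamma>1))) * (t1 - s1) powr \<gamma>1"
        proof (rule holder_from_dyadic[where N="\<lambda>s t. S.Nrm s t \<omega>" and W="sqrt (integral\<^sup>L lborel (ball_weight lam R :: real ^ 'd \<Rightarrow> real))"])
          fix n k :: nat assume "k < 2 ^ n"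
          then have "S.Nrm (pt n k) (pt n (k + 1)) \<omega> \<le> sqrt (X * 2 powr (- (2 * \<gamma>1 * real n)))"
            unfolding S.Nrm_def N2 using dy by (intro real_sqrt_le_mono) auto
          also have "\<dots> = sqrt X * 2 powr (- \<gamma>1 * real n)"
          proof -
            have "2 powr (- (2 * \<gamma>1 * real n)) = (2 powr (- \<gamma>1 * real n))\<^sup>2"
              by (simp add: power2_eq_square powr_add[symmetric] mult.assoc)
            then show ?thesis by (simp add: real_sqrt_mult)
          qed
          finally show "S.Nrm (real k * T / 2 ^ n) (real (k + 1) * T / 2 ^ n) \<omega> \<le> sqrt X * 2 powr (- \<gamma>1 * real n)"
            by (simp add: pt_def)
        qed (use T \<gamma> X0 st S.Nrm_triangle[OF \<omega>] S.Nrm_le[OF \<omega>] in \<open>auto simp: \<gamma>1_def\<close>)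
        then have "(S.Nrm s1 t1 \<omega>)\<^sup>2 \<le> (sqrt X * hc * (t1 - s1) powr \<gamma>1)\<^sup>2"
          unfolding hc_def by (intro power_mono S.Nrm_nonneg) auto
        also have "\<dots> = X * hc\<^sup>2 * (t1 - s1) powr (2 * \<gamma>1)"
        proof -
          have "((t1 - s1) powr \<gamma>1)\<^sup>2 = (t1 - s1) powr (2 * \<gamma>1)" by (simp add: power2_eq_square powr_add[symmetric])
          then show ?thesis using X0 by (simp add: power_mult_distrib)
        qed
        finally show ?thesis unfolding S.Nrm_square N2 X_def by (simp add: mult_ac)
      qed
      define \<Delta> where "\<Delta> = t2 - s2"
      have \<Delta>: "0 < \<Delta>" using st by (simp add: \<Delta>_def)
      \<comment> \<open>With this e, the choice of \<tau> gives both terms of Young's inequality the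
        same power \<open>\<Delta> powr e\<close>.\<close>
      define e where "e = 1 - 1 / real m - \<eta>"
      define \<tau> where "\<tau> = \<Delta> powr (- e / real m)"
      have \<tau>: "0 < \<tau>" using \<Delta> by (simp add: \<tau>_def)
      have \<tau>1: "\<tau> powr (- real m) = \<Delta> powr e" using m by (simp add: \<tau>_def powr_powr)
      have \<tau>2: "\<tau> powr q' * \<Delta> powr (1 - \<eta> * q') = \<Delta> powr e"
      proof -
        have "- e / real m * q' + (1 - \<eta> * q') = e"
        proof -
          have 1: "q' * (1 - 1 / real m) = 1" "q' / real m = q' - 1" using m by (simp_all add: q'_def field_simps)
          have "q' * e = q' * (1 - 1 / real m) - \<eta> * q'" unfolding e_def by (simp add: algebra_simps)
          then have "1 - \<eta> * q' = q' * e" using 1 by simp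
          moreover have "- e / real m * q' = - e * (q' / real m)" by simp
          ultimately show ?thesis unfolding 1(2) by (simp add: algebra_simps)
        qed
        then show ?thesis by (simp add: \<tau>_def powr_powr powr_add[symmetric])
      qed
      define h where "h = hc\<^sup>2 * (t1 - s1) powr (2 * \<gamma>1)"
      have h0: "0 \<le> h" by (simp add: h_def)
      have Em: "(\<lambda>b. E R s t b \<omega>) \<in> borel_measurable borel" for s t
        using \<omega> by (intro E_joint) auto
      have "(\<integral>\<^sup>+b. ennreal (E R s1 t1 b \<omega>) \<partial>interval_measure_on s2 t2)
         = (\<integral>\<^sup>+b. ennreal (E R s1 t1 b \<omega>) * indicator {s2..t2} b \<partial>lborel)"
        using Em by (intro nn_integral_interval_measure_on) measurable
      also have "\<dots> \<le> (\<integral>\<^sup>+b. ennreal (h * \<tau> powr q') * (ennreal (\<bar>b - s2\<bar> powr (- (\<eta> * q'))) * indicator {s2..t2} b) + ennreal (h * \<tau> powr (- real m)) * (ennreal (b powr (\<eta> * real m)) * q R b \<omega> * indicator {0..T} b) \<partial>lborel)"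
      proof (rule nn_integral_mono_AE)
        show "AE b in lborel. ennreal (E R s1 t1 b \<omega>) * indicator {s2..t2} b \<le> ennreal (h * \<tau> powr q') * (ennreal (\<bar>b - s2\<bar> powr (- (\<eta> * q'))) * indicator {s2..t2} b) + ennreal (h * \<tau> powr (- real m)) * (ennreal (b powr (\<eta> * real m)) * q R b \<omega> * indicator {0..T} b)"
          using fin AE_lborel_singleton[of s2]
        proof eventually_elim
          case (elim b)
          show ?case
          proof (cases "b \<in> {s2..t2}")
            case True
            then have b: "0 < b" "b \<le> T" "s2 < b" using elim st by auto
            have fb: "ennreal (b powr (\<eta> * real m)) * q R b \<omega> \<noteq> \<infinity>" using elim b by auto
            have "E R s1 t1 b \<omega> \<le> h * (b powr (-\<eta>) * Q b powr (1 / real m))"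
              unfolding h_def by (rule Ebound[OF b(1,2) fb])
            also have "\<dots> \<le> h * (\<tau> powr q' * (b powr (-\<eta>)) powr q' + \<tau> powr (- real m) * Q b)"
              unfolding q'_def using h0 Q0 \<tau> m by (intro mult_left_mono mult_le_young) auto
            \<comment> \<open>Moving the singularity from 0 to s2 makes the integral depend on the
              length only; the interval at the axis is the worst one.\<close>
            also have "(b powr (-\<eta>)) powr q' \<le> \<bar>b - s2\<bar> powr (- (\<eta> * q'))"
              using b st \<eta>0 q'1 by (auto simp: powr_powr intro!: powr_mono2')
            finally have "E R s1 t1 b \<omega> \<le> h * (\<tau> powr q' * \<bar>b - s2\<bar> powr (- (\<eta> * q')) + \<tau> powr (- real m) * Q b)"
              using h0 by (simp add: mult_left_mono)
            then have "ennreal (E R s1 t1 b \<omega>) \<le> ennreal (h * \<tau> powr q' * \<bar>b - s2\<bar> powr (- (\<eta> * q')) + h * \<tau> powr (- real m) * Q b)"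
              by (intro ennreal_leI) (simp add: algebra_simps)
            also have "\<dots> = ennreal (h * \<tau> powr q') * ennreal (\<bar>b - s2\<bar> powr (- (\<eta> * q'))) + ennreal (h * \<tau> powr (- real m)) * ennreal (Q b)"
              using h0 Q0 by (simp add: ennreal_plus ennreal_mult)
            also have "ennreal (Q b) = ennreal (b powr (\<eta> * real m)) * q R b \<omega>"
              unfolding Q_def using fb by (simp add: less_top)
            finally show ?thesis using True b by simp
          qed simp
        qed
      qed
      also have "\<dots> = ennreal (h * \<tau> powr q') * (\<integral>\<^sup>+b. ennreal (\<bar>b - s2\<bar> powr (- (\<eta> * q'))) * indicator {s2..t2} b \<partial>lborel) + ennreal (h * \<tau> powr (- real m)) * (\<integral>\<^sup>+b. ennreal (b powr (\<eta> * real m)) * q R b \<omega> * indicator {0..T} b \<partial>lborel)"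
        using q_meas[OF \<omega>] by (subst nn_integral_add) (auto simp: nn_integral_cmult)
      also have "(\<integral>\<^sup>+b. ennreal (b powr (\<eta> * real m)) * q R b \<omega> * indicator {0..T} b \<partial>lborel) = Z R \<omega>"
        unfolding Z_def by (intro nn_integral_interval_measure_on[symmetric] borel_measurable_times_ennreal q_meas[OF \<omega>]) measurable
      also have "ennreal (h * \<tau> powr q') * (\<integral>\<^sup>+b. ennreal (\<bar>b - s2\<bar> powr (- (\<eta> * q'))) * indicator {s2..t2} b \<partial>lborel) + ennreal (h * \<tau> powr (- real m)) * Z R \<omega>
         \<le> ennreal (h * \<tau> powr q') * ennreal (2 * (t2 - s2) powr (1 - \<eta> * q') / (1 - \<eta> * q')) + ennreal (h * \<tau> powr (- real m)) * ennreal Cz"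
        using st \<eta>q by (intro add_mono mult_left_mono nn_integral_powr_dist Cz) auto
      also have "\<dots> = ennreal (h * \<tau> powr q' * (2 * \<Delta> powr (1 - \<eta> * q') / (1 - \<eta> * q')) + h * \<tau> powr (- real m) * Cz)"
      proof -
        have nn: "0 \<le> h * \<tau> powr q'" "0 \<le> 2 * \<Delta> powr (1 - \<eta> * q') / (1 - \<eta> * q')" "0 \<le> h * \<tau> powr (- real m)"
          using h0 \<eta>q by auto
        show ?thesis
          unfolding \<Delta>_def[symmetric]
          by (simp only: ennreal_mult[OF nn(1,2)] ennreal_mult[OF nn(3) Cz0]
              ennreal_plus[OF mult_nonneg_nonneg[OF nn(1,2)] mult_nonneg_nonneg[OF nn(3) Cz0]])
      qed
      also have "h * \<tau> powr q' * (2 * \<Delta> powr (1 - \<eta> * q') / (1 - \<eta> * q')) + h * \<tau> powr (- real m) * Cz = h * (c2 + Cz) * \<Delta> powr e"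
      proof -
        have "h * \<tau> powr q' * (2 * \<Delta> powr (1 - \<eta> * q') / (1 - \<eta> * q')) = h * c2 * (\<tau> powr q' * \<Delta> powr (1 - \<eta> * q'))"
          by (simp add: c2_def)
        then show ?thesis unfolding \<tau>1 \<tau>2 by (simp add: algebra_simps)
      qed
      finally have Eint: "(\<integral>\<^sup>+b. ennreal (E R s1 t1 b \<omega>) \<partial>interval_measure_on s2 t2) \<le> ennreal (h * (c2 + Cz) * \<Delta> powr e)" .
      have "(\<integral>\<^sup>+z. ennreal (ball_weight lam R z * (norm (\<integral>b. slice_ft s1 t1 b z \<omega> \<partial>interval_measure_on s2 t2))\<^sup>2) \<partial>lborel)
        \<le> ennreal (t2 - s2) * (\<integral>\<^sup>+b. ennreal (E R s1 t1 b \<omega>) \<partial>interval_measure_on s2 t2)"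
        unfolding E_def using st by (intro rectangle_le_slices \<omega> ball_weight_measurable ball_weight_nonneg ball_weight_integrable) auto
      also have "\<dots> \<le> ennreal \<Delta> * ennreal (h * (c2 + Cz) * \<Delta> powr e)"
        unfolding \<Delta>_def[symmetric] by (intro mult_left_mono Eint) simp
      also have "\<dots> = ennreal (h * (c2 + Cz) * (\<Delta> * \<Delta> powr e))"
        using \<Delta> h0 c20 Cz0 by (simp add: ennreal_mult[symmetric] mult_ac)
      \<comment> \<open>The factor from Cauchy--Schwarz raises e to 1 + e, twice the exponent of the
        norm.\<close>
      also have "\<Delta> * \<Delta> powr e = \<Delta> powr (2 * (1 - \<alpha> * H2 - 1 / (2 * real m)))"
      proof -
        have "2 * (1 - \<alpha> * H2 - 1 / (2 * real m)) = 1 + e" using m by (simp add: e_def \<eta>_def field_simps)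
        then show ?thesis using \<Delta> by (simp only: powr_add) simp
      qed
      finally show ?thesis by (simp add: h_def \<Delta>_def mult_ac)
    qed
    show ?case
      by (rule exI[of _ "hc\<^sup>2 * (c2 + Cz)"]) (use main c20 Cz0 in \<open>auto simp: \<gamma>1_def\<close>)
  qed
qed

end

section \<open>Absolute continuity of the occupation measure\<close>

text \<open>Cubes rather than balls: closeness in all coordinates is an intersection of events for
  the independent components.\<close>

definition cube :: "'b::euclidean_space \<Rightarrow> real \<Rightarrow> 'b set" where
  "cube y e = {x. \<forall>i\<in>Basis. \<bar>x \<bullet> i - y \<bullet> i\<bar> \<le> e / 2}"

lemma cube_eq_cbox: "cube y e = cbox (y - (e / 2) *\<^sub>R One) (y + (e / 2) *\<^sub>R One)"
  unfolding cube_def cbox_def abs_diff_le_iff by (auto simp: inner_simps)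

lemma emeasure_cube: "0 \<le> e \<Longrightarrow> emeasure lborel (cube (y :: 'b::euclidean_space) e) = ennreal (e ^ DIM('b))"
  unfolding cube_eq_cbox by (subst emeasure_lborel_cbox) (auto simp: inner_simps)

lemma cube_sets [measurable]: "cube y e \<in> sets borel"
  by (simp add: cube_eq_cbox)

text \<open>Mollifying \<open>\<nu>\<close> by small cubes gives densities that are bounded in \<open>L\<^sup>2\<close>, since the squared
  norm is controlled by the collision probability.\<close>

lemma absolutely_continuous_if_collisions:
  fixes \<nu> :: "'b::euclidean_space measure"
  assumes fin: "finite_measure \<nu>" and [measurable_cong]: "sets \<nu> = sets borel"
    and e: "\<And>n. 0 < e n" "e \<longlonglongrightarrow> 0"
    and C: "0 \<le> C" "\<And>n. (\<integral>\<^sup>+x. \<integral>\<^sup>+y. indicator {x. \<forall>i\<in>Basis. \<bar>x \<bullet> i\<bar> \<le> e n} (x - y) \<partial>\<nu> \<partial>\<nu>) \<le> ennreal (C * e n ^ DIM('b))"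
    and N: "N \<in> sets borel" "emeasure lborel N = 0"
  shows "emeasure \<nu> N = 0"
proof -
  interpret \<nu>: finite_measure \<nu> by fact
  interpret P: pair_sigma_finite \<nu> "lborel :: 'b measure" ..
  have cm: "{p. snd p \<in> cube (fst p) d} \<in> sets (borel \<Otimes>\<^sub>M (borel :: 'b measure))" for d
  proof -
    have "{p \<in> space (borel \<Otimes>\<^sub>M (borel :: 'b measure)). \<forall>i\<in>Basis. \<bar>snd p \<bullet> i - fst p \<bullet> i\<bar> \<le> d / 2} \<in> sets (borel \<Otimes>\<^sub>M borel)"
      by (rule sets.sets_Collect_finite_All) auto
    then show ?thesis by (simp add: cube_def space_pair_measure)
  qed
  have cmeas[measurable]: "(\<lambda>p. indicator (cube (f p) d) (g p) :: ennreal) \<in> borel_measurable K"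
    if [measurable]: "f \<in> borel_measurable K" "g \<in> borel_measurable K" for f g :: "'z \<Rightarrow> 'b" and d and K :: "'z measure"
  proof -
    have 1: "(\<lambda>p. (f p, g p)) \<in> measurable K (borel \<Otimes>\<^sub>M borel)" by measurable
    have 2: "(\<lambda>q. indicator {p::'b \<times> 'b. snd p \<in> cube (fst p) d} q :: ennreal) \<in> borel_measurable (borel \<Otimes>\<^sub>M borel)"
      using cm[of d] by simp
    show ?thesis using measurable_compose[OF 1 2] by (simp add: indicator_def)
  qed
  define D where "D = DIM('b)"
  \<comment> \<open>The mollified measure without the factor \<open>1 / e n ^ D\<close>.\<close>
  define G where "G n x = (\<integral>\<^sup>+y. indicator (cube y (e n)) x \<partial>\<nu>)" for n x
  have Gm[measurable]: "G n \<in> borel_measurable borel" for n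
    unfolding G_def[abs_def] by (rule \<nu>.borel_measurable_nn_integral) (unfold split_beta', measurable)
  have Gfin: "G n x \<le> emeasure \<nu> UNIV" for n x
  proof -
    have "G n x \<le> (\<integral>\<^sup>+y. 1 \<partial>\<nu>)" unfolding G_def by (intro nn_integral_mono) (auto simp: indicator_def)
    also have "\<dots> = emeasure \<nu> UNIV" using sets_eq_imp_space_eq[OF assms(2)] by simp
    finally show ?thesis .
  qed
  have "UNIV = space \<nu>" using sets_eq_imp_space_eq[OF assms(2)] by simp
  then have Gtop: "G n x \<noteq> \<top>" for n x
    using order.strict_trans1[OF Gfin \<nu>.emeasure_finite[of UNIV, unfolded less_top]] by (simp add: less_top)
  have coll: "(\<integral>\<^sup>+x. G n x * G n x \<partial>lborel) \<le> ennreal (C * (e n ^ D) * (e n ^ D))" for n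
  proof -
    have "(\<integral>\<^sup>+x. G n x * G n x \<partial>lborel) = (\<integral>\<^sup>+x. \<integral>\<^sup>+y. indicator (cube y (e n)) x * G n x \<partial>\<nu> \<partial>lborel)"
      unfolding G_def[of n] by (intro nn_integral_cong nn_integral_multc[symmetric]) measurable
    also have "\<dots> = (\<integral>\<^sup>+y. \<integral>\<^sup>+x. indicator (cube y (e n)) x * G n x \<partial>lborel \<partial>\<nu>)"
      by (rule P.Fubini') (unfold split_beta', measurable)
    also have "\<dots> = (\<integral>\<^sup>+y. \<integral>\<^sup>+x. \<integral>\<^sup>+y'. indicator (cube y (e n)) x * indicator (cube y' (e n)) x \<partial>\<nu> \<partial>lborel \<partial>\<nu>)"
      unfolding G_def by (intro nn_integral_cong nn_integral_cmult[symmetric]) measurable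
    also have "\<dots> = (\<integral>\<^sup>+y. \<integral>\<^sup>+y'. \<integral>\<^sup>+x. indicator (cube y (e n)) x * indicator (cube y' (e n)) x \<partial>lborel \<partial>\<nu> \<partial>\<nu>)"
      by (intro nn_integral_cong P.Fubini') (unfold split_beta', measurable)
    \<comment> \<open>Two cubes of edge \<open>e n\<close> meet only if their centres differ by at
      most \<open>e n\<close> in each coordinate, and the overlap is at most one cube.\<close>
    also have "\<dots> \<le> (\<integral>\<^sup>+y. \<integral>\<^sup>+y'. ennreal (e n ^ D) * indicator {x. \<forall>i\<in>Basis. \<bar>x \<bullet> i\<bar> \<le> e n} (y - y') \<partial>\<nu> \<partial>\<nu>)"
    proof (intro nn_integral_mono)
      fix y y' :: 'b
      show "(\<integral>\<^sup>+x. indicator (cube y (e n)) x * indicator (cube y' (e n)) x \<partial>lborel) \<le> ennreal (e n ^ D) * indicator {x. \<forall>i\<in>Basis. \<bar>x \<bullet> i\<bar> \<le> e n} (y - y')"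
      proof (cases "\<forall>i\<in>Basis. \<bar>(y - y') \<bullet> i\<bar> \<le> e n")
        case True
        have "(\<integral>\<^sup>+x. indicator (cube y (e n)) x * indicator (cube y' (e n)) x \<partial>lborel) \<le> (\<integral>\<^sup>+x. indicator (cube y (e n)) x \<partial>lborel)"
          by (intro nn_integral_mono) (auto simp: indicator_def)
        then show ?thesis using True e(1)[of n] by (simp add: emeasure_cube D_def)
      next
        case False
        then obtain i where i: "i \<in> Basis" "e n < \<bar>(y - y') \<bullet> i\<bar>" by (auto simp: not_le)
        have "x \<notin> cube y (e n) \<or> x \<notin> cube y' (e n)" for x
        proof (rule ccontr)
          assume "\<not> (x \<notin> cube y (e n) \<or> x \<notin> cube y' (e n))"
          then have "\<bar>x \<bullet> i - y \<bullet> i\<bar> \<le> e n / 2" "\<bar>x \<bullet> i - y' \<bullet> i\<bar> \<le> e n / 2" using i by (auto simp: cube_def)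
          then show False
            using i(2) abs_triangle_ineq4[of "x \<bullet> i - y' \<bullet> i" "x \<bullet> i - y \<bullet> i"] by (simp add: inner_diff_left)
        qed
        then have "(\<lambda>x. indicator (cube y (e n)) x * indicator (cube y' (e n)) x :: ennreal) = (\<lambda>x. 0)" by (auto simp: indicator_def fun_eq_iff)
        then show ?thesis by (simp only: nn_integral_const) simp
      qed
    qed
    also have "\<dots> = ennreal (e n ^ D) * (\<integral>\<^sup>+y. \<integral>\<^sup>+y'. indicator {x. \<forall>i\<in>Basis. \<bar>x \<bullet> i\<bar> \<le> e n} (y - y') \<partial>\<nu> \<partial>\<nu>)"
    proof -
      have cb: "{x::'b. \<forall>i\<in>Basis. \<bar>x \<bullet> i\<bar> \<le> e n} = cube 0 (2 * e n)" by (auto simp: cube_def)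
      show ?thesis unfolding cb
        by (subst nn_integral_cmult[symmetric]) (auto simp: nn_integral_cmult intro!: \<nu>.borel_measurable_nn_integral)
    qed
    also have "\<dots> \<le> ennreal (e n ^ D) * ennreal (C * e n ^ D)"
      using C(2)[of n] by (intro mult_left_mono) (auto simp: D_def)
    also have "\<dots> = ennreal (C * (e n ^ D) * (e n ^ D))"
      using C(1) e(1)[of n] by (simp add: ennreal_mult[symmetric] mult_ac)
    finally show ?thesis .
  qed
  \<comment> \<open>Open sets first: small cubes around a point of U lie inside U, so Fatou's lemma
    recovers \<nu> from the mollifications. Null sets follow by outer regularity.\<close>
  have openU: "emeasure \<nu> U \<le> ennreal (\<delta> * (1 + C))" if U: "open U" "emeasure lborel U \<le> ennreal (\<delta>\<^sup>2)" and \<delta>: "0 < \<delta>" for U \<delta>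
  proof -
    have [measurable]: "U \<in> sets borel" using U by simp
    define h where "h n y = (\<integral>\<^sup>+x. ennreal (1 / e n ^ D) * (indicator (cube y (e n)) x * indicator U x) \<partial>lborel)" for n y
    have hm[measurable]: "h n \<in> borel_measurable \<nu>" for n
      unfolding h_def[abs_def] by (rule lborel.borel_measurable_nn_integral) (unfold split_beta', measurable)
    have "emeasure \<nu> U = (\<integral>\<^sup>+y. indicator U y \<partial>\<nu>)" by simp
    also have "\<dots> \<le> (\<integral>\<^sup>+y. liminf (\<lambda>n. h n y) \<partial>\<nu>)"
    proof (rule nn_integral_mono)
      fix y
      show "indicator U y \<le> liminf (\<lambda>n. h n y)"
      proof (cases "y \<in> U")
        case True
        then obtain d where d: "0 < d" "ball y d \<subseteq> U" using U open_contains_ball by blast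
        have "(\<lambda>n. e n * real D) \<longlonglongrightarrow> 0 * real D" by (intro tendsto_intros e)
        then have "\<forall>\<^sub>F n in sequentially. e n * real D < d" using d by (intro order_tendstoD) auto
        then have "\<forall>\<^sub>F n in sequentially. 1 \<le> h n y"
        proof eventually_elim
          case (elim n)
          have "cube y (e n) \<subseteq> U"
          proof
            fix x assume x: "x \<in> cube y (e n)"
            have "norm (x - y) \<le> (\<Sum>i\<in>Basis. \<bar>(x - y) \<bullet> i\<bar>)" by (rule norm_le_l1)
            also have "\<dots> \<le> (\<Sum>i\<in>(Basis::'b set). e n)"
              using x e(1)[of n] by (intro sum_mono) (force simp: cube_def inner_diff_left)
            also have "\<dots> = e n * real D" by (simp add: D_def)
            finally have "x \<in> ball y d" using elim by (simp add: dist_norm norm_minus_commute)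
            then show "x \<in> U" using d by auto
          qed
          then have "(\<lambda>x. indicator (cube y (e n)) x * indicator U x :: ennreal) = indicator (cube y (e n))"
            by (auto simp: indicator_def fun_eq_iff)
          moreover have "h n y = ennreal (1 / e n ^ D) * (\<integral>\<^sup>+x. indicator (cube y (e n)) x * indicator U x \<partial>lborel)"
            unfolding h_def by (rule nn_integral_cmult) measurable
          ultimately have "h n y = ennreal (1 / e n ^ D) * (\<integral>\<^sup>+x. indicator (cube y (e n)) x \<partial>lborel)" by (simp only:)
          then have "h n y = ennreal (1 / e n ^ D) * ennreal (e n ^ D)"
            using e(1)[of n] by (simp add: emeasure_cube D_def)
          also have "\<dots> = 1" using e(1)[of n] by (simp add: ennreal_mult[symmetric])
          finally show ?case by simp
        qed
        then have "1 \<le> liminf (\<lambda>n. h n y)" by (rule Liminf_bounded)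
        then show ?thesis using True by simp
      qed simp
    qed
    also have "\<dots> \<le> liminf (\<lambda>n. \<integral>\<^sup>+y. h n y \<partial>\<nu>)" by (rule nn_integral_liminf) measurable
    also have "\<dots> \<le> ennreal (\<delta> * (1 + C))"
    proof -
      have "(\<integral>\<^sup>+y. h n y \<partial>\<nu>) \<le> ennreal (\<delta> * (1 + C))" for n
      proof -
        define k where "k = 1 / e n ^ D"
        have k: "0 < k" using e(1)[of n] by (simp add: k_def)
        have "(\<integral>\<^sup>+y. h n y \<partial>\<nu>) = (\<integral>\<^sup>+x. \<integral>\<^sup>+y. ennreal k * (indicator (cube y (e n)) x * indicator U x) \<partial>\<nu> \<partial>lborel)"
          unfolding h_def k_def by (rule P.Fubini'[symmetric]) (unfold split_beta', measurable)
        also have "\<dots> = (\<integral>\<^sup>+x. ennreal k * G n x * indicator U x \<partial>lborel)"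
          unfolding G_def by (intro nn_integral_cong) (simp add: nn_integral_cmult nn_integral_multc mult.assoc)
        \<comment> \<open>Young's inequality with weight \<delta> splits the integral into the
          volume of U and the squared norm of the mollified density.\<close>
        also have "\<dots> \<le> (\<integral>\<^sup>+x. ennreal (1 / \<delta>) * indicator U x + ennreal (\<delta> * k\<^sup>2) * (G n x * G n x) \<partial>lborel)"
        proof (rule nn_integral_mono)
          fix x :: 'b
          obtain g where g: "G n x = ennreal g" "0 \<le> g" using Gtop[of n x] by (cases "G n x") auto
          have "k * g \<le> 1 / \<delta> + \<delta> * k\<^sup>2 * (g * g)"
          proof -
            have "0 \<le> (1 - \<delta> * (k * g))\<^sup>2 / \<delta>" using \<delta> by simp
            also have "\<dots> = 1 / \<delta> - 2 * (k * g) + \<delta> * k\<^sup>2 * (g * g)" using \<delta> by (simp add: field_simps power2_eq_square)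
            finally have "2 * (k * g) \<le> 1 / \<delta> + \<delta> * k\<^sup>2 * (g * g)" by linarith
            moreover have "0 \<le> k * g" using k g by simp
            ultimately show ?thesis by linarith
          qed
          then have "ennreal (k * g) \<le> ennreal (1 / \<delta> + \<delta> * k\<^sup>2 * (g * g))" by (rule ennreal_leI)
          then have *: "ennreal k * G n x \<le> ennreal (1 / \<delta>) + ennreal (\<delta> * k\<^sup>2) * (G n x * G n x)"
            using g k \<delta> by (simp add: ennreal_mult[symmetric] ennreal_plus[symmetric] del: ennreal_plus)
          show "ennreal k * G n x * indicator U x \<le> ennreal (1 / \<delta>) * indicator U x + ennreal (\<delta> * k\<^sup>2) * (G n x * G n x)"
            using * by (cases "x \<in> U") auto
        qed
        also have "\<dots> = ennreal (1 / \<delta>) * emeasure lborel U + ennreal (\<delta> * k\<^sup>2) * (\<integral>\<^sup>+x. G n x * G n x \<partial>lborel)"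
          by (simp add: nn_integral_add nn_integral_cmult)
        also have "\<dots> \<le> ennreal (1 / \<delta>) * ennreal (\<delta>\<^sup>2) + ennreal (\<delta> * k\<^sup>2) * ennreal (C * (e n ^ D) * (e n ^ D))"
          by (intro add_mono mult_left_mono U coll) auto
        also have "\<dots> = ennreal (1 / \<delta> * \<delta>\<^sup>2 + \<delta> * k\<^sup>2 * (C * (e n ^ D) * (e n ^ D)))"
          using \<delta> C(1) e(1)[of n] by (simp add: ennreal_mult[symmetric] ennreal_plus[symmetric] del: ennreal_plus)
        also have "1 / \<delta> * \<delta>\<^sup>2 + \<delta> * k\<^sup>2 * (C * (e n ^ D) * (e n ^ D)) = \<delta> * (1 + C)"
          using \<delta> e(1)[of n] by (simp add: k_def power2_eq_square field_simps)
        finally show ?thesis .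
      qed
      then have "liminf (\<lambda>n. \<integral>\<^sup>+y. h n y \<partial>\<nu>) \<le> liminf (\<lambda>n. ennreal (\<delta> * (1 + C)))"
        by (intro Liminf_mono always_eventually allI)
      then show ?thesis by (simp add: Liminf_const)
    qed
    finally show ?thesis .
  qed
  have "emeasure \<nu> N \<le> ennreal x" if x: "0 < x" for x
  proof -
    define \<delta> where "\<delta> = x / (1 + C)"
    have \<delta>: "0 < \<delta>" using x C(1) by (simp add: \<delta>_def)
    obtain U where U: "open U" "N \<subseteq> U" "emeasure lborel (U - N) < ennreal (\<delta>\<^sup>2)"
      using outer_regular_lborel[OF N(1), of "\<delta>\<^sup>2"] \<delta> by auto
    have "emeasure lborel U \<le> emeasure lborel (U - N) + emeasure lborel N"
      using emeasure_subadditive[of "U - N" lborel N] U N(1) by (simp add: Un_absorb2)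
    then have "emeasure lborel U \<le> ennreal (\<delta>\<^sup>2)" using U N(2) by simp
    from openU[OF U(1) this \<delta>] have "emeasure \<nu> U \<le> ennreal x" using C(1) by (simp add: \<delta>_def)
    moreover have "emeasure \<nu> N \<le> emeasure \<nu> U" using U by (intro emeasure_mono) (auto simp: assms(2))
    ultimately show ?thesis by simp
  qed
  then have "emeasure \<nu> N \<le> 0 + ennreal x" if "0 < x" for x using that by (simp only: add_0_left)
  then have "emeasure \<nu> N \<le> 0" by (rule ennreal_le_epsilon)
  then show ?thesis by (simp only: le_zero_eq)
qed

section \<open>Variance of increments of the sheet\<close>

lemma fbm_cov_commute: "fbm_cov H a b = fbm_cov H b a"
  by (simp add: fbm_cov_def abs_minus_commute)

lemma fbm_cov_diag: "0 \<le> a \<Longrightarrow> fbm_cov H a a = a powr (2 * H)"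
  by (simp add: fbm_cov_def)

text \<open>Up to a positive factor the form is the squared L2 norm of a combination of two
  kernels.\<close>

lemma fbm_cov_quadratic:
  assumes "0 < H" "H < 1" "0 \<le> a" "0 \<le> b"
  shows "0 \<le> x\<^sup>2 * fbm_cov H a a + 2 * x * y * fbm_cov H a b + y\<^sup>2 * fbm_cov H b b"
proof -
  have "0 \<le> fbm_kernel_const H * (\<Sum>j\<in>UNIV. \<Sum>k\<in>UNIV. (if j then x else y) * (if k then x else y) * fbm_cov H (if j then a else b) (if k then a else b))"
    by (subst fbm_kernel_sum_integral[OF assms(1,2), symmetric, where J="UNIV :: bool set"]) (use assms in auto)
  also have "(\<Sum>j\<in>UNIV. \<Sum>k\<in>UNIV. (if j then x else y) * (if k then x else y) * fbm_cov H (if j then a else b) (if k then a else b))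
     = x\<^sup>2 * fbm_cov H a a + 2 * x * y * fbm_cov H a b + y\<^sup>2 * fbm_cov H b b"
    by (simp add: UNIV_bool power2_eq_square fbm_cov_commute[of H b a] algebra_simps)
  finally show ?thesis using fbm_kernel_const_pos[OF assms(1,2)] by (simp only: zero_le_mult_iff) auto
qed

text \<open>The kernel estimate with a as the only past time; c is free and is set to the regression
  coefficient later.\<close>

lemma fbm_cov_nondeterminism:
  assumes H: "0 < H" "H < 1" and a: "0 \<le> a" "a < a'"
  shows "(a' - a) powr (2 * H) / (2 * H * fbm_kernel_const H) \<le> fbm_cov H a' a' - 2 * c * fbm_cov H a a' + c\<^sup>2 * fbm_cov H a a"
proof -
  have C: "0 < fbm_kernel_const H" by (rule fbm_kernel_const_pos[OF H])
  have "(a' - a) powr (2 * H) / (2 * H) \<le> (\<integral>x. (fbm_kernel H a' x + (\<Sum>j\<in>{()}. (- c) * fbm_kernel H a x))\<^sup>2 \<partial>lborel)"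
    by (rule fbm_kernel_nondeterminism) (use assms in auto)
  also have "\<dots> = (\<integral>x. (\<Sum>j\<in>UNIV. (if j then 1 else - c) * fbm_kernel H (if j then a' else a) x)\<^sup>2 \<partial>lborel)"
    by (intro Bochner_Integration.integral_cong refl) (simp add: UNIV_bool)
  also have "\<dots> = fbm_kernel_const H * (\<Sum>j\<in>UNIV. \<Sum>k\<in>UNIV. (if j then 1 else - c) * (if k then 1 else - c) * fbm_cov H (if j then a' else a) (if k then a' else a))"
    by (rule fbm_kernel_sum_integral[OF H]) (use a in auto)
  also have "\<dots> = fbm_kernel_const H * (fbm_cov H a' a' - 2 * c * fbm_cov H a a' + c\<^sup>2 * fbm_cov H a a)"
    by (simp add: UNIV_bool power2_eq_square fbm_cov_commute[of H a' a] algebra_simps)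
  finally have "(a' - a) powr (2 * H) / (2 * H) / fbm_kernel_const H \<le> fbm_cov H a' a' - 2 * c * fbm_cov H a a' + c\<^sup>2 * fbm_cov H a a"
    using C by (simp only: pos_divide_le_eq mult.commute)
  then show ?thesis by simp
qed

text \<open>The variance of one component of the increment from (a, b) to (a', b').\<close>

definition sheet_incr_var :: "real \<Rightarrow> real \<Rightarrow> real \<Rightarrow> real \<Rightarrow> real \<Rightarrow> real \<Rightarrow> real" where
  "sheet_incr_var H1 H2 a b a' b' = fbm_cov H1 a' a' * fbm_cov H2 b' b' - 2 * (fbm_cov H1 a a' * fbm_cov H2 b b') + fbm_cov H1 a a * fbm_cov H2 b b"

text \<open>With kernels \<open>f\<close> and \<open>g\<close> for the two covariances, the increment corresponds to
  \<open>f a' \<otimes> g b' - f a \<otimes> g b\<close>, which is at least as long as the distance of \<open>f a'\<close> to the line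
  spanned by \<open>f a\<close>, times the length of \<open>g b'\<close>.\<close>

lemma sheet_incr_var_lower:
  assumes H: "0 < H1" "H1 < 1" "0 < H2" "H2 < 1" and ab: "0 < a" "a < a'" "0 < b" "0 < b'"
  shows "b' powr (2 * H2) * ((a' - a) powr (2 * H1) / (2 * H1 * fbm_kernel_const H1)) \<le> sheet_incr_var H1 H2 a b a' b'"
proof -
  define A where "A = fbm_cov H1 a a"
  define A' where "A' = fbm_cov H1 a' a'"
  define P where "P = fbm_cov H1 a a'"
  define B where "B = fbm_cov H2 b b"
  define B' where "B' = fbm_cov H2 b' b'"
  define Q where "Q = fbm_cov H2 b b'"
  have pos: "0 < A" "0 < B" "0 < B'" "B' = b' powr (2 * H2)"
    unfolding A_def B_def B'_def using ab by (auto simp: fbm_cov_diag)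
  have Q2: "Q\<^sup>2 \<le> B * B'"
  proof -
    \<comment> \<open>The minimiser Q / B turns the quadratic form into the Cauchy--Schwarz
      inequality.\<close>
    have "0 \<le> (Q / B)\<^sup>2 * B + 2 * (Q / B) * (- 1) * Q + (- 1)\<^sup>2 * B'"
      using fbm_cov_quadratic[OF H(3,4), of b b' "Q / B" "- 1"] ab unfolding Q_def B_def B'_def by simp
    also have "\<dots> = B' - Q\<^sup>2 / B" using pos by (simp add: power2_eq_square field_simps)
    finally show ?thesis using pos by (simp add: field_simps)
  qed
  have L: "(a' - a) powr (2 * H1) / (2 * H1 * fbm_kernel_const H1) \<le> A' - P\<^sup>2 / A"
  proof -
    \<comment> \<open>At the regression coefficient P / A the right-hand side is the conditional
      variance.\<close>
    have "(a' - a) powr (2 * H1) / (2 * H1 * fbm_kernel_const H1) \<le> A' - 2 * (P / A) * P + (P / A)\<^sup>2 * A"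
      unfolding A_def A'_def P_def by (rule fbm_cov_nondeterminism[OF H(1,2)]) (use ab in auto)
    also have "\<dots> = A' - P\<^sup>2 / A" using pos by (simp add: power2_eq_square field_simps)
    finally show ?thesis .
  qed
  have "b' powr (2 * H2) * ((a' - a) powr (2 * H1) / (2 * H1 * fbm_kernel_const H1)) \<le> B' * (A' - P\<^sup>2 / A)"
    unfolding pos(4)[symmetric] using L pos by (intro mult_left_mono) auto
  also have "\<dots> = A' * B' - P\<^sup>2 * B' / A" by (simp add: algebra_simps)
  also have "\<dots> \<le> A' * B' - P\<^sup>2 * (Q\<^sup>2 / B) / A"
  proof -
    have "Q\<^sup>2 / B \<le> B'" using Q2 pos by (simp add: field_simps)
    then have "P\<^sup>2 * (Q\<^sup>2 / B) / A \<le> P\<^sup>2 * B' / A" using pos by (intro divide_right_mono mult_left_mono) auto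
    then show ?thesis by simp
  qed
  also have "\<dots> \<le> A' * B' - 2 * (P * Q) + A * B"
  proof -
    have "0 \<le> (P * Q - A * B)\<^sup>2 / (A * B)" using pos by simp
    also have "\<dots> = P\<^sup>2 * (Q\<^sup>2 / B) / A - 2 * (P * Q) + A * B" using pos by (simp add: power2_eq_square field_simps)
    finally show ?thesis by simp
  qed
  finally show ?thesis by (simp add: sheet_incr_var_def A_def A'_def B_def B'_def P_def Q_def)
qed

lemma sheet_incr_var_sym:
  "sheet_incr_var H1 H2 a b a' b' = sheet_incr_var H1 H2 a' b' a b"
  "sheet_incr_var H1 H2 a b a' b' = sheet_incr_var H2 H1 b a b' a'"
  by (simp_all add: sheet_incr_var_def fbm_cov_commute[of _ a' a] fbm_cov_commute[of _ b' b] mult_ac)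

text \<open>All times are at least e, so the power of b' is bounded below; symmetry removes the
  order of a and a'.\<close>

lemma sheet_incr_var_lower_dist:
  assumes H: "0 < H1" "H1 < 1" "0 < H2" "H2 < 1" and e: "0 < e" and ab: "e \<le> a" "e \<le> a'" "e \<le> b" "e \<le> b'" "a \<noteq> a'"
  shows "e powr (2 * H2) / (2 * H1 * fbm_kernel_const H1) * \<bar>a - a'\<bar> powr (2 * H1) \<le> sheet_incr_var H1 H2 a b a' b'"
proof -
  have C: "0 < fbm_kernel_const H1" by (rule fbm_kernel_const_pos[OF H(1,2)])
  have *: "e powr (2 * H2) / (2 * H1 * fbm_kernel_const H1) * (a' - a) powr (2 * H1) \<le> sheet_incr_var H1 H2 a b a' b'"
    if "a < a'" "e \<le> a" "e \<le> b" "e \<le> b'" for a a' b b'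
  proof -
    have "e powr (2 * H2) \<le> b' powr (2 * H2)" using that e H by (intro powr_mono2) auto
    then have "e powr (2 * H2) * ((a' - a) powr (2 * H1) / (2 * H1 * fbm_kernel_const H1)) \<le> b' powr (2 * H2) * ((a' - a) powr (2 * H1) / (2 * H1 * fbm_kernel_const H1))"
      using C H by (intro mult_right_mono) auto
    also have "\<dots> \<le> sheet_incr_var H1 H2 a b a' b'" using that e by (intro sheet_incr_var_lower H) auto
    finally show ?thesis by simp
  qed
  show ?thesis
  proof (cases "a < a'")
    case True then show ?thesis using *[of a a' b b'] ab by (simp add: abs_minus_commute)
  next
    case False
    then show ?thesis using *[of a' a b' b] ab sheet_incr_var_sym(1)[of H1 H2 a b a' b'] by simp
  qed
qed

section \<open>Probabilities of small increments\<close>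

context fbs
begin

lemma w_incr_variance:
  assumes "(a, b) \<in> time_square T" "(a', b') \<in> time_square T"
  shows "(\<integral>\<omega>. (w (a', b') \<omega> $ i - w (a, b) \<omega> $ i)\<^sup>2 \<partial>M) = sheet_incr_var H1 H2 a b a' b'"
proof -
  have "(\<integral>\<omega>. (w (a', b') \<omega> $ i - w (a, b) \<omega> $ i)\<^sup>2 \<partial>M) = (\<integral>\<omega>. w (a', b') \<omega> $ i * w (a', b') \<omega> $ i - 2 * (w (a, b) \<omega> $ i * w (a', b') \<omega> $ i) + w (a, b) \<omega> $ i * w (a, b) \<omega> $ i \<partial>M)"
    by (intro Bochner_Integration.integral_cong refl) (simp add: power2_eq_square algebra_simps)
  also have "\<dots> = sheet_incr_var H1 H2 a b a' b'"
    using w_comp_cov[of "(a', b')" "(a', b')" i i] w_comp_cov[of "(a, b)" "(a', b')" i i] w_comp_cov[of "(a, b)" "(a, b)" i i] assms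
    by (simp add: sheet_incr_var_def)
  finally show ?thesis .
qed

lemma w_incr_comp_small:
  assumes st: "(a, b) \<in> time_square T" "(a', b') \<in> time_square T" and v: "0 < sheet_incr_var H1 H2 a b a' b'" and e: "0 < e"
  shows "prob {\<omega>\<in>space M. \<bar>w (a', b') \<omega> $ i - w (a, b) \<omega> $ i\<bar> \<le> e} \<le> e / sqrt (sheet_incr_var H1 H2 a b a' b')"
proof -
  define Y where "Y \<omega> = w (a', b') \<omega> $ i - w (a, b) \<omega> $ i" for \<omega>
  define \<sigma> where "\<sigma> = sqrt (sheet_incr_var H1 H2 a b a' b')"
  have \<sigma>: "0 < \<sigma>" using v by (simp add: \<sigma>_def)
  have "gaussian_variable M (\<lambda>\<omega>. \<Sum>j\<in>UNIV. (if j then axis i 1 else - axis i 1) \<bullet> w (if j then (a', b') else (a, b)) \<omega>)"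
    using st by (intro w_gaussian) auto
  then have g: "gaussian_variable M Y" by (simp add: Y_def[abs_def] UNIV_bool inner_axis_1)
  have mean: "(\<integral>\<omega>. Y \<omega> \<partial>M) = 0"
    unfolding Y_def using w_comp_integrable[OF st(1)] w_comp_integrable[OF st(2)] w_comp_mean[OF st(1)] w_comp_mean[OF st(2)] by simp
  have var: "(\<integral>\<omega>. (Y \<omega>)\<^sup>2 \<partial>M) = sheet_incr_var H1 H2 a b a' b'" unfolding Y_def by (rule w_incr_variance[OF st])
  have D: "distributed M lborel Y (\<lambda>x. ennreal (normal_density 0 \<sigma> x))"
    using gaussian_variable_centered(4)[OF g mean] v unfolding var \<sigma>_def by simp
  have "emeasure M {\<omega>\<in>space M. \<bar>Y \<omega>\<bar> \<le> e} = emeasure M (Y -` {-e..e} \<inter> space M)"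
    by (intro arg_cong[where f="emeasure M"]) auto
  also have "\<dots> = (\<integral>\<^sup>+x. ennreal (normal_density 0 \<sigma> x) * indicator {-e..e} x \<partial>lborel)"
    using distributed_emeasure[OF D] by simp
  \<comment> \<open>The density is at most 1/(2\<sigma>) as \<open>sqrt (2 * pi)\<close> exceeds 2;
    the interval has length 2e.\<close>
  also have "\<dots> \<le> (\<integral>\<^sup>+x. ennreal (1 / (2 * \<sigma>)) * indicator {-e..e} x \<partial>lborel)"
  proof (intro nn_integral_mono mult_right_mono ennreal_leI)
    fix x
    have "2 * \<sigma> \<le> sqrt (2 * pi * \<sigma>\<^sup>2)"
      using \<sigma> pi_gt3 by (intro real_le_rsqrt) (simp add: power_mult_distrib)
    then have "1 / sqrt (2 * pi * \<sigma>\<^sup>2) \<le> 1 / (2 * \<sigma>)" using \<sigma> by (intro divide_left_mono) auto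
    moreover have "exp (- (x - 0)\<^sup>2 / (2 * \<sigma>\<^sup>2)) \<le> 1" by simp
    ultimately have "1 / sqrt (2 * pi * \<sigma>\<^sup>2) * exp (- (x - 0)\<^sup>2 / (2 * \<sigma>\<^sup>2)) \<le> 1 / (2 * \<sigma>) * 1"
      using \<sigma> by (intro mult_mono) auto
    then show "normal_density 0 \<sigma> x \<le> 1 / (2 * \<sigma>)" by (simp add: normal_density_def)
  qed simp
  also have "\<dots> = ennreal (e / \<sigma>)" using e \<sigma> by (simp add: nn_integral_cmult ennreal_mult[symmetric])
  finally show ?thesis using e \<sigma> by (simp add: emeasure_eq_measure Y_def \<sigma>_def)
qed

text \<open>Independence of the component processes passes to their increments and gives one factor
  per component.\<close>

lemma w_incr_small:
  assumes st: "(a, b) \<in> time_square T" "(a', b') \<in> time_square T" and v: "0 < sheet_incr_var H1 H2 a b a' b'" and e: "0 < e"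
  shows "prob {\<omega>\<in>space M. \<forall>i. \<bar>w (a', b') \<omega> $ i - w (a, b) \<omega> $ i\<bar> \<le> e} \<le> (e / sqrt (sheet_incr_var H1 H2 a b a' b')) ^ CARD('d)"
proof -
  let ?N = "\<Pi>\<^sub>M s\<in>time_square T. (borel :: real measure)"
  have ind: "indep_vars (\<lambda>_. ?N) (component_process T w) UNIV"
    using sheet by (auto simp: fractional_brownian_sheet_def)
  have "indep_vars (\<lambda>_. borel) (\<lambda>k \<omega>. (\<lambda>f. f (a', b') - f (a, b)) (component_process T w k \<omega>)) UNIV"
    by (rule indep_vars_compose2[OF ind]) (use st in \<open>auto intro!: borel_measurable_diff measurable_component_singleton\<close>)
  then have ind': "indep_vars (\<lambda>_. borel) (\<lambda>k \<omega>. w (a', b') \<omega> $ k - w (a, b) \<omega> $ k) UNIV"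
    using st by (simp add: component_process_def)
  have "prob {\<omega>\<in>space M. \<forall>i. \<bar>w (a', b') \<omega> $ i - w (a, b) \<omega> $ i\<bar> \<le> e}
     = prob (\<Inter>i\<in>UNIV. (\<lambda>\<omega>. w (a', b') \<omega> $ i - w (a, b) \<omega> $ i) -` {-e..e} \<inter> space M)"
  proof -
    have ab: "\<bar>x\<bar> \<le> e \<longleftrightarrow> - e \<le> x \<and> x \<le> e" for x :: real by auto
    show ?thesis by (intro arg_cong[where f=prob]) (auto simp only: ab vimage_def atLeastAtMost_iff mem_Collect_eq Int_iff INT_iff)
  qed
  also have "\<dots> = (\<Prod>i\<in>UNIV. prob ((\<lambda>\<omega>. w (a', b') \<omega> $ i - w (a, b) \<omega> $ i) -` {-e..e} \<inter> space M))"
    by (rule indep_varsD[OF ind']) auto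
  also have "\<dots> \<le> (\<Prod>i\<in>(UNIV::'d set). e / sqrt (sheet_incr_var H1 H2 a b a' b'))"
  proof (intro prod_mono conjI)
    fix i
    have "(\<lambda>\<omega>. w (a', b') \<omega> $ i - w (a, b) \<omega> $ i) -` {-e..e} \<inter> space M = {\<omega>\<in>space M. \<bar>w (a', b') \<omega> $ i - w (a, b) \<omega> $ i\<bar> \<le> e}"
      by auto
    then show "prob ((\<lambda>\<omega>. w (a', b') \<omega> $ i - w (a, b) \<omega> $ i) -` {-e..e} \<inter> space M) \<le> e / sqrt (sheet_incr_var H1 H2 a b a' b')"
      using w_incr_comp_small[OF assms] by simp
  qed simp
  finally show ?thesis by simp
qed

end

section \<open>Collisions of the path and null sets\<close>

context fbs
begin

text \<open>The variance V dominates a power of each time distance. Writing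
  \<open>V powr (- d / 2)\<close> as a product with shares p and 1 - p of the exponent, and using
  one bound for each factor, gives a product of one-dimensional singularities.\<close>

lemma collision_prob:
  fixes p e0 :: real
  assumes p: "0 \<le> p" "p \<le> 1" and e0: "0 < e0"
  shows "\<exists>k\<ge>0. \<forall>a b a' b' e. a \<in> {e0..T} \<longrightarrow> a' \<in> {e0..T} \<longrightarrow> b \<in> {e0..T} \<longrightarrow> b' \<in> {e0..T} \<longrightarrow> a \<noteq> a' \<longrightarrow> b \<noteq> b' \<longrightarrow> 0 < e \<longrightarrow>
    prob {\<omega>\<in>space M. \<forall>i. \<bar>w (a', b') \<omega> $ i - w (a, b) \<omega> $ i\<bar> \<le> e}
      \<le> e ^ CARD('d) * (k * (\<bar>a' - a\<bar> powr (- (CARD('d) * p * H1)) * \<bar>b' - b\<bar> powr (- (CARD('d) * (1 - p) * H2))))"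
proof -
  define D where "D = real CARD('d)"
  have D: "0 < D" by (simp add: D_def)
  define k1 where "k1 = e0 powr (2 * H2) / (2 * H1 * fbm_kernel_const H1)"
  define k2 where "k2 = e0 powr (2 * H1) / (2 * H2 * fbm_kernel_const H2)"
  have k: "0 < k1" "0 < k2" using e0 H fbm_kernel_const_pos by (auto simp: k1_def k2_def)
  show ?thesis
  proof (intro exI[of _ "k1 powr (- (D * p / 2)) * k2 powr (- (D * (1 - p) / 2))"] conjI allI impI)
    fix a b a' b' e :: real
    assume ab: "a \<in> {e0..T}" "a' \<in> {e0..T}" "b \<in> {e0..T}" "b' \<in> {e0..T}" "a \<noteq> a'" "b \<noteq> b'" and e: "0 < e"
    define V where "V = sheet_incr_var H1 H2 a b a' b'"
    have V1: "k1 * \<bar>a' - a\<bar> powr (2 * H1) \<le> V"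
      using sheet_incr_var_lower_dist[OF H e0, of a a' b b'] ab by (simp add: V_def k1_def abs_minus_commute)
    have V2: "k2 * \<bar>b' - b\<bar> powr (2 * H2) \<le> V"
      using sheet_incr_var_lower_dist[OF H(3,4,1,2) e0, of b b' a a'] ab sheet_incr_var_sym(2)[of H1 H2 a b a' b']
      by (simp add: V_def k2_def abs_minus_commute)
    have pos1: "0 < k1 * \<bar>a' - a\<bar> powr (2 * H1)" and pos2: "0 < k2 * \<bar>b' - b\<bar> powr (2 * H2)" using k ab by auto
    have V: "0 < V" using V1 pos1 by linarith
    have "prob {\<omega>\<in>space M. \<forall>i. \<bar>w (a', b') \<omega> $ i - w (a, b) \<omega> $ i\<bar> \<le> e} \<le> (e / sqrt V) ^ CARD('d)"
      unfolding V_def by (rule w_incr_small) (use ab e e0 V in \<open>auto simp: time_square_def V_def\<close>)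
    also have "\<dots> = e ^ CARD('d) * (V powr (- (D * p / 2)) * V powr (- (D * (1 - p) / 2)))"
    proof -
      have A: "(1 / sqrt V) ^ CARD('d) = V powr (- (D / 2))"
        using V by (simp add: D_def powr_half_sqrt[symmetric] powr_realpow[symmetric] powr_powr powr_minus_divide power_one_over)
      have "- (D * p / 2) + - (D * (1 - p) / 2) = - (D / 2)" by (simp add: field_simps)
      then have "V powr (- (D * p / 2)) * V powr (- (D * (1 - p) / 2)) = V powr (- (D / 2))"
        by (simp only: powr_add[symmetric])
      then have "V powr (- (D * p / 2)) * V powr (- (D * (1 - p) / 2)) = (1 / sqrt V) ^ CARD('d)" unfolding A .
      then show ?thesis by (simp add: power_divide)
    qed
    also have "\<dots> \<le> e ^ CARD('d) * ((k1 * \<bar>a' - a\<bar> powr (2 * H1)) powr (- (D * p / 2)) * (k2 * \<bar>b' - b\<bar> powr (2 * H2)) powr (- (D * (1 - p) / 2)))"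
      using p D e by (intro mult_left_mono mult_mono powr_mono2' V1 pos1 V2 pos2) auto
    also have "(k1 * \<bar>a' - a\<bar> powr (2 * H1)) powr (- (D * p / 2)) = k1 powr (- (D * p / 2)) * \<bar>a' - a\<bar> powr (- (CARD('d) * p * H1))"
      using k by (simp add: powr_mult powr_powr D_def mult_ac)
    also have "(k2 * \<bar>b' - b\<bar> powr (2 * H2)) powr (- (D * (1 - p) / 2)) = k2 powr (- (D * (1 - p) / 2)) * \<bar>b' - b\<bar> powr (- (CARD('d) * (1 - p) * H2))"
      using k by (simp add: powr_mult powr_powr D_def mult_ac)
    finally show "prob {\<omega>\<in>space M. \<forall>i. \<bar>w (a', b') \<omega> $ i - w (a, b) \<omega> $ i\<bar> \<le> e}
      \<le> e ^ CARD('d) * (k1 powr (- (D * p / 2)) * k2 powr (- (D * (1 - p) / 2)) * (\<bar>a' - a\<bar> powr (- (CARD('d) * p * H1)) * \<bar>b' - b\<bar> powr (- (CARD('d) * (1 - p) * H2))))"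
      by (simp add: mult_ac)
  qed simp
qed

text \<open>For the p chosen here both singularities of \<open>collision_prob\<close> are
  integrable, so the normalised collision integrals have bounded expectation. Fatou's lemma bounds
  them along a path-dependent subsequence, which is enough for
  \<open>absolutely_continuous_if_collisions\<close>. The null sets N are quantified after the path,
  so one exceptional set serves them all.\<close>

lemma occupation_null_inner:
  assumes d: "real CARD('d) < 1 / H1 + 1 / H2" and e0: "0 < e0" "e0 < T"
  shows "AE \<omega> in M. \<forall>N. N \<in> sets borel \<longrightarrow> emeasure lborel N = 0 \<longrightarrow>
    (AE r in interval_measure_on e0 T \<Otimes>\<^sub>M interval_measure_on e0 T. W (fst r) (snd r) \<omega> \<notin> N)"
proof -
  let ?L = "interval_measure_on e0 T"
  let ?D = "real CARD('d)"
  interpret L: finite_measure ?L by (rule finite_interval_measure_on)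
  interpret LL: pair_sigma_finite ?L ?L ..
  define \<mu> where "\<mu> = ?L \<Otimes>\<^sub>M ?L"
  have \<mu>fin: "finite_measure \<mu>" unfolding \<mu>_def by (rule finite_measure_pair_measure) unfold_locales
  interpret \<mu>: finite_measure \<mu> by (rule \<mu>fin)
  interpret \<mu>M: pair_sigma_finite \<mu> M ..
  have sets_\<mu>[measurable_cong]: "sets \<mu> = sets (borel \<Otimes>\<^sub>M borel)" unfolding \<mu>_def by (intro sets_pair_measure_cong) auto
  have D0: "0 < ?D" by simp
  \<comment> \<open>An admissible p satisfies \<open>d * p * H1 < 1\<close> and
    \<open>d * (1 - p) * H2 < 1\<close>; the hypothesis \<open>d < 1 / H1 + 1 / H2\<close> is what
    makes the two conditions compatible.\<close>
  have "max 0 (1 - 1 / (?D * H2)) < min 1 (1 / (?D * H1))"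
  proof -
    have "1 - 1 / (?D * H2) < 1 / (?D * H1)"
    proof -
      have "?D / ?D < (1 / H1 + 1 / H2) / ?D" using d D0 by (intro divide_strict_right_mono) auto
      then show ?thesis using H by (simp add: add_divide_distrib mult.commute)
    qed
    then show ?thesis using H by auto
  qed
  then obtain p where p: "max 0 (1 - 1 / (?D * H2)) < p" "p < min 1 (1 / (?D * H1))" using dense by blast
  have x1: "?D * p * H1 < 1" using p(2) H by (simp add: field_simps)
  have y1: "?D * (1 - p) * H2 < 1"
  proof -
    have "1 - p < 1 / (?D * H2)" using p(1) by simp
    then show ?thesis using H by (simp add: pos_less_divide_eq mult_ac)
  qed
  obtain k where k: "0 \<le> k" and coll: "\<And>a b a' b' e. a \<in> {e0..T} \<Longrightarrow> a' \<in> {e0..T} \<Longrightarrow> b \<in> {e0..T} \<Longrightarrow> b' \<in> {e0..T} \<Longrightarrow> a \<noteq> a' \<Longrightarrow> b \<noteq> b' \<Longrightarrow> 0 < e \<Longrightarrow>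
    prob {\<omega>\<in>space M. \<forall>i. \<bar>w (a', b') \<omega> $ i - w (a, b) \<omega> $ i\<bar> \<le> e}
      \<le> e ^ CARD('d) * (k * (\<bar>a' - a\<bar> powr (- (?D * p * H1)) * \<bar>b' - b\<bar> powr (- (?D * (1 - p) * H2))))"
    using collision_prob[of p e0] p e0 by auto
  define Y where "Y r \<omega> = W (fst r) (snd r) \<omega>" for r \<omega>
  have Y[measurable (raw)]: "(\<lambda>q. Y (f q) (h q)) \<in> borel_measurable K" if [measurable]: "f \<in> measurable K (borel \<Otimes>\<^sub>M borel)" "h \<in> measurable K M" for f h and K :: "'z measure"
    unfolding Y_def by (rule W_joint) measurable
  define e where "e n = 1 / real (Suc n)" for n
  have e: "0 < e n" for n by (simp add: e_def)
  define B where "B n = {x::real^'d. \<forall>i\<in>Basis. \<bar>x \<bullet> i\<bar> \<le> e n}" for n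
  have B[measurable]: "B n \<in> sets borel" for n
  proof -
    have "B n = cube 0 (2 * e n)" by (auto simp: B_def cube_def)
    then show ?thesis by simp
  qed
  \<comment> \<open>Normalised collision integrals at scale \<open>e n\<close>, the quantity whose
    boundedness gives absolute continuity.\<close>
  define Q where "Q n \<omega> = ennreal (1 / e n ^ CARD('d)) * (\<integral>\<^sup>+r. \<integral>\<^sup>+r'. indicator (B n) (Y r \<omega> - Y r' \<omega>) \<partial>\<mu> \<partial>\<mu>)" for n \<omega>
  have Qm[measurable]: "Q n \<in> borel_measurable M" for n
    unfolding Q_def[abs_def]
    by (intro borel_measurable_times_ennreal borel_measurable_const \<mu>.borel_measurable_nn_integral)
       (unfold split_beta', intro \<mu>.borel_measurable_nn_integral, unfold split_beta', measurable)
  define Kx where "Kx = 2 * (T - e0) powr (1 - ?D * p * H1) / (1 - ?D * p * H1)"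
  define Ky where "Ky = 2 * (T - e0) powr (1 - ?D * (1 - p) * H2) / (1 - ?D * (1 - p) * H2)"
  have K0: "0 \<le> Kx" "0 \<le> Ky" using x1 y1 by (auto simp: Kx_def Ky_def)
  have EQ: "(\<integral>\<^sup>+\<omega>. Q n \<omega> \<partial>M) \<le> ennreal (k * Kx * Ky) * (emeasure \<mu> (space \<mu>))" for n
  proof -
    define \<phi> where "\<phi> r r' = (\<integral>\<^sup>+\<omega>. indicator (B n) (Y r \<omega> - Y r' \<omega>) \<partial>M)" for r r'
    have \<phi>m[measurable]: "(\<lambda>r'. \<phi> r r') \<in> borel_measurable (borel \<Otimes>\<^sub>M borel)" for r
    proof -
      have "r \<in> space (borel \<Otimes>\<^sub>M borel)" by (simp add: space_pair_measure)
      then show ?thesis unfolding \<phi>_def by (intro borel_measurable_nn_integral) (unfold split_beta', measurable)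
    qed
    have "(\<integral>\<^sup>+\<omega>. Q n \<omega> \<partial>M) = ennreal (1 / e n ^ CARD('d)) * (\<integral>\<^sup>+\<omega>. \<integral>\<^sup>+r. \<integral>\<^sup>+r'. indicator (B n) (Y r \<omega> - Y r' \<omega>) \<partial>\<mu> \<partial>\<mu> \<partial>M)"
      unfolding Q_def
      by (intro nn_integral_cmult \<mu>.borel_measurable_nn_integral) (unfold split_beta', intro \<mu>.borel_measurable_nn_integral, unfold split_beta', measurable)
    also have "(\<integral>\<^sup>+\<omega>. \<integral>\<^sup>+r. \<integral>\<^sup>+r'. indicator (B n) (Y r \<omega> - Y r' \<omega>) \<partial>\<mu> \<partial>\<mu> \<partial>M) = (\<integral>\<^sup>+r. \<integral>\<^sup>+\<omega>. \<integral>\<^sup>+r'. indicator (B n) (Y r \<omega> - Y r' \<omega>) \<partial>\<mu> \<partial>M \<partial>\<mu>)"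
      by (rule \<mu>M.Fubini') (unfold split_beta', intro \<mu>.borel_measurable_nn_integral, unfold split_beta', measurable)
    also have "\<dots> = (\<integral>\<^sup>+r. \<integral>\<^sup>+r'. \<phi> r r' \<partial>\<mu> \<partial>\<mu>)"
      unfolding \<phi>_def
    proof (rule nn_integral_cong)
      fix r :: "real \<times> real"
      have "r \<in> space (borel \<Otimes>\<^sub>M borel)" by (simp add: space_pair_measure)
      then show "(\<integral>\<^sup>+\<omega>. \<integral>\<^sup>+r'. indicator (B n) (Y r \<omega> - Y r' \<omega>) \<partial>\<mu> \<partial>M) = (\<integral>\<^sup>+r'. \<integral>\<^sup>+\<omega>. indicator (B n) (Y r \<omega> - Y r' \<omega>) \<partial>M \<partial>\<mu>)"
        by (intro \<mu>M.Fubini') (unfold split_beta', measurable)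
    qed
    also have "\<dots> \<le> (\<integral>\<^sup>+r. ennreal (e n ^ CARD('d) * (k * Kx * Ky)) \<partial>\<mu>)"
    proof (rule nn_integral_mono_AE)
      have AEL: "AE x in ?L. x \<in> {e0..T}" by (simp add: AE_interval_measure_on)
      have AE\<mu>: "AE r in \<mu>. fst r \<in> {e0..T} \<and> snd r \<in> {e0..T}"
        unfolding \<mu>_def
        by (rule LL.AE_pair_measure[where P="\<lambda>r. fst r \<in> {e0..T} \<and> snd r \<in> {e0..T}"])
           (measurable, use AEL in \<open>auto elim: eventually_mono\<close>)
      show "AE r in \<mu>. (\<integral>\<^sup>+r'. \<phi> r r' \<partial>\<mu>) \<le> ennreal (e n ^ CARD('d) * (k * Kx * Ky))"
        using AE\<mu>
      proof eventually_elim
        case (elim r)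
        obtain a' b' where r: "r = (a', b')" by (cases r)
        have ab': "a' \<in> {e0..T}" "b' \<in> {e0..T}" using elim by (auto simp: r)
        define c where "c = e n ^ CARD('d) * k"
        have c: "0 \<le> c" using e[of n] k by (simp add: c_def)
        have "(\<integral>\<^sup>+r'. \<phi> r r' \<partial>\<mu>) = (\<integral>\<^sup>+a. \<integral>\<^sup>+b. \<phi> r (a, b) \<partial>?L \<partial>?L)"
          unfolding \<mu>_def by (rule L.nn_integral_fst[symmetric]) measurable
        also have "\<dots> \<le> (\<integral>\<^sup>+a. \<integral>\<^sup>+b. ennreal c * ennreal (\<bar>a - a'\<bar> powr (- (?D * p * H1))) * ennreal (\<bar>b - b'\<bar> powr (- (?D * (1 - p) * H2))) \<partial>?L \<partial>?L)"
        proof (rule nn_integral_mono_AE)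
          have na: "AE a in ?L. a \<noteq> x" for x
            unfolding AE_interval_measure_on using AE_lborel_singleton[of x] by eventually_elim auto
          show "AE a in ?L. (\<integral>\<^sup>+b. \<phi> r (a, b) \<partial>?L) \<le> (\<integral>\<^sup>+b. ennreal c * ennreal (\<bar>a - a'\<bar> powr (- (?D * p * H1))) * ennreal (\<bar>b - b'\<bar> powr (- (?D * (1 - p) * H2))) \<partial>?L)"
            using AEL na[of a']
          proof eventually_elim
            case (elim a)
            show ?case
            proof (rule nn_integral_mono_AE)
              show "AE b in ?L. \<phi> r (a, b) \<le> ennreal c * ennreal (\<bar>a - a'\<bar> powr (- (?D * p * H1))) * ennreal (\<bar>b - b'\<bar> powr (- (?D * (1 - p) * H2)))"
                using AEL na[of b']
              proof eventually_elim
                case (elim b)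
                note a = \<open>a \<in> {e0..T}\<close> \<open>a \<noteq> a'\<close>
                have cl: "clamp_time a = a" "clamp_time b = b" "clamp_time a' = a'" "clamp_time b' = b'"
                  using a elim ab' e0 by (auto intro!: clamp_time(3))
                have ts: "(a, b) \<in> time_square T" "(a', b') \<in> time_square T" using a elim ab' e0 by (auto simp: time_square_def)
                have "\<phi> r (a, b) = (\<integral>\<^sup>+\<omega>. indicator {\<omega>\<in>space M. \<forall>i. \<bar>w (a', b') \<omega> $ i - w (a, b) \<omega> $ i\<bar> \<le> e n} \<omega> \<partial>M)"
                  unfolding \<phi>_def Y_def W_def r fst_conv snd_conv cl
                  by (intro nn_integral_cong) (auto simp: B_def indicator_def Basis_vec_def inner_axis)
                also have "\<dots> = ennreal (prob {\<omega>\<in>space M. \<forall>i. \<bar>w (a', b') \<omega> $ i - w (a, b) \<omega> $ i\<bar> \<le> e n})"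
                proof -
                  have "{\<omega>\<in>space M. \<forall>i\<in>UNIV. \<bar>w (a', b') \<omega> $ i - w (a, b) \<omega> $ i\<bar> \<le> e n} \<in> events"
                    by (rule sets.sets_Collect_finite_All) (use w_comp_measurable[OF ts(1)] w_comp_measurable[OF ts(2)] in auto)
                  then show ?thesis by (simp add: emeasure_eq_measure)
                qed
                also have "\<dots> \<le> ennreal (e n ^ CARD('d) * (k * (\<bar>a' - a\<bar> powr (- (?D * p * H1)) * \<bar>b' - b\<bar> powr (- (?D * (1 - p) * H2)))))"
                  using a elim ab' e[of n] by (intro ennreal_leI coll) auto
                also have "\<dots> = ennreal c * ennreal (\<bar>a - a'\<bar> powr (- (?D * p * H1))) * ennreal (\<bar>b - b'\<bar> powr (- (?D * (1 - p) * H2)))"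
                proof -
                  have "e n ^ CARD('d) * (k * (\<bar>a' - a\<bar> powr (- (?D * p * H1)) * \<bar>b' - b\<bar> powr (- (?D * (1 - p) * H2))))
                    = c * \<bar>a - a'\<bar> powr (- (?D * p * H1)) * \<bar>b - b'\<bar> powr (- (?D * (1 - p) * H2))"
                    by (simp add: c_def abs_minus_commute mult_ac)
                  then show ?thesis using c by (simp only: ennreal_mult mult_nonneg_nonneg powr_ge_zero)
                qed
                finally show ?case .
              qed
            qed
          qed
        qed
        also have "\<dots> = ennreal c * ((\<integral>\<^sup>+a. ennreal (\<bar>a - a'\<bar> powr (- (?D * p * H1))) \<partial>?L) * (\<integral>\<^sup>+b. ennreal (\<bar>b - b'\<bar> powr (- (?D * (1 - p) * H2))) \<partial>?L))"
          by (simp add: nn_integral_cmult nn_integral_multc mult.assoc)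
        also have "\<dots> \<le> ennreal c * (ennreal Kx * ennreal Ky)"
          unfolding Kx_def Ky_def
          by (intro mult_left_mono mult_mono; (subst nn_integral_interval_measure_on, measurable)?)
             (use nn_integral_powr_dist[OF x1 ab'(1)] nn_integral_powr_dist[OF y1 ab'(2)] in auto)
        also have "\<dots> = ennreal (e n ^ CARD('d) * (k * Kx * Ky))"
          using c K0 by (simp add: c_def ennreal_mult[symmetric] mult_ac)
        finally show ?case .
      qed
    qed
    also have "ennreal (1 / e n ^ CARD('d)) * (\<integral>\<^sup>+r. ennreal (e n ^ CARD('d) * (k * Kx * Ky)) \<partial>\<mu>) = ennreal (k * Kx * Ky) * emeasure \<mu> (space \<mu>)"
    proof -
      have "ennreal (1 / e n ^ CARD('d)) * ennreal (e n ^ CARD('d) * (k * Kx * Ky)) = ennreal (k * Kx * Ky)"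
        using e[of n] k K0 by (simp add: ennreal_mult[symmetric])
      then show ?thesis by (simp add: mult.assoc[symmetric])
    qed
    finally show ?thesis by (simp add: mult_left_mono)
  qed
  have "(\<integral>\<^sup>+\<omega>. liminf (\<lambda>n. Q n \<omega>) \<partial>M) \<le> liminf (\<lambda>n. \<integral>\<^sup>+\<omega>. Q n \<omega> \<partial>M)"
    by (rule nn_integral_liminf) measurable
  also have "\<dots> \<le> liminf (\<lambda>n::nat. ennreal (k * Kx * Ky) * (emeasure \<mu> (space \<mu>)))"
    using EQ by (intro Liminf_mono always_eventually allI)
  also have "\<dots> = ennreal (k * Kx * Ky) * (emeasure \<mu> (space \<mu>))" by (simp add: Liminf_const)
  also have "\<dots> < \<infinity>"
  proof -
    have "emeasure \<mu> (space \<mu>) < \<top>" using \<mu>.emeasure_finite[of "space \<mu>"] by (simp only: less_top infinity_ennreal_def)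
    then show ?thesis by (simp add: ennreal_mult_less_top)
  qed
  finally have "AE \<omega> in M. liminf (\<lambda>n. Q n \<omega>) \<noteq> \<infinity>"
    by (intro nn_integral_PInf_AE) auto
  then show ?thesis
    using AE_space
  proof eventually_elim
    case (elim \<omega>)
    have [measurable]: "(\<lambda>r. Y r \<omega>) \<in> borel_measurable (borel \<Otimes>\<^sub>M borel)"
      using Y[of "\<lambda>r. r" "borel \<Otimes>\<^sub>M borel" "\<lambda>_. \<omega>"] elim by simp
    \<comment> \<open>The added 1 makes the inequality with the lower limit strict.\<close>
    define C where "C = enn2real (liminf (\<lambda>n. Q n \<omega>)) + 1"
    have C0: "0 \<le> C" by (simp add: C_def)
    have lt: "liminf (\<lambda>n. Q n \<omega>) < ennreal C"
    proof -
      have "liminf (\<lambda>n. Q n \<omega>) < \<top>" using elim(1) unfolding infinity_ennreal_def by (simp only: less_top)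
      then have "liminf (\<lambda>n. Q n \<omega>) = ennreal (enn2real (liminf (\<lambda>n. Q n \<omega>)))" by (rule ennreal_enn2real[symmetric])
      also have "\<dots> < ennreal C" unfolding C_def by (rule ennreal_lessI) (auto intro: add_nonneg_pos)
      finally show ?thesis .
    qed
    \<comment> \<open>A finite lower limit only yields infinitely many good n, hence the subsequence
      below.\<close>
    have "\<not> (\<forall>\<^sub>F n in sequentially. ennreal C \<le> Q n \<omega>)"
    proof
      assume "\<forall>\<^sub>F n in sequentially. ennreal C \<le> Q n \<omega>"
      then have "ennreal C \<le> liminf (\<lambda>n. Q n \<omega>)" by (rule Liminf_bounded)
      then show False using lt by simp
    qed
    then have inf: "infinite {n. Q n \<omega> < ennreal C}"
      unfolding eventually_sequentially infinite_nat_iff_unbounded_le by (auto simp: not_le)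
    obtain s :: "nat \<Rightarrow> nat" where s: "strict_mono s" "\<forall>n. s n \<in> {n. Q n \<omega> < ennreal C}"
      using infinite_enumerate[OF inf] by auto
    have "(\<lambda>r. Y r \<omega>) \<in> borel_measurable \<mu>" by measurable
    define \<nu> where "\<nu> = distr \<mu> borel (\<lambda>r. Y r \<omega>)"
    have \<nu>fin: "finite_measure \<nu>" unfolding \<nu>_def by (rule \<mu>.finite_measure_distr) measurable
    interpret \<nu>: finite_measure \<nu> by fact
    have \<nu>0: "emeasure \<nu> N = 0" if N: "N \<in> sets borel" "emeasure lborel N = 0" for N
    proof (rule absolutely_continuous_if_collisions[OF \<nu>fin _ _ _ C0 _ N, where e="e \<circ> s"])
      show "sets \<nu> = sets borel" by (simp add: \<nu>_def)
      show "0 < (e \<circ> s) n" for n using e by simp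
      have "e \<longlonglongrightarrow> 0" unfolding e_def using LIMSEQ_Suc[OF lim_1_over_n] by simp
      then show "(e \<circ> s) \<longlonglongrightarrow> 0" by (rule LIMSEQ_subseq_LIMSEQ[OF _ s(1)])
      fix n
      have "(\<integral>\<^sup>+x. \<integral>\<^sup>+y. indicator (B (s n)) (x - y) \<partial>\<nu> \<partial>\<nu>) = (\<integral>\<^sup>+r. \<integral>\<^sup>+r'. indicator (B (s n)) (Y r \<omega> - Y r' \<omega>) \<partial>\<mu> \<partial>\<mu>)"
      proof -
        have "(\<integral>\<^sup>+y. indicator (B (s n)) (x - y) \<partial>\<nu>) = (\<integral>\<^sup>+r'. indicator (B (s n)) (x - Y r' \<omega>) \<partial>\<mu>)" for x
          unfolding \<nu>_def by (rule nn_integral_distr) measurable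
        moreover have "(\<integral>\<^sup>+x. (\<integral>\<^sup>+r'. indicator (B (s n)) (x - Y r' \<omega>) \<partial>\<mu>) \<partial>\<nu>) = (\<integral>\<^sup>+r. \<integral>\<^sup>+r'. indicator (B (s n)) (Y r \<omega> - Y r' \<omega>) \<partial>\<mu> \<partial>\<mu>)"
        proof -
          have [measurable]: "(\<lambda>q. Y (snd q) \<omega>) \<in> borel_measurable (borel \<Otimes>\<^sub>M \<mu>)"
            by (rule measurable_compose[OF measurable_snd, where g="\<lambda>r. Y r \<omega>"]) measurable
          have mm: "(\<lambda>x. \<integral>\<^sup>+r'. indicator (B (s n)) (x - Y r' \<omega>) \<partial>\<mu>) \<in> borel_measurable (borel :: (real ^ 'd) measure)"
            by (rule \<mu>.borel_measurable_nn_integral) (unfold split_beta', measurable)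
          show ?thesis unfolding \<nu>_def by (rule nn_integral_distr[OF \<open>(\<lambda>r. Y r \<omega>) \<in> borel_measurable \<mu>\<close>]) (use mm in simp)
        qed
        ultimately show ?thesis by simp
      qed
      also have "\<dots> = ennreal (e (s n) ^ CARD('d)) * Q (s n) \<omega>"
        using e[of "s n"] by (simp add: Q_def mult.assoc[symmetric] ennreal_mult[symmetric])
      also have "\<dots> \<le> ennreal (e (s n) ^ CARD('d)) * ennreal C" using s(2)[rule_format, of n] by (intro mult_left_mono) auto
      also have "\<dots> = ennreal (C * (e \<circ> s) n ^ DIM(real ^ 'd))"
        using e[of "s n"] C0 by (simp add: ennreal_mult[symmetric] mult.commute)
      finally show "(\<integral>\<^sup>+x. \<integral>\<^sup>+y. indicator {x. \<forall>i\<in>Basis. \<bar>x \<bullet> i\<bar> \<le> (e \<circ> s) n} (x - y) \<partial>\<nu> \<partial>\<nu>) \<le> ennreal (C * (e \<circ> s) n ^ DIM(real ^ 'd))"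
        by (simp add: B_def)
    qed
    show ?case
    proof (intro allI impI)
      fix N :: "(real ^ 'd) set" assume N: "N \<in> sets borel" "emeasure lborel N = 0"
      have "N \<in> null_sets \<nu>" using \<nu>0[OF N] N by (auto simp: null_sets_def \<nu>_def)
      then have "AE x in \<nu>. x \<notin> N" by (rule AE_not_in)
      then have "AE r in \<mu>. Y r \<omega> \<notin> N"
        unfolding \<nu>_def using N \<open>(\<lambda>r. Y r \<omega>) \<in> borel_measurable \<mu>\<close> by (subst (asm) AE_distr_iff) auto
      then show "AE r in ?L \<Otimes>\<^sub>M ?L. W (fst r) (snd r) \<omega> \<notin> N"
        unfolding Y_def \<mu>_def .
    qed
  qed
qed

text \<open>The square is exhausted by squares away from the axes, and the axes are null sets in
  time.\<close>

lemma occupation_null: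
  assumes d: "real CARD('d) < 1 / H1 + 1 / H2"
  shows "AE \<omega> in M. \<forall>N. N \<in> sets borel \<longrightarrow> emeasure lborel N = 0 \<longrightarrow>
    (AE r in lborel. r \<in> time_square T \<longrightarrow> w r \<omega> \<notin> N)"
proof -
  \<comment> \<open>k + 2 keeps the margin strictly below T.\<close>
  define e0 where "e0 k = T / real (k + 2)" for k :: nat
  have e0: "0 < e0 k" "e0 k < T" for k using T by (auto simp: e0_def field_simps intro: add_pos_nonneg)
  have "AE \<omega> in M. \<forall>k. \<forall>N. N \<in> sets borel \<longrightarrow> emeasure lborel N = 0 \<longrightarrow>
    (AE r in interval_measure_on (e0 k) T \<Otimes>\<^sub>M interval_measure_on (e0 k) T. W (fst r) (snd r) \<omega> \<notin> N)"
    unfolding AE_all_countable by (intro allI occupation_null_inner[OF d e0])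
  then show ?thesis
  proof eventually_elim
    case (elim \<omega>)
    show ?case
    proof (intro allI impI)
      fix N :: "(real ^ 'd) set" assume N: "N \<in> sets borel" "emeasure lborel N = 0"
      have "AE r in lborel. r \<in> {e0 k..T} \<times> {e0 k..T} \<longrightarrow> W (fst r) (snd r) \<omega> \<notin> N" for k
      proof -
        have eq: "interval_measure_on (e0 k) T \<Otimes>\<^sub>M interval_measure_on (e0 k) T
          = density (lborel \<Otimes>\<^sub>M lborel) (\<lambda>(x, y). indicator {e0 k..T} x * indicator {e0 k..T} y)"
        proof -
          interpret finite_measure "interval_measure_on (e0 k) T" by (rule finite_interval_measure_on)
          have "sigma_finite_measure (density lborel (indicator {e0 k..T} :: real \<Rightarrow> ennreal))"
            unfolding interval_measure_on_def[symmetric] by unfold_locales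
          then show ?thesis unfolding interval_measure_on_def
            by (intro pair_measure_density lborel.sigma_finite_measure_axioms) auto
        qed
        have "AE r in interval_measure_on (e0 k) T \<Otimes>\<^sub>M interval_measure_on (e0 k) T. W (fst r) (snd r) \<omega> \<notin> N"
          using elim N by blast
        then have "AE r in lborel \<Otimes>\<^sub>M lborel. r \<in> {e0 k..T} \<times> {e0 k..T} \<longrightarrow> W (fst r) (snd r) \<omega> \<notin> N"
          unfolding eq by (subst (asm) AE_density) (auto elim!: eventually_mono simp: indicator_def split_beta')
        then show ?thesis unfolding lborel_prod .
      qed
      then have 1: "AE r in lborel. \<forall>k. r \<in> {e0 k..T} \<times> {e0 k..T} \<longrightarrow> W (fst r) (snd r) \<omega> \<notin> N"
        unfolding AE_all_countable by blast
      have 2: "AE r in (lborel :: (real \<times> real) measure). fst r \<noteq> 0 \<and> snd r \<noteq> 0"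
      proof -
        have "AE r in lborel \<Otimes>\<^sub>M (lborel :: real measure). fst r \<noteq> (0::real) \<and> snd r \<noteq> 0"
        proof (rule lborel_pair.AE_pair_measure)
          show "AE x in lborel. AE y in lborel. fst (x, y) \<noteq> (0::real) \<and> snd (x, y) \<noteq> (0::real)"
            using AE_lborel_singleton[of "0::real"]
          proof eventually_elim
            case (elim x)
            show ?case using AE_lborel_singleton[of "0::real"] by eventually_elim (use elim in auto)
          qed
        qed measurable
        then show ?thesis unfolding lborel_prod .
      qed
      show "AE r in lborel. r \<in> time_square T \<longrightarrow> w r \<omega> \<notin> N"
        using 1 2
      proof eventually_elim
        case (elim r)
        show ?case
        proof
          assume r: "r \<in> time_square T"
          then have pos: "0 < fst r" "0 < snd r" "fst r \<le> T" "snd r \<le> T"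
            using elim(2) by (auto simp: time_square_def less_le)
          obtain k :: nat where k: "T / min (fst r) (snd r) < real k" using reals_Archimedean2 by blast
          have "T < real k * min (fst r) (snd r)" using k pos by (simp add: field_simps)
          also have "\<dots> \<le> real (k + 2) * min (fst r) (snd r)" using pos by (intro mult_right_mono) auto
          finally have le: "T \<le> real (k + 2) * min (fst r) (snd r)" by (rule less_imp_le)
          have "e0 k \<le> real (k + 2) * min (fst r) (snd r) / real (k + 2)"
            unfolding e0_def by (rule divide_right_mono[OF le]) simp
          also have "\<dots> = min (fst r) (snd r)" by (rule nonzero_mult_div_cancel_left) simp
          finally have "e0 k \<le> min (fst r) (snd r)" .
          then have "W (fst r) (snd r) \<omega> \<notin> N" using elim(1) pos by (cases r) auto
          moreover have "W (fst r) (snd r) = w r" using pos by (cases r) (simp add: W_def clamp_time(3))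
          ultimately show "w r \<omega> \<notin> N" by simp
        qed
      qed
    qed
  qed
qed

end

section \<open>Local times and the main estimate\<close>

text \<open>Radon--Nikodym; finiteness of the measure makes the density finite almost everywhere, so
  it has a real version.\<close>

lemma density_exists_if_null:
  fixes \<mu> :: "'b::euclidean_space measure"
  assumes fin: "finite_measure \<mu>" and sets: "sets \<mu> = sets borel"
    and null: "\<And>N. N \<in> sets borel \<Longrightarrow> emeasure lborel N = 0 \<Longrightarrow> emeasure \<mu> N = 0"
  shows "\<exists>f. f \<in> borel_measurable borel \<and> (\<forall>x. 0 \<le> f x) \<and> \<mu> = density lborel (\<lambda>x. ennreal (f x :: real))"
proof -
  interpret finite_measure \<mu> by fact
  have "absolutely_continuous lborel \<mu>"
    unfolding absolutely_continuous_def null_sets_def using null sets by auto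
  then obtain g where g: "g \<in> borel_measurable lborel" "density lborel g = \<mu>"
    using sigma_finite_measure.Radon_Nikodym[OF sigma_finite_lborel, of \<mu>] sets by auto
  have "(\<integral>\<^sup>+x. g x \<partial>lborel) = emeasure (density lborel g) (space lborel)"
    using g(1) by (subst emeasure_density) (auto intro!: nn_integral_cong)
  also have "\<dots> \<noteq> \<infinity>" unfolding g(2) using emeasure_finite by simp
  finally have AEg: "AE x in lborel. g x \<noteq> \<infinity>" by (intro nn_integral_PInf_AE g(1))
  have "density lborel (\<lambda>x. ennreal (enn2real (g x))) = density lborel g"
  proof (rule density_cong)
    show "AE x in lborel. ennreal (enn2real (g x)) = g x"
      using AEg by eventually_elim (simp add: less_top)
  qed (use g(1) in auto)
  then show ?thesis using g by (intro exI[of _ "\<lambda>x. enn2real (g x)"]) auto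
qed

context fbs
begin

definition lower_rectangle :: "real \<times> real \<Rightarrow> (real \<times> real) set" where
  "lower_rectangle t = {s \<in> time_square T. time_less s t}"

lemma time_square_sets [measurable]: "time_square T \<in> sets borel"
  unfolding time_square_def by (intro borel_closed closed_Times closed_atLeastAtMost)

lemma lower_rectangle_sets [measurable]: "lower_rectangle t \<in> sets borel"
proof -
  have "lower_rectangle t = time_square T \<inter> {..<fst t} \<times> {..<snd t}"
    by (auto simp: lower_rectangle_def time_less_def)
  moreover have "{..<fst t} \<times> {..<snd t} \<in> sets borel" by (intro borel_open open_Times open_lessThan)
  ultimately show ?thesis by auto
qed

lemma w_path_measurable:
  assumes "\<omega> \<in> space M"
  shows "(\<lambda>r. W (fst r) (snd r) \<omega>) \<in> borel_measurable borel"
  by (rule borel_measurable_continuous_onI[OF W_continuous[OF assms]])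

lemma w_eq_W: "r \<in> time_square T \<Longrightarrow> w r = W (fst r) (snd r)"
  by (cases r) (auto simp: W_def time_square_def clamp_time(3))

lemma occupation_measure_eq:
  assumes "\<omega> \<in> space M"
  shows "occupation_measure T (\<lambda>s. w s \<omega>) t = distr (restrict_space lborel (lower_rectangle t)) borel (\<lambda>r. W (fst r) (snd r) \<omega>)"
  unfolding occupation_measure_def lower_rectangle_def[symmetric]
  by (intro distr_cong refl) (auto simp: space_restrict_space lower_rectangle_def w_eq_W)

lemma restrict_lower_rectangle_finite: "finite_measure (restrict_space lborel (lower_rectangle t))"
proof (rule finite_measureI)
  have "lower_rectangle t \<subseteq> cbox (0, 0) (T, T)"
    by (auto simp: lower_rectangle_def time_square_def)
  then have "emeasure lborel (lower_rectangle t) \<le> emeasure lborel (cbox (0, 0) (T, T))"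
    by (intro emeasure_mono) auto
  also have "\<dots> < \<infinity>" by (rule emeasure_lborel_cbox_finite)
  finally show "emeasure (restrict_space lborel (lower_rectangle t)) (space (restrict_space lborel (lower_rectangle t))) \<noteq> \<infinity>"
    by (simp add: space_restrict_space emeasure_restrict_space)
qed

lemma W_restrict_measurable:
  "\<omega> \<in> space M \<Longrightarrow> (\<lambda>r. W (fst r) (snd r) \<omega>) \<in> borel_measurable (restrict_space lborel (lower_rectangle t))"
  by (rule measurable_restrict_space1) (use w_path_measurable in simp)

lemma local_time_exists:
  assumes \<omega>: "\<omega> \<in> space M"
    and null: "\<And>N. N \<in> sets borel \<Longrightarrow> emeasure lborel N = 0 \<Longrightarrow> AE r in lborel. r \<in> time_square T \<longrightarrow> w r \<omega> \<notin> N"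
  shows "\<exists>L. is_local_time T (\<lambda>s. w s \<omega>) L"
proof -
  have "\<exists>f. f \<in> borel_measurable borel \<and> (\<forall>x. 0 \<le> f x) \<and> occupation_measure T (\<lambda>s. w s \<omega>) t = density lborel (\<lambda>x. ennreal (f x))" for t
  proof (rule density_exists_if_null)
    show "finite_measure (occupation_measure T (\<lambda>s. w s \<omega>) t)"
      unfolding occupation_measure_eq[OF \<omega>]
      by (rule finite_measure.finite_measure_distr[OF restrict_lower_rectangle_finite W_restrict_measurable[OF \<omega>]])
    show "sets (occupation_measure T (\<lambda>s. w s \<omega>) t) = sets borel" by (simp add: occupation_measure_def)
    fix N :: "(real ^ 'd) set" assume N: "N \<in> sets borel" "emeasure lborel N = 0"
    let ?A = "(\<lambda>r. W (fst r) (snd r) \<omega>) -` N \<inter> lower_rectangle t"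
    have meas: "?A \<in> sets borel"
    proof -
      have "(\<lambda>r. W (fst r) (snd r) \<omega>) -` N \<in> sets borel"
        using measurable_sets[OF w_path_measurable[OF \<omega>] N(1)] by simp
      then show ?thesis by auto
    qed
    have "AE r in lborel. r \<notin> ?A"
      using null[OF N] by eventually_elim (auto simp: lower_rectangle_def w_eq_W)
    then have "emeasure lborel ?A = 0"
      using meas by (subst (asm) AE_iff_measurable[where N="?A"]) auto
    then show "emeasure (occupation_measure T (\<lambda>s. w s \<omega>) t) N = 0"
      unfolding occupation_measure_eq[OF \<omega>]
      by (subst emeasure_distr[OF W_restrict_measurable[OF \<omega>] N(1)])
         (simp add: space_restrict_space emeasure_restrict_space)
  qed
  then obtain L where "\<And>t. L t \<in> borel_measurable borel \<and> (\<forall>x. 0 \<le> L t x) \<and> occupation_measure T (\<lambda>s. w s \<omega>) t = density lborel (\<lambda>x. ennreal (L t x))"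
    by metis
  then show ?thesis unfolding is_local_time_def by blast
qed

text \<open>The occupation formula with an exponential as test function.\<close>

lemma local_time_fourier:
  assumes \<omega>: "\<omega> \<in> space M" and L: "is_local_time T (\<lambda>s. w s \<omega>) L" and t: "t \<in> time_square T"
  shows "integrable lborel (L t)"
    "(\<integral>x. L t x *\<^sub>R cis (- (z \<bullet> x)) \<partial>lborel) = (\<integral>r. indicator (lower_rectangle t) r *\<^sub>R cis (- (z \<bullet> W (fst r) (snd r) \<omega>)) \<partial>lborel)"
proof -
  have Lt[measurable]: "L t \<in> borel_measurable borel" and Lnn: "\<And>x. 0 \<le> L t x"
    and Ld: "occupation_measure T (\<lambda>s. w s \<omega>) t = density lborel (\<lambda>x. ennreal (L t x))"
    using L t by (auto simp: is_local_time_def)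
  have [measurable]: "(\<lambda>r. W (fst r) (snd r) \<omega>) \<in> borel_measurable (restrict_space lborel (lower_rectangle t))"
    by (rule W_restrict_measurable[OF \<omega>])
  interpret O: finite_measure "occupation_measure T (\<lambda>s. w s \<omega>) t"
    unfolding occupation_measure_eq[OF \<omega>]
    by (rule finite_measure.finite_measure_distr[OF restrict_lower_rectangle_finite W_restrict_measurable[OF \<omega>]])
  show "integrable lborel (L t)"
  proof (rule integrableI_nonneg)
    have "(\<integral>\<^sup>+x. ennreal (L t x) \<partial>lborel) = emeasure (density lborel (\<lambda>x. ennreal (L t x))) UNIV"
      by (subst emeasure_density) auto
    also have "\<dots> < \<infinity>" unfolding Ld[symmetric] using O.emeasure_finite[of UNIV] by (simp only: less_top infinity_ennreal_def)
    finally show "(\<integral>\<^sup>+x. ennreal (L t x) \<partial>lborel) < \<infinity>" .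
  qed (use Lnn in auto)
  have "(\<integral>x. L t x *\<^sub>R cis (- (z \<bullet> x)) \<partial>lborel) = (\<integral>x. cis (- (z \<bullet> x)) \<partial>occupation_measure T (\<lambda>s. w s \<omega>) t)"
    unfolding Ld using Lnn by (subst integral_density) auto
  also have "\<dots> = (\<integral>r. cis (- (z \<bullet> W (fst r) (snd r) \<omega>)) \<partial>restrict_space lborel (lower_rectangle t))"
    unfolding occupation_measure_eq[OF \<omega>] by (rule integral_distr) measurable
  also have "\<dots> = (\<integral>r. indicator (lower_rectangle t) r *\<^sub>R cis (- (z \<bullet> W (fst r) (snd r) \<omega>)) \<partial>lborel)"
    by (rule integral_restrict_space) auto
  finally show "(\<integral>x. L t x *\<^sub>R cis (- (z \<bullet> x)) \<partial>lborel) = (\<integral>r. indicator (lower_rectangle t) r *\<^sub>R cis (- (z \<bullet> W (fst r) (snd r) \<omega>)) \<partial>lborel)" .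
qed

text \<open>The transform is linear in the occupation measure, and the four rectangles below the
  corners combine to the rectangle between s and t; Fubini then exhibits the transforms of the
  slices.\<close>

lemma rect_incr_fourier:
  assumes \<omega>: "\<omega> \<in> space M" and L: "is_local_time T (\<lambda>s. w s \<omega>) L"
    and st: "0 \<le> s1" "s1 < t1" "t1 \<le> T" "0 \<le> s2" "s2 < t2" "t2 \<le> T"
  shows "integrable lborel (\<lambda>x. rect_incr (\<lambda>r. L r x) (s1, s2) (t1, t2))"
    "fourier_transform (\<lambda>x. rect_incr (\<lambda>r. L r x) (s1, s2) (t1, t2)) z = (\<integral>b. slice_ft s1 t1 b z \<omega> \<partial>interval_measure_on s2 t2)"
proof -
  define g where "g r = cis (- (z \<bullet> W (fst r) (snd r) \<omega>))" for r :: "real \<times> real"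
  have gm[measurable]: "g \<in> borel_measurable borel"
    unfolding g_def using w_path_measurable[OF \<omega>] by measurable
  have tsq: "(t1, t2) \<in> time_square T" "(t1, s2) \<in> time_square T" "(s1, t2) \<in> time_square T" "(s1, s2) \<in> time_square T"
    using st by (auto simp: time_square_def)
  have iL: "integrable lborel (L r)" if "r \<in> time_square T" for r by (rule local_time_fourier(1)[OF \<omega> L that])
  show "integrable lborel (\<lambda>x. rect_incr (\<lambda>r. L r x) (s1, s2) (t1, t2))"
    unfolding rect_incr_def using iL tsq by auto
  have iLc: "integrable lborel (\<lambda>x. L r x *\<^sub>R cis (- (z \<bullet> x)))" if "r \<in> time_square T" for r
    by (rule Bochner_Integration.integrable_bound[OF iL[OF that]])
       (use iL[OF that] in auto)
  have ig: "integrable lborel (\<lambda>r. indicator S r *\<^sub>R g r)" if "S \<in> sets borel" "S \<subseteq> cbox (0, 0) (T, T)" for S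
  proof (rule Bochner_Integration.integrable_bound[where f="indicator (cbox (0, 0) (T, T)) :: real \<times> real \<Rightarrow> real"])
    show "integrable lborel (indicator (cbox (0, 0) (T, T)) :: real \<times> real \<Rightarrow> real)"
      using emeasure_lborel_cbox_finite[of "(0, 0)" "(T, T)"] by (intro integrable_real_indicator) auto
    show "AE r in lborel. norm (indicator S r *\<^sub>R g r) \<le> norm (indicator (cbox (0, 0) (T, T)) r :: real)"
      using that(2) by (intro AE_I2) (auto simp: indicator_def g_def)
  qed (use that(1) in measurable)
  have low: "lower_rectangle r \<subseteq> cbox (0, 0) (T, T)" for r
    by (auto simp: lower_rectangle_def time_square_def)
  have "fourier_transform (\<lambda>x. rect_incr (\<lambda>r. L r x) (s1, s2) (t1, t2)) z
    = (\<integral>x. L (t1, t2) x *\<^sub>R cis (- (z \<bullet> x)) - L (t1, s2) x *\<^sub>R cis (- (z \<bullet> x)) - L (s1, t2) x *\<^sub>R cis (- (z \<bullet> x)) + L (s1, s2) x *\<^sub>R cis (- (z \<bullet> x)) \<partial>lborel)"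
    by (simp add: fourier_transform_def rect_incr_def scaleR_left_diff_distrib scaleR_left_distrib)
  also have "\<dots> = (\<integral>r. indicator (lower_rectangle (t1, t2)) r *\<^sub>R g r \<partial>lborel) - (\<integral>r. indicator (lower_rectangle (t1, s2)) r *\<^sub>R g r \<partial>lborel)
      - (\<integral>r. indicator (lower_rectangle (s1, t2)) r *\<^sub>R g r \<partial>lborel) + (\<integral>r. indicator (lower_rectangle (s1, s2)) r *\<^sub>R g r \<partial>lborel)"
    using iLc tsq by (simp add: local_time_fourier(2)[OF \<omega> L] g_def)
  also have "\<dots> = (\<integral>r. indicator (lower_rectangle (t1, t2)) r *\<^sub>R g r - indicator (lower_rectangle (t1, s2)) r *\<^sub>R g r
      - indicator (lower_rectangle (s1, t2)) r *\<^sub>R g r + indicator (lower_rectangle (s1, s2)) r *\<^sub>R g r \<partial>lborel)"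
    using ig[OF lower_rectangle_sets low] by simp
  \<comment> \<open>Half-open, since the occupation measure counts times strictly below t; the
    closed rectangle differs by a null set.\<close>
  also have "\<dots> = (\<integral>r. indicator ({s1..<t1} \<times> {s2..<t2}) r *\<^sub>R g r \<partial>lborel)"
    using st by (intro Bochner_Integration.integral_cong refl)
      (auto simp: indicator_def lower_rectangle_def time_square_def time_less_def)
  also have "\<dots> = (\<integral>r. indicator ({s1..t1} \<times> {s2..t2}) r *\<^sub>R g r \<partial>lborel)"
  proof (rule integral_cong_AE)
    have "AE r in lborel \<Otimes>\<^sub>M (lborel :: real measure). fst r \<noteq> t1 \<and> snd r \<noteq> t2"
    proof (rule lborel_pair.AE_pair_measure)
      show "AE x in lborel. AE y in lborel. fst (x, y) \<noteq> t1 \<and> snd (x, y) \<noteq> t2"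
        using AE_lborel_singleton[of t1]
      proof eventually_elim
        case (elim x)
        show ?case using AE_lborel_singleton[of t2] by eventually_elim (use elim in auto)
      qed
    qed measurable
    then have "AE r in lborel. fst r \<noteq> t1 \<and> snd r \<noteq> t2" unfolding lborel_prod .
    then show "AE r in lborel. indicator ({s1..<t1} \<times> {s2..<t2}) r *\<^sub>R g r = indicator ({s1..t1} \<times> {s2..t2}) r *\<^sub>R g r"
      by eventually_elim (auto simp: indicator_def)
    have "{s1..<t1} \<times> {s2..<t2} \<in> sets (borel \<Otimes>\<^sub>M borel)" "{s1..t1} \<times> {s2..t2} \<in> sets (borel \<Otimes>\<^sub>M borel)" by auto
    then have [measurable]: "{s1..<t1} \<times> {s2..<t2} \<in> sets borel" "{s1..t1} \<times> {s2..t2} \<in> sets borel" unfolding borel_prod by auto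
    show "(\<lambda>r. indicator ({s1..<t1} \<times> {s2..<t2}) r *\<^sub>R g r) \<in> borel_measurable lborel" by measurable
    show "(\<lambda>r. indicator ({s1..t1} \<times> {s2..t2}) r *\<^sub>R g r) \<in> borel_measurable lborel" by measurable
  qed
  also have "\<dots> = (\<integral>b. \<integral>a. indicator ({s1..t1} \<times> {s2..t2}) (a, b) *\<^sub>R g (a, b) \<partial>lborel \<partial>lborel)"
  proof -
    have "{s1..t1} \<times> {s2..t2} \<in> sets (borel \<Otimes>\<^sub>M borel)" by auto
    then have "{s1..t1} \<times> {s2..t2} \<in> sets borel" unfolding borel_prod by auto
    then have "integrable lborel (\<lambda>r. indicator ({s1..t1} \<times> {s2..t2}) r *\<^sub>R g r)"
      using st by (intro ig) auto
    then have "integrable (lborel \<Otimes>\<^sub>M lborel) (\<lambda>(a, b). indicator ({s1..t1} \<times> {s2..t2}) (a, b) *\<^sub>R g (a, b))"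
      unfolding lborel_prod by (simp add: split_beta')
    from lborel_pair.integral_snd[OF this] show ?thesis unfolding lborel_prod by (simp add: split_beta')
  qed
  also have "\<dots> = (\<integral>b. indicator {s2..t2} b *\<^sub>R slice_ft s1 t1 b z \<omega> \<partial>lborel)"
  proof (intro Bochner_Integration.integral_cong refl)
    fix b
    have m: "(\<lambda>a. cis (- (z \<bullet> W a b \<omega>))) \<in> borel_measurable borel"
      using \<omega> W_joint[of "\<lambda>a. a" borel "\<lambda>_. b" "\<lambda>_. \<omega>"] by measurable
    have "(\<integral>a. indicator ({s1..t1} \<times> {s2..t2}) (a, b) *\<^sub>R g (a, b) \<partial>lborel) = (\<integral>a. indicator {s2..t2} b *\<^sub>R (indicator {s1..t1} a *\<^sub>R cis (- (z \<bullet> W a b \<omega>))) \<partial>lborel)"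
      by (intro Bochner_Integration.integral_cong refl) (auto simp: indicator_def g_def)
    also have "\<dots> = indicator {s2..t2} b *\<^sub>R slice_ft s1 t1 b z \<omega>"
      unfolding slice_ft_def by (simp only: integral_scaleR_right integral_interval_measure_on[OF m])
    finally show "(\<integral>a. indicator ({s1..t1} \<times> {s2..t2}) (a, b) *\<^sub>R g (a, b) \<partial>lborel) = indicator {s2..t2} b *\<^sub>R slice_ft s1 t1 b z \<omega>" .
  qed
  also have "\<dots> = (\<integral>b. slice_ft s1 t1 b z \<omega> \<partial>interval_measure_on s2 t2)"
    using \<omega> by (intro integral_interval_measure_on[symmetric] slice_ft_joint) auto
  finally show "fourier_transform (\<lambda>x. rect_incr (\<lambda>r. L r x) (s1, s2) (t1, t2)) z = (\<integral>b. slice_ft s1 t1 b z \<omega> \<partial>interval_measure_on s2 t2)" .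
qed

text \<open>Fatou's lemma as the radius grows: at every z the cut-off is eventually
  inactive.\<close>

lemma bessel_norm_le_of_ball_weights:
  assumes f: "integrable lborel f" and B: "0 \<le> B"
    and le: "\<And>R. (\<integral>\<^sup>+z. ennreal (ball_weight lam R z * (norm (fourier_transform f z))\<^sup>2) \<partial>lborel) \<le> ennreal B"
  shows "in_bessel_space lam (f :: real ^ 'd \<Rightarrow> real)" "bessel_norm lam f \<le> sqrt B"
proof -
  have [measurable]: "f \<in> borel_measurable borel" using f by auto
  have [measurable]: "fourier_transform f \<in> borel_measurable borel"
    unfolding fourier_transform_def[abs_def]
    by (rule lborel.borel_measurable_lebesgue_integral) (unfold split_beta', measurable)
  have "(\<integral>\<^sup>+z. ennreal (bessel_integrand lam f z) \<partial>lborel) \<le> (\<integral>\<^sup>+z. liminf (\<lambda>R. ennreal (ball_weight lam R z * (norm (fourier_transform f z))\<^sup>2)) \<partial>lborel)"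
  proof (rule nn_integral_mono)
    fix z :: "real ^ 'd"
    obtain R0 :: nat where R0: "norm z < real R0" using reals_Archimedean2 by blast
    have "\<forall>\<^sub>F R in sequentially. ennreal (bessel_integrand lam f z) \<le> ennreal (ball_weight lam R z * (norm (fourier_transform f z))\<^sup>2)"
      using eventually_ge_at_top[of R0]
    proof eventually_elim
      case (elim R)
      then have "norm z < real R" using R0 by linarith
      then show ?case by (simp add: bessel_integrand_def ball_weight_def)
    qed
    then show "ennreal (bessel_integrand lam f z) \<le> liminf (\<lambda>R. ennreal (ball_weight lam R z * (norm (fourier_transform f z))\<^sup>2))"
      by (rule Liminf_bounded)
  qed
  also have "\<dots> \<le> liminf (\<lambda>R. \<integral>\<^sup>+z. ennreal (ball_weight lam R z * (norm (fourier_transform f z))\<^sup>2) \<partial>lborel)"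
    by (rule nn_integral_liminf) measurable
  also have "\<dots> \<le> liminf (\<lambda>R::nat. ennreal B)" using le by (intro Liminf_mono always_eventually allI)
  also have "\<dots> = ennreal B" by (simp add: Liminf_const)
  finally have nB: "(\<integral>\<^sup>+z. ennreal (bessel_integrand lam f z) \<partial>lborel) \<le> ennreal B" .
  have i: "integrable lborel (bessel_integrand lam f)"
  proof (rule integrableI_nonneg)
    show "bessel_integrand lam f \<in> borel_measurable lborel" unfolding bessel_integrand_def[abs_def] by measurable
    show "(\<integral>\<^sup>+z. ennreal (bessel_integrand lam f z) \<partial>lborel) < \<infinity>" using nB by (auto intro: order.strict_trans1)
  qed (auto simp: bessel_integrand_def)
  then show "in_bessel_space lam f" using f by (simp add: in_bessel_space_def)
  have "ennreal (\<integral>z. bessel_integrand lam f z \<partial>lborel) \<le> ennreal B"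
  proof -
    have "(\<integral>\<^sup>+z. ennreal (bessel_integrand lam f z) \<partial>lborel) = ennreal (\<integral>z. bessel_integrand lam f z \<partial>lborel)"
      by (rule nn_integral_eq_integral[OF i]) (simp add: bessel_integrand_def)
    then show ?thesis using nB by (simp only:)
  qed
  then have "(\<integral>z. bessel_integrand lam f z \<partial>lborel) \<le> B" using B by (simp add: ennreal_le_iff)
  then show "bessel_norm lam f \<le> sqrt B" by (simp add: bessel_norm_def)
qed

end

text \<open>On a bounded time interval an exponent may be lowered at the price of a
  constant.\<close>

lemma powr_le_powr_bounded:
  fixes x T \<gamma> \<gamma>' :: real
  assumes "0 < x" "x \<le> T" "\<gamma> \<le> \<gamma>'"
  shows "x powr \<gamma>' \<le> T powr (\<gamma>' - \<gamma>) * x powr \<gamma>"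
proof -
  have "x powr \<gamma>' = x powr (\<gamma>' - \<gamma>) * x powr \<gamma>" by (simp add: powr_add[symmetric])
  also have "x powr (\<gamma>' - \<gamma>) \<le> T powr (\<gamma>' - \<gamma>)" using assms by (intro powr_mono2) auto
  finally show ?thesis by (simp add: mult_right_mono)
qed

theorem theorem3:
  fixes M :: "'a measure"
    and T H1 H2 lam :: real
    and w :: "real \<times> real \<Rightarrow> 'a \<Rightarrow> real ^ 'd"
  assumes "0 < T"
    and "fractional_brownian_sheet M T H1 H2 w"
    and "lam < 1 / (2 * max H1 H2) - real CARD('d) / 2"
    and "0 \<le> lam + real CARD('d) / 2"
    and "real CARD('d) < 1 / H1 + 1 / H2"
  shows "AE \<omega> in M. \<exists>L. is_local_time T (\<lambda>s. w s \<omega>) L \<and>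
    (\<forall>\<gamma>1 \<in> {1/2 <..< 1 - (lam + real CARD('d) / 2) * H1}.
     \<forall>\<gamma>2 \<in> {1/2 <..< 1 - (lam + real CARD('d) / 2) * H2}.
     \<exists>C>0. \<forall>s\<in>time_square T. \<forall>t\<in>time_square T. time_less s t \<longrightarrow>
       in_bessel_space lam (\<lambda>x. rect_incr (\<lambda>r. L r x) s t) \<and>
       bessel_norm lam (\<lambda>x. rect_incr (\<lambda>r. L r x) s t)
         \<le> C * (fst t - fst s) powr \<gamma>1 * (snd t - snd s) powr \<gamma>2)"
proof -
  interpret prob_space M using assms(2) by (simp add: fractional_brownian_sheet_def)
  interpret fbs M T H1 H2 w by unfold_locales (use assms in auto)
  define \<theta> where "\<theta> = lam + real CARD('d) / 2"
  define h where "h = max H1 H2"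
  have h: "0 < h" "H1 \<le> h" "H2 \<le> h" using H by (auto simp: h_def)
  define \<delta> where "\<delta> = 1 / (2 * h) - \<theta>"
  have \<theta>: "0 \<le> \<theta>" "0 < \<delta>" using assms(3,4) by (auto simp: \<theta>_def \<delta>_def h_def)
  \<comment> \<open>A sequence decreasing to \<theta>; \<open>n + 2\<close> makes even its first
    term smaller than \<open>1 / (2 * h)\<close>.\<close>
  define \<alpha> where "\<alpha> n = \<theta> + \<delta> / real (n + 2)" for n
  have \<alpha>: "0 < \<alpha> n" "\<theta> < \<alpha> n" "\<alpha> n < 1 / (2 * h)" for n
  proof -
    have "0 < \<delta> / real (n + 2)" using \<theta> by simp
    then show "0 < \<alpha> n" "\<theta> < \<alpha> n" unfolding \<alpha>_def using \<theta>(1) by linarith+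
    have "\<delta> / real (n + 2) < \<delta> / 1" using \<theta> by (intro divide_strict_left_mono) auto
    then show "\<alpha> n < 1 / (2 * h)" by (simp add: \<alpha>_def \<delta>_def)
  qed
  have \<alpha>H: "2 * \<alpha> n * H1 < 1" "2 * \<alpha> n * H2 < 1" for n
  proof -
    have "2 * \<alpha> n * h < 1" using \<alpha>(3)[of n] h by (simp add: field_simps)
    moreover have "2 * \<alpha> n * H1 \<le> 2 * \<alpha> n * h" "2 * \<alpha> n * H2 \<le> 2 * \<alpha> n * h"
      using \<alpha>(1)[of n] h by (auto intro!: mult_left_mono)
    ultimately show "2 * \<alpha> n * H1 < 1" "2 * \<alpha> n * H2 < 1" by linarith+
  qed
  \<comment> \<open>The condition under which the singularity in b stays integrable after Young's
    inequality with exponent m/(m-1).\<close>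
  define good where "good n m \<longleftrightarrow> 2 \<le> m \<and> 2 * \<alpha> n * H2 * (real m / (real m - 1)) < 1" for n m :: nat
  \<comment> \<open>All pairs at once, so that the exceptional set is fixed before the exponents
    \<gamma>1 and \<gamma>2.\<close>
  have est: "AE \<omega> in M. \<forall>n m. good n m \<longrightarrow> (\<exists>C\<ge>0. \<forall>R s1 t1 s2 t2. 0 \<le> s1 \<longrightarrow> s1 < t1 \<longrightarrow> t1 \<le> T \<longrightarrow> 0 \<le> s2 \<longrightarrow> s2 < t2 \<longrightarrow> t2 \<le> T \<longrightarrow>
    (\<integral>\<^sup>+z. ennreal (ball_weight lam R z * (norm (\<integral>b. slice_ft s1 t1 b z \<omega> \<partial>interval_measure_on s2 t2))\<^sup>2) \<partial>lborel)
      \<le> ennreal (C * (t1 - s1) powr (2 * (1 - \<alpha> n * H1 - 1 / real m)) * (t2 - s2) powr (2 * (1 - \<alpha> n * H2 - 1 / (2 * real m)))))"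
    unfolding AE_all_countable
  proof (intro allI)
    fix n m
    show "AE \<omega> in M. good n m \<longrightarrow> (\<exists>C\<ge>0. \<forall>R s1 t1 s2 t2. 0 \<le> s1 \<longrightarrow> s1 < t1 \<longrightarrow> t1 \<le> T \<longrightarrow> 0 \<le> s2 \<longrightarrow> s2 < t2 \<longrightarrow> t2 \<le> T \<longrightarrow>
    (\<integral>\<^sup>+z. ennreal (ball_weight lam R z * (norm (\<integral>b. slice_ft s1 t1 b z \<omega> \<partial>interval_measure_on s2 t2))\<^sup>2) \<partial>lborel)
      \<le> ennreal (C * (t1 - s1) powr (2 * (1 - \<alpha> n * H1 - 1 / real m)) * (t2 - s2) powr (2 * (1 - \<alpha> n * H2 - 1 / (2 * real m)))))"
    proof (cases "good n m")
      case True
      then have m: "2 \<le> m" "2 * \<alpha> n * H2 * (real m / (real m - 1)) < 1" by (auto simp: good_def)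
      have "1 / real m \<le> 1 / 2" using m by (intro divide_left_mono) auto
      then have "0 < 1 - \<alpha> n * H1 - 1 / real m" using \<alpha>H(1)[of n] by linarith
      moreover have "real CARD('d) / 2 < \<alpha> n - lam" using \<alpha>(2)[of n] by (simp add: \<theta>_def)
      ultimately show ?thesis using slice_estimate[OF \<alpha>(1) \<alpha>H(1) _ m] by (auto elim!: eventually_mono)
    qed simp
  qed
  show ?thesis
    using est occupation_null[OF assms(5)] AE_space
  proof eventually_elim
    case (elim \<omega>)
    note \<omega> = \<open>\<omega> \<in> space M\<close>
    obtain L where L: "is_local_time T (\<lambda>s. w s \<omega>) L"
      using local_time_exists[OF \<omega>] elim(2) by blast
    have "\<exists>C>0. \<forall>s\<in>time_square T. \<forall>t\<in>time_square T. time_less s t \<longrightarrow>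
       in_bessel_space lam (\<lambda>x. rect_incr (\<lambda>r. L r x) s t) \<and>
       bessel_norm lam (\<lambda>x. rect_incr (\<lambda>r. L r x) s t)
         \<le> C * (fst t - fst s) powr \<gamma>1 * (snd t - snd s) powr \<gamma>2"
      if \<gamma>: "\<gamma>1 < 1 - \<theta> * H1" "\<gamma>2 < 1 - \<theta> * H2" for \<gamma>1 \<gamma>2
    proof -
      have "(\<lambda>n. \<delta> * (1 / real (n + 2))) \<longlonglongrightarrow> \<delta> * 0"
        by (intro tendsto_intros LIMSEQ_ignore_initial_segment lim_1_over_n)
      then have lim: "\<alpha> \<longlonglongrightarrow> \<theta>"
        using tendsto_add[OF tendsto_const, of _ 0 sequentially \<theta>] by (simp add: \<alpha>_def[abs_def])
      have "(\<lambda>n. 1 - \<alpha> n * H1) \<longlonglongrightarrow> 1 - \<theta> * H1" "(\<lambda>n. 1 - \<alpha> n * H2) \<longlonglongrightarrow> 1 - \<theta> * H2"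
        by (intro tendsto_intros lim)+
      then have "\<forall>\<^sub>F n in sequentially. \<gamma>1 < 1 - \<alpha> n * H1" "\<forall>\<^sub>F n in sequentially. \<gamma>2 < 1 - \<alpha> n * H2"
        using \<gamma> by (auto intro: order_tendstoD)
      then have "\<forall>\<^sub>F n in sequentially. \<gamma>1 < 1 - \<alpha> n * H1 \<and> \<gamma>2 < 1 - \<alpha> n * H2" by (rule eventually_conj)
      then obtain n where n: "\<gamma>1 < 1 - \<alpha> n * H1" "\<gamma>2 < 1 - \<alpha> n * H2" by (auto simp: eventually_sequentially)
      have l1: "(\<lambda>m. 1 / real m) \<longlonglongrightarrow> 0" by (rule lim_1_over_n)
      have "(\<lambda>m. 1 - \<alpha> n * H1 - 1 / real m) \<longlonglongrightarrow> 1 - \<alpha> n * H1 - 0" by (intro tendsto_intros l1)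
      then have e1: "\<forall>\<^sub>F m in sequentially. \<gamma>1 < 1 - \<alpha> n * H1 - 1 / real m" using n by (intro order_tendstoD) auto
      have "(\<lambda>m. 1 - \<alpha> n * H2 - 1 / real m / 2) \<longlonglongrightarrow> 1 - \<alpha> n * H2 - 0 / 2" by (intro tendsto_intros l1) simp
      then have e2: "\<forall>\<^sub>F m in sequentially. \<gamma>2 < 1 - \<alpha> n * H2 - 1 / real m / 2" using n by (intro order_tendstoD) auto
      have "(\<lambda>m. 2 * \<alpha> n * H2 * (1 / (1 - 1 / real m))) \<longlonglongrightarrow> 2 * \<alpha> n * H2 * (1 / (1 - 0))"
        by (intro tendsto_intros l1) simp
      then have e3: "\<forall>\<^sub>F m in sequentially. 2 * \<alpha> n * H2 * (1 / (1 - 1 / real m)) < 1"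
        using \<alpha>H(2)[of n] by (intro order_tendstoD) auto
      have "\<forall>\<^sub>F m in sequentially. \<gamma>1 < 1 - \<alpha> n * H1 - 1 / real m \<and> \<gamma>2 < 1 - \<alpha> n * H2 - 1 / (2 * real m) \<and> good n m"
        using e1 e2 e3 eventually_ge_at_top[of 2]
      proof eventually_elim
        case (elim m)
        have "1 / (1 - 1 / real m) = real m / (real m - 1)" using elim(4) by (simp add: field_simps)
        then show ?case using elim by (simp add: good_def mult.commute)
      qed
      then obtain m where m: "\<gamma>1 < 1 - \<alpha> n * H1 - 1 / real m" "\<gamma>2 < 1 - \<alpha> n * H2 - 1 / (2 * real m)" "good n m"
        by (auto simp: eventually_sequentially)
      define g1 where "g1 = 1 - \<alpha> n * H1 - 1 / real m"
      define g2 where "g2 = 1 - \<alpha> n * H2 - 1 / (2 * real m)"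
      obtain C where C: "0 \<le> C" "\<And>R s1 t1 s2 t2. 0 \<le> s1 \<Longrightarrow> s1 < t1 \<Longrightarrow> t1 \<le> T \<Longrightarrow> 0 \<le> s2 \<Longrightarrow> s2 < t2 \<Longrightarrow> t2 \<le> T \<Longrightarrow>
        (\<integral>\<^sup>+z. ennreal (ball_weight lam R z * (norm (\<integral>b. slice_ft s1 t1 b z \<omega> \<partial>interval_measure_on s2 t2))\<^sup>2) \<partial>lborel)
        \<le> ennreal (C * (t1 - s1) powr (2 * g1) * (t2 - s2) powr (2 * g2))"
        using elim(1) m(3) unfolding g1_def g2_def by meson
      \<comment> \<open>The 1 makes the constant positive also when C = 0.\<close>
      define C' where "C' = sqrt C * (T powr (g1 - \<gamma>1) * T powr (g2 - \<gamma>2)) + 1"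
      have C': "0 < C'" using C(1) by (auto simp: C'_def intro!: add_nonneg_pos)
      show ?thesis
      proof (intro exI[of _ C'] conjI C' ballI impI)
        fix s t assume s: "s \<in> time_square T" and t: "t \<in> time_square T" and st: "time_less s t"
        obtain s1 s2 t1 t2 where eq: "s = (s1, s2)" "t = (t1, t2)" by (cases s, cases t)
        have b: "0 \<le> s1" "s1 < t1" "t1 \<le> T" "0 \<le> s2" "s2 < t2" "t2 \<le> T"
          using s t st by (auto simp: eq time_square_def time_less_def)
        let ?f = "\<lambda>x. rect_incr (\<lambda>r. L r x) s t"
        define Bd where "Bd = C * (t1 - s1) powr (2 * g1) * (t2 - s2) powr (2 * g2)"
        have Bd: "0 \<le> Bd" using C(1) by (simp add: Bd_def)
        have f: "integrable lborel ?f" unfolding eq by (rule rect_incr_fourier(1)[OF \<omega> L b])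
        have le: "(\<integral>\<^sup>+z. ennreal (ball_weight lam R z * (norm (fourier_transform ?f z))\<^sup>2) \<partial>lborel) \<le> ennreal Bd" for R
          unfolding eq rect_incr_fourier(2)[OF \<omega> L b] Bd_def by (rule C(2)[OF b])
        show "in_bessel_space lam ?f" by (rule bessel_norm_le_of_ball_weights(1)[OF f Bd le])
        have "bessel_norm lam ?f \<le> sqrt Bd" by (rule bessel_norm_le_of_ball_weights(2)[OF f Bd le])
        also have "\<dots> = sqrt C * ((t1 - s1) powr g1 * (t2 - s2) powr g2)"
        proof -
          have "x powr (2 * g) = (x powr g)\<^sup>2" for x g :: real by (simp add: power2_eq_square powr_add[symmetric])
          then show ?thesis by (simp add: Bd_def real_sqrt_mult)
        qed
        also have "\<dots> \<le> sqrt C * ((T powr (g1 - \<gamma>1) * (t1 - s1) powr \<gamma>1) * (T powr (g2 - \<gamma>2) * (t2 - s2) powr \<gamma>2))"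
          using b m C(1) by (intro mult_left_mono mult_mono powr_le_powr_bounded) (auto simp: g1_def g2_def)
        also have "\<dots> = (sqrt C * (T powr (g1 - \<gamma>1) * T powr (g2 - \<gamma>2))) * ((t1 - s1) powr \<gamma>1 * (t2 - s2) powr \<gamma>2)"
          by (simp add: mult_ac)
        also have "\<dots> \<le> C' * ((t1 - s1) powr \<gamma>1 * (t2 - s2) powr \<gamma>2)"
          unfolding C'_def by (intro mult_right_mono) auto
        finally show "bessel_norm lam ?f \<le> C' * (fst t - fst s) powr \<gamma>1 * (snd t - snd s) powr \<gamma>2"
          by (simp add: eq mult.assoc)
      qed
    qed
    then show ?case
      using L unfolding \<theta>_def by (intro exI[of _ L] conjI ballI) auto
  qed
qed

end
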